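(* Let $\mu>0$ and $\frac{10}3=\overline q<p<6$. There is a constant $\widetilde\kappa>0$ (sufficiently small) such that the following holds for every $a\in(0,\widetilde\kappa)$ satisfying $1-\frac35C_{\overline q}^{\overline q}\mu a^{4/3}>0$ and $$\Big(\frac1{C_p^p\gamma_pa^{p(1-\gamma_p)}}\Big)^{\frac1{p\gamma_p-2}}\Big(1-\frac35C_{\overline q}^{\overline q}\mu a^{\frac43}\Big)^{\frac1{p\gamma_p-2}}\frac1{a^3}\ \ge\ \frac{4\gamma_p-1}{4(1-\gamma_p)}C_{12/5}^{12/5}.$$ For $q\in(\overline q,p)$ tending to $\overline q$, let $(\lambda_q,u_q)\in\mathbb R^+\times\mathcal H_r$ be the radial mountain pass type normalized solution, at the level $c_{q,r}$, of $$-\Delta u+\lambda u+(|x|^{-1}\ast|u|^2)u=|u|^{p-2}u+\mu|u|^{q-2}u\ \text{ in }\mathbb R^3,\qquad \int_{\mathbb R^3}|u|^2dx=a^2. \tag{E$_q$}$$ Then there is $(\lambda,u)\in\mathbb R^+\times\mathcal H_r$ such that, up to a subsequence, $u_q\to u$ in $\mathcal H$ and $\lambda_q\to\lambda$ in $\mathbb R$ as $q\to\overline q$, where $\mathcal J_{\overline q}(u)=c_{\overline q,r}$ and $(\lambda,u)$ solves (E$_{\overline q}$).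
   Context: $\mathbb R^+=(0,\infty)$; $\mathcal H=H^1(\mathbb R^3,\mathbb C)$; $\mathcal H_r$ its radial subspace; $|\cdot|_t$ the $L^t(\mathbb R^3)$ norm; $S_a=\{u\in\mathcal H:|u|_2=a\}$. $\gamma_t=\frac{3(t-2)}{2t}$ and, for $2<t<6$, $C_t$ is the sharp constant in $|u|_t\le C_t|u|_2^{1-\gamma_t}|\nabla u|_2^{\gamma_t}$, $u\in\mathcal H$. For $q\in[\overline q,p)$: $$\mathcal J_q(u)=\frac12\int|\nabla u|^2+\frac14\iint\frac{|u(x)|^2|u(y)|^2}{|x-y|}dxdy-\frac1p\int|u|^p-\frac{\mu}{q}\int|u|^q,$$ $$P_q(u)=\int|\nabla u|^2+\frac14\iint\frac{|u(x)|^2|u(y)|^2}{|x-y|}dxdy-\gamma_p\int|u|^p-\mu\gamma_q\int|u|^q,$$ $\mathcal P_{q,r}=\{u\in S_a\cap\mathcal H_r:P_q(u)=0\}$, and $c_{q,r}=\inf_{\mathcal P_{q,r}}\mathcal J_q$, which is positive and equals the mountain pass level of $\mathcal J_q$ on $S_a\cap\mathcal H_r$. It is known (Chen–Tang–Yuan) that for $\overline q<q<p<6$, $\mu>0$ and $a\in(0,\widetilde\kappa)$ small enough, (E$_q$) has a solution $(\lambda_q,u_q)\in\mathbb R^+\times\mathcal H_r$ with $u_q>0$ and $\mathcal J_q(u_q)=c_{q,r}>0$; this is the "radial mountain pass type normalized solution". "Up to a subsequence" refers to sequences $q_n\to\overline q$ with $q_n>\overline q$. *)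

theory Defs
  imports "HOL-Analysis.Analysis"
begin

section \<open>Smooth test functions and weak gradients\<close>

type_synonym space = "real ^ 3"

definition partial :: "3 \<Rightarrow> (space \<Rightarrow> real) \<Rightarrow> space \<Rightarrow> real" where
  "partial i f x = frechet_derivative f (at x) (axis i 1)"

text \<open>The value of \<open>partial\<close> is only meaningful for differentiable functions, so
  differentiability is demanded separately at every stage.\<close>

primrec Ck :: "nat \<Rightarrow> (space \<Rightarrow> real) \<Rightarrow> bool" where
  "Ck 0 f \<longleftrightarrow> continuous_on UNIV f"
| "Ck (Suc k) f \<longleftrightarrow> f differentiable_on UNIV \<and> (\<forall>i. Ck k (partial i f))"

definition test_functions :: "(space \<Rightarrow> real) set" where
  "test_functions = {\<phi>. (\<forall>k. Ck k \<phi>) \<and> compact (closure {x. \<phi> x \<noteq> 0})}"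

text \<open>Functions are used as representatives of their classes modulo almost everywhere
  equality; each Lebesgue class has a Borel representative, so \<open>lborel\<close> suffices.\<close>

definition L2 :: "(space \<Rightarrow> 'a::euclidean_space) set" where
  "L2 = {u \<in> borel_measurable lborel. integrable lborel (\<lambda>x. (norm (u x))\<^sup>2)}"

definition has_weak_gradient :: "(space \<Rightarrow> complex) \<Rightarrow> (space \<Rightarrow> complex ^ 3) \<Rightarrow> bool" where
  "has_weak_gradient u g \<longleftrightarrow>
     (\<forall>\<phi>\<in>test_functions. \<forall>i.
        (LINT x|lborel. partial i \<phi> x *\<^sub>R u x) = - (LINT x|lborel. \<phi> x *\<^sub>R (g x $ i)))"

section \<open>The Sobolev space of complex functions and its radial subspace\<close>

definition H1 :: "(space \<Rightarrow> complex) set" where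
  "H1 = {u \<in> L2. \<exists>g\<in>L2. has_weak_gradient u g}"

text \<open>The weak gradient is unique up to a null set; every use below is under an integral.\<close>

definition weak_grad :: "(space \<Rightarrow> complex) \<Rightarrow> space \<Rightarrow> complex ^ 3" where
  "weak_grad u = (SOME g. g \<in> L2 \<and> has_weak_gradient u g)"

definition H1r :: "(space \<Rightarrow> complex) set" where
  "H1r = {u \<in> H1. \<exists>f. AE x in lborel. u x = f (norm x)}"

text \<open>For \<open>u \<in> H1\<close> and \<open>2 \<le> t \<le> 6\<close> the integral is finite by the Sobolev embedding.\<close>

definition Lp_norm :: "real \<Rightarrow> (space \<Rightarrow> 'a::euclidean_space) \<Rightarrow> real" where
  "Lp_norm t u = (LINT x|lborel. norm (u x) powr t) powr (1 / t)"

definition H1_norm :: "(space \<Rightarrow> complex) \<Rightarrow> real" where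
  "H1_norm u =
     sqrt ((LINT x|lborel. (norm (weak_grad u x))\<^sup>2) + (LINT x|lborel. (cmod (u x))\<^sup>2))"

definition mass_sphere :: "real \<Rightarrow> (space \<Rightarrow> complex) set" where
  "mass_sphere a = {u \<in> H1. Lp_norm 2 u = a}"

section \<open>The sharp Gagliardo--Nirenberg constant\<close>

definition gn_exp :: "real \<Rightarrow> real" where
  "gn_exp t = 3 * (t - 2) / (2 * t)"

definition gn_const :: "real \<Rightarrow> real" where
  "gn_const t = Inf {C. C \<ge> 0 \<and>
     (\<forall>u\<in>H1. Lp_norm t u \<le>
        C * Lp_norm 2 u powr (1 - gn_exp t) * Lp_norm 2 (weak_grad u) powr gn_exp t)}"

section \<open>The energy, the Pohozaev functional and the level\<close>

text \<open>The convolution of \<open>1 / \<bar>x\<bar>\<close> with \<open>\<bar>u\<bar>\<^sup>2\<close>; the integrand is 0 at \<open>y = x\<close>, a null set.\<close>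

definition coulomb_potential :: "(space \<Rightarrow> complex) \<Rightarrow> space \<Rightarrow> real" where
  "coulomb_potential u x = (LINT y|lborel. (cmod (u y))\<^sup>2 / norm (x - y))"

definition coulomb_energy :: "(space \<Rightarrow> complex) \<Rightarrow> real" where
  "coulomb_energy u =
     (LINT x|lborel. LINT y|lborel. (cmod (u x))\<^sup>2 * (cmod (u y))\<^sup>2 / norm (x - y))"

definition energy :: "real \<Rightarrow> real \<Rightarrow> real \<Rightarrow> (space \<Rightarrow> complex) \<Rightarrow> real" where
  "energy \<mu> p q u =
     1 / 2 * (LINT x|lborel. (norm (weak_grad u x))\<^sup>2) + 1 / 4 * coulomb_energy u
     - 1 / p * (LINT x|lborel. cmod (u x) powr p)
     - \<mu> / q * (LINT x|lborel. cmod (u x) powr q)"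

definition pohozaev :: "real \<Rightarrow> real \<Rightarrow> real \<Rightarrow> (space \<Rightarrow> complex) \<Rightarrow> real" where
  "pohozaev \<mu> p q u =
     (LINT x|lborel. (norm (weak_grad u x))\<^sup>2) + 1 / 4 * coulomb_energy u
     - gn_exp p * (LINT x|lborel. cmod (u x) powr p)
     - \<mu> * gn_exp q * (LINT x|lborel. cmod (u x) powr q)"

definition pohozaev_set_r :: "real \<Rightarrow> real \<Rightarrow> real \<Rightarrow> real \<Rightarrow> (space \<Rightarrow> complex) set" where
  "pohozaev_set_r \<mu> p a q = {u \<in> mass_sphere a \<inter> H1r. pohozaev \<mu> p q u = 0}"

definition level_r :: "real \<Rightarrow> real \<Rightarrow> real \<Rightarrow> real \<Rightarrow> real" where
  "level_r \<mu> p a q = (INF u\<in>pohozaev_set_r \<mu> p a q. energy \<mu> p q u)"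

section \<open>Normalized solutions\<close>

text \<open>The equation is understood weakly, tested against all of the (complex) space.\<close>

definition weak_solution ::
    "real \<Rightarrow> real \<Rightarrow> real \<Rightarrow> real \<Rightarrow> (space \<Rightarrow> complex) \<Rightarrow> bool" where
  "weak_solution \<mu> p q lam u \<longleftrightarrow> u \<in> H1 \<and>
     (\<forall>v\<in>H1.
        (LINT x|lborel. (\<Sum>i\<in>UNIV. weak_grad u x $ i * cnj (weak_grad v x $ i)))
        + of_real lam * (LINT x|lborel. u x * cnj (v x))
        + (LINT x|lborel. of_real (coulomb_potential u x) * u x * cnj (v x))
        = (LINT x|lborel. of_real (cmod (u x) powr (p - 2)) * u x * cnj (v x))
        + of_real \<mu> * (LINT x|lborel. of_real (cmod (u x) powr (q - 2)) * u x * cnj (v x)))"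

definition normalized_solution ::
    "real \<Rightarrow> real \<Rightarrow> real \<Rightarrow> real \<Rightarrow> real \<Rightarrow> (space \<Rightarrow> complex) \<Rightarrow> bool" where
  "normalized_solution \<mu> p a q lam u \<longleftrightarrow>
     weak_solution \<mu> p q lam u \<and> (LINT x|lborel. (cmod (u x))\<^sup>2) = a\<^sup>2"

text \<open>Positivity of a complex-valued \<open>u\<close> means that it is real and positive almost everywhere.\<close>

definition radial_mp_solution ::
    "real \<Rightarrow> real \<Rightarrow> real \<Rightarrow> real \<Rightarrow> real \<Rightarrow> (space \<Rightarrow> complex) \<Rightarrow> bool" where
  "radial_mp_solution \<mu> p a q lam u \<longleftrightarrow>
     lam > 0 \<and> u \<in> H1r \<and> (AE x in lborel. Im (u x) = 0 \<and> Re (u x) > 0) \<and>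
     normalized_solution \<mu> p a q lam u \<and> energy \<mu> p q u = level_r \<mu> p a q"

end

theory Submission
  imports Defs "HOL-Complex_Analysis.Great_Picard"
begin

text \<open>A radial Sobolev function agrees almost everywhere with a continuous profile that decays like
  \<open>\<bar>x\<bar> powr (- 1 / 2)\<close>; this decay replaces the compact embeddings and gives the radial Gagliardo--Nirenberg
  inequality with some constant, which suffices because \<open>\<kappa>\<close> may be chosen small. Solutions satisfy the Pohozaev
  identity, since the energy along the mass preserving dilations of a solution lies above its initial
  value up to an error of order \<open>o(s)\<close>. The identity, the equation and the smallness of \<open>a\<close> bound the gradients
  from above and the multipliers from above and away from zero. Testing the difference of two equations with the
  difference of the solutions shows that a pointwise convergent subsequence is Cauchy in \<open>H1\<close>. Finally the levels are
  upper semicontinuous as \<open>q\<close> decreases to \<open>10/3\<close>: a function on the limiting Pohozaev set can be moved onto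
  the nearby ones by a dilation close to the identity.\<close>

section \<open>Calculus of smooth functions\<close>

text \<open>A radial function comes with an arbitrary profile, not known to be measurable; a
  continuous profile is therefore built from the spherical mean of the radial derivative and only
  then identified with the function. For the Pohozaev identity the obstacle is that
  \<open>x . grad u\<close> is not known to be square integrable, while the mass of the difference
  between a solution and its dilation by \<open>s\<close> must be \<open>o(s)\<close>. In a ball of
  radius \<open>R\<close> the gradient gives order \<open>s^2 R^2\<close>; outside it a finite
  second moment is needed, which is why the equation is tested with a truncation of
  \<open>|x|^2 u\<close>. Positivity enters through phases: a solution and its dilations share one,
  so the first variation of each power is that of the moduli. Two more points come from totality:
  the equation is tested with nonradial functions, and an integral that does not exist has the value
  0, so integrability precedes every limit; and an infimum over the reals says something only once
  its set is nonempty and the energy is bounded below on it.\<close>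

lemma partial_has_derivative:
  assumes "(f has_derivative f') (at x)"
  shows "partial i f x = f' (axis i 1)"
  using frechet_derivative_at[OF assms] by (simp add: partial_def)

lemma Ck_imp_continuous: "Ck k f \<Longrightarrow> continuous_on UNIV f"
  by (cases k) (auto simp: differentiable_imp_continuous_on)

lemma Ck_Suc_imp: "Ck (Suc k) f \<Longrightarrow> Ck k f"
proof (induction k arbitrary: f)
  case 0
  then show ?case by (auto simp: differentiable_imp_continuous_on)
next
  case (Suc k)
  then show ?case by (metis Ck.simps(2))
qed

lemma differentiable_partialD:
  assumes "f differentiable_on UNIV"
  shows "(f has_derivative frechet_derivative f (at x)) (at x)"
  using assms by (simp add: differentiable_on_def frechet_derivative_works)

text \<open>\<open>partial\<close> rests on \<open>frechet_derivative\<close>, which is a choice;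
  uniqueness of derivatives lets smoothness be proved from any explicit derivative \<open>D\<close>
  instead.\<close>

lemma Ck_SucI:
  assumes "\<And>x. (f has_derivative D x) (at x)" and "\<And>i. Ck k (\<lambda>x. D x (axis i 1))"
  shows "Ck (Suc k) f"
proof -
  have "partial i f = (\<lambda>x. D x (axis i 1))" for i
    using partial_has_derivative[OF assms(1)] by blast
  moreover have "f differentiable_on UNIV"
    using assms(1) by (auto simp: differentiable_on_def differentiable_def intro: has_derivative_at_withinI)
  ultimately show ?thesis using assms(2) by simp
qed

lemma Ck_SucD: "Ck (Suc k) f \<Longrightarrow> Ck k (\<lambda>x. frechet_derivative f (at x) (axis i 1))"
  by (simp add: partial_def[abs_def])

lemma Ck_const: "Ck k (\<lambda>x. c)"
proof (induction k arbitrary: c)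
  case (Suc k)
  show ?case by (rule Ck_SucI[of _ "\<lambda>_ _. 0"]) (auto simp: Suc)
qed auto

lemma Ck_add:
  assumes "Ck k f" "Ck k g" shows "Ck k (\<lambda>x. f x + g x)"
  using assms
proof (induction k arbitrary: f g)
  case (Suc k)
  show ?case
  proof (rule Ck_SucI)
    fix x show "((\<lambda>x. f x + g x) has_derivative
      (\<lambda>h. frechet_derivative f (at x) h + frechet_derivative g (at x) h)) (at x)"
      using Suc.prems by (intro has_derivative_add differentiable_partialD) auto
  next
    fix i show "Ck k (\<lambda>x. frechet_derivative f (at x) (axis i 1) + frechet_derivative g (at x) (axis i 1))"
      by (intro Suc.IH Ck_SucD Suc.prems)
  qed
qed (auto intro: continuous_intros)

lemma Ck_mult:
  assumes "Ck k f" "Ck k g" shows "Ck k (\<lambda>x. f x * g x)"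
  using assms
proof (induction k arbitrary: f g)
  case (Suc k)
  show ?case
  proof (rule Ck_SucI)
    fix x show "((\<lambda>x. f x * g x) has_derivative
      (\<lambda>h. f x * frechet_derivative g (at x) h + frechet_derivative f (at x) h * g x)) (at x)"
      using Suc.prems by (intro has_derivative_mult differentiable_partialD) auto
  next
    fix i show "Ck k (\<lambda>x. f x * frechet_derivative g (at x) (axis i 1) + frechet_derivative f (at x) (axis i 1) * g x)"
      by (intro Ck_add Suc.IH Ck_SucD Suc.prems Ck_Suc_imp)
  qed
qed (auto intro: continuous_intros)

lemma Ck_prod:
  assumes "finite I" "\<And>i. i \<in> I \<Longrightarrow> Ck k (f i)" shows "Ck k (\<lambda>x. \<Prod>i\<in>I. f i x)"
  using assms by (induction I rule: finite_induct) (auto intro: Ck_const Ck_mult)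

lemma Ck_coord: "Ck k (\<lambda>x. x $ i)"
proof (cases k)
  case (Suc m)
  show ?thesis unfolding Suc
    by (rule Ck_SucI[of _ "\<lambda>_ h. h $ i"])
      (auto intro!: Ck_const bounded_linear_imp_has_derivative bounded_linear_vec_nth)
qed (auto intro: continuous_intros)

lemma space_norm_sq: "(norm (x::space))\<^sup>2 = x$1 * x$1 + x$2 * x$2 + x$3 * x$3"
  by (simp add: power2_norm_eq_inner inner_vec_def sum_3)

lemma Ck_norm_sq: "Ck k (\<lambda>x. (norm x)\<^sup>2)"
  unfolding space_norm_sq by (intro Ck_add Ck_mult Ck_coord)

section \<open>Smooth functions of one variable and flat bumps\<close>

text \<open>The derivative is existentially quantified, so a closure rule only has to exhibit one.
  The set \<open>I\<close> is there for real powers, which are smooth on a half line only;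
  derivatives are two sided, so \<open>I\<close> is meant to be open.\<close>

primrec Dk :: "real set \<Rightarrow> nat \<Rightarrow> (real \<Rightarrow> real) \<Rightarrow> bool" where
  "Dk I 0 h \<longleftrightarrow> continuous_on I h"
| "Dk I (Suc k) h \<longleftrightarrow> (\<exists>h'. (\<forall>t\<in>I. (h has_real_derivative h' t) (at t)) \<and> Dk I k h')"

lemma Dk_SucI:
  assumes "\<And>t. t \<in> I \<Longrightarrow> (h has_real_derivative h' t) (at t)" "Dk I k h'"
  shows "Dk I (Suc k) h"
  using assms by auto

lemma Ck_compose:
  assumes "Dk I k h" "Ck k f" "\<And>x. f x \<in> I"
  shows "Ck k (\<lambda>x. h (f x))"
  using assms
proof (induction k arbitrary: h f)
  case 0
  then show ?case by (auto intro: continuous_on_compose2)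
next
  case (Suc k)
  from Suc.prems(1) obtain h' where "\<forall>t\<in>I. (h has_real_derivative h' t) (at t)" and h': "Dk I k h'" by auto
  then have d: "(h has_real_derivative h' t) (at t)" if "t \<in> I" for t using that by blast
  show ?case
  proof (rule Ck_SucI)
    fix x
    have "(h has_derivative (\<lambda>s. h' (f x) * s)) (at (f x))"
      using d[OF Suc.prems(3)] by (simp add: has_field_derivative_def)
    moreover have "(f has_derivative frechet_derivative f (at x)) (at x)"
      using Suc.prems(2) by (intro differentiable_partialD) auto
    ultimately show "((\<lambda>x. h (f x)) has_derivative (\<lambda>d. h' (f x) * frechet_derivative f (at x) d)) (at x)"
      using has_derivative_compose by blast
  next
    fix i
    show "Ck k (\<lambda>x. h' (f x) * frechet_derivative f (at x) (axis i 1))"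
      by (intro Ck_mult Suc.IH[OF h'] Ck_SucD Suc.prems Ck_Suc_imp)
  qed
qed

lemma Dk_add:
  assumes "Dk I k f" "Dk I k g" shows "Dk I k (\<lambda>x. f x + g x)"
  using assms
proof (induction k arbitrary: f g)
  case (Suc k)
  then obtain f' g' where "\<forall>t\<in>I. (f has_real_derivative f' t) (at t)" "Dk I k f'"
    "\<forall>t\<in>I. (g has_real_derivative g' t) (at t)" "Dk I k g'" by auto
  with Suc.IH[of f' g'] show ?case
    by (auto intro!: exI[of _ "\<lambda>x. f' x + g' x"] derivative_intros)
qed (auto intro: continuous_intros)

lemma Dk_cmult: assumes "Dk I k f" shows "Dk I k (\<lambda>x. c * f x)"
  using assms
proof (induction k arbitrary: f)
  case (Suc k)
  then obtain f' where "\<forall>t\<in>I. (f has_real_derivative f' t) (at t)" "Dk I k f'" by auto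
  with Suc.IH[of f'] show ?case
    by (auto intro!: exI[of _ "\<lambda>x. c * f' x"] derivative_eq_intros)
qed (auto intro: continuous_intros)

lemma Dk_affine:
  assumes "Dk UNIV k f" shows "Dk UNIV k (\<lambda>x. f (a * x + b))"
  using assms
proof (induction k arbitrary: f)
  case 0
  then show ?case by (auto intro!: continuous_on_compose2[of UNIV f UNIV] continuous_intros)
next
  case (Suc k)
  then obtain f' where *: "\<And>t. (f has_real_derivative f' t) (at t)" "Dk UNIV k f'" by auto
  have "Dk UNIV k (\<lambda>x. a * f' (a * x + b))" by (intro Dk_cmult Suc.IH *)
  moreover have "((\<lambda>x. f (a * x + b)) has_real_derivative a * f' (a * t + b)) (at t)" for t
    by (rule DERIV_cong[OF DERIV_chain2[OF *(1)]]) (auto intro!: derivative_eq_intros)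
  ultimately show ?case by (intro Dk_SucI[of UNIV "\<lambda>x. f (a * x + b)"])
qed

text \<open>The classical flat function \<open>exp (- 1 / t)\<close> divided by a power of
  \<open>t\<close>. The powers close the family under differentiation up to linear combinations, so
  one induction treats all derivatives.\<close>

definition flat :: "nat \<Rightarrow> real \<Rightarrow> real" where
  "flat m t = (if t > 0 then exp (- 1 / t) / t ^ m else 0)"

lemma flat_tendsto_0: "(flat m \<longlongrightarrow> 0) (at 0)"
proof -
  have "((\<lambda>s::real. s ^ m / exp s) \<longlongrightarrow> 0) at_top"
    by (rule tendsto_power_div_exp_0)
  then have "((\<lambda>t::real. (inverse t) ^ m / exp (inverse t)) \<longlongrightarrow> 0) (at_right 0)"
    by (rule filterlim_compose[OF _ filterlim_inverse_at_top_right])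
  then have "(flat m \<longlongrightarrow> 0) (at_right 0)"
  proof (rule Lim_transform_eventually)
    show "\<forall>\<^sub>F t in at_right 0. inverse t ^ m / exp (inverse t) = flat m t"
      by (auto simp: eventually_at_right_field flat_def exp_minus field_simps intro!: exI[of _ 1])
  qed
  moreover have "(flat m \<longlongrightarrow> 0) (at_left 0)"
    by (rule tendsto_eventually) (auto simp: eventually_at_left_field flat_def intro!: exI[of _ "-1"])
  ultimately show ?thesis by (simp add: filterlim_at_split)
qed

lemma flat_has_derivative:
  "(flat m has_real_derivative (flat (m + 2) t - m * flat (m + 1) t)) (at t)"
proof -
  consider "t > 0" | "t < 0" | "t = 0" by linarith
  then show ?thesis
  proof cases
    case 1
    have "((\<lambda>t. exp (- 1 / t) / t ^ m) has_real_derivative (flat (m + 2) t - m * flat (m + 1) t)) (at t)"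
      using 1 by (auto intro!: derivative_eq_intros simp: flat_def)
       (cases m; simp add: field_simps power2_eq_square)
    moreover have ev: "\<forall>\<^sub>F s in nhds t. exp (- 1 / s) / s ^ m = flat m s"
      using eventually_nhds_in_open[of "{0<..}" t] 1 by (auto elim!: eventually_mono simp: flat_def)
    ultimately show ?thesis using DERIV_cong_ev[OF refl ev refl] by simp
  next
    case 2
    have "((\<lambda>t. 0) has_real_derivative (flat (m + 2) t - m * flat (m + 1) t)) (at t)"
      using 2 by (auto simp: flat_def)
    moreover have ev: "\<forall>\<^sub>F s in nhds t. 0 = flat m s"
      using eventually_nhds_in_open[of "{..<0}" t] 2 by (auto elim!: eventually_mono simp: flat_def)
    ultimately show ?thesis using DERIV_cong_ev[OF refl ev refl] by simp
  next
    case 3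
    \<comment> \<open>The difference quotient of \<open>flat m\<close> at 0 is
      \<open>flat (m + 1)\<close> itself, for increments of either sign.\<close>
    have "((\<lambda>h. (flat m (0 + h) - flat m 0) / h) \<longlongrightarrow> 0) (at 0)"
      using flat_tendsto_0[of "m + 1"]
      by (rule Lim_transform_eventually) (auto simp: flat_def eventually_at_filter)
    then show ?thesis using 3 by (simp add: DERIV_def flat_def)
  qed
qed

lemma Dk_flat: "Dk UNIV k (flat m)"
proof (induction k arbitrary: m)
  case 0
  show ?case
    by (auto intro!: continuous_at_imp_continuous_on DERIV_isCont[OF flat_has_derivative])
next
  case (Suc k)
  have "Dk UNIV k (\<lambda>t. flat (m + 2) t + (- m) * flat (m + 1) t)"
    by (intro Dk_add Dk_cmult Suc)
  then show ?case using flat_has_derivative[of m] by (intro Dk_SucI[of _ "flat m"]) auto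
qed
lemma test_functionsI:
  assumes "\<And>k. Ck k \<phi>" "\<And>x. R < norm x \<Longrightarrow> \<phi> x = 0"
  shows "\<phi> \<in> test_functions"
proof -
  have "{x. \<phi> x \<noteq> 0} \<subseteq> cball 0 R" using assms(2) by (force simp: not_less[symmetric])
  then have "closure {x. \<phi> x \<noteq> 0} \<subseteq> cball 0 R" by (rule closure_minimal) simp
  then have "compact (closure {x. \<phi> x \<noteq> 0})"
    by (meson bounded_cball bounded_subset closed_closure compact_eq_bounded_closed)
  with assms(1) show ?thesis by (simp add: test_functions_def)
qed

lemma test_functionE:
  assumes "\<phi> \<in> test_functions"
  obtains R where "0 < R" "\<And>x. R < norm x \<Longrightarrow> \<phi> x = 0"
proof -
  have "bounded {x. \<phi> x \<noteq> 0}"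
    using assms compact_imp_bounded bounded_subset[OF _ closure_subset] by (auto simp: test_functions_def)
  then obtain R where "R > 0" "\<And>x. \<phi> x \<noteq> 0 \<Longrightarrow> norm x \<le> R" by (auto simp: bounded_pos)
  with that show thesis by (meson not_le)
qed

section \<open>Functions determined by their integrals\<close>

text \<open>A Dynkin argument: the sets \<open>Z\<close> in question are closed under complements
  and countable disjoint unions, and the open boxes are an intersection stable generator of the
  Borel sets.\<close>

lemma integral_preimage_eq_0:
  fixes h :: "'a \<Rightarrow> 'b::{banach,second_countable_topology}" and t :: "'a \<Rightarrow> 'c::euclidean_space"
  assumes h: "integrable M h" and t[measurable]: "t \<in> borel_measurable M"
    and box: "\<And>a b. (LINT x|M. indicator (box a b) (t x) *\<^sub>R h x) = 0"
    and Z: "Z \<in> sets borel"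
  shows "(LINT x|M. indicator Z (t x) *\<^sub>R h x) = 0"
proof -
  have [measurable]: "h \<in> borel_measurable M" using h by simp
  have int: "integrable M (\<lambda>x. indicator A (t x) *\<^sub>R h x)" if [measurable]: "A \<in> sets borel" for A
    using h by (rule Bochner_Integration.integrable_bound) (auto simp: indicator_def)
  \<comment> \<open>Complements require a vanishing total integral, obtained by exhausting the space
    with boxes.\<close>
  have total: "(LINT x|M. h x) = 0"
  proof (rule LIMSEQ_unique)
    show "(\<lambda>n. LINT x|M. indicator (box (- (real n *\<^sub>R One)) (real n *\<^sub>R One)) (t x) *\<^sub>R h x) \<longlonglongrightarrow> (LINT x|M. h x)"
    proof (rule integral_dominated_convergence[where w="\<lambda>x. norm (h x)"])
      show "AE x in M. (\<lambda>n. indicator (box (- (real n *\<^sub>R One)) (real n *\<^sub>R One)) (t x) *\<^sub>R h x) \<longlonglongrightarrow> h x"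
      proof (rule AE_I2)
        fix x
        obtain N where N: "t x \<in> box (- (real N *\<^sub>R One)) (real N *\<^sub>R One)"
          using UN_box_eq_UNIV[where 'a='c] by blast
        have "\<forall>\<^sub>F n in sequentially. indicator (box (- (real n *\<^sub>R One)) (real n *\<^sub>R One)) (t x) *\<^sub>R h x = h x"
          using eventually_ge_at_top[of N]
        proof eventually_elim
          case (elim n)
          with N have "t x \<in> box (- (real n *\<^sub>R One)) (real n *\<^sub>R One)"
            by (auto simp: mem_box)
          then show ?case by simp
        qed
        then show "(\<lambda>n. indicator (box (- (real n *\<^sub>R One)) (real n *\<^sub>R One)) (t x) *\<^sub>R h x) \<longlonglongrightarrow> h x"
          by (rule tendsto_eventually)
      qed
    qed (use h in \<open>auto simp: indicator_def\<close>)
    show "(\<lambda>n. LINT x|M. indicator (box (- (real n *\<^sub>R One)) (real n *\<^sub>R One)) (t x) *\<^sub>R h x) \<longlonglongrightarrow> 0"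
      by (simp add: box)
  qed
  have Z': "Z \<in> sigma_sets UNIV (range (\<lambda>(a, b). box a b))"
    using Z by (simp add: borel_eq_box)
  have "Int_stable (range (\<lambda>(a, b). box a b :: 'c set))" "range (\<lambda>(a, b). box a b :: 'c set) \<subseteq> Pow UNIV"
    by (auto simp: Int_stable_def box_Int_box)
  from this Z' show ?thesis
  proof (induction rule: sigma_sets_induct_disjoint)
    case (compl A)
    then have [measurable]: "A \<in> sets borel" by (simp add: borel_eq_box)
    have "(LINT x|M. indicator (UNIV - A) (t x) *\<^sub>R h x) = (LINT x|M. h x - indicator A (t x) *\<^sub>R h x)"
      by (intro Bochner_Integration.integral_cong) (auto simp: indicator_def)
    then show ?case using compl total h int by simp
  next
    case (union A)
    then have [measurable]: "A i \<in> sets borel" for i by (auto simp: borel_eq_box)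
    let ?A = "\<lambda>i. t -` A i \<inter> space M"
    have eq: "set_lebesgue_integral M (t -` B \<inter> space M) h = (LINT x|M. indicator B (t x) *\<^sub>R h x)" for B
      unfolding set_lebesgue_integral_def by (intro Bochner_Integration.integral_cong) (auto simp: indicator_def)
    have "set_lebesgue_integral M (\<Union>i. ?A i) h = (\<Sum>i. set_lebesgue_integral M (?A i) h)"
    proof (rule lebesgue_integral_countable_add)
      show "?A i \<inter> ?A j = {}" if "i \<noteq> j" for i j
        using union(1) that by (auto simp: disjoint_family_on_def)
      show "set_integrable M (\<Union>i. ?A i) h"
        unfolding set_integrable_def using h by (rule Bochner_Integration.integrable_bound) (auto simp: indicator_def)
    qed auto
    moreover have "(\<Union>i. ?A i) = t -` (\<Union>i. A i) \<inter> space M" by auto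
    ultimately show ?case using union by (simp only: eq) simp
  qed (auto simp: box)
qed

text \<open>A product over the coordinates, rather than a radial cutoff, tends to the indicator of
  an open box as \<open>k\<close> grows; boxes are what the Dynkin argument asks for.\<close>

lemma smooth_bump_box:
  fixes a b :: space and k :: real
  assumes "k > 0"
  shows "(\<lambda>x. \<Prod>i\<in>UNIV. flat 0 (k * (x $ i - a $ i)) * flat 0 (k * (b $ i - x $ i))) \<in> test_functions"
proof (rule test_functionsI[where R="norm a + norm b"])
  fix m
  have c: "Ck m (\<lambda>x. flat 0 (r * x $ i + t))" for r t i
    by (rule Ck_compose[OF Dk_affine[OF Dk_flat] Ck_coord]) auto
  have "Ck m (\<lambda>x. flat 0 (k * (x $ i - a $ i)))" "Ck m (\<lambda>x. flat 0 (k * (b $ i - x $ i)))" for i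
    using c[of k i "- k * a $ i"] c[of "- k" i "k * b $ i"] by (simp_all add: algebra_simps)
  then show "Ck m (\<lambda>x. \<Prod>i\<in>UNIV. flat 0 (k * (x $ i - a $ i)) * flat 0 (k * (b $ i - x $ i)))"
    by (intro Ck_prod Ck_mult) auto
next
  fix x :: space assume x: "norm a + norm b < norm x"
  have "\<exists>i. \<not> (a $ i < x $ i \<and> x $ i < b $ i)"
  proof (rule ccontr)
    assume "\<nexists>i. \<not> (a $ i < x $ i \<and> x $ i < b $ i)"
    then have *: "a $ i < x $ i \<and> x $ i < b $ i" for i by blast
    have "norm (x $ i) \<le> norm (\<bar>a $ i\<bar> + \<bar>b $ i\<bar>)" for i
      using *[of i] unfolding real_norm_def by arith
    then have "norm x \<le> norm (\<chi> i. \<bar>a $ i\<bar> + \<bar>b $ i\<bar>)"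
      by (intro norm_le_componentwise_cart) auto
    also have "\<dots> = norm ((\<chi> i. \<bar>a $ i\<bar>) + (\<chi> i. \<bar>b $ i\<bar>))" by (simp add: plus_vec_def)
    also have "\<dots> \<le> norm (\<chi> i. \<bar>a $ i\<bar>) + norm (\<chi> i. \<bar>b $ i\<bar>)" by (rule norm_triangle_ineq)
    also have "\<dots> = norm a + norm b" by (simp add: norm_vec_def L2_set_def)
    finally show False using x by simp
  qed
  then obtain i where "a $ i \<ge> x $ i \<or> x $ i \<ge> b $ i" by (auto simp: not_less)
  with assms have "flat 0 (k * (x $ i - a $ i)) * flat 0 (k * (b $ i - x $ i)) = 0"
    by (auto simp: flat_def zero_less_mult_iff)
  then show "(\<Prod>i\<in>UNIV. flat 0 (k * (x $ i - a $ i)) * flat 0 (k * (b $ i - x $ i))) = 0"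
    by (intro prod_zero) auto
qed

lemma flat_0_le_1: "0 \<le> flat 0 t" "flat 0 t \<le> 1"
  by (auto simp: flat_def)

lemma flat_0_scaled_tendsto: "(\<lambda>k. flat 0 (real (Suc k) * s)) \<longlonglongrightarrow> (if s > 0 then 1 else 0)"
proof (cases "s > 0")
  case True
  have "(\<lambda>k. inverse s * inverse (real (Suc k))) \<longlonglongrightarrow> inverse s * 0"
    by (intro tendsto_mult tendsto_const LIMSEQ_inverse_real_of_nat)
  from tendsto_exp[OF tendsto_minus[OF this]]
  have "(\<lambda>k. exp (- (inverse s * inverse (real (Suc k))))) \<longlonglongrightarrow> exp (- (inverse s * 0))" .
  then show ?thesis using True by (simp add: flat_def divide_simps mult_ac del: of_nat_Suc)
qed (auto simp: flat_def zero_less_mult_iff)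

text \<open>Bumps pass to boxes by dominated convergence, boxes to Borel sets by the Dynkin
  argument, and a density whose integrals over all Borel sets vanish is zero. Everything happens
  inside a bounded box, so integrability on boxes is enough; countably many boxes then cover the
  space.\<close>

lemma AE_zero_if_orthogonal_to_test_functions:
  fixes h :: "space \<Rightarrow> 'b::{banach,second_countable_topology}"
  assumes [measurable]: "h \<in> borel_measurable lborel"
    and loc: "\<And>a b. integrable lborel (\<lambda>x. indicator (box a b) x *\<^sub>R h x)"
    and orth: "\<And>\<phi>. \<phi> \<in> test_functions \<Longrightarrow> (LINT x|lborel. \<phi> x *\<^sub>R h x) = 0"
  shows "AE x in lborel. h x = 0"
proof -
  have box0: "(LINT x|lborel. indicator (box a b) x *\<^sub>R h x) = 0" for a b :: space
  proof (rule LIMSEQ_unique)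
    define \<phi> where "\<phi> k x = (\<Prod>i\<in>UNIV. flat 0 (real (Suc k) * (x $ i - a $ i)) * flat 0 (real (Suc k) * (b $ i - x $ i)))" for k and x :: space
    have test: "\<phi> k \<in> test_functions" for k
      using smooth_bump_box[of "real (Suc k)" a b] by (simp add: \<phi>_def[abs_def])
    show "(\<lambda>k. LINT x|lborel. \<phi> k x *\<^sub>R h x) \<longlonglongrightarrow> 0"
      using orth[OF test] by simp
    have mem: "x \<in> box a b \<longleftrightarrow> (\<forall>i. a $ i < x $ i \<and> x $ i < b $ i)" for x by (simp add: mem_box_cart)
    have lim: "(\<lambda>k. \<phi> k x) \<longlonglongrightarrow> indicator (box a b) x" for x
    proof -
      have "(\<lambda>k. \<phi> k x) \<longlonglongrightarrow> (\<Prod>i\<in>UNIV. (if x $ i - a $ i > 0 then 1 else 0) * (if b $ i - x $ i > 0 then 1 else 0))"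
        unfolding \<phi>_def by (intro tendsto_prod tendsto_mult flat_0_scaled_tendsto)
      moreover have "(\<Prod>i\<in>UNIV. (if x $ i - a $ i > 0 then 1 else 0) * (if b $ i - x $ i > 0 then 1 else 0)) = (indicator (box a b) x :: real)"
      proof (cases "x \<in> box a b")
        case False
        then obtain i where "\<not> (a $ i < x $ i \<and> x $ i < b $ i)" by (auto simp: mem)
        then show ?thesis using False by (intro prod_zero[THEN trans]) (auto intro!: exI[of _ i])
      qed (auto simp: mem)
      ultimately show ?thesis by simp
    qed
    have bd: "0 \<le> \<phi> k x \<and> \<phi> k x \<le> indicator (box a b) x" for k x
    proof (cases "x \<in> box a b")
      case True
      then show ?thesis unfolding \<phi>_def by (auto intro!: prod_nonneg prod_le_1 mult_nonneg_nonneg mult_le_one flat_0_le_1)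
    next
      case False
      then have "\<exists>i. \<not> (real (Suc k) * (x $ i - a $ i) > 0 \<and> real (Suc k) * (b $ i - x $ i) > 0)"
        by (auto simp: mem zero_less_mult_iff simp del: of_nat_Suc)
      then have "\<phi> k x = 0" unfolding \<phi>_def by (intro prod_zero) (auto simp: flat_def simp del: of_nat_Suc)
      then show ?thesis by (metis indicator_pos_le order_refl)
    qed
    have [measurable]: "\<phi> k \<in> borel_measurable borel" for k
      using test
      by (intro borel_measurable_continuous_onI Ck_imp_continuous[of 0]) (simp add: test_functions_def)
    show "(\<lambda>k. LINT x|lborel. \<phi> k x *\<^sub>R h x) \<longlonglongrightarrow> (LINT x|lborel. indicator (box a b) x *\<^sub>R h x)"
    proof (rule integral_dominated_convergence[where w="\<lambda>x. norm (indicator (box a b) x *\<^sub>R h x)"])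
      show "AE x in lborel. norm (\<phi> k x *\<^sub>R h x) \<le> norm (indicator (box a b) x *\<^sub>R h x)" for k
        using bd by (intro AE_I2) (auto intro!: mult_right_mono)
      show "AE x in lborel. (\<lambda>k. \<phi> k x *\<^sub>R h x) \<longlonglongrightarrow> indicator (box a b) x *\<^sub>R h x"
        using lim by (intro AE_I2 tendsto_intros)
    qed (use integrable_norm[OF loc[of a b]] in auto)
  qed
  have "AE x in lborel. indicator (box (- (R *\<^sub>R One)) (R *\<^sub>R One)) x *\<^sub>R h x = 0" for R
  proof (rule sigma_finite_measure.density_zero[OF sigma_finite_lborel loc])
    fix A :: "space set" assume A: "A \<in> sets lborel"
    show "set_lebesgue_integral lborel A (\<lambda>x. indicator (box (- (R *\<^sub>R One)) (R *\<^sub>R One)) x *\<^sub>R h x) = 0"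
      unfolding set_lebesgue_integral_def
    proof (rule integral_preimage_eq_0[OF loc, where t="\<lambda>x. x"])
      fix a b :: space
      have "(\<lambda>x. indicator (box a b) x *\<^sub>R indicator (box (- (R *\<^sub>R One)) (R *\<^sub>R One)) x *\<^sub>R h x)
        = (\<lambda>x. indicator (box a b \<inter> box (- (R *\<^sub>R One)) (R *\<^sub>R One)) x *\<^sub>R h x)"
        by (auto simp: indicator_def)
      then show "(LINT x|lborel. indicator (box a b) x *\<^sub>R indicator (box (- (R *\<^sub>R One)) (R *\<^sub>R One)) x *\<^sub>R h x) = 0"
        using box0 by (simp add: box_Int_box)
    qed (use A in auto)
  qed
  then have "AE x in lborel. \<forall>n::nat. indicator (box (- (real n *\<^sub>R One)) (real n *\<^sub>R One)) x *\<^sub>R h x = 0"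
    unfolding AE_all_countable by blast
  then show ?thesis
  proof (rule AE_mp, intro AE_I2 impI)
    fix x assume *: "\<forall>n::nat. indicator (box (- (real n *\<^sub>R One)) (real n *\<^sub>R One)) x *\<^sub>R h x = 0"
    obtain N :: nat where "x \<in> box (- (real N *\<^sub>R One)) (real N *\<^sub>R One)"
      using UN_box_eq_UNIV[where 'a=space] by blast
    with *[rule_format, of N] show "h x = 0" by simp
  qed
qed


section \<open>Integration tools\<close>

text \<open>Cauchy-Schwarz is first applied to nonnegative integrals, which makes integrability of
  the product a conclusion.\<close>

lemma L2_mult:
  fixes f g :: "'a \<Rightarrow> real"
  assumes [measurable]: "f \<in> borel_measurable M" "g \<in> borel_measurable M"
    and f: "integrable M (\<lambda>x. (f x)\<^sup>2)" and g: "integrable M (\<lambda>x. (g x)\<^sup>2)"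
  shows "integrable M (\<lambda>x. f x * g x)"
    and "\<bar>LINT x|M. f x * g x\<bar> \<le> sqrt (LINT x|M. (f x)\<^sup>2) * sqrt (LINT x|M. (g x)\<^sup>2)"
    and "(LINT x|M. \<bar>f x * g x\<bar>) \<le> sqrt (LINT x|M. (f x)\<^sup>2) * sqrt (LINT x|M. (g x)\<^sup>2)"
proof -
  let ?F = "LINT x|M. (f x)\<^sup>2" and ?G = "LINT x|M. (g x)\<^sup>2"
  have "(\<integral>\<^sup>+x. ennreal \<bar>f x\<bar> * ennreal \<bar>g x\<bar> \<partial>M)\<^sup>2 \<le> (\<integral>\<^sup>+x. ennreal \<bar>f x\<bar> ^ 2 \<partial>M) * (\<integral>\<^sup>+x. ennreal \<bar>g x\<bar> ^ 2 \<partial>M)"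
    by (rule Cauchy_Schwarz_nn_integral) auto
  also have "(\<integral>\<^sup>+x. ennreal \<bar>f x\<bar> ^ 2 \<partial>M) = ennreal ?F"
    using f by (subst nn_integral_eq_integral[symmetric]) (auto simp: ennreal_power)
  also have "(\<integral>\<^sup>+x. ennreal \<bar>g x\<bar> ^ 2 \<partial>M) = ennreal ?G"
    using g by (subst nn_integral_eq_integral[symmetric]) (auto simp: ennreal_power)
  finally have *: "(\<integral>\<^sup>+x. ennreal \<bar>f x * g x\<bar> \<partial>M)\<^sup>2 \<le> ennreal (?F * ?G)"
    by (simp add: ennreal_mult abs_mult)
  have "(\<integral>\<^sup>+x. ennreal \<bar>f x * g x\<bar> \<partial>M) < \<infinity>"
  proof (rule ccontr)
    assume "\<not> (\<integral>\<^sup>+x. ennreal \<bar>f x * g x\<bar> \<partial>M) < \<infinity>"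
    then have "(\<integral>\<^sup>+x. ennreal \<bar>f x * g x\<bar> \<partial>M) = top" by (auto simp: not_less top_unique)
    with * show False by (simp add: power2_eq_square top_unique)
  qed
  then show int: "integrable M (\<lambda>x. f x * g x)"
    by (intro integrableI_bounded) auto
  have "(\<integral>\<^sup>+x. ennreal \<bar>f x * g x\<bar> \<partial>M) = ennreal (LINT x|M. \<bar>f x * g x\<bar>)"
    using int by (intro nn_integral_eq_integral) auto
  with * have "(LINT x|M. \<bar>f x * g x\<bar>)\<^sup>2 \<le> ?F * ?G"
    by (simp add: ennreal_power)
  then show le: "(LINT x|M. \<bar>f x * g x\<bar>) \<le> sqrt ?F * sqrt ?G"
    unfolding real_sqrt_mult[symmetric] by (rule real_le_rsqrt)
  have "\<bar>LINT x|M. f x * g x\<bar> \<le> (LINT x|M. \<bar>f x * g x\<bar>)"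
    by (rule integral_abs_bound)
  with le show "\<bar>LINT x|M. f x * g x\<bar> \<le> sqrt ?F * sqrt ?G" by linarith
qed

section \<open>Completeness of L2 with a square integrable majorant\<close>

lemma term_le_suminf_ennreal: "F k \<le> (\<Sum>k. F k :: ennreal)"
  using sum_le_suminf[of F "{k}"] by simp

text \<open>The theorem of Riesz and Fischer with its majorant \<open>W\<close> exported: that
  majorant is what dominated convergence needs in all later limits along the subsequence.\<close>

lemma L2_Cauchy_subseq:
  fixes f :: "nat \<Rightarrow> 'a \<Rightarrow> 'b::{banach,second_countable_topology}"
  assumes meas[measurable]: "\<And>n. f n \<in> borel_measurable M"
    and int: "\<And>n. integrable M (\<lambda>x. (norm (f n x))\<^sup>2)"
    and Cauchy: "\<And>e. e > 0 \<Longrightarrow> \<exists>N. \<forall>m\<ge>N. \<forall>n\<ge>N. (LINT x|M. (norm (f m x - f n x))\<^sup>2) < e"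
  obtains r g W where "strict_mono r" "g \<in> borel_measurable M" "integrable M (\<lambda>x. (norm (g x))\<^sup>2)"
    "W \<in> borel_measurable M" "integrable M (\<lambda>x. (W x)\<^sup>2)"
    "AE x in M. \<forall>k. norm (f (r k) x) \<le> W x" "AE x in M. norm (g x) \<le> W x"
    "AE x in M. (\<lambda>k. f (r k) x) \<longlonglongrightarrow> g x"
    "(\<lambda>k. LINT x|M. (norm (f (r k) x - g x))\<^sup>2) \<longlonglongrightarrow> 0"
proof -
  obtain r where r: "\<And>k. \<forall>m\<ge>r k. (LINT x|M. (norm (f m x - f (r k) x))\<^sup>2) < (1/4) ^ k" "\<And>k. r k < r (Suc k)"
  proof -
    have ex: "\<exists>y. (\<forall>m\<ge>y. (LINT x|M. (norm (f m x - f y x))\<^sup>2) < (1/4) ^ k) \<and> n < y" for k n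
    proof -
      obtain N where N: "\<forall>m\<ge>N. \<forall>n\<ge>N. (LINT x|M. (norm (f m x - f n x))\<^sup>2) < (1/4) ^ k"
        using Cauchy[of "(1/4) ^ k"] by auto
      then have "\<forall>m\<ge>max N (Suc n). (LINT x|M. (norm (f m x - f (max N (Suc n)) x))\<^sup>2) < (1/4) ^ k"
        by auto
      then show ?thesis by (intro exI[of _ "max N (Suc n)"]) auto
    qed
    from dependent_nat_choice[of "\<lambda>k y. \<forall>m\<ge>y. (LINT x|M. (norm (f m x - f y x))\<^sup>2) < (1/4) ^ k" "\<lambda>k x y. x < y"]
    obtain r where "\<forall>k. (\<forall>m\<ge>r k. (LINT x|M. (norm (f m x - f (r k) x))\<^sup>2) < (1/4) ^ k) \<and> r k < r (Suc k)"
      using ex by blast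
    then show ?thesis by (intro that[of r]) auto
  qed
  have mono: "strict_mono r" using r(2) by (simp add: strict_mono_Suc_iff)
  define d where "d k x = norm (f (r (Suc k)) x - f (r k) x)" for k x
  have [measurable]: "d k \<in> borel_measurable M" for k unfolding d_def by measurable
  have d_int: "integrable M (\<lambda>x. (d k x)\<^sup>2)" for k
  proof (rule Bochner_Integration.integrable_bound[OF Bochner_Integration.integrable_add[OF integrable_mult_right[OF int[of "r (Suc k)"], of 2] integrable_mult_right[OF int[of "r k"], of 2]]])
    show "AE x in M. norm ((d k x)\<^sup>2) \<le> norm (2 * (norm (f (r (Suc k)) x))\<^sup>2 + 2 * (norm (f (r k) x))\<^sup>2)"
    proof (rule AE_I2)
      fix x
      have "(d k x)\<^sup>2 \<le> (norm (f (r (Suc k)) x) + norm (f (r k) x))\<^sup>2"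
        unfolding d_def by (intro power_mono norm_triangle_ineq4) auto
      also have "\<dots> \<le> 2 * (norm (f (r (Suc k)) x))\<^sup>2 + 2 * (norm (f (r k) x))\<^sup>2"
        using sum_squares_bound[of "norm (f (r (Suc k)) x)" "norm (f (r k) x)"] by (simp add: power2_sum)
      finally show "norm ((d k x)\<^sup>2) \<le> norm (2 * (norm (f (r (Suc k)) x))\<^sup>2 + 2 * (norm (f (r k) x))\<^sup>2)" by simp
    qed
  qed auto
  have d_le: "(LINT x|M. (d k x)\<^sup>2) \<le> (1/4) ^ k" for k
    using r(1)[of k] r(2)[of k] unfolding d_def by (auto intro: less_imp_le)
  have "(\<integral>\<^sup>+x. (\<Sum>k. ennreal (2 ^ k * (d k x)\<^sup>2)) \<partial>M) = (\<Sum>k. \<integral>\<^sup>+x. ennreal (2 ^ k * (d k x)\<^sup>2) \<partial>M)"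
    by (intro nn_integral_suminf) auto
  also have "\<dots> = (\<Sum>k. ennreal (2 ^ k * (LINT x|M. (d k x)\<^sup>2)))"
  proof (rule arg_cong[where f=suminf], rule ext)
    fix k
    show "(\<integral>\<^sup>+x. ennreal (2 ^ k * (d k x)\<^sup>2) \<partial>M) = ennreal (2 ^ k * (LINT x|M. (d k x)\<^sup>2))"
      using d_int[of k] by (subst nn_integral_eq_integral) auto
  qed
  also have "\<dots> \<le> (\<Sum>k. ennreal ((1/2) ^ k))"
  proof (intro suminf_le ennreal_leI allI)
    fix k
    have "2 ^ k * (LINT x|M. (d k x)\<^sup>2) \<le> 2 ^ k * (1/4) ^ k" using d_le by simp
    also have "\<dots> = (2 * (1/4)) ^ k" unfolding power_mult_distrib ..
    finally show "2 ^ k * (LINT x|M. (d k x)\<^sup>2) \<le> (1/2) ^ k" by simp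
  qed auto
  also have "\<dots> = ennreal 2"
  proof -
    have "(\<Sum>k. ennreal ((1/2) ^ k)) = ennreal (\<Sum>k. (1/2) ^ k)"
      by (rule suminf_ennreal2) (auto intro: summable_geometric)
    also have "(\<Sum>k. (1/2::real) ^ k) = 2" by (subst suminf_geometric) auto
    finally show ?thesis .
  qed
  finally have fin: "(\<integral>\<^sup>+x. (\<Sum>k. ennreal (2 ^ k * (d k x)\<^sup>2)) \<partial>M) < \<infinity>"
    by (rule le_less_trans) simp
  \<comment> \<open>Squared distances below \<open>(1/4) ^ k\<close> leave room for the weights
    \<open>2 ^ k\<close>, so \<open>S\<close> is integrable. Conversely a finite value
    \<open>S x\<close> bounds the \<open>k\<close>-th increment at \<open>x\<close> by
    \<open>sqrt (S x)\<close> times the \<open>k\<close>-th power of \<open>sqrt (1 / 2)\<close>;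
    the increments are summable by a geometric series, and \<open>W\<close> below is the first term
    plus that series.\<close>
  define S where "S x = enn2real (\<Sum>k. ennreal (2 ^ k * (d k x)\<^sup>2))" for x
  have [measurable]: "S \<in> borel_measurable M" unfolding S_def by measurable
  have AE_fin: "AE x in M. (\<Sum>k. ennreal (2 ^ k * (d k x)\<^sup>2)) \<noteq> \<infinity>"
    using fin by (intro nn_integral_PInf_AE) auto
  have S_int: "integrable M S"
  proof (rule integrableI_bounded)
    have "(\<integral>\<^sup>+x. ennreal (norm (S x)) \<partial>M) \<le> (\<integral>\<^sup>+x. (\<Sum>k. ennreal (2 ^ k * (d k x)\<^sup>2)) \<partial>M)"
      unfolding S_def by (intro nn_integral_mono) (simp add: ennreal_enn2real_if)
    from le_less_trans[OF this fin] show "(\<integral>\<^sup>+x. ennreal (norm (S x)) \<partial>M) < \<infinity>" .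
  qed auto
  have S_nn: "S x \<ge> 0" for x unfolding S_def by simp
  define c :: real where "c = sqrt (1 / 2)"
  have c1: "0 < c" "c < 1" unfolding c_def by auto
  define b where "b = 1 / (1 - c)"
  have b: "b \<ge> 0" unfolding b_def using c1 by simp
  have dS: "d k x \<le> c ^ k * sqrt (S x)" if "(\<Sum>k. ennreal (2 ^ k * (d k x)\<^sup>2)) \<noteq> \<infinity>" for k x
  proof -
    have "ennreal (2 ^ k * (d k x)\<^sup>2) \<le> (\<Sum>k. ennreal (2 ^ k * (d k x)\<^sup>2))"
      by (rule term_le_suminf_ennreal)
    also have "\<dots> = ennreal (S x)" unfolding S_def using that by (simp add: ennreal_enn2real_if)
    finally have "2 ^ k * (d k x)\<^sup>2 \<le> S x" using S_nn by (simp add: ennreal_le_iff)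
    then have "(d k x)\<^sup>2 \<le> (1/2) ^ k * S x" by (simp add: pos_le_divide_eq power_one_over mult.commute)
    then have "d k x \<le> sqrt ((1/2) ^ k * S x)" by (rule real_le_rsqrt)
    then show ?thesis by (simp only: real_sqrt_mult real_sqrt_power c_def)
  qed
  define W where "W x = norm (f (r 0) x) + sqrt (S x) * b" for x
  have [measurable]: "W \<in> borel_measurable M" unfolding W_def by measurable
  have W_nn: "W x \<ge> 0" for x unfolding W_def using S_nn[of x] b by simp
  have W_int: "integrable M (\<lambda>x. (W x)\<^sup>2)"
  proof (rule Bochner_Integration.integrable_bound[OF Bochner_Integration.integrable_add[OF integrable_mult_right[OF int[of "r 0"], of 2] integrable_mult_right[OF S_int, of "2 * b\<^sup>2"]]])
    show "AE x in M. norm ((W x)\<^sup>2) \<le> norm (2 * (norm (f (r 0) x))\<^sup>2 + 2 * b\<^sup>2 * S x)"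
    proof (rule AE_I2)
      fix x
      have "(W x)\<^sup>2 \<le> 2 * (norm (f (r 0) x))\<^sup>2 + 2 * (sqrt (S x) * b)\<^sup>2"
        unfolding W_def using sum_squares_bound[of "norm (f (r 0) x)" "sqrt (S x) * b"] by (simp add: power2_sum)
      also have "(sqrt (S x) * b)\<^sup>2 = b\<^sup>2 * S x"
        unfolding power_mult_distrib using S_nn[of x] by (simp add: mult.commute)
      finally show "norm ((W x)\<^sup>2) \<le> norm (2 * (norm (f (r 0) x))\<^sup>2 + 2 * b\<^sup>2 * S x)"
        by (simp add: mult.assoc)
    qed
  qed auto
  have bound: "norm (f (r k) x) \<le> W x" and conv: "convergent (\<lambda>k. f (r k) x)"
    if fx: "(\<Sum>k. ennreal (2 ^ k * (d k x)\<^sup>2)) \<noteq> \<infinity>" for k x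
  proof -
    have sg: "summable (\<lambda>j. c ^ j * sqrt (S x))" "(\<Sum>j. c ^ j * sqrt (S x)) = sqrt (S x) * b"
      using c1 by (auto intro!: summable_mult2 summable_geometric simp: suminf_geometric suminf_mult2[symmetric] b_def)
    have tele: "f (r k) x = f (r 0) x + (\<Sum>j<k. f (r (Suc j)) x - f (r j) x)" for k
      using sum_lessThan_telescope[of "\<lambda>j. f (r j) x" k] by simp
    have "norm (f (r k) x) \<le> norm (f (r 0) x) + (\<Sum>j<k. norm (f (r (Suc j)) x - f (r j) x))"
      unfolding tele[of k] by (intro order_trans[OF norm_triangle_ineq] add_left_mono norm_sum)
    also have "(\<Sum>j<k. norm (f (r (Suc j)) x - f (r j) x)) \<le> (\<Sum>j<k. c ^ j * sqrt (S x))"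
      using dS[OF fx] unfolding d_def by (intro sum_mono)
    also have "\<dots> \<le> (\<Sum>j. c ^ j * sqrt (S x))"
      using sg(1) S_nn c1 by (intro sum_le_suminf) auto
    finally show "norm (f (r k) x) \<le> W x" unfolding W_def sg by simp
    have "summable (\<lambda>j. f (r (Suc j)) x - f (r j) x)"
      using dS[OF fx] unfolding d_def by (intro summable_comparison_test'[OF sg(1), of 0])
    then have "convergent (\<lambda>k. \<Sum>j<k. f (r (Suc j)) x - f (r j) x)" by (simp add: summable_iff_convergent)
    from convergent_add[OF convergent_const[of "f (r 0) x"] this]
    show "convergent (\<lambda>k. f (r k) x)" unfolding tele[symmetric] .
  qed
  define g where "g x = lim (\<lambda>k. f (r k) x)" for x
  have [measurable]: "g \<in> borel_measurable M" unfolding g_def by measurable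
  have AE_b: "AE x in M. \<forall>k. norm (f (r k) x) \<le> W x" using AE_fin by eventually_elim (use bound in blast)
  have AE_l: "AE x in M. (\<lambda>k. f (r k) x) \<longlonglongrightarrow> g x"
    using AE_fin by eventually_elim (use conv in \<open>auto simp: g_def convergent_LIMSEQ_iff\<close>)
  have AE_g: "AE x in M. norm (g x) \<le> W x"
    using AE_b AE_l
  proof eventually_elim
    case (elim x)
    then show ?case by (intro tendsto_upperbound[OF tendsto_norm[OF elim(2)]]) auto
  qed
  have g_int: "integrable M (\<lambda>x. (norm (g x))\<^sup>2)"
    by (rule Bochner_Integration.integrable_bound[OF W_int])
      (use AE_g in \<open>auto elim!: eventually_mono intro!: power_mono\<close>)
  have "(\<lambda>k. LINT x|M. (norm (f (r k) x - g x))\<^sup>2) \<longlonglongrightarrow> (LINT x|M. 0)"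
  proof (rule integral_dominated_convergence[where w="\<lambda>x. 4 * (W x)\<^sup>2"])
    show "AE x in M. (\<lambda>k. (norm (f (r k) x - g x))\<^sup>2) \<longlonglongrightarrow> 0"
      using AE_l
    proof eventually_elim
      case (elim x)
      from tendsto_power[OF tendsto_norm[OF tendsto_diff[OF elim tendsto_const[of "g x"]]], of 2]
      show ?case by simp
    qed
    fix k
    show "AE x in M. norm ((norm (f (r k) x - g x))\<^sup>2) \<le> 4 * (W x)\<^sup>2"
      using AE_b AE_g
    proof eventually_elim
      case (elim x)
      have "norm (f (r k) x - g x) \<le> 2 * W x"
        using norm_triangle_ineq4[of "f (r k) x" "g x"] elim(1)[rule_format, of k] elim(2) by linarith
      then have "(norm (f (r k) x - g x))\<^sup>2 \<le> (2 * W x)\<^sup>2" by (intro power_mono) auto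
      then show ?case by (simp add: power_mult_distrib)
    qed
  qed (use W_int in auto)
  then have "(\<lambda>k. LINT x|M. (norm (f (r k) x - g x))\<^sup>2) \<longlonglongrightarrow> 0" by simp
  with that[OF mono _ g_int _ W_int AE_b AE_g AE_l] show thesis by auto
qed

section \<open>Integrals under dilations and in polar coordinates\<close>

lemma scaling_nn_integral:
  fixes f :: "'a::euclidean_space \<Rightarrow> ennreal"
  assumes [measurable]: "f \<in> borel_measurable borel" and c: "c > 0"
  shows "(\<integral>\<^sup>+x. f x \<partial>lborel) = ennreal (c ^ DIM('a)) * (\<integral>\<^sup>+x. f (c *\<^sub>R x) \<partial>lborel)"
  using c by (subst lborel_affine[of c 0]) (auto simp: nn_integral_density nn_integral_distr nn_integral_cmult)

lemma scaling_integrable: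
  fixes f :: "'a::euclidean_space \<Rightarrow> 'b::{banach,second_countable_topology}"
  assumes f: "integrable lborel f" and c: "c > 0"
  shows "integrable lborel (\<lambda>x. f (c *\<^sub>R x))"
proof -
  have [measurable]: "f \<in> borel_measurable borel" using f by auto
  from f scaling_nn_integral[of "\<lambda>x. ennreal (norm (f x))", OF _ c] c show ?thesis
    unfolding integrable_iff_bounded by (auto simp: ennreal_mult_less_top)
qed

lemma scaling_integral:
  fixes f :: "'a::euclidean_space \<Rightarrow> 'b::{banach,second_countable_topology}"
  assumes c: "c > 0"
  shows "(LINT x|lborel. f (c *\<^sub>R x)) = (1 / c ^ DIM('a)) *\<^sub>R (LINT x|lborel. f x)"
proof (cases "integrable lborel f")
  case True
  then have [measurable]: "f \<in> borel_measurable borel" by auto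
  have "(LINT x|lborel. f x) = c ^ DIM('a) *\<^sub>R (LINT x|lborel. f (c *\<^sub>R x))"
    using c scaling_integrable[OF True c]
    by (subst lborel_affine[of c 0]) (auto simp: integral_density integral_distr)
  then show ?thesis using c by simp
next
  case False
  have "\<not> integrable lborel (\<lambda>x. f (c *\<^sub>R x))"
    using scaling_integrable[of "\<lambda>x. f (c *\<^sub>R x)" "1 / c"] c False by auto
  with False show ?thesis by (simp add: not_integrable_integral_eq)
qed

lemma scaling_AE:
  assumes "AE x in lborel. P (x :: 'a::euclidean_space)" "c > 0"
  shows "AE x in lborel. P (c *\<^sub>R x)"
proof -
  from assms(1) obtain N where N: "{x. \<not> P x} \<subseteq> N" "N \<in> sets borel" "emeasure lborel N = 0"
    by (auto elim!: AE_E)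
  then have [measurable]: "N \<in> sets borel" by simp
  have "(\<integral>\<^sup>+x. indicator N (c *\<^sub>R x) \<partial>lborel) = 0"
    using scaling_nn_integral[of "indicator N" c] N(3) assms(2) by simp
  then have "AE x in lborel. indicator N (c *\<^sub>R x) = (0::ennreal)"
    by (subst (asm) nn_integral_0_iff_AE) auto
  then show ?thesis by eventually_elim (use N(1) in \<open>auto simp: indicator_def split: if_splits\<close>)
qed

lemma emeasure_space_cball: "r \<ge> 0 \<Longrightarrow> emeasure lborel (cball (0::space) r) = ennreal (4 / 3 * pi * r ^ 3)"
  by (simp add: emeasure_cball unit_ball_vol_3)

text \<open>Both measures give \<open>{..a}\<close> the volume of a ball,
  \<open>4 / 3 * pi * a ^ 3\<close>, and these half lines are an intersection stable generator. Only
  balls are measured, so no parametrisation of the sphere occurs.\<close>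

lemma polar_distr:
  "distr lborel borel (norm :: space \<Rightarrow> real) = density lborel (\<lambda>r. ennreal (4 * pi * r\<^sup>2) * indicator {0..} r)"
proof (rule measure_eqI_generator_eq[where E="range (\<lambda>a::real. {..a})" and \<Omega>=UNIV and A="\<lambda>i. {..real i}"])
  show "Int_stable (range (\<lambda>a::real. {..a}))" by (auto simp: Int_stable_def)
  show "sets (distr lborel borel (norm :: space \<Rightarrow> real)) = sigma_sets UNIV (range (\<lambda>a::real. {..a}))"
    "sets (density lborel (\<lambda>r. ennreal (4 * pi * r\<^sup>2) * indicator {0..} r)) = sigma_sets UNIV (range (\<lambda>a::real. {..a}))"
    by (simp_all add: borel_eq_atMost)
  have L: "emeasure (distr lborel borel (norm :: space \<Rightarrow> real)) {..a} = (if a < 0 then 0 else ennreal (4 / 3 * pi * a ^ 3))" for a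
  proof -
    have "emeasure (distr lborel borel (norm :: space \<Rightarrow> real)) {..a} = emeasure lborel (cball (0::space) a)"
      by (subst emeasure_distr) (auto intro!: arg_cong[where f="emeasure lborel"])
    then show ?thesis by (auto simp: emeasure_space_cball)
  qed
  show "emeasure (distr lborel borel (norm :: space \<Rightarrow> real)) X =
      emeasure (density lborel (\<lambda>r. ennreal (4 * pi * r\<^sup>2) * indicator {0..} r)) X"
    if "X \<in> range (\<lambda>a::real. {..a})" for X
  proof -
    from that obtain a where X: "X = {..a}" by auto
    have "emeasure (density lborel (\<lambda>r. ennreal (4 * pi * r\<^sup>2) * indicator {0..} r)) X =
      (\<integral>\<^sup>+r. ennreal (4 * pi * r\<^sup>2) * indicator {0..a} r \<partial>lborel)"
      unfolding X by (subst emeasure_density) (auto intro!: nn_integral_cong simp: indicator_def)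
    also have "\<dots> = (if a < 0 then 0 else ennreal (4 / 3 * pi * a ^ 3))"
    proof (cases "a < 0")
      case False
      then have "(\<integral>\<^sup>+r. ennreal (4 * pi * r\<^sup>2) * indicator {0..a} r \<partial>lborel) = ennreal (4 / 3 * pi * a ^ 3 - 4 / 3 * pi * 0 ^ 3)"
        by (intro nn_integral_FTC_Icc) (auto intro!: derivative_eq_intros simp: power2_eq_square power3_eq_cube)
      with False show ?thesis by simp
    qed simp
    finally show ?thesis using L X by simp
  qed
  show "(\<Union>i. {..real i}) = UNIV" by (auto intro: real_arch_simple)
  show "emeasure (distr lborel borel (norm :: space \<Rightarrow> real)) {..real i} \<noteq> \<infinity>" for i by (subst L) auto
qed auto

lemma polar_nn_integral:
  assumes [measurable]: "k \<in> borel_measurable borel"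
  shows "(\<integral>\<^sup>+x. k (norm (x::space)) \<partial>lborel) = (\<integral>\<^sup>+r. ennreal (4 * pi * r\<^sup>2) * indicator {0..} r * k r \<partial>lborel)"
proof -
  have "(\<integral>\<^sup>+x. k (norm (x::space)) \<partial>lborel) = (\<integral>\<^sup>+r. k r \<partial>distr lborel borel (norm :: space \<Rightarrow> real))"
    by (subst nn_integral_distr) auto
  then show ?thesis unfolding polar_distr by (subst (asm) nn_integral_density) auto
qed

lemma polar_integral:
  fixes k :: "real \<Rightarrow> 'b::{banach,second_countable_topology}"
  assumes [measurable]: "k \<in> borel_measurable borel"
  shows "(LINT x|lborel. k (norm (x::space))) = (LINT r|lborel. (4 * pi * r\<^sup>2 * indicator {0..} r) *\<^sub>R k r)"
proof -
  have "(LINT x|lborel. k (norm (x::space))) = (LINT r|distr lborel borel (norm :: space \<Rightarrow> real). k r)"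
    by (subst integral_distr) auto
  also have "distr lborel borel (norm :: space \<Rightarrow> real) = density lborel (\<lambda>r. ennreal (4 * pi * r\<^sup>2 * indicator {0..} r))"
    unfolding polar_distr by (intro arg_cong[where f="density lborel"]) (auto simp: indicator_def fun_eq_iff)
  finally show ?thesis by (subst (asm) integral_density) auto
qed

lemma nn_integral_norm_powr:
  assumes "s < 3" 
  shows "(\<integral>\<^sup>+x. ennreal (norm (x::space) powr (- s)) * indicator (cball 0 R) x \<partial>lborel) < \<infinity>"
proof (cases "R \<ge> 0")
  case True
  have m: "(\<lambda>r. ennreal (r powr - s) * indicator {0..R} r) \<in> borel_measurable borel" by measurable
  have "(\<integral>\<^sup>+x. ennreal (norm (x::space) powr (- s)) * indicator (cball 0 R) x \<partial>lborel)
     = (\<integral>\<^sup>+x. ennreal (norm (x::space) powr (- s)) * indicator {0..R} (norm x) \<partial>lborel)"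
    by (intro nn_integral_cong) (auto simp: indicator_def)
  also have "\<dots> = (\<integral>\<^sup>+r. ennreal (4 * pi * r\<^sup>2) * indicator {0..} r * (ennreal (r powr - s) * indicator {0..R} r) \<partial>lborel)"
    by (rule polar_nn_integral[OF m])
  also have "\<dots> = (\<integral>\<^sup>+r. ennreal (4 * pi) * (indicator {0..R} r * ennreal (r powr (2 - s))) \<partial>lborel)"
  proof (rule nn_integral_cong)
    fix r :: real
    have "r\<^sup>2 * r powr - s = r powr (2 - s)" if "r > 0"
      using that by (simp add: powr_diff powr_minus field_simps powr_numeral)
    moreover have "0 powr (2 - s) = 0" by simp
    ultimately show "ennreal (4 * pi * r\<^sup>2) * indicator {0..} r * (ennreal (r powr - s) * indicator {0..R} r) =
         ennreal (4 * pi) * (indicator {0..R} r * ennreal (r powr (2 - s)))"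
      by (cases "r = 0") (auto simp: indicator_def ennreal_mult[symmetric] mult.assoc)
  qed
  also have "\<dots> = ennreal (4 * pi) * (\<integral>\<^sup>+r. indicator {0..R} r * ennreal (r powr (2 - s)) \<partial>lborel)"
    by (intro nn_integral_cmult) auto
  also have "(\<integral>\<^sup>+r. indicator {0..R} r * ennreal (r powr (2 - s)) \<partial>lborel) = ennreal (R powr (2 - s + 1) / (2 - s + 1))"
  proof -
    have "((\<lambda>r. if r \<in> {0..R} then r powr (2 - s) else 0) has_integral (R powr (2 - s + 1) / (2 - s + 1))) UNIV"
      using has_integral_powr_from_0[of "2 - s" R] assms True by (subst has_integral_restrict_UNIV) auto
    then have "(\<integral>\<^sup>+r. ennreal (if r \<in> {0..R} then r powr (2 - s) else 0) \<partial>lborel) = ennreal (R powr (2 - s + 1) / (2 - s + 1))"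
      by (intro nn_integral_has_integral_lborel) auto
    moreover have "(\<integral>\<^sup>+r. ennreal (if r \<in> {0..R} then r powr (2 - s) else 0) \<partial>lborel)
      = (\<integral>\<^sup>+r. indicator {0..R} r * ennreal (r powr (2 - s)) \<partial>lborel)"
      by (intro nn_integral_cong) (auto simp: indicator_def)
    ultimately show ?thesis by simp
  qed
  finally show ?thesis by (simp add: ennreal_mult[symmetric] ennreal_mult_less_top)
qed (auto simp: indicator_def)


section \<open>Square integrable functions and weak gradients\<close>

lemma L2_measurable[measurable_dest]: "u \<in> L2 \<Longrightarrow> u \<in> borel_measurable lborel"
  by (simp add: L2_def)

lemma L2_integrable: "u \<in> L2 \<Longrightarrow> integrable lborel (\<lambda>x. (norm (u x))\<^sup>2)"
  by (simp add: L2_def)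

lemma L2I: "u \<in> borel_measurable lborel \<Longrightarrow> integrable lborel (\<lambda>x. (norm (u x))\<^sup>2) \<Longrightarrow> u \<in> L2"
  by (simp add: L2_def)

lemma L2_bound:
  assumes "v \<in> L2" "u \<in> borel_measurable lborel" "AE x in lborel. norm (u x) \<le> c * norm (v x)"
  shows "u \<in> L2"
proof (rule L2I)
  show "integrable lborel (\<lambda>x. (norm (u x))\<^sup>2)"
  proof (rule Bochner_Integration.integrable_bound[OF integrable_mult_right[OF L2_integrable[OF assms(1)], of "c\<^sup>2"]])
    show "AE x in lborel. norm ((norm (u x))\<^sup>2) \<le> norm (c\<^sup>2 * (norm (v x))\<^sup>2)"
      using assms(3)
    proof eventually_elim
      case (elim x)
      then have "(norm (u x))\<^sup>2 \<le> (c * norm (v x))\<^sup>2" by (intro power_mono) auto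
      then show ?case by (simp add: power_mult_distrib)
    qed
  qed (use assms(2) in simp)
qed (use assms in simp)

lemma L2_add:
  fixes u v :: "space \<Rightarrow> 'a::euclidean_space"
  assumes "u \<in> L2" "v \<in> L2" shows "(\<lambda>x. u x + v x) \<in> L2"
proof (rule L2I)
  have [measurable]: "u \<in> borel_measurable lborel" "v \<in> borel_measurable lborel" using assms by (auto dest: L2_measurable)
  show "integrable lborel (\<lambda>x. (norm (u x + v x))\<^sup>2)"
  proof (rule Bochner_Integration.integrable_bound[OF Bochner_Integration.integrable_add[OF
      integrable_mult_right[OF L2_integrable[OF assms(1)], of 2] integrable_mult_right[OF L2_integrable[OF assms(2)], of 2]]])
    show "AE x in lborel. norm ((norm (u x + v x))\<^sup>2) \<le> norm (2 * (norm (u x))\<^sup>2 + 2 * (norm (v x))\<^sup>2)"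
    proof (rule AE_I2)
      fix x
      have "(norm (u x + v x))\<^sup>2 \<le> (norm (u x) + norm (v x))\<^sup>2"
        by (intro power_mono norm_triangle_ineq) auto
      also have "\<dots> \<le> 2 * (norm (u x))\<^sup>2 + 2 * (norm (v x))\<^sup>2"
        using sum_squares_bound[of "norm (u x)" "norm (v x)"] by (simp add: power2_sum)
      finally show "norm ((norm (u x + v x))\<^sup>2) \<le> norm (2 * (norm (u x))\<^sup>2 + 2 * (norm (v x))\<^sup>2)" by simp
    qed
  qed simp
qed (use assms in \<open>auto dest!: L2_measurable\<close>)

lemma L2_scaleR: "u \<in> L2 \<Longrightarrow> (\<lambda>x. c *\<^sub>R u x) \<in> L2"
  by (rule L2_bound[where v=u and c="\<bar>c\<bar>"]) (auto dest: L2_measurable)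

lemma L2_diff:
  fixes u v :: "space \<Rightarrow> 'a::euclidean_space"
  assumes "u \<in> L2" "v \<in> L2" shows "(\<lambda>x. u x - v x) \<in> L2"
  using L2_add[OF assms(1) L2_scaleR[OF assms(2), of "-1"]] by simp

lemma L2_norm_mult:
  fixes u :: "space \<Rightarrow> 'a::euclidean_space" and v :: "space \<Rightarrow> 'b::euclidean_space"
  assumes u: "u \<in> L2" and v: "v \<in> L2"
  shows "integrable lborel (\<lambda>x. norm (u x) * norm (v x))"
    and "(LINT x|lborel. norm (u x) * norm (v x)) \<le> sqrt (LINT x|lborel. (norm (u x))\<^sup>2) * sqrt (LINT x|lborel. (norm (v x))\<^sup>2)"
proof -
  have [measurable]: "u \<in> borel_measurable lborel" "v \<in> borel_measurable lborel" using assms by (auto dest: L2_measurable)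
  have m: "(\<lambda>x. norm (u x)) \<in> borel_measurable lborel" "(\<lambda>x. norm (v x)) \<in> borel_measurable lborel" by measurable
  note * = L2_mult[OF m L2_integrable[OF u] L2_integrable[OF v]]
  show "integrable lborel (\<lambda>x. norm (u x) * norm (v x))" by (rule *(1))
  from *(3) show "(LINT x|lborel. norm (u x) * norm (v x)) \<le> sqrt (LINT x|lborel. (norm (u x))\<^sup>2) * sqrt (LINT x|lborel. (norm (v x))\<^sup>2)"
    by simp
qed

lemma L2_product_integrable:
  fixes u :: "space \<Rightarrow> 'a::euclidean_space" and v :: "space \<Rightarrow> 'b::euclidean_space"
    and f :: "space \<Rightarrow> 'c::{banach,second_countable_topology}"
  assumes u: "u \<in> L2" and v: "v \<in> L2" and "f \<in> borel_measurable lborel"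
    and "\<And>x. norm (f x) \<le> norm (u x) * norm (v x)"
  shows "integrable lborel f"
  by (rule Bochner_Integration.integrable_bound[OF L2_norm_mult(1)[OF u v]]) (use assms in auto)

lemma L2_inner:
  fixes u v :: "space \<Rightarrow> 'a::euclidean_space"
  assumes u: "u \<in> L2" and v: "v \<in> L2"
  shows "integrable lborel (\<lambda>x. inner (u x) (v x))"
    and "\<bar>LINT x|lborel. inner (u x) (v x)\<bar> \<le> sqrt (LINT x|lborel. (norm (u x))\<^sup>2) * sqrt (LINT x|lborel. (norm (v x))\<^sup>2)"
proof -
  have [measurable]: "u \<in> borel_measurable lborel" "v \<in> borel_measurable lborel" using assms by (auto dest: L2_measurable)
  show i: "integrable lborel (\<lambda>x. inner (u x) (v x))"
    by (rule L2_product_integrable[OF u v]) (auto simp: Cauchy_Schwarz_ineq2)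
  have "\<bar>LINT x|lborel. inner (u x) (v x)\<bar> \<le> (LINT x|lborel. \<bar>inner (u x) (v x)\<bar>)"
    by (rule integral_abs_bound)
  also have "\<dots> \<le> (LINT x|lborel. norm (u x) * norm (v x))"
    using i by (intro integral_mono L2_norm_mult[OF u v]) (auto simp: Cauchy_Schwarz_ineq2)
  also note L2_norm_mult(2)[OF u v]
  finally show "\<bar>LINT x|lborel. inner (u x) (v x)\<bar> \<le> sqrt (LINT x|lborel. (norm (u x))\<^sup>2) * sqrt (LINT x|lborel. (norm (v x))\<^sup>2)" .
qed

lemma test_function_continuous: "\<phi> \<in> test_functions \<Longrightarrow> continuous_on UNIV \<phi>"
  unfolding test_functions_def using Ck_imp_continuous by blast

lemma test_function_measurable[measurable_dest]: "\<phi> \<in> test_functions \<Longrightarrow> \<phi> \<in> borel_measurable lborel"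
  using borel_measurable_continuous_onI[OF test_function_continuous] by simp

lemma partial_test_function:
  assumes "\<phi> \<in> test_functions" shows "partial i \<phi> \<in> test_functions"
proof -
  obtain R where R: "0 < R" "\<And>x. R < norm x \<Longrightarrow> \<phi> x = 0" using test_functionE[OF assms] by blast
  show ?thesis
  proof (rule test_functionsI[where R=R])
    show "Ck k (partial i \<phi>)" for k using assms Ck.simps(2)[of k \<phi>] by (auto simp: test_functions_def)
    fix x :: space assume x: "R < norm x"
    have "((\<lambda>x. 0) has_derivative (\<lambda>h. 0)) (at x)" by simp
    then have "(\<phi> has_derivative (\<lambda>h. 0)) (at x)"
    proof (rule has_derivative_transform_within_open)
      show "open {x::space. R < norm x}" by (intro open_Collect_less continuous_intros)
      show "x \<in> {x. R < norm x}" using x by simp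
    qed (use R in auto)
    then show "partial i \<phi> x = 0" by (rule partial_has_derivative)
  qed
qed

lemma test_function_bounded:
  assumes "\<phi> \<in> test_functions"
  obtains B where "B > 0" "\<And>x. \<bar>\<phi> x\<bar> \<le> B"
proof -
  obtain R where R: "0 < R" "\<And>x. R < norm x \<Longrightarrow> \<phi> x = 0" using test_functionE[OF assms] by blast
  have "compact (\<phi> ` cball 0 R)"
    by (intro compact_continuous_image continuous_on_subset[OF test_function_continuous[OF assms]]) auto
  then have "bounded (\<phi> ` cball 0 R)" by (rule compact_imp_bounded)
  then obtain B where B: "B > 0" "\<And>x. x \<in> cball 0 R \<Longrightarrow> \<bar>\<phi> x\<bar> \<le> B"
    by (auto simp: bounded_pos)
  have "\<bar>\<phi> x\<bar> \<le> B" for x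
  proof (cases "x \<in> cball 0 R")
    case False
    then have "\<phi> x = 0" using R(2)[of x] by simp
    then show ?thesis using B(1) by simp
  qed (use B in auto)
  with B(1) that show thesis by blast
qed

lemma integrable_indicator_ball: "integrable lborel (indicator (cball (0::space) R) :: space \<Rightarrow> real)"
  by (rule integrable_real_indicator) (use emeasure_bounded_finite[OF bounded_cball] in auto)

lemma test_function_L2:
  assumes "\<phi> \<in> test_functions" shows "\<phi> \<in> L2"
proof (rule L2I)
  obtain R where R: "0 < R" "\<And>x. R < norm x \<Longrightarrow> \<phi> x = 0" using test_functionE[OF assms] by blast
  obtain B where B: "B > 0" "\<And>x. \<bar>\<phi> x\<bar> \<le> B" using test_function_bounded[OF assms] by blast
  have [measurable]: "\<phi> \<in> borel_measurable lborel" using assms by (rule test_function_measurable)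
  show "integrable lborel (\<lambda>x. (norm (\<phi> x))\<^sup>2)"
  proof (rule Bochner_Integration.integrable_bound[OF integrable_mult_right[OF integrable_indicator_ball[of R], of "B\<^sup>2"]])
    show "AE x in lborel. norm ((norm (\<phi> x))\<^sup>2) \<le> norm (B\<^sup>2 * indicator (cball 0 R) x)"
    proof (rule AE_I2)
      fix x
      have "(\<bar>\<phi> x\<bar>)\<^sup>2 \<le> B\<^sup>2" by (intro power_mono B) auto
      then show "norm ((norm (\<phi> x))\<^sup>2) \<le> norm (B\<^sup>2 * indicator (cball 0 R) x)"
        using R(2)[of x] by (cases "R < norm x") (auto simp: indicator_def)
    qed
  qed simp
qed (use assms in \<open>rule test_function_measurable\<close>)

lemma test_function_times_L2:
  fixes u :: "space \<Rightarrow> 'a::euclidean_space"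
  assumes "\<phi> \<in> test_functions" "u \<in> L2" shows "integrable lborel (\<lambda>x. \<phi> x *\<^sub>R u x)"
proof -
  have [measurable]: "\<phi> \<in> borel_measurable lborel" "u \<in> borel_measurable lborel"
    using assms by (auto dest: L2_measurable test_function_measurable)
  show ?thesis by (rule L2_product_integrable[OF test_function_L2[OF assms(1)] assms(2)]) auto
qed

lemma borel_measurable_component[measurable (raw)]:
  fixes g :: "'a \<Rightarrow> 'b::euclidean_space ^ 'n"
  assumes "g \<in> borel_measurable M" shows "(\<lambda>x. g x $ i) \<in> borel_measurable M"
proof -
  have "(\<lambda>v::'b ^ 'n. v $ i) \<in> borel_measurable borel"
    by (intro borel_measurable_continuous_onI continuous_intros)
  from measurable_compose[OF assms this] show ?thesis .
qed

lemma L2_component: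
  fixes g :: "space \<Rightarrow> complex ^ 3"
  assumes "g \<in> L2" shows "(\<lambda>x. g x $ i) \<in> L2"
  by (rule L2_bound[OF assms, where c=1]) 
    (use L2_measurable[OF assms] Finite_Cartesian_Product.norm_nth_le in auto)

lemma L2_vec:
  fixes g :: "space \<Rightarrow> complex ^ 3"
  assumes "\<And>i. (\<lambda>x. g x $ i) \<in> L2" shows "g \<in> L2"
proof (rule L2I)
  have [measurable]: "(\<lambda>x. g x $ i) \<in> borel_measurable lborel" for i using assms by (rule L2_measurable)
  show m: "g \<in> borel_measurable lborel"
    by (subst borel_measurable_euclidean_space) (auto simp: Basis_vec_def inner_axis)
  have "(\<lambda>x. (norm (g x))\<^sup>2) = (\<lambda>x. \<Sum>i\<in>UNIV. (norm (g x $ i))\<^sup>2)"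
    by (auto simp: norm_vec_def L2_set_def sum_nonneg)
  then show "integrable lborel (\<lambda>x. (norm (g x))\<^sup>2)"
    using L2_integrable[OF assms] by simp
qed

lemma L2_orthogonal_test_functions:
  fixes h :: "space \<Rightarrow> 'a::euclidean_space"
  assumes h: "h \<in> L2" and orth: "\<And>\<phi>. \<phi> \<in> test_functions \<Longrightarrow> (LINT x|lborel. \<phi> x *\<^sub>R h x) = 0"
  shows "AE x in lborel. h x = 0"
proof (rule AE_zero_if_orthogonal_to_test_functions[OF _ _ orth])
  have [measurable]: "h \<in> borel_measurable lborel" using h by (rule L2_measurable)
  show "h \<in> borel_measurable lborel" by simp
  fix a b :: space
  have "(indicator (box a b) :: space \<Rightarrow> real) \<in> L2"
  proof (rule L2I)
    have "integrable lborel (indicator (box a b) :: space \<Rightarrow> real)"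
      by (rule integrable_real_indicator) (use emeasure_bounded_finite[OF bounded_box] in auto)
    then show "integrable lborel (\<lambda>x. (norm (indicator (box a b) x :: real))\<^sup>2)"
      by (rule back_subst[of "integrable lborel"]) (auto simp: indicator_def)
  qed simp
  then show "integrable lborel (\<lambda>x. indicator (box a b) x *\<^sub>R h x)"
    by (rule L2_product_integrable[OF _ h]) auto
qed auto

lemma weak_gradient_unique:
  assumes "has_weak_gradient u g" "has_weak_gradient u h" "g \<in> L2" "h \<in> L2"
  shows "AE x in lborel. g x = h x"
proof -
  have "AE x in lborel. g x $ i - h x $ i = 0" for i
  proof (rule L2_orthogonal_test_functions)
    show "(\<lambda>x. g x $ i - h x $ i) \<in> L2" by (intro L2_diff L2_component assms)
    fix \<phi> assume t: "\<phi> \<in> test_functions"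
    have "(LINT x|lborel. \<phi> x *\<^sub>R (g x $ i)) = (LINT x|lborel. \<phi> x *\<^sub>R (h x $ i))"
      using assms(1,2)[unfolded has_weak_gradient_def, rule_format, OF t, of i] by simp
    then show "(LINT x|lborel. \<phi> x *\<^sub>R (g x $ i - h x $ i)) = 0"
      using test_function_times_L2[OF t L2_component[OF assms(3)]] test_function_times_L2[OF t L2_component[OF assms(4)]]
      by (simp add: scaleR_diff_right)
  qed
  then have "AE x in lborel. \<forall>i\<in>UNIV. g x $ i - h x $ i = 0" by (intro AE_finite_allI) auto
  then show ?thesis by eventually_elim (simp add: vec_eq_iff)
qed

lemma H1D:
  assumes "u \<in> H1"
  shows "u \<in> L2" "weak_grad u \<in> L2" "has_weak_gradient u (weak_grad u)"
proof -
  have "\<exists>g. g \<in> L2 \<and> has_weak_gradient u g" using assms by (auto simp: H1_def)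
  from someI_ex[OF this] show "weak_grad u \<in> L2" "has_weak_gradient u (weak_grad u)" by (auto simp: weak_grad_def)
qed (use assms in \<open>simp add: H1_def\<close>)

lemma H1_measurable[measurable_dest]: "u \<in> H1 \<Longrightarrow> u \<in> borel_measurable lborel"
  using H1D(1) L2_measurable by blast

lemma weak_grad_measurable[measurable_dest]: "u \<in> H1 \<Longrightarrow> weak_grad u \<in> borel_measurable lborel"
  using H1D(2) L2_measurable by blast

lemma H1I:
  assumes "u \<in> L2" "g \<in> L2" "has_weak_gradient u g"
  shows "u \<in> H1" "AE x in lborel. weak_grad u x = g x"
proof -
  show "u \<in> H1" using assms by (auto simp: H1_def)
  from H1D[OF this] assms show "AE x in lborel. weak_grad u x = g x" by (intro weak_gradient_unique)
qed

lemma has_weak_gradient_add: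
  assumes "u \<in> L2" "v \<in> L2" "g \<in> L2" "h \<in> L2" "has_weak_gradient u g" "has_weak_gradient v h"
  shows "has_weak_gradient (\<lambda>x. u x + v x) (\<lambda>x. g x + h x)"
  unfolding has_weak_gradient_def
proof (intro ballI allI)
  fix \<phi> i assume t: "\<phi> \<in> test_functions"
  show "(LINT x|lborel. partial i \<phi> x *\<^sub>R (u x + v x)) = - (LINT x|lborel. \<phi> x *\<^sub>R (g x + h x) $ i)"
    using assms(5,6) t test_function_times_L2[OF partial_test_function[OF t] assms(1), of i]
      test_function_times_L2[OF partial_test_function[OF t] assms(2), of i]
      test_function_times_L2[OF t L2_component[OF assms(3), of i]]
      test_function_times_L2[OF t L2_component[OF assms(4), of i]]
    by (simp add: scaleR_add_right has_weak_gradient_def)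
qed

lemma has_weak_gradient_cmult:
  assumes "has_weak_gradient u g"
  shows "has_weak_gradient (\<lambda>x. c * u x) (\<lambda>x. c *s g x)"
  unfolding has_weak_gradient_def
proof (intro ballI allI)
  fix \<phi> i assume t: "\<phi> \<in> test_functions"
  have "(LINT x|lborel. partial i \<phi> x *\<^sub>R (c * u x)) = c * (LINT x|lborel. partial i \<phi> x *\<^sub>R u x)"
    by (subst integral_mult_right_zero[symmetric]) (simp add: mult_scaleR_right)
  also have "\<dots> = - (c * (LINT x|lborel. \<phi> x *\<^sub>R (g x $ i)))"
    using assms t by (simp add: has_weak_gradient_def)
  also have "c * (LINT x|lborel. \<phi> x *\<^sub>R (g x $ i)) = (LINT x|lborel. \<phi> x *\<^sub>R (c *s g x) $ i)"
    by (subst integral_mult_right_zero[symmetric]) (simp add: mult_scaleR_right)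
  finally show "(LINT x|lborel. partial i \<phi> x *\<^sub>R (c * u x)) = - (LINT x|lborel. \<phi> x *\<^sub>R (c *s g x) $ i)" .
qed

lemma norm_vector_smult: "norm (c *s (g :: complex ^ 'n)) = cmod c * norm g"
  by (simp add: norm_vec_def norm_mult L2_set_right_distrib)

lemma L2_cmult:
  assumes "u \<in> L2" shows "(\<lambda>x. c * u x :: complex) \<in> L2"
  by (rule L2_bound[OF assms, where c="cmod c"]) (use L2_measurable[OF assms] in \<open>auto simp: norm_mult\<close>)

lemma L2_vsmult:
  assumes "g \<in> L2" shows "(\<lambda>x. c *s g x :: complex ^ 3) \<in> L2"
proof (rule L2_vec)
  show "(\<lambda>x. (c *s g x) $ i) \<in> L2" for i using L2_cmult[OF L2_component[OF assms], of c i] by simp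
qed

lemma H1_add:
  assumes "u \<in> H1" "v \<in> H1"
  shows "(\<lambda>x. u x + v x) \<in> H1" "AE x in lborel. weak_grad (\<lambda>x. u x + v x) x = weak_grad u x + weak_grad v x"
  using H1I[OF L2_add L2_add has_weak_gradient_add] H1D[OF assms(1)] H1D[OF assms(2)] by auto

lemma H1_cmult:
  assumes "u \<in> H1"
  shows "(\<lambda>x. c * u x) \<in> H1" "AE x in lborel. weak_grad (\<lambda>x. c * u x) x = c *s weak_grad u x"
  using H1I[OF L2_cmult L2_vsmult has_weak_gradient_cmult] H1D[OF assms(1)] by auto

lemma H1_diff:
  assumes "u \<in> H1" "v \<in> H1"
  shows "(\<lambda>x. u x - v x) \<in> H1" "AE x in lborel. weak_grad (\<lambda>x. u x - v x) x = weak_grad u x - weak_grad v x"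
proof -
  have *: "(\<lambda>x. u x - v x) = (\<lambda>x. u x + (- 1) * v x)" by auto
  show "(\<lambda>x. u x - v x) \<in> H1" unfolding * by (intro H1_add H1_cmult assms)
  have "AE x in lborel. weak_grad (\<lambda>x. u x + (- 1) * v x) x = weak_grad u x + weak_grad (\<lambda>x. (- 1) * v x) x"
    by (intro H1_add H1_cmult assms)
  then show "AE x in lborel. weak_grad (\<lambda>x. u x - v x) x = weak_grad u x - weak_grad v x"
    using H1_cmult(2)[OF assms(2), of "- 1"] unfolding *
    by eventually_elim (simp add: vector_sneg_minus1[symmetric])
qed

section \<open>Dilations and smooth multipliers of Sobolev functions\<close>

lemma Ck_scale: "Ck k f \<Longrightarrow> Ck k (\<lambda>x. f (c *\<^sub>R x))"
proof (induction k arbitrary: f)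
  case 0
  then show ?case by (auto intro!: continuous_on_compose2[of UNIV f UNIV] continuous_intros)
next
  case (Suc k)
  show ?case
  proof (rule Ck_SucI)
    fix x
    have "(f has_derivative frechet_derivative f (at (c *\<^sub>R x))) (at (c *\<^sub>R x))"
      using Suc.prems by (intro differentiable_partialD) auto
    moreover have "((\<lambda>x. c *\<^sub>R x) has_derivative (\<lambda>h. c *\<^sub>R h)) (at x)" by (auto intro!: derivative_eq_intros)
    ultimately show "((\<lambda>x. f (c *\<^sub>R x)) has_derivative (\<lambda>h. frechet_derivative f (at (c *\<^sub>R x)) (c *\<^sub>R h))) (at x)"
      using has_derivative_compose by blast
    fix i
    have "linear (frechet_derivative f (at (c *\<^sub>R x)))" for x
      using Suc.prems by (intro linear_frechet_derivative) (auto simp: differentiable_on_def)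
    then have "(\<lambda>x. frechet_derivative f (at (c *\<^sub>R x)) (c *\<^sub>R axis i 1)) = (\<lambda>x. c * frechet_derivative f (at (c *\<^sub>R x)) (axis i 1))"
      by (simp add: linear_cmul)
    moreover have "Ck k (\<lambda>x. c * frechet_derivative f (at (c *\<^sub>R x)) (axis i 1))"
      by (intro Ck_mult Ck_const Suc.IH[OF Ck_SucD[OF Suc.prems]])
    ultimately show "Ck k (\<lambda>x. frechet_derivative f (at (c *\<^sub>R x)) (c *\<^sub>R axis i 1))" by simp
  qed
qed

lemma partial_scale:
  assumes "f differentiable_on UNIV"
  shows "partial i (\<lambda>x. f (c *\<^sub>R x)) x = c * partial i f (c *\<^sub>R x)"
proof -
  have d: "(f has_derivative frechet_derivative f (at (c *\<^sub>R x))) (at (c *\<^sub>R x))"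
    using assms by (intro differentiable_partialD) auto
  moreover have "((\<lambda>x. c *\<^sub>R x) has_derivative (\<lambda>h. c *\<^sub>R h)) (at x)" by (auto intro!: derivative_eq_intros)
  ultimately have "((\<lambda>x. f (c *\<^sub>R x)) has_derivative (\<lambda>h. frechet_derivative f (at (c *\<^sub>R x)) (c *\<^sub>R h))) (at x)"
    using has_derivative_compose by blast
  moreover have "linear (frechet_derivative f (at (c *\<^sub>R x)))"
    using d by (rule has_derivative_linear)
  ultimately show ?thesis
    by (subst partial_has_derivative) (auto simp: partial_def linear_cmul)
qed

lemma test_function_differentiable: "\<phi> \<in> test_functions \<Longrightarrow> \<phi> differentiable_on UNIV"
  unfolding test_functions_def using Ck.simps(2) by blast

lemma test_function_scale:
  assumes "\<phi> \<in> test_functions" "c > 0"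
  shows "(\<lambda>x. \<phi> (c *\<^sub>R x)) \<in> test_functions"
proof -
  obtain R where R: "0 < R" "\<And>x. R < norm x \<Longrightarrow> \<phi> x = 0" using test_functionE[OF assms(1)] by blast
  show ?thesis
  proof (rule test_functionsI[where R="R / c"])
    show "Ck k (\<lambda>x. \<phi> (c *\<^sub>R x))" for k using assms(1) by (intro Ck_scale) (simp add: test_functions_def)
    show "\<phi> (c *\<^sub>R x) = 0" if "R / c < norm x" for x
      using that assms(2) by (intro R) (simp add: pos_divide_less_eq mult.commute)
  qed
qed

lemma L2_dilation:
  fixes u :: "space \<Rightarrow> 'a::euclidean_space"
  assumes "u \<in> L2" "c > 0" shows "(\<lambda>x. u (c *\<^sub>R x)) \<in> L2"
proof (rule L2I)
  have [measurable]: "u \<in> borel_measurable borel" using L2_measurable[OF assms(1)] by simp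
  show "(\<lambda>x. u (c *\<^sub>R x)) \<in> borel_measurable lborel" by simp
qed (rule scaling_integrable[OF L2_integrable[OF assms(1)] assms(2)])

lemma has_weak_gradient_dilation:
  assumes "has_weak_gradient u g" "c > 0"
  shows "has_weak_gradient (\<lambda>x. u (c *\<^sub>R x)) (\<lambda>x. c *\<^sub>R g (c *\<^sub>R x))"
  unfolding has_weak_gradient_def
proof (intro ballI allI)
  fix \<phi> i assume t: "\<phi> \<in> test_functions"
  \<comment> \<open>The dilation is moved onto the test function; the Jacobian
    \<open>1 / c ^ 3\<close> appears on both sides.\<close>
  let ?\<psi> = "\<lambda>x. \<phi> ((1 / c) *\<^sub>R x)"
  have t': "?\<psi> \<in> test_functions" using test_function_scale[OF t, of "1 / c"] assms(2) by simp
  have p: "partial i \<phi> x = c * partial i ?\<psi> (c *\<^sub>R x)" for x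
    using partial_scale[OF test_function_differentiable[OF t], of i "1 / c"] assms(2) by simp
  have "(LINT x|lborel. partial i \<phi> x *\<^sub>R u (c *\<^sub>R x)) = c *\<^sub>R (LINT x|lborel. partial i ?\<psi> (c *\<^sub>R x) *\<^sub>R u (c *\<^sub>R x))"
    by (simp only: p scaleR_scaleR[symmetric] integral_scaleR_right)
  also have "\<dots> = c *\<^sub>R (1 / c ^ 3) *\<^sub>R (LINT x|lborel. partial i ?\<psi> x *\<^sub>R u x)"
    using scaling_integral[OF assms(2), of "\<lambda>x. partial i ?\<psi> x *\<^sub>R u x"] by simp
  also have "\<dots> = - (c *\<^sub>R (1 / c ^ 3) *\<^sub>R (LINT x|lborel. ?\<psi> x *\<^sub>R (g x $ i)))"
    using assms(1) t' by (simp add: has_weak_gradient_def)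
  also have "c *\<^sub>R (1 / c ^ 3) *\<^sub>R (LINT x|lborel. ?\<psi> x *\<^sub>R (g x $ i)) = c *\<^sub>R (LINT x|lborel. \<phi> x *\<^sub>R (g (c *\<^sub>R x) $ i))"
    using scaling_integral[OF assms(2), of "\<lambda>x. ?\<psi> x *\<^sub>R (g x $ i)"] assms(2) by simp
  also have "\<dots> = (LINT x|lborel. \<phi> x *\<^sub>R ((c *\<^sub>R g (c *\<^sub>R x)) $ i))"
    by (subst integral_scaleR_right[symmetric]) (simp add: mult.commute)
  finally show "(LINT x|lborel. partial i \<phi> x *\<^sub>R u (c *\<^sub>R x)) = - (LINT x|lborel. \<phi> x *\<^sub>R ((c *\<^sub>R g (c *\<^sub>R x)) $ i))" .
qed

lemma H1_dilation:
  assumes "u \<in> H1" "c > 0"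
  shows "(\<lambda>x. u (c *\<^sub>R x)) \<in> H1" "AE x in lborel. weak_grad (\<lambda>x. u (c *\<^sub>R x)) x = c *\<^sub>R weak_grad u (c *\<^sub>R x)"
  using H1I[of "\<lambda>x. u (c *\<^sub>R x)" "\<lambda>x. c *\<^sub>R weak_grad u (c *\<^sub>R x)"]
    L2_dilation[OF H1D(1)[OF assms(1)] assms(2)] L2_scaleR[OF L2_dilation[OF H1D(2)[OF assms(1)] assms(2)], of c]
    has_weak_gradient_dilation[OF H1D(3)[OF assms(1)] assms(2)]
  by blast+

text \<open>The identity for \<open>u\<close> is tested with \<open>w \<phi>\<close>, which is a
  test function however \<open>w\<close> grows. Square integrability of the product and of its
  gradient is a separate matter, settled where the multiplier is concrete.\<close>

lemma has_weak_gradient_smooth_mult: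
  assumes "u \<in> L2" "g \<in> L2" "has_weak_gradient u g" and w: "\<And>k. Ck k w"
  shows "has_weak_gradient (\<lambda>x. w x *\<^sub>R u x) (\<lambda>x. \<chi> i. w x *\<^sub>R (g x $ i) + partial i w x *\<^sub>R u x)"
  unfolding has_weak_gradient_def
proof (intro ballI allI)
  fix \<phi> i assume t: "\<phi> \<in> test_functions"
  have wd: "w differentiable_on UNIV" using w[of "Suc 0"] by simp
  have prod_test: "(\<lambda>x. f x * \<phi> x) \<in> test_functions" if "\<And>k. Ck k f" for f
  proof -
    obtain R where R: "0 < R" "\<And>x. R < norm x \<Longrightarrow> \<phi> x = 0" using test_functionE[OF t] by blast
    show ?thesis by (rule test_functionsI[where R=R]) (use R that t in \<open>auto intro!: Ck_mult simp: test_functions_def\<close>)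
  qed
  have pw: "Ck k (partial i w)" for k using w[of "Suc k"] by simp
  have p: "partial i (\<lambda>x. w x * \<phi> x) x = w x * partial i \<phi> x + partial i w x * \<phi> x" for x
    using partial_has_derivative[OF has_derivative_mult[OF differentiable_partialD[OF wd] differentiable_partialD[OF test_function_differentiable[OF t]]]]
    by (simp add: partial_def)
  note i1 = test_function_times_L2[OF partial_test_function[OF prod_test[OF w]] assms(1), of i]
  note i2 = test_function_times_L2[OF prod_test[OF pw] assms(1)]
  note i3 = test_function_times_L2[OF prod_test[OF w] L2_component[OF assms(2)], of i]
  have "(LINT x|lborel. partial i \<phi> x *\<^sub>R w x *\<^sub>R u x) = (LINT x|lborel. partial i (\<lambda>x. w x * \<phi> x) x *\<^sub>R u x - (partial i w x * \<phi> x) *\<^sub>R u x)"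
    unfolding p by (intro Bochner_Integration.integral_cong) (auto simp: algebra_simps scaleR_add_left)
  also have "\<dots> = - (LINT x|lborel. (w x * \<phi> x) *\<^sub>R (g x $ i)) - (LINT x|lborel. (partial i w x * \<phi> x) *\<^sub>R u x)"
    using i1 i2 assms(3) prod_test[OF w] by (simp add: has_weak_gradient_def)
  also have "\<dots> = - (LINT x|lborel. (w x * \<phi> x) *\<^sub>R (g x $ i) + (partial i w x * \<phi> x) *\<^sub>R u x)"
    using i2 i3 by simp
  finally show "(LINT x|lborel. partial i \<phi> x *\<^sub>R w x *\<^sub>R u x) =
      - (LINT x|lborel. \<phi> x *\<^sub>R (\<chi> i. w x *\<^sub>R (g x $ i) + partial i w x *\<^sub>R u x) $ i)"
    by (simp add: algebra_simps scaleR_add_right)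
qed


section \<open>Profiles of radial Sobolev functions\<close>

text \<open>The representative \<open>f\<close> of a radial function need not be measurable; inner regularity supplies a compact set
  on which the argument can be run.\<close>

lemma radial_AE_nonpos:
  fixes h :: "space \<Rightarrow> real"
  assumes h: "integrable lborel h" and rad: "AE x in lborel. h x = f (norm x)"
    and zero: "\<And>Z. Z \<in> sets borel \<Longrightarrow> (LINT x|lborel. indicator Z (norm x) *\<^sub>R h x) = 0"
  shows "AE x in lborel. h x \<le> 0"
proof -
  have [measurable]: "h \<in> borel_measurable borel" using h by auto
  from rad obtain N where N: "{x. h x \<noteq> f (norm x)} \<subseteq> N" "N \<in> sets borel" "emeasure lborel N = 0"
    by (auto elim!: AE_E)
  have [measurable]: "N \<in> sets borel" by (rule N)
  have null: "AE x in lborel. x \<notin> ({x. h x > 0} - N) \<inter> cball 0 (real n)" for n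
  proof -
    let ?S = "({x. h x > 0} - N) \<inter> cball 0 (real n)"
    have Sb[measurable]: "?S \<in> sets borel" by measurable
    have Sl: "?S \<in> lmeasurable"
      by (rule bounded_set_imp_lmeasurable) (use Sb in \<open>auto intro: bounded_Int\<close>)
    have "measure lebesgue ?S = 0"
    proof (rule ccontr)
      assume "measure lebesgue ?S \<noteq> 0"
      then have pos: "measure lebesgue ?S > 0" by (simp add: zero_less_measure_iff)
      from sets_lebesgue_inner_closed[OF fmeasurableD[OF Sl] pos] obtain T where T0: "closed T" "T \<subseteq> ?S"
        "?S - T \<in> lmeasurable" "emeasure lebesgue (?S - T) < ennreal (measure lebesgue ?S)" by blast
      have T: "compact T" "T \<subseteq> ?S" "measure lebesgue (?S - T) < measure lebesgue ?S"
      proof -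
        have "bounded T" by (rule bounded_subset[OF _ T0(2)]) (auto intro: bounded_Int)
        with T0(1) show "compact T" by (simp add: compact_eq_bounded_closed)
        show "measure lebesgue (?S - T) < measure lebesgue ?S"
          using T0(3,4) by (simp add: emeasure_eq_measure2 ennreal_less_iff)
      qed (rule T0)
      have Tm[measurable]: "T \<in> sets borel" using T(1) by (simp add: borel_compact)
      have Tl: "T \<in> lmeasurable" using T(1) by (rule lmeasurable_compact)
      have "measure lebesgue ?S = measure lebesgue T + measure lebesgue (?S - T)"
        using measurable_measure_Diff[OF Sl _ T(2)] Tl by (auto simp: fmeasurableD)
      with T(3) have "measure lebesgue T > 0" by simp
      then have Tpos: "emeasure lborel T > 0"
        using emeasure_eq_measure2[OF Tl] Tm by simp
      \<comment> \<open>The set of radii where \<open>f\<close> is positive may fail to be Borel,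
        but the image of the compact set \<open>T\<close> under the norm is compact. Off
        \<open>N\<close>, a point whose radius lies in that image has the same value of
        \<open>h\<close> as some point of \<open>T\<close>, hence a positive one.\<close>
      have cZ: "compact (norm ` T)" by (intro compact_continuous_image continuous_intros T)
      then have Z: "norm ` T \<in> sets borel" by (rule borel_compact)
      have [measurable]: "norm ` T \<in> sets borel" by (rule Z)
      have pos': "indicator (norm ` T) (norm x) *\<^sub>R h x \<ge> 0" if "x \<notin> N" for x
      proof (cases "norm x \<in> norm ` T")
        case True
        then obtain y where y: "y \<in> T" "norm x = norm y" by auto
        have "h x = f (norm x)" "h y = f (norm y)" using N(1) that T(2) y(1) by auto
        moreover have "h y > 0" using y(1) T(2) by auto
        ultimately show ?thesis using y by simp
      qed simp
      have AEN: "AE x in lborel. x \<notin> N" using N by (intro AE_not_in) (auto simp: null_sets_def)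
      have int: "integrable lborel (\<lambda>x. indicator (norm ` T) (norm x) *\<^sub>R h x)"
        by (rule Bochner_Integration.integrable_bound[OF h]) (auto simp: indicator_def)
      have "AE x in lborel. indicator (norm ` T) (norm x) *\<^sub>R h x = 0"
      proof -
        have "AE x in lborel. 0 \<le> indicator (norm ` T) (norm x) *\<^sub>R h x"
          using AEN by eventually_elim (rule pos')
        from integral_nonneg_eq_0_iff_AE[OF int this] zero[OF Z] show ?thesis by simp
      qed
      then have "AE x in lborel. x \<notin> T"
      proof eventually_elim
        case (elim x)
        show ?case
        proof
          assume x: "x \<in> T"
          then have "h x > 0" using T(2) by auto
          with elim x show False by (simp add: indicator_def)
        qed
      qed
      then have "emeasure lborel T = 0" using AE_iff_measurable[of T lborel "\<lambda>x. x \<notin> T"] Tm by simp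
      with Tpos show False by simp
    qed
    then have "emeasure lebesgue ?S = 0" using Sl by (simp add: emeasure_eq_measure2)
    then have "emeasure lborel ?S = 0" using Sb by simp
    then show ?thesis using Sb by (intro AE_not_in) (auto simp: null_sets_def)
  qed
  have "AE x in lborel. \<forall>n. x \<notin> ({x. h x > 0} - N) \<inter> cball 0 (real n)"
    unfolding AE_all_countable using null by blast
  moreover have "AE x in lborel. x \<notin> N" using N by (intro AE_not_in) (auto simp: null_sets_def)
  ultimately show ?thesis
  proof eventually_elim
    case (elim x)
    obtain n where "norm x \<le> real n" using real_arch_simple by blast
    with elim(1)[rule_format, of n] elim(2) show ?case by (auto simp: not_less)
  qed
qed

lemma radial_AE_zero:
  fixes h :: "space \<Rightarrow> complex"
  assumes h: "integrable lborel h" and rad: "AE x in lborel. h x = f (norm x)"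
    and zero: "\<And>Z. Z \<in> sets borel \<Longrightarrow> (LINT x|lborel. indicator Z (norm x) *\<^sub>R h x) = 0"
  shows "AE x in lborel. h x = 0"
proof -
  have [measurable]: "h \<in> borel_measurable borel" using h by auto
  have i: "integrable lborel (\<lambda>x. indicator Z (norm x) *\<^sub>R h x)" if [measurable]: "Z \<in> sets borel" for Z
    by (rule Bochner_Integration.integrable_bound[OF h]) (auto simp: indicator_def)
  have re: "(LINT x|lborel. indicator Z (norm x) *\<^sub>R Re (h x)) = 0" "(LINT x|lborel. indicator Z (norm x) *\<^sub>R Im (h x)) = 0"
    if "Z \<in> sets borel" for Z
    using arg_cong[OF zero[OF that], of Re] arg_cong[OF zero[OF that], of Im] i[OF that]
    by (simp_all add: integral_Re[symmetric] integral_Im[symmetric] del: integral_Re integral_Im)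
  have "AE x in lborel. Re (h x) \<le> 0"
    using h rad re by (intro radial_AE_nonpos[where f="\<lambda>r. Re (f r)"]) (auto elim!: eventually_mono)
  moreover have "AE x in lborel. - Re (h x) \<le> 0"
    using h rad re by (intro radial_AE_nonpos[where f="\<lambda>r. - Re (f r)"]) (auto elim!: eventually_mono)
  moreover have "AE x in lborel. Im (h x) \<le> 0"
    using h rad re by (intro radial_AE_nonpos[where f="\<lambda>r. Im (f r)"]) (auto elim!: eventually_mono)
  moreover have "AE x in lborel. - Im (h x) \<le> 0"
    using h rad re by (intro radial_AE_nonpos[where f="\<lambda>r. - Im (f r)"]) (auto elim!: eventually_mono)
  ultimately show ?thesis by eventually_elim (simp add: complex_eq_iff)
qed

lemma integrable_indicator_bounded:
  fixes A :: "'a::euclidean_space set"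
  assumes "bounded A" "A \<in> sets borel"
  shows "integrable lborel (indicator A :: 'a \<Rightarrow> real)"
  using emeasure_bounded_finite[OF assms(1)] assms(2) by (intro integrable_real_indicator) auto


section \<open>The profile of a Sobolev function and its decay\<close>

definition dirichlet :: "(space \<Rightarrow> complex) \<Rightarrow> real" where
  "dirichlet u = (LINT x|lborel. (norm (weak_grad u x))\<^sup>2)"

text \<open>The radial derivative divided by the area of the sphere of radius \<open>|x|\<close>.
  Integrating it over a shell therefore integrates the spherical mean of the radial derivative over
  the radii.\<close>

definition radial_density :: "(space \<Rightarrow> complex) \<Rightarrow> space \<Rightarrow> complex" where
  "radial_density u x = (1 / (4 * pi * norm x ^ 3)) *\<^sub>R (\<Sum>i\<in>UNIV. (x $ i) *\<^sub>R (weak_grad u x $ i))"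

text \<open>The spherical mean recovered from its derivative by integrating from infinity inwards.
  It is defined for every \<open>u\<close>, is measurable for \<open>u\<close> in \<open>H1\<close>,
  and refers to no representative of a radial function.\<close>

definition profile :: "(space \<Rightarrow> complex) \<Rightarrow> real \<Rightarrow> complex" where
  "profile u r = - (LINT x|lborel. indicator {r<..} (norm x) *\<^sub>R radial_density u x)"

lemma norm_radial_sum: "norm (\<Sum>i\<in>UNIV. (x $ i) *\<^sub>R (g $ i)) \<le> norm (x::space) * norm (g :: complex ^ 3)"
proof -
  have "norm (\<Sum>i\<in>UNIV. (x $ i) *\<^sub>R (g $ i)) \<le> (\<Sum>i\<in>UNIV. \<bar>x $ i\<bar> * \<bar>norm (g $ i)\<bar>)"
    by (rule order_trans[OF norm_sum]) simp
  also have "\<dots> \<le> L2_set (\<lambda>i. x $ i) UNIV * L2_set (\<lambda>i. norm (g $ i)) UNIV"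
    by (rule L2_set_mult_ineq)
  finally show ?thesis by (simp add: norm_vec_def L2_set_def)
qed

lemma norm_radial_density: "norm (radial_density u x) \<le> norm (weak_grad u x) * (1 / (4 * pi * (norm x)\<^sup>2))"
proof (cases "x = 0")
  case False
  have "norm (radial_density u x) = (1 / (4 * pi * norm x ^ 3)) * norm (\<Sum>i\<in>UNIV. (x $ i) *\<^sub>R (weak_grad u x $ i))"
    unfolding radial_density_def by simp
  also have "\<dots> \<le> (1 / (4 * pi * norm x ^ 3)) * (norm x * norm (weak_grad u x))"
    by (intro mult_left_mono norm_radial_sum) auto
  also have "\<dots> = norm (weak_grad u x) * (1 / (4 * pi * (norm x)\<^sup>2))"
    using False by (simp add: field_simps power2_eq_square power3_eq_cube)
  finally show ?thesis .
qed (simp add: radial_density_def)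

lemma radial_density_measurable:
  assumes "u \<in> H1" shows "radial_density u \<in> borel_measurable borel"
proof -
  have [measurable]: "weak_grad u \<in> borel_measurable borel" using weak_grad_measurable[OF assms] by simp
  show ?thesis unfolding radial_density_def[abs_def] by measurable
qed

lemma integral_norm_m4:
  assumes "r > 0"
  shows "integrable lborel (\<lambda>x::space. indicator {r<..} (norm x) * (1 / norm x ^ 4))"
    and "(LINT x|lborel. indicator {r<..} (norm (x::space)) * (1 / norm x ^ 4)) = 4 * pi / r"
proof -
  have "(\<integral>\<^sup>+x. ennreal (indicator {r<..} (norm (x::space)) * (1 / norm x ^ 4)) \<partial>lborel)
    = (\<integral>\<^sup>+\<rho>. ennreal (4 * pi * \<rho>\<^sup>2) * indicator {0..} \<rho> * ennreal (indicator {r<..} \<rho> * (1 / \<rho> ^ 4)) \<partial>lborel)"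
    by (rule polar_nn_integral) measurable
  also have "\<dots> = (\<integral>\<^sup>+\<rho>. ennreal (4 * pi / \<rho>\<^sup>2) * indicator {r..} \<rho> \<partial>lborel)"
  proof (rule nn_integral_cong_AE)
    show "AE \<rho> in lborel. ennreal (4 * pi * \<rho>\<^sup>2) * indicator {0..} \<rho> * ennreal (indicator {r<..} \<rho> * (1 / \<rho> ^ 4)) =
         ennreal (4 * pi / \<rho>\<^sup>2) * indicator {r..} \<rho>"
      using AE_lborel_singleton[of r]
    proof eventually_elim
      case (elim \<rho>)
      show ?case
      proof (cases "\<rho> > r")
        case True
        have "(4 * pi * \<rho>\<^sup>2) * (1 / \<rho> ^ 4) = 4 * pi / \<rho>\<^sup>2"
          using True assms by (simp add: field_simps power2_eq_square power4_eq_xxxx)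
        then show ?thesis using True assms by (simp add: ennreal_mult[symmetric] flip: times_divide_eq_right)
      qed (use elim in auto)
    qed
  qed
  also have "\<dots> = ennreal (0 - (- 4 * pi / r))"
  proof (rule nn_integral_FTC_atLeast)
    show "((\<lambda>\<rho>. - 4 * pi / \<rho>) has_real_derivative 4 * pi / \<rho>\<^sup>2) (at \<rho>)" if "r \<le> \<rho>" for \<rho>
      using that assms by (auto intro!: derivative_eq_intros simp: power2_eq_square)
    have "((\<lambda>\<rho>::real. (- 4 * pi) * inverse \<rho>) \<longlongrightarrow> (- 4 * pi) * 0) at_top"
      by (intro tendsto_mult tendsto_const tendsto_inverse_0_at_top filterlim_ident)
    then show "((\<lambda>\<rho>. - 4 * pi / \<rho>) \<longlongrightarrow> 0) at_top" by (simp add: divide_inverse)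
  qed (use assms in auto)
  finally have *: "(\<integral>\<^sup>+x. ennreal (indicator {r<..} (norm (x::space)) * (1 / norm x ^ 4)) \<partial>lborel) = ennreal (4 * pi / r)" by simp
  show "integrable lborel (\<lambda>x::space. indicator {r<..} (norm x) * (1 / norm x ^ 4))"
    using * by (intro integrableI_nonneg) auto
  show "(LINT x|lborel. indicator {r<..} (norm (x::space)) * (1 / norm x ^ 4)) = 4 * pi / r"
    using * assms by (intro integral_eq_nn_integral[THEN trans]) auto
qed

lemma shell_norm_m4:
  assumes "0 < r" "r \<le> s"
  shows "integrable lborel (\<lambda>x::space. indicator {r<..s} (norm x) * (1 / norm x ^ 4))"
    and "(LINT x|lborel. indicator {r<..s} (norm (x::space)) * (1 / norm x ^ 4)) = 4 * pi * (1 / r - 1 / s)"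
proof -
  have s: "s > 0" using assms by simp
  have e: "(\<lambda>x::space. indicator {r<..s} (norm x) * (1 / norm x ^ 4)) =
    (\<lambda>x::space. indicator {r<..} (norm x) * (1 / norm x ^ 4) - indicator {s<..} (norm x) * (1 / norm x ^ 4))"
    using assms by (auto simp: indicator_def)
  show "integrable lborel (\<lambda>x::space. indicator {r<..s} (norm x) * (1 / norm x ^ 4))"
    unfolding e by (intro Bochner_Integration.integrable_diff integral_norm_m4 assms s)
  show "(LINT x|lborel. indicator {r<..s} (norm (x::space)) * (1 / norm x ^ 4)) = 4 * pi * (1 / r - 1 / s)"
    unfolding e using integral_norm_m4[OF assms(1)] integral_norm_m4[OF s] by (simp add: algebra_simps)
qed

text \<open>Cauchy-Schwarz between the gradient and the weight \<open>1 / (4 pi |x|^2)\<close>,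
  whose square is \<open>|x|^(-4) / (16 pi^2)\<close>. The set of radii is general because half
  lines yield decay and shells yield continuity.\<close>

lemma shell_radial_density:
  assumes u: "u \<in> H1" and S: "S \<in> sets borel"
    and int: "integrable lborel (\<lambda>x::space. indicator S (norm x) * (1 / norm x ^ 4))"
  shows "integrable lborel (\<lambda>x. indicator S (norm x) *\<^sub>R radial_density u x)"
    and "(norm (LINT x|lborel. indicator S (norm x) *\<^sub>R radial_density u x))\<^sup>2 \<le>
      (LINT x|lborel. indicator S (norm x) * (norm (weak_grad u x))\<^sup>2) *
      (LINT x|lborel. indicator S (norm (x::space)) * (1 / norm x ^ 4)) / (16 * pi\<^sup>2)"
proof -
  have [measurable]: "S \<in> sets borel" "weak_grad u \<in> borel_measurable borel" "radial_density u \<in> borel_measurable borel"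
    using S weak_grad_measurable[OF u] radial_density_measurable[OF u] by auto
  let ?g = "\<lambda>x. indicator S (norm x) * norm (weak_grad u x)"
  let ?k = "\<lambda>x::space. indicator S (norm x) * (1 / (4 * pi * (norm x)\<^sup>2))"
  have g2: "(?g x)\<^sup>2 = indicator S (norm x) * (norm (weak_grad u x))\<^sup>2" for x by (auto simp: indicator_def)
  have k2: "(?k x)\<^sup>2 = (1 / (16 * pi\<^sup>2)) * (indicator S (norm x) * (1 / norm x ^ 4))" for x
    by (auto simp: indicator_def power_divide power_mult_distrib)
  have ig: "integrable lborel (\<lambda>x. (?g x)\<^sup>2)" unfolding g2
    by (rule Bochner_Integration.integrable_bound[OF L2_integrable[OF H1D(2)[OF u]]]) (auto simp: indicator_def)
  have ik: "integrable lborel (\<lambda>x. (?k x)\<^sup>2)" unfolding k2 using int by (rule integrable_mult_right)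
  have m: "?g \<in> borel_measurable lborel" "?k \<in> borel_measurable lborel" by measurable
  note CS = L2_mult[OF m ig ik]
  have le: "norm (indicator S (norm x) *\<^sub>R radial_density u x) \<le> ?g x * ?k x" for x
    using norm_radial_density[of u x] by (auto simp: indicator_def)
  show "integrable lborel (\<lambda>x. indicator S (norm x) *\<^sub>R radial_density u x)"
    by (rule Bochner_Integration.integrable_bound[OF CS(1)]) (use le in \<open>auto intro: order_trans\<close>)
  have "norm (LINT x|lborel. indicator S (norm x) *\<^sub>R radial_density u x) \<le> (LINT x|lborel. ?g x * ?k x)"
    using le by (intro order_trans[OF integral_norm_bound] integral_mono integrable_norm CS(1)
      \<open>integrable lborel (\<lambda>x. indicator S (norm x) *\<^sub>R radial_density u x)\<close>) auto
  also have "\<dots> \<le> sqrt (LINT x|lborel. (?g x)\<^sup>2) * sqrt (LINT x|lborel. (?k x)\<^sup>2)" using CS(2) by linarith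
  finally have "(norm (LINT x|lborel. indicator S (norm x) *\<^sub>R radial_density u x))\<^sup>2
    \<le> (sqrt (LINT x|lborel. (?g x)\<^sup>2) * sqrt (LINT x|lborel. (?k x)\<^sup>2))\<^sup>2"
    by (intro power_mono) auto
  also have "\<dots> = (LINT x|lborel. (?g x)\<^sup>2) * (LINT x|lborel. (?k x)\<^sup>2)"
    by (simp add: power_mult_distrib)
  also have "\<dots> = (LINT x|lborel. indicator S (norm x) * (norm (weak_grad u x))\<^sup>2) *
      (LINT x|lborel. indicator S (norm (x::space)) * (1 / norm x ^ 4)) / (16 * pi\<^sup>2)"
    by (simp only: g2 k2 integral_mult_right_zero) simp
  finally show "(norm (LINT x|lborel. indicator S (norm x) *\<^sub>R radial_density u x))\<^sup>2 \<le>
      (LINT x|lborel. indicator S (norm x) * (norm (weak_grad u x))\<^sup>2) *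
      (LINT x|lborel. indicator S (norm (x::space)) * (1 / norm x ^ 4)) / (16 * pi\<^sup>2)" .
qed

lemma dirichlet_nonneg: "0 \<le> dirichlet u"
  unfolding dirichlet_def by simp

lemma restricted_dirichlet_le:
  assumes "u \<in> H1" "S \<in> sets borel"
  shows "(LINT x|lborel. indicator S (norm x) * (norm (weak_grad u x))\<^sup>2) \<le> dirichlet u"
proof -
  have [measurable]: "S \<in> sets borel" "weak_grad u \<in> borel_measurable borel"
    using assms weak_grad_measurable[OF assms(1)] by auto
  note i = L2_integrable[OF H1D(2)[OF assms(1)]]
  show ?thesis unfolding dirichlet_def
    by (rule integral_mono[OF Bochner_Integration.integrable_bound[OF i] i]) (auto simp: indicator_def)
qed

text \<open>The weight \<open>|x|^(-4)\<close> integrates to \<open>4 pi / r\<close> outside the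
  ball of radius \<open>r\<close>. Only the gradient enters, which is why the rate is
  \<open>r powr (- 1 / 2)\<close>; the same rate then limits the singularity at the origin.\<close>

lemma profile_bound:
  assumes u: "u \<in> H1" and r: "r > 0"
  shows "(norm (profile u r))\<^sup>2 \<le> dirichlet u / (4 * pi * r)"
proof -
  have "(norm (profile u r))\<^sup>2 \<le> (LINT x|lborel. indicator {r<..} (norm x) * (norm (weak_grad u x))\<^sup>2) * (4 * pi / r) / (16 * pi\<^sup>2)"
    using shell_radial_density(2)[OF u _ integral_norm_m4(1)[OF r]]
    by (simp only: profile_def norm_minus_cancel integral_norm_m4(2)[OF r]) simp
  also have "\<dots> \<le> dirichlet u * (4 * pi / r) / (16 * pi\<^sup>2)"
    using r by (intro divide_right_mono mult_right_mono restricted_dirichlet_le u) auto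
  also have "\<dots> = dirichlet u / (4 * pi * r)" by (simp add: power2_eq_square)
  finally show ?thesis .
qed

text \<open>The gradient integral stays on the shell. This locality produces a second small factor
  when the estimate is integrated over the radii for a dilation close to the identity.\<close>

lemma profile_diff_bound:
  assumes u: "u \<in> H1" and rs: "0 < r" "r \<le> s"
  shows "(norm (profile u r - profile u s))\<^sup>2 \<le>
    (LINT x|lborel. indicator {r<..s} (norm x) * (norm (weak_grad u x))\<^sup>2) * (1 / r - 1 / s) / (4 * pi)"
proof -
  have s: "s > 0" using rs by simp
  have "profile u r - profile u s = - (LINT x|lborel. indicator {r<..s} (norm x) *\<^sub>R radial_density u x)"
  proof -
    have "profile u s - profile u r = (LINT x|lborel. indicator {r<..} (norm x) *\<^sub>R radial_density u x - indicator {s<..} (norm x) *\<^sub>R radial_density u x)"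
      unfolding profile_def using shell_radial_density(1)[OF u _ integral_norm_m4(1)] rs s by simp
    also have "\<dots> = (LINT x|lborel. indicator {r<..s} (norm x) *\<^sub>R radial_density u x)"
      using rs by (intro Bochner_Integration.integral_cong) (auto simp: indicator_def)
    finally show ?thesis by (simp add: algebra_simps)
  qed
  then have "(norm (profile u r - profile u s))\<^sup>2 \<le>
      (LINT x|lborel. indicator {r<..s} (norm x) * (norm (weak_grad u x))\<^sup>2) * (4 * pi * (1 / r - 1 / s)) / (16 * pi\<^sup>2)"
    using shell_radial_density(2)[OF u _ shell_norm_m4(1)[OF rs]] by (simp only: shell_norm_m4(2)[OF rs] norm_minus_cancel) simp
  also have "\<dots> = (LINT x|lborel. indicator {r<..s} (norm x) * (norm (weak_grad u x))\<^sup>2) * (1 / r - 1 / s) / (4 * pi)"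
  proof -
    have "y * (4 * pi * z) / (16 * pi\<^sup>2) = y * z / (4 * pi)" for y z :: real by (simp add: power2_eq_square)
    then show ?thesis .
  qed
  finally show ?thesis .
qed

text \<open>Equicontinuity away from the origin for profiles with bounded gradients; it serves to
  extract pointwise convergent subsequences.\<close>

lemma profile_holder:
  assumes u: "u \<in> H1" and rs: "0 < r" "0 < s"
  shows "norm (profile u r - profile u s) \<le> sqrt (dirichlet u * \<bar>1 / r - 1 / s\<bar> / (4 * pi))"
proof -
  have *: "norm (profile u r - profile u s) \<le> sqrt (dirichlet u * \<bar>1 / r - 1 / s\<bar> / (4 * pi))"
    if "0 < r" "r \<le> s" for r s
  proof (rule real_le_rsqrt)
    have "1 / r - 1 / s \<ge> 0" using that by (simp add: frac_le)
    then show "(norm (profile u r - profile u s))\<^sup>2 \<le> dirichlet u * \<bar>1 / r - 1 / s\<bar> / (4 * pi)"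
      by (intro order_trans[OF profile_diff_bound[OF u that]] divide_right_mono mult_mono restricted_dirichlet_le u)
        (auto simp: dirichlet_nonneg)
  qed
  show ?thesis
  proof (cases "r \<le> s")
    case False
    then have "norm (profile u s - profile u r) \<le> sqrt (dirichlet u * \<bar>1 / s - 1 / r\<bar> / (4 * pi))" using rs by (intro *) auto
    then show ?thesis by (simp add: norm_minus_commute abs_minus_commute)
  qed (use rs * in auto)
qed

lemma profile_measurable:
  assumes "u \<in> H1" shows "profile u \<in> borel_measurable borel"
proof -
  have [measurable]: "radial_density u \<in> borel_measurable borel" by (rule radial_density_measurable[OF assms])
  have "profile u = (\<lambda>r. - (LINT x|lborel. (if r < norm x then radial_density u x else 0)))"
    unfolding profile_def[abs_def]
    by (intro ext arg_cong[where f=uminus] Bochner_Integration.integral_cong) (auto simp: indicator_def)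
  then show ?thesis by simp
qed


lemma indicator_L2:
  assumes "bounded A" "A \<in> sets borel" shows "(indicator A :: space \<Rightarrow> real) \<in> L2"
proof (rule L2I)
  have "(\<lambda>x. (norm (indicator A x :: real))\<^sup>2) = (indicator A :: space \<Rightarrow> real)" by (auto simp: indicator_def)
  then show "integrable lborel (\<lambda>x. (norm (indicator A x :: real))\<^sup>2)"
    using integrable_indicator_bounded[OF assms] by simp
  show "(indicator A :: space \<Rightarrow> real) \<in> borel_measurable lborel" using assms(2) by simp
qed

lemma ball_L2_integrable:
  fixes f :: "space \<Rightarrow> 'a::euclidean_space"
  assumes "f \<in> L2" shows "integrable lborel (\<lambda>x. indicator (cball 0 R) x * norm (f x))"
proof -
  have [measurable]: "f \<in> borel_measurable borel" using L2_measurable[OF assms] by simp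
  have [measurable]: "(indicator (cball (0::space) R) :: space \<Rightarrow> real) \<in> borel_measurable borel"
    by (rule borel_measurable_indicator) auto
  show ?thesis by (rule L2_product_integrable[OF indicator_L2[of "cball 0 R"] assms]) auto
qed


lemma integrable_pair_bound:
  fixes f :: "'a::euclidean_space \<times> 'b::euclidean_space \<Rightarrow> 'c::{banach,second_countable_topology}"
  assumes f: "f \<in> borel_measurable (lborel \<Otimes>\<^sub>M lborel)" and \<phi>: "integrable lborel \<phi>" and G: "integrable lborel G"
    and b: "\<And>s y. norm (f (s, y)) \<le> \<phi> s * G y"
  shows "integrable (lborel \<Otimes>\<^sub>M lborel) f"
proof (rule lborel_pair.Fubini_integrable[OF f])
  have [measurable]: "f \<in> borel_measurable (lborel \<Otimes>\<^sub>M lborel)" by (rule f)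
  have i: "integrable lborel (\<lambda>y. f (s, y))" for s
    by (rule Bochner_Integration.integrable_bound[OF integrable_mult_right[OF G, of "\<phi> s"]])
      (auto intro!: AE_I2 order_trans[OF b])
  then show "AE s in lborel. integrable lborel (\<lambda>y. f (s, y))" by simp
  show "integrable lborel (\<lambda>s. LINT y|lborel. norm (f (s, y)))"
  proof (rule Bochner_Integration.integrable_bound[OF integrable_mult_left[OF \<phi>, of "LINT y|lborel. G y"]])
    show "AE s in lborel. norm (LINT y|lborel. norm (f (s, y))) \<le> norm (\<phi> s * (LINT y|lborel. G y))"
    proof (rule AE_I2)
      fix s
      have "(LINT y|lborel. norm (f (s, y))) \<le> (LINT y|lborel. \<phi> s * G y)"
        by (rule integral_mono[OF integrable_norm[OF i] integrable_mult_right[OF G] b])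
      moreover have "0 \<le> (LINT y|lborel. norm (f (s, y)))" by (intro Bochner_Integration.integral_nonneg) simp
      ultimately show "norm (LINT y|lborel. norm (f (s, y))) \<le> norm (\<phi> s * (LINT y|lborel. G y))" by simp
    qed
  qed measurable
qed

section \<open>Dilation differences of weakly differentiable functions\<close>

text \<open>The fundamental theorem of calculus along a ray: on the curve
  \<open>x / \<sigma>\<close> the integrand is minus the \<open>\<sigma>\<close>-derivative of a
  function with gradient \<open>g\<close>, and \<open>\<sigma>\<close> between \<open>1 / 2\<close>
  and 1 joins \<open>2 x\<close> to \<open>x\<close>.\<close>

definition radial_avg :: "(space \<Rightarrow> complex ^ 3) \<Rightarrow> space \<Rightarrow> complex" where
  "radial_avg g x = (LINT \<sigma>|lborel. indicator {1/2..1} \<sigma> *\<^sub>R (\<Sum>i\<in>UNIV. (x $ i / \<sigma>\<^sup>2) *\<^sub>R (g ((1 / \<sigma>) *\<^sub>R x) $ i)))"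

text \<open>The divergence of the field \<open>\<sigma>\<^sup>2 \<psi>(\<sigma> y) y\<close>, which is also the \<open>\<sigma>\<close>-derivative of \<open>\<sigma>\<^sup>3 \<psi>(\<sigma> y)\<close>.\<close>

definition dil_div :: "(space \<Rightarrow> real) \<Rightarrow> real \<Rightarrow> space \<Rightarrow> real" where
  "dil_div \<psi> \<sigma> y = 3 * \<sigma>\<^sup>2 * \<psi> (\<sigma> *\<^sub>R y) + \<sigma> ^ 3 * (\<Sum>i\<in>UNIV. y $ i * partial i \<psi> (\<sigma> *\<^sub>R y))"

lemma test_function_has_derivative:
  assumes "\<psi> \<in> test_functions"
  shows "(\<psi> has_derivative (\<lambda>h. \<Sum>i\<in>UNIV. h $ i * partial i \<psi> x)) (at x)"
proof -
  have d: "(\<psi> has_derivative frechet_derivative \<psi> (at x)) (at x)"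
    using test_function_differentiable[OF assms] by (simp add: differentiable_on_def frechet_derivative_works[symmetric])
  have lin: "linear (frechet_derivative \<psi> (at x))" using d by (rule has_derivative_linear)
  have "frechet_derivative \<psi> (at x) h = (\<Sum>i\<in>UNIV. h $ i * partial i \<psi> x)" for h
  proof -
    have "(\<Sum>i\<in>UNIV. (h $ i) *\<^sub>R axis i 1) = h" by (simp add: vec_eq_iff axis_def if_distrib cong: if_cong)
    then have "frechet_derivative \<psi> (at x) h = frechet_derivative \<psi> (at x) (\<Sum>i\<in>UNIV. (h $ i) *\<^sub>R axis i 1)" by simp
    also have "\<dots> = (\<Sum>i\<in>UNIV. h $ i * partial i \<psi> x)" unfolding partial_def linear_sum[OF lin] linear_scale[OF lin] by simp
    finally show ?thesis .
  qed
  then have "frechet_derivative \<psi> (at x) = (\<lambda>h. \<Sum>i\<in>UNIV. h $ i * partial i \<psi> x)" by (rule ext)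
  with d show ?thesis by (simp only:)
qed

lemma coord_dil_test_function:
  assumes \<psi>: "\<psi> \<in> test_functions" and \<sigma>: "\<sigma> > 0"
  shows "(\<lambda>y. \<sigma>\<^sup>2 * y $ i * \<psi> (\<sigma> *\<^sub>R y)) \<in> test_functions"
    and "(\<Sum>i\<in>UNIV. partial i (\<lambda>y. \<sigma>\<^sup>2 * y $ i * \<psi> (\<sigma> *\<^sub>R y)) y) = dil_div \<psi> \<sigma> y"
proof -
  obtain R where R: "R > 0" "\<And>x. R < norm x \<Longrightarrow> \<psi> x = 0" using test_functionE[OF \<psi>] by blast
  have C: "Ck k \<psi>" for k using \<psi> by (simp add: test_functions_def)
  show "(\<lambda>y. \<sigma>\<^sup>2 * y $ i * \<psi> (\<sigma> *\<^sub>R y)) \<in> test_functions"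
  proof (rule test_functionsI[of _ "R / \<sigma>"])
    show "Ck k (\<lambda>y. \<sigma>\<^sup>2 * y $ i * \<psi> (\<sigma> *\<^sub>R y))" for k by (intro Ck_mult Ck_const Ck_coord Ck_scale C)
    show "\<sigma>\<^sup>2 * x $ i * \<psi> (\<sigma> *\<^sub>R x) = 0" if "R / \<sigma> < norm x" for x
      using R(2)[of "\<sigma> *\<^sub>R x"] that \<sigma> by (simp add: pos_divide_less_eq mult.commute)
  qed
  have "partial i (\<lambda>y. \<sigma>\<^sup>2 * y $ i * \<psi> (\<sigma> *\<^sub>R y)) y = \<sigma>\<^sup>2 * \<psi> (\<sigma> *\<^sub>R y) + \<sigma> ^ 3 * (y $ i * partial i \<psi> (\<sigma> *\<^sub>R y))" for i
  proof -
    have s: "((\<lambda>y. \<sigma> *\<^sub>R y) has_derivative (\<lambda>h. \<sigma> *\<^sub>R h)) (at y)" by (auto intro!: derivative_eq_intros)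
    have c: "((\<lambda>y. \<sigma>\<^sup>2 * y $ i) has_derivative (\<lambda>h. \<sigma>\<^sup>2 * h $ i)) (at y)"
      by (intro bounded_linear_imp_has_derivative bounded_linear_compose[OF bounded_linear_mult_right bounded_linear_vec_nth])
    have "(\<sigma> *\<^sub>R axis i 1) $ j * z = (if j = i then \<sigma> * z else 0)" for j z by (simp add: axis_def)
    then have "(\<Sum>j\<in>UNIV. (\<sigma> *\<^sub>R axis i 1) $ j * partial j \<psi> (\<sigma> *\<^sub>R y)) = \<sigma> * partial i \<psi> (\<sigma> *\<^sub>R y)" by (simp only: sum.delta finite) simp
    then show ?thesis
      unfolding partial_has_derivative[OF has_derivative_mult[OF c has_derivative_compose[OF s test_function_has_derivative[OF \<psi>]]]]
      by (simp only: axis_nth) (simp add: power_eq_if)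
  qed
  then show "(\<Sum>i\<in>UNIV. partial i (\<lambda>y. \<sigma>\<^sup>2 * y $ i * \<psi> (\<sigma> *\<^sub>R y)) y) = dil_div \<psi> \<sigma> y"
    by (simp add: dil_div_def sum.distrib sum_distrib_left)
qed

text \<open>\<open>dil_div\<close> is the \<open>\<sigma>\<close>-derivative of
  \<open>\<sigma> ^ 3 * \<psi> (\<sigma> y)\<close>; the 8 is the inverse cube of the lower endpoint
  \<open>1 / 2\<close>.\<close>

lemma dil_div_integral:
  assumes \<psi>: "\<psi> \<in> test_functions"
  shows "(LINT \<sigma>|lborel. indicator {1/2..1} \<sigma> *\<^sub>R dil_div \<psi> \<sigma> y) = \<psi> y - \<psi> ((1 / 2) *\<^sub>R y) / 8"
    and "continuous_on {1/2..1} (\<lambda>\<sigma>. dil_div \<psi> \<sigma> y)"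
proof -
  have D: "((\<lambda>\<sigma>. \<sigma> ^ 3 * \<psi> (\<sigma> *\<^sub>R y)) has_vector_derivative dil_div \<psi> \<sigma> y) (at \<sigma> within {1/2..1})" for \<sigma>
  proof -
    have "((\<lambda>\<sigma>. \<sigma> *\<^sub>R y) has_derivative (\<lambda>h. h *\<^sub>R y)) (at \<sigma>)" by (auto intro!: derivative_eq_intros)
    from has_derivative_compose[OF this test_function_has_derivative[OF \<psi>]]
    have "((\<lambda>\<sigma>. \<psi> (\<sigma> *\<^sub>R y)) has_derivative (\<lambda>h. (\<Sum>i\<in>UNIV. y $ i * partial i \<psi> (\<sigma> *\<^sub>R y)) * h)) (at \<sigma>)"
      by (simp add: mult.commute[of "sum _ _"] sum_distrib_left mult.assoc)
    then have 1: "((\<lambda>\<sigma>. \<psi> (\<sigma> *\<^sub>R y)) has_real_derivative (\<Sum>i\<in>UNIV. y $ i * partial i \<psi> (\<sigma> *\<^sub>R y))) (at \<sigma>)"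
      by (simp only: has_field_derivative_def)
    have 2: "((\<lambda>\<sigma>. \<sigma> ^ 3) has_real_derivative 3 * \<sigma>\<^sup>2) (at \<sigma>)" by (auto intro!: derivative_eq_intros)
    have "((\<lambda>\<sigma>. \<sigma> ^ 3 * \<psi> (\<sigma> *\<^sub>R y)) has_real_derivative dil_div \<psi> \<sigma> y) (at \<sigma>)"
      by (rule DERIV_cong[OF DERIV_mult[OF 2 1]]) (simp add: dil_div_def mult.commute)
    then show ?thesis by (simp add: has_real_derivative_iff_has_vector_derivative has_vector_derivative_at_within)
  qed
  show c: "continuous_on {1/2..1} (\<lambda>\<sigma>. dil_div \<psi> \<sigma> y)"
    unfolding dil_div_def
    by (intro continuous_intros continuous_on_compose2[OF test_function_continuous[OF \<psi>]] continuous_on_compose2[OF test_function_continuous[OF partial_test_function[OF \<psi>]]]) auto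
  have "(1 / 2 :: real) \<le> 1" "1 ^ 3 * \<psi> (1 *\<^sub>R y) - (1 / 2) ^ 3 * \<psi> ((1 / 2) *\<^sub>R y) = \<psi> y - \<psi> ((1 / 2) *\<^sub>R y) / 8"
    by (simp_all add: power3_eq_cube)
  with integral_FTC_Icc[OF this(1) D c] show "(LINT \<sigma>|lborel. indicator {1/2..1} \<sigma> *\<^sub>R dil_div \<psi> \<sigma> y) = \<psi> y - \<psi> ((1 / 2) *\<^sub>R y) / 8"
    by (simp only:)
qed


text \<open>The only demand on the weight is that \<open>w x * norm x\<close> be square integrable.
  This covers test functions, indicators of boxes and radial cutoffs, and later a weight singular at
  the origin.\<close>

lemma radial_avg_weighted:
  assumes [measurable]: "w \<in> borel_measurable borel" and w: "integrable lborel (\<lambda>x. (w x * norm x)\<^sup>2)" and g: "g \<in> L2"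
  shows "integrable (lborel \<Otimes>\<^sub>M lborel) (\<lambda>(\<sigma>, x). indicator {1/2..1} \<sigma> *\<^sub>R (\<Sum>i\<in>UNIV. (w x * (x $ i / \<sigma>\<^sup>2)) *\<^sub>R (g ((1 / \<sigma>) *\<^sub>R x) $ i)))" (is ?A)
    and "integrable lborel (\<lambda>x. w x *\<^sub>R radial_avg g x)"
    and "(LINT x|lborel. w x *\<^sub>R radial_avg g x) = (LINT \<sigma>|lborel. indicator {1/2..1} \<sigma> *\<^sub>R (LINT x|lborel. (\<Sum>i\<in>UNIV. (w x * (x $ i / \<sigma>\<^sup>2)) *\<^sub>R (g ((1 / \<sigma>) *\<^sub>R x) $ i))))"
proof -
  have [measurable]: "g \<in> borel_measurable borel" using L2_measurable[OF g] by simp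
  let ?f = "\<lambda>\<sigma> x. indicator {1/2..1::real} \<sigma> *\<^sub>R (\<Sum>i\<in>UNIV. (w x * (x $ i / \<sigma>\<^sup>2)) *\<^sub>R (g ((1 / \<sigma>) *\<^sub>R x) $ i))"
  let ?d = "\<lambda>\<sigma> x. 2 * ((w x * norm x)\<^sup>2 + (norm (g ((1 / \<sigma>) *\<^sub>R x)))\<^sup>2)"
  have gi: "integrable lborel (\<lambda>x. (norm (g ((1 / \<sigma>) *\<^sub>R x)))\<^sup>2)" if "\<sigma> > 0" for \<sigma> by (rule L2_integrable[OF L2_dilation[OF g]]) (use that in simp)
  have fb: "norm (?f \<sigma> x) \<le> ?d \<sigma> x" if \<sigma>: "\<sigma> \<in> {1/2..1}" for \<sigma> x
  proof -
    define G where "G = norm (g ((1 / \<sigma>) *\<^sub>R x))"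
    have "(1 / 2)\<^sup>2 \<le> \<sigma>\<^sup>2" using \<sigma> by (intro power_mono) auto
    \<comment> \<open>This 4 and the inequality \<open>2 a b \<le> a^2 + b^2\<close> account for the
      factor 2 in the majorant.\<close>
    then have s4: "1 / \<sigma>\<^sup>2 \<le> 4" using \<sigma> by (simp add: divide_le_eq power2_eq_square)
    have "norm (?f \<sigma> x) = norm ((w x / \<sigma>\<^sup>2) *\<^sub>R (\<Sum>i\<in>UNIV. (x $ i) *\<^sub>R (g ((1 / \<sigma>) *\<^sub>R x) $ i)))"
      unfolding scaleR_sum_right using \<sigma> by (simp add: mult_ac)
    also have "\<dots> \<le> \<bar>w x / \<sigma>\<^sup>2\<bar> * (norm x * G)" unfolding norm_scaleR G_def by (intro mult_left_mono norm_radial_sum) simp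
    also have "\<dots> = 1 / \<sigma>\<^sup>2 * (\<bar>w x * norm x\<bar> * G)" by (simp add: abs_mult)
    also have "\<dots> \<le> 4 * (\<bar>w x * norm x\<bar> * G)" using s4 by (intro mult_right_mono) (auto simp: G_def)
    also have "\<dots> \<le> ?d \<sigma> x" using sum_squares_bound[of "\<bar>w x * norm x\<bar>" G] by (simp add: G_def)
    finally show ?thesis .
  qed
  have fi: "integrable lborel (?f \<sigma>)" for \<sigma>
  proof (cases "\<sigma> \<in> {1/2..1}")
    case True
    then have "\<sigma> > 0" by simp
    show ?thesis by (rule Bochner_Integration.integrable_bound[OF integrable_mult_right[OF Bochner_Integration.integrable_add[OF w gi[OF \<open>\<sigma> > 0\<close>]], of 2]])
      (use fb[OF True] in \<open>auto intro!: AE_I2 order_trans[OF _ abs_ge_self]\<close>)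
  qed simp
  show A: ?A
  proof (rule lborel_pair.Fubini_integrable)
    show "(\<lambda>(\<sigma>, x). ?f \<sigma> x) \<in> borel_measurable (lborel \<Otimes>\<^sub>M lborel)" by measurable
    show "AE \<sigma> in lborel. integrable lborel (\<lambda>x. case (\<sigma>, x) of (\<sigma>, x) \<Rightarrow> ?f \<sigma> x)" using fi by simp
    show "integrable lborel (\<lambda>\<sigma>. LINT x|lborel. norm (case (\<sigma>, x) of (\<sigma>, x) \<Rightarrow> ?f \<sigma> x))"
    proof (rule Bochner_Integration.integrable_bound)
      define K where "K = 2 * ((LINT x|lborel. (w x * norm x)\<^sup>2) + (LINT x|lborel. (norm (g x))\<^sup>2))"
      show "integrable lborel (\<lambda>\<sigma>. indicator {1/2..1::real} \<sigma> * K)"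
        by (intro integrable_mult_left integrable_indicator_bounded) auto
      show "(\<lambda>\<sigma>. LINT x|lborel. norm (case (\<sigma>, x) of (\<sigma>, x) \<Rightarrow> ?f \<sigma> x)) \<in> borel_measurable lborel" by measurable
      show "AE \<sigma> in lborel. norm (LINT x|lborel. norm (case (\<sigma>, x) of (\<sigma>, x) \<Rightarrow> ?f \<sigma> x)) \<le> norm (indicator {1/2..1} \<sigma> * K)"
      proof (rule AE_I2)
        fix \<sigma> :: real
        show "norm (LINT x|lborel. norm (case (\<sigma>, x) of (\<sigma>, x) \<Rightarrow> ?f \<sigma> x)) \<le> norm (indicator {1/2..1} \<sigma> * K)"
        proof (cases "\<sigma> \<in> {1/2..1}")
          case True
          then have \<sigma>: "\<sigma> > 0" "\<sigma> ^ 3 \<le> 1" "1 / \<sigma> > 0" by (auto intro: power_le_one)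
          have "(LINT x|lborel. norm (?f \<sigma> x)) \<le> (LINT x|lborel. ?d \<sigma> x)"
            by (rule integral_mono[OF integrable_norm[OF fi] _ fb[OF True]]) (use w gi[OF \<sigma>(1)] in simp)
          also have "\<dots> = 2 * ((LINT x|lborel. (w x * norm x)\<^sup>2) + \<sigma> ^ 3 * (LINT x|lborel. (norm (g x))\<^sup>2))"
            using w gi[OF \<sigma>(1)] scaling_integral[OF \<sigma>(3), of "\<lambda>x. (norm (g x))\<^sup>2"] by (simp add: power_divide)
          also have "\<dots> \<le> K" unfolding K_def using \<sigma> by (intro mult_left_mono add_left_mono mult_left_le_one_le) auto
          finally have 1: "(LINT x|lborel. norm (?f \<sigma> x)) \<le> K" .
          have "0 \<le> (LINT x|lborel. norm (?f \<sigma> x))" by (intro Bochner_Integration.integral_nonneg) simp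
          with 1 True show ?thesis by simp
        qed simp
      qed
    qed
  qed
  have e: "(LINT \<sigma>|lborel. ?f \<sigma> x) = w x *\<^sub>R radial_avg g x" for x
    unfolding radial_avg_def integral_scaleR_right[symmetric] scaleR_sum_right scaleR_scaleR by (simp only: mult_ac)
  show "integrable lborel (\<lambda>x. w x *\<^sub>R radial_avg g x)" using lborel_pair.integrable_snd[of "\<lambda>\<sigma> x. ?f \<sigma> x"] A unfolding e by simp
  show "(LINT x|lborel. w x *\<^sub>R radial_avg g x) = (LINT \<sigma>|lborel. indicator {1/2..1} \<sigma> *\<^sub>R (LINT x|lborel. (\<Sum>i\<in>UNIV. (w x * (x $ i / \<sigma>\<^sup>2)) *\<^sub>R (g ((1 / \<sigma>) *\<^sub>R x) $ i))))"
    using lborel_pair.Fubini_integral[of "\<lambda>\<sigma> x. ?f \<sigma> x"] A unfolding e integral_scaleR_right by simp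
qed

lemma bounded_support_weight:
  assumes [measurable]: "w \<in> borel_measurable borel" and w: "\<And>x. \<bar>w x\<bar> \<le> c * indicator (cball 0 R) (x::space)" and R: "R \<ge> 0"
  shows "w \<in> L2" "integrable lborel (\<lambda>x. (w x * norm x)\<^sup>2)"
proof -
  have I: "(indicator (cball 0 R) :: space \<Rightarrow> real) \<in> L2" by (rule indicator_L2) auto
  show "w \<in> L2" by (rule L2_bound[OF I, of _ c]) (use w in auto)
  have "0 \<le> c" using w[of 0] R by simp
  then have "norm (w x * norm x) \<le> c * R * norm (indicator (cball 0 R) x :: real)" for x
    using mult_mono[OF w[of x], of "norm x" R] w[of x] by (cases "norm x \<le> R") (auto simp: abs_mult)
  then have "(\<lambda>x. w x * norm x) \<in> L2" by (intro L2_bound[OF I, of _ "c * R"]) auto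
  from L2_integrable[OF this] show "integrable lborel (\<lambda>x. (w x * norm x)\<^sup>2)" by simp
qed

text \<open>The ray formula holds by duality: for a test function \<open>\<psi>\<close>, the
  derivative of \<open>\<sigma> ^ 3 * \<psi> (\<sigma> y)\<close> in \<open>\<sigma>\<close> is a
  divergence in \<open>y\<close>, so the weak gradient may be tested with it for each
  \<open>\<sigma>\<close>. Exchanging the integrals identifies both sides against every
  \<open>\<psi>\<close>.\<close>

theorem dilation_difference:
  assumes v: "v \<in> H1"
  shows "AE x in lborel. v (2 *\<^sub>R x) - v x = radial_avg (weak_grad v) x"
proof -
  let ?g = "weak_grad v"
  have [measurable]: "v \<in> borel_measurable borel" "?g \<in> borel_measurable borel"
    using H1_measurable[OF v] weak_grad_measurable[OF v] by auto
  have v2: "(\<lambda>x. v (2 *\<^sub>R x)) \<in> L2" by (rule L2_dilation[OF H1D(1)[OF v]]) simp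
  have T: "(\<lambda>x. v (2 *\<^sub>R x) - v x) \<in> L2" by (rule L2_diff[OF v2 H1D(1)[OF v]])
  have orth: "(LINT x|lborel. \<psi> x *\<^sub>R (v (2 *\<^sub>R x) - v x)) = (LINT x|lborel. \<psi> x *\<^sub>R radial_avg ?g x) \<and> integrable lborel (\<lambda>x. \<psi> x *\<^sub>R radial_avg ?g x)"
    if \<psi>: "\<psi> \<in> test_functions" for \<psi>
  proof -
    obtain R where R: "R > 0" "\<And>x. R < norm x \<Longrightarrow> \<psi> x = 0" using test_functionE[OF \<psi>] by blast
    obtain M where M: "M > 0" "\<And>x. \<bar>\<psi> x\<bar> \<le> M" using test_function_bounded[OF \<psi>] by blast
    have [measurable]: "\<psi> \<in> borel_measurable borel" "partial i \<psi> \<in> borel_measurable borel" for i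
      using test_function_measurable[OF \<psi>] test_function_measurable[OF partial_test_function[OF \<psi>]] by auto
    have "\<bar>\<psi> x\<bar> \<le> M * indicator (cball 0 R) x" for x using R(2)[of x] M(2)[of x] by (cases "norm x \<le> R") auto
    note W = radial_avg_weighted[OF _ bounded_support_weight(2)[OF _ this less_imp_le[OF R(1)]] H1D(2)[OF v]]
    \<comment> \<open>Since \<open>\<sigma> \<ge> 1 / 2\<close>, all dilates of
      \<open>\<psi>\<close> live in the ball of radius \<open>2 * R\<close>, so one constant
      dominates the double integral.\<close>
    have "\<exists>K\<ge>0. \<forall>\<sigma>\<in>{1/2..1}. \<forall>y\<in>cball 0 (2 * R). \<bar>dil_div \<psi> \<sigma> y\<bar> \<le> K"
    proof -
      have "continuous_on ({1/2..1} \<times> cball 0 (2 * R)) (\<lambda>(\<sigma>, y). dil_div \<psi> \<sigma> y)"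
        unfolding dil_div_def case_prod_unfold
        by (intro continuous_intros continuous_on_compose2[OF test_function_continuous[OF \<psi>]]
            continuous_on_compose2[OF test_function_continuous[OF partial_test_function[OF \<psi>]]]) auto
      then have "compact ((\<lambda>(\<sigma>, y). dil_div \<psi> \<sigma> y) ` ({1/2..1} \<times> cball 0 (2 * R)))"
        by (intro compact_continuous_image compact_Times) auto
      then obtain K where "\<forall>z\<in>(\<lambda>(\<sigma>, y). dil_div \<psi> \<sigma> y) ` ({1/2..1} \<times> cball 0 (2 * R)). \<bar>z\<bar> \<le> K"
        by (auto dest!: compact_imp_bounded simp: bounded_iff)
      then show ?thesis by (intro exI[of _ "max K 0"]) (auto simp: le_max_iff_disj)
    qed
    then obtain K where K: "K \<ge> 0" "\<And>\<sigma> y. \<sigma> \<in> {1/2..1} \<Longrightarrow> norm y \<le> 2 * R \<Longrightarrow> \<bar>dil_div \<psi> \<sigma> y\<bar> \<le> K" by auto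
    have db: "\<bar>dil_div \<psi> \<sigma> y\<bar> \<le> indicator (cball 0 (2 * R)) y * K" if \<sigma>: "\<sigma> \<in> {1/2..1}" for \<sigma> y
    proof (cases "norm y \<le> 2 * R")
      case False
      have "1 / 2 * norm y \<le> \<sigma> * norm y" using \<sigma> by (intro mult_right_mono) auto
      then have n: "R < norm (\<sigma> *\<^sub>R y)" using False \<sigma> by simp
      have "partial i \<psi> (\<sigma> *\<^sub>R y) = 0" for i
      proof -
        have "open {x::space. R < norm x}" by (intro open_Collect_less continuous_intros)
        then have ev: "\<forall>\<^sub>F x in nhds (\<sigma> *\<^sub>R y). \<psi> x = 0"
          using n R(2) by (auto simp: eventually_nhds intro!: exI[of _ "{x::space. R < norm x}"])
        have "(\<psi> has_derivative (\<lambda>_. 0)) (at (\<sigma> *\<^sub>R y))"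
          by (rule has_derivative_transform_eventually[OF has_derivative_const[of 0]])
            (use ev R(2)[OF n] in \<open>auto simp: eventually_at_filter elim!: eventually_mono\<close>)
        from partial_has_derivative[OF this] show ?thesis .
      qed
      then show ?thesis using R(2)[OF n] False by (simp add: dil_div_def)
    qed (use K \<sigma> in auto)
    let ?F = "\<lambda>\<sigma> y. (indicator {1/2..1::real} \<sigma> * dil_div \<psi> \<sigma> y) *\<^sub>R v y"
    have [measurable]: "(\<lambda>(\<sigma>, y). dil_div \<psi> \<sigma> y) \<in> borel_measurable (lborel \<Otimes>\<^sub>M lborel)"
      unfolding dil_div_def[abs_def] by measurable
    have F: "integrable (lborel \<Otimes>\<^sub>M lborel) (\<lambda>(\<sigma>, y). ?F \<sigma> y)"
    proof (rule integrable_pair_bound)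
      show "integrable lborel (\<lambda>\<sigma>. indicator {1/2..1::real} \<sigma> * K)" by (intro integrable_mult_left integrable_indicator_bounded) auto
      show "integrable lborel (\<lambda>y. indicator (cball 0 (2 * R)) y * norm (v y))" by (rule ball_L2_integrable[OF H1D(1)[OF v]])
      show "norm (case (\<sigma>, y) of (\<sigma>, y) \<Rightarrow> ?F \<sigma> y) \<le> indicator {1/2..1::real} \<sigma> * K * (indicator (cball 0 (2 * R)) y * norm (v y))" for \<sigma> y
        using mult_right_mono[OF db[of \<sigma> y], of "norm (v y)"] by (cases "\<sigma> \<in> {1/2..1}") (simp_all add: mult_ac)
    qed measurable
    \<comment> \<open>The weak gradient is tested with each component of the field; the substitution
      \<open>y = x / \<sigma>\<close> then frees \<open>\<psi>\<close> from
      \<open>\<sigma>\<close>.\<close>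
    have inner: "(LINT y|lborel. dil_div \<psi> \<sigma> y *\<^sub>R v y) = - (LINT x|lborel. (\<Sum>i\<in>UNIV. (\<psi> x * (x $ i / \<sigma>\<^sup>2)) *\<^sub>R (?g ((1 / \<sigma>) *\<^sub>R x) $ i)))"
      if \<sigma>: "\<sigma> > 0" for \<sigma>
    proof -
      let ?c = "\<lambda>i y. \<sigma>\<^sup>2 * y $ i * \<psi> (\<sigma> *\<^sub>R y)"
      note t = coord_dil_test_function[OF \<psi> \<sigma>]
      have i1: "integrable lborel (\<lambda>y. partial i (?c i) y *\<^sub>R v y)" for i
        by (rule test_function_times_L2[OF partial_test_function[OF t(1)] H1D(1)[OF v]])
      have i2: "integrable lborel (\<lambda>y. ?c i y *\<^sub>R (?g y $ i))" for i
        by (rule test_function_times_L2[OF t(1) L2_component[OF H1D(2)[OF v]]])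
      have "(LINT y|lborel. dil_div \<psi> \<sigma> y *\<^sub>R v y) = (\<Sum>i\<in>UNIV. LINT y|lborel. partial i (?c i) y *\<^sub>R v y)"
        unfolding t(2)[symmetric] scaleR_sum_left by (rule Bochner_Integration.integral_sum[OF i1])
      also have "\<dots> = - (\<Sum>i\<in>UNIV. LINT y|lborel. ?c i y *\<^sub>R (?g y $ i))"
        using H1D(3)[OF v] t(1) unfolding has_weak_gradient_def sum_negf[symmetric] by (intro sum.cong refl) blast
      also have "(\<Sum>i\<in>UNIV. LINT y|lborel. ?c i y *\<^sub>R (?g y $ i)) = (LINT y|lborel. (\<Sum>i\<in>UNIV. ?c i y *\<^sub>R (?g y $ i)))"
        by (rule Bochner_Integration.integral_sum[OF i2, symmetric])
      also have "\<dots> = (1 / \<sigma> ^ 3) *\<^sub>R (LINT x|lborel. (\<Sum>i\<in>UNIV. ?c i ((1 / \<sigma>) *\<^sub>R x) *\<^sub>R (?g ((1 / \<sigma>) *\<^sub>R x) $ i)))"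
        using scaling_integral[of "1 / \<sigma>" "\<lambda>y. \<Sum>i\<in>UNIV. ?c i y *\<^sub>R (?g y $ i)"] \<sigma> by (simp add: power_divide)
      also have "\<dots> = (LINT x|lborel. (\<Sum>i\<in>UNIV. (\<psi> x * (x $ i / \<sigma>\<^sup>2)) *\<^sub>R (?g ((1 / \<sigma>) *\<^sub>R x) $ i)))"
        unfolding integral_scaleR_right[symmetric] scaleR_sum_right using \<sigma>
        by (intro Bochner_Integration.integral_cong refl sum.cong) (simp add: power_eq_if mult.commute)
      finally show ?thesis .
    qed
    have "(LINT y|lborel. (\<psi> y - \<psi> ((1 / 2) *\<^sub>R y) / 8) *\<^sub>R v y) = (LINT y|lborel. LINT \<sigma>|lborel. ?F \<sigma> y)"
    proof (rule Bochner_Integration.integral_cong[OF refl])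
      fix y
      have "set_integrable lborel {1/2..1} (\<lambda>\<sigma>. dil_div \<psi> \<sigma> y)" by (rule borel_integrable_compact[OF compact_Icc dil_div_integral(2)[OF \<psi>], folded set_integrable_def])
      then show "(\<psi> y - \<psi> ((1 / 2) *\<^sub>R y) / 8) *\<^sub>R v y = (LINT \<sigma>|lborel. ?F \<sigma> y)"
        unfolding dil_div_integral(1)[OF \<psi>, symmetric] set_integrable_def by simp
    qed
    also have "\<dots> = (LINT \<sigma>|lborel. LINT y|lborel. ?F \<sigma> y)"
      using lborel_pair.Fubini_integral[of "\<lambda>\<sigma> y. ?F \<sigma> y"] F by simp
    also have "\<dots> = (LINT \<sigma>|lborel. - (indicator {1/2..1} \<sigma> *\<^sub>R (LINT x|lborel. (\<Sum>i\<in>UNIV. (\<psi> x * (x $ i / \<sigma>\<^sup>2)) *\<^sub>R (?g ((1 / \<sigma>) *\<^sub>R x) $ i)))))"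
      by (intro Bochner_Integration.integral_cong refl) (simp add: inner split: split_indicator)
    also have "\<dots> = - (LINT x|lborel. \<psi> x *\<^sub>R radial_avg ?g x)"
      unfolding integral_minus using W(3) by simp
    finally have 1: "(LINT y|lborel. (\<psi> y - \<psi> ((1 / 2) *\<^sub>R y) / 8) *\<^sub>R v y) = - (LINT x|lborel. \<psi> x *\<^sub>R radial_avg ?g x)" .
    have \<psi>2: "(\<lambda>y. \<psi> ((1 / 2) *\<^sub>R y)) \<in> test_functions" by (rule test_function_scale[OF \<psi>]) simp
    note i = test_function_times_L2[OF \<psi> H1D(1)[OF v]] test_function_times_L2[OF \<psi>2 H1D(1)[OF v]] test_function_times_L2[OF \<psi> v2]
    have e: "(\<psi> y - \<psi> ((1 / 2) *\<^sub>R y) / 8) *\<^sub>R v y = \<psi> y *\<^sub>R v y - (1 / 8) *\<^sub>R (\<psi> ((1 / 2) *\<^sub>R y) *\<^sub>R v y)" for y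
      by (simp add: scaleR_diff_left)
    \<comment> \<open>The Jacobian 8 of the dilation by 2 matches the boundary term at
      \<open>\<sigma> = 1 / 2\<close>.\<close>
    have "(LINT x|lborel. \<psi> x *\<^sub>R v (2 *\<^sub>R x)) = (1 / 8) *\<^sub>R (LINT y|lborel. \<psi> ((1 / 2) *\<^sub>R y) *\<^sub>R v y)"
      using scaling_integral[of 2 "\<lambda>y. \<psi> ((1 / 2) *\<^sub>R y) *\<^sub>R v y"] by simp
    then have "(LINT x|lborel. \<psi> x *\<^sub>R (v (2 *\<^sub>R x) - v x)) = - (LINT y|lborel. (\<psi> y - \<psi> ((1 / 2) *\<^sub>R y) / 8) *\<^sub>R v y)"
      unfolding e scaleR_diff_right
      by (simp only: Bochner_Integration.integral_diff[OF i(3,1)] Bochner_Integration.integral_diff[OF i(1) integrable_scaleR_right[OF i(2)]] integral_scaleR_right) simp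
    with 1 W(2) show ?thesis by simp
  qed
  have [measurable]: "radial_avg ?g \<in> borel_measurable borel"
  proof -
    have "radial_avg ?g \<in> borel_measurable lborel" unfolding radial_avg_def by measurable
    then show ?thesis by simp
  qed
  have "AE x in lborel. v (2 *\<^sub>R x) - v x - radial_avg ?g x = 0"
  proof (rule AE_zero_if_orthogonal_to_test_functions)
    show "(\<lambda>x. v (2 *\<^sub>R x) - v x - radial_avg ?g x) \<in> borel_measurable lborel" by measurable
    show "integrable lborel (\<lambda>x. indicator (box a b) x *\<^sub>R (v (2 *\<^sub>R x) - v x - radial_avg ?g x))" for a b
    proof -
      obtain R where "\<And>x. x \<in> box a b \<Longrightarrow> norm x \<le> R" using bounded_box[of a b] by (auto simp: bounded_iff)
      then have "\<bar>indicator (box a b) x :: real\<bar> \<le> 1 * indicator (cball 0 (max R 0)) x" for x :: space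
        by (auto simp: le_max_iff_disj split: split_indicator)
      note B = bounded_support_weight[OF _ this]
      have "integrable lborel (\<lambda>x. indicator (box a b) x *\<^sub>R radial_avg ?g x)"
        by (rule radial_avg_weighted(2)[OF _ B(2) H1D(2)[OF v]]) auto
      moreover have "integrable lborel (\<lambda>x. indicator (box a b) x *\<^sub>R (v (2 *\<^sub>R x) - v x))"
        by (rule L2_product_integrable[OF B(1) T]) auto
      ultimately show ?thesis unfolding scaleR_diff_right[of _ "v _ - v _"] by (rule Bochner_Integration.integrable_diff[rotated])
    qed
    show "(LINT x|lborel. \<phi> x *\<^sub>R (v (2 *\<^sub>R x) - v x - radial_avg ?g x)) = 0" if "\<phi> \<in> test_functions" for \<phi>
      using orth[OF that] Bochner_Integration.integral_diff[OF test_function_times_L2[OF that T], of "\<lambda>x. \<phi> x *\<^sub>R radial_avg ?g x"]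
      by (simp add: scaleR_diff_right[of _ "v _ - v _"])
  qed
  then show ?thesis by eventually_elim simp
qed


section \<open>Radial functions are given by their profile\<close>

text \<open>The profile and the function have the same dilation differences in the mean over spheres; both vanish at infinity,
  so iterating the dilation identifies them.\<close>

lemma profile_pairing:
  assumes u: "u \<in> H1" and [measurable]: "k \<in> borel_measurable borel" and a: "0 < a" "a \<le> b"
    and k: "\<And>r. \<bar>k r\<bar> \<le> indicator {a..b} r"
  shows "(LINT x|lborel. k (norm x) *\<^sub>R (profile u (2 * norm x) - profile u (norm (x::space)))) = (LINT x|lborel. k (norm x) *\<^sub>R radial_avg (weak_grad u) x)"
proof -
  let ?\<rho> = "radial_density u" and ?g = "weak_grad u"
  have [measurable]: "?\<rho> \<in> borel_measurable borel" "profile u \<in> borel_measurable borel" "?g \<in> borel_measurable borel"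
    using radial_density_measurable[OF u] profile_measurable[OF u] weak_grad_measurable[OF u] by auto
  have i: "integrable lborel (\<lambda>y. indicator {r<..} (norm y) *\<^sub>R ?\<rho> y)" if "r > 0" for r
    by (rule shell_radial_density(1)[OF u _ integral_norm_m4(1)[OF that]]) simp
  define G where "G y = norm (indicator {a / 2<..} (norm y) *\<^sub>R ?\<rho> y)" for y
  have Gi: "integrable lborel G" unfolding G_def using integrable_norm[OF i[of "a / 2"]] a by simp
  have k0: "k r = 0" if "r \<notin> {a..b}" for r using k[of r] that by simp
  have k1: "\<bar>k r\<bar> \<le> 1" for r using k[of r] by (rule order_trans) (simp add: indicator_def)
  \<comment> \<open>With \<open>s\<close> the radius at which the density is evaluated,
    \<open>c1\<close> is the kernel for a shell from \<open>r\<close> to \<open>2 r\<close> in polar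
    coordinates, and \<open>c2\<close> is the same kernel after the substitution
    \<open>r = \<sigma> s\<close>.\<close>
  define c1 where "c1 s r = 4 * pi * r\<^sup>2 * k r * indicator {r<..2 * r} s" for s r
  define c2 where "c2 s \<sigma> = indicator {1/2..1} \<sigma> * (4 * pi * \<sigma>\<^sup>2 * s ^ 3 * k (\<sigma> * s))" for s \<sigma>
  have c1_le: "norm (c1 (norm y) r *\<^sub>R ?\<rho> y) \<le> (4 * pi * b\<^sup>2 * indicator {a..b} r) * G y" and c1_b: "\<bar>c1 (norm y) r\<bar> \<le> 4 * pi * b\<^sup>2 * indicator {a..b} r" for r and y :: space
  proof -
    have "\<bar>c1 (norm y) r\<bar> \<le> 4 * pi * b\<^sup>2 * indicator {a..b} r * indicator {a / 2<..} (norm y)"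
    proof (cases "r \<in> {a..b} \<and> r < norm y")
      case True
      then have "r\<^sup>2 * \<bar>k r\<bar> \<le> b\<^sup>2 * 1" using a k1[of r] by (intro mult_mono power_mono) auto
      then show ?thesis using True a by (auto simp: c1_def abs_mult indicator_def)
    qed (use k0[of r] in \<open>auto simp: c1_def\<close>)
    from mult_right_mono[OF this, of "norm (?\<rho> y)"] this
    show "norm (c1 (norm y) r *\<^sub>R ?\<rho> y) \<le> (4 * pi * b\<^sup>2 * indicator {a..b} r) * G y" "\<bar>c1 (norm y) r\<bar> \<le> 4 * pi * b\<^sup>2 * indicator {a..b} r"
      by (auto simp: G_def mult.assoc split: split_indicator_asm split_indicator)
  qed
  have c2_le: "norm (c2 (norm y) \<sigma> *\<^sub>R ?\<rho> y) \<le> (indicator {1/2..1} \<sigma> * (4 * pi * (2 * b) ^ 3)) * G y" for \<sigma> and y :: space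
  proof (cases "\<sigma> \<in> {1/2..1} \<and> \<sigma> * norm y \<in> {a..b}")
    case True
    have "1 / 2 * norm y \<le> \<sigma> * norm y" "\<sigma> * norm y \<le> 1 * norm y" using True by (intro mult_right_mono; simp)+
    then have y: "norm y \<le> 2 * b" "a / 2 < norm y" using True a by auto
    have "\<sigma>\<^sup>2 * norm y ^ 3 * \<bar>k (\<sigma> * norm y)\<bar> \<le> 1 * (2 * b) ^ 3 * 1"
      using True y k1 a by (intro mult_mono power_mono power_le_one) auto
    from mult_right_mono[OF this, of "4 * pi * norm (?\<rho> y)"] show ?thesis using True y by (simp add: c2_def G_def abs_mult mult_ac)
  qed (use k0[of "\<sigma> * norm y"] a in \<open>auto simp: c2_def G_def indicator_def\<close>)
  have m1: "(\<lambda>(r, y). c1 (norm (y::space)) r *\<^sub>R ?\<rho> y) \<in> borel_measurable (lborel \<Otimes>\<^sub>M lborel)"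
  proof -
    have "indicator {r<..2 * r} s = (if r < s \<and> s \<le> 2 * r then 1 else (0::real))" for r s :: real by (auto simp: indicator_def)
    then show ?thesis unfolding c1_def by simp
  qed
  have m2: "(\<lambda>(\<sigma>, y). c2 (norm (y::space)) \<sigma> *\<^sub>R ?\<rho> y) \<in> borel_measurable (lborel \<Otimes>\<^sub>M lborel)"
    unfolding c2_def by measurable
  have ib: "integrable lborel (\<lambda>r. 4 * pi * b\<^sup>2 * indicator {a..b} r)" "integrable lborel (\<lambda>\<sigma>::real. indicator {1/2..1} \<sigma> * (4 * pi * (2 * b) ^ 3))"
    by (intro integrable_mult_right integrable_mult_left integrable_indicator_bounded; simp)+
  have I1: "integrable (lborel \<Otimes>\<^sub>M lborel) (\<lambda>(r, y). c1 (norm y) r *\<^sub>R ?\<rho> y)"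
    by (rule integrable_pair_bound[OF m1 ib(1) Gi]) (use c1_le in simp)
  have I2: "integrable (lborel \<Otimes>\<^sub>M lborel) (\<lambda>(\<sigma>, y). c2 (norm y) \<sigma> *\<^sub>R ?\<rho> y)"
    by (rule integrable_pair_bound[OF m2 ib(2) Gi]) (use c2_le in simp)
  have sub: "(LINT r|lborel. c1 s r) = (LINT \<sigma>|lborel. c2 s \<sigma>)" if s: "s > 0" for s
  proof -
    have [measurable]: "c1 s \<in> borel_measurable borel" "c2 s \<in> borel_measurable borel"
    proof -
      have "indicator {r<..2 * r} s = (if r < s \<and> s \<le> 2 * r then 1 else (0::real))" for r by (auto simp: indicator_def)
      then show "c1 s \<in> borel_measurable borel" unfolding c1_def by simp
      show "c2 s \<in> borel_measurable borel" unfolding c2_def by measurable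
    qed
    have "(LINT r|lborel. c1 s r) = (LINT \<sigma>|lborel. s * c1 s (s * \<sigma>))"
      using lborel_integral_real_affine[of s "c1 s" 0] s by simp
    also have "\<dots> = (LINT \<sigma>|lborel. c2 s \<sigma>)"
    proof (rule integral_cong_AE)
      \<comment> \<open>\<open>c1\<close> excludes the endpoint \<open>\<sigma> = 1\<close> that
        \<open>c2\<close> includes.\<close>
      show "AE \<sigma> in lborel. s * c1 s (s * \<sigma>) = c2 s \<sigma>"
        using AE_lborel_singleton[of "1::real"]
      proof eventually_elim
        case (elim \<sigma>)
        have "s \<in> {s * \<sigma><..2 * (s * \<sigma>)} \<longleftrightarrow> \<sigma> \<in> {1/2..1}" using s elim by (auto simp: field_simps)
        then have "indicator {s * \<sigma><..2 * (s * \<sigma>)} s = (indicator {1/2..1} \<sigma> :: real)" by (simp only: indicator_def)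
        then show ?case unfolding c1_def c2_def by (simp add: power2_eq_square power3_eq_cube mult_ac)
      qed
    qed measurable
    finally show ?thesis .
  qed
  have "(LINT x|lborel. k (norm x) *\<^sub>R (profile u (2 * norm x) - profile u (norm (x::space))))
    = (LINT r|lborel. (4 * pi * r\<^sup>2 * indicator {0..} r) *\<^sub>R (k r *\<^sub>R (profile u (2 * r) - profile u r)))"
    by (rule polar_integral) measurable
  also have "\<dots> = (LINT r|lborel. LINT y|lborel. c1 (norm y) r *\<^sub>R ?\<rho> y)"
  proof (rule Bochner_Integration.integral_cong[OF refl])
    fix r
    show "(4 * pi * r\<^sup>2 * indicator {0..} r) *\<^sub>R (k r *\<^sub>R (profile u (2 * r) - profile u r)) = (LINT y|lborel. c1 (norm y) r *\<^sub>R ?\<rho> y)"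
    proof (cases "r \<in> {a..b}")
      case True
      then have r: "r > 0" "2 * r > 0" using a by auto
      have "profile u (2 * r) - profile u r = (LINT y|lborel. indicator {r<..} (norm y) *\<^sub>R ?\<rho> y - indicator {2 * r<..} (norm y) *\<^sub>R ?\<rho> y)"
        unfolding profile_def Bochner_Integration.integral_diff[OF i[OF r(1)] i[OF r(2)]] by simp
      also have "\<dots> = (LINT y|lborel. indicator {r<..2 * r} (norm y) *\<^sub>R ?\<rho> y)"
        using r by (intro Bochner_Integration.integral_cong refl) (auto simp: indicator_def)
      finally show ?thesis using r unfolding c1_def scaleR_scaleR[symmetric] integral_scaleR_right by simp
    qed (simp add: k0 c1_def)
  qed
  also have "\<dots> = (LINT y|lborel. LINT r|lborel. c1 (norm y) r *\<^sub>R ?\<rho> y)"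
    using lborel_pair.Fubini_integral[of "\<lambda>r y. c1 (norm y) r *\<^sub>R ?\<rho> y"] I1 by simp
  also have "\<dots> = (LINT y|lborel. LINT \<sigma>|lborel. c2 (norm y) \<sigma> *\<^sub>R ?\<rho> y)"
  proof (rule Bochner_Integration.integral_cong[OF refl])
    fix y :: space
    show "(LINT r|lborel. c1 (norm y) r *\<^sub>R ?\<rho> y) = (LINT \<sigma>|lborel. c2 (norm y) \<sigma> *\<^sub>R ?\<rho> y)"
    proof (cases "y = 0")
      case False
      have j: "integrable lborel (c1 (norm y))"
      proof (rule Bochner_Integration.integrable_bound[OF ib(1)])
        have "indicator {r<..2 * r} s = (if r < s \<and> s \<le> 2 * r then 1 else (0::real))" for r s :: real by (auto simp: indicator_def)
        then show "c1 (norm y) \<in> borel_measurable lborel" unfolding c1_def by simp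
        show "AE r in lborel. norm (c1 (norm y) r) \<le> norm (4 * pi * b\<^sup>2 * indicator {a..b} r)" using c1_b by (auto intro!: AE_I2 order_trans[OF _ abs_ge_self])
      qed
      have j2: "integrable lborel (c2 (norm y))"
      proof (rule Bochner_Integration.integrable_bound)
        show "integrable lborel (\<lambda>\<sigma>::real. indicator {1/2..1} \<sigma> * (4 * pi * norm y ^ 3))" by (intro integrable_mult_left integrable_indicator_bounded) auto
        show "c2 (norm y) \<in> borel_measurable lborel" unfolding c2_def by measurable
        show "AE \<sigma> in lborel. norm (c2 (norm y) \<sigma>) \<le> norm (indicator {1/2..1} \<sigma> * (4 * pi * norm y ^ 3))"
        proof (rule AE_I2)
          fix \<sigma>
          show "norm (c2 (norm y) \<sigma>) \<le> norm (indicator {1/2..1} \<sigma> * (4 * pi * norm y ^ 3))"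
          proof (cases "\<sigma> \<in> {1/2..1}")
            case True
            then have "\<sigma>\<^sup>2 * \<bar>k (\<sigma> * norm y)\<bar> \<le> 1 * 1" using k1 by (intro mult_mono power_le_one) auto
            from mult_right_mono[OF this, of "4 * pi * norm y ^ 3"] show ?thesis using True by (simp add: c2_def abs_mult mult_ac)
          qed (simp add: c2_def)
        qed
      qed
      from False sub[of "norm y"] show ?thesis using j j2 by simp
    qed (simp add: radial_density_def)
  qed
  also have "\<dots> = (LINT \<sigma>|lborel. LINT y|lborel. c2 (norm y) \<sigma> *\<^sub>R ?\<rho> y)"
    using lborel_pair.Fubini_integral[of "\<lambda>\<sigma> y. c2 (norm y) \<sigma> *\<^sub>R ?\<rho> y"] I2 by simp
  also have "\<dots> = (LINT \<sigma>|lborel. indicator {1/2..1} \<sigma> *\<^sub>R (LINT x|lborel. (\<Sum>i\<in>UNIV. (k (norm x) * (x $ i / \<sigma>\<^sup>2)) *\<^sub>R (?g ((1 / \<sigma>) *\<^sub>R x) $ i))))"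
  proof (rule Bochner_Integration.integral_cong[OF refl])
    fix \<sigma>
    show "(LINT y|lborel. c2 (norm y) \<sigma> *\<^sub>R ?\<rho> y) = indicator {1/2..1} \<sigma> *\<^sub>R (LINT x|lborel. (\<Sum>i\<in>UNIV. (k (norm x) * (x $ i / \<sigma>\<^sup>2)) *\<^sub>R (?g ((1 / \<sigma>) *\<^sub>R x) $ i)))"
    proof (cases "\<sigma> \<in> {1/2..1}")
      case True
      then have \<sigma>: "\<sigma> > 0" by simp
      have "(LINT x|lborel. (\<Sum>i\<in>UNIV. (k (norm x) * (x $ i / \<sigma>\<^sup>2)) *\<^sub>R (?g ((1 / \<sigma>) *\<^sub>R x) $ i)))
        = (1 / (1 / \<sigma>) ^ 3) *\<^sub>R (LINT y|lborel. (\<Sum>i\<in>UNIV. (k (\<sigma> * norm y) * (y $ i / \<sigma>)) *\<^sub>R (?g y $ i)))"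
        using scaling_integral[of "1 / \<sigma>" "\<lambda>y. \<Sum>i\<in>UNIV. (k (\<sigma> * norm y) * (y $ i / \<sigma>)) *\<^sub>R (?g y $ i)"] \<sigma> by (simp add: power2_eq_square)
      also have "\<dots> = (LINT y|lborel. c2 (norm y) \<sigma> *\<^sub>R ?\<rho> y)"
        unfolding integral_scaleR_right[symmetric] scaleR_sum_right
      proof (rule Bochner_Integration.integral_cong[OF refl])
        fix y :: space
        show "(\<Sum>i\<in>UNIV. (1 / (1 / \<sigma>) ^ 3) *\<^sub>R (k (\<sigma> * norm y) * (y $ i / \<sigma>)) *\<^sub>R (?g y $ i)) = c2 (norm y) \<sigma> *\<^sub>R ?\<rho> y"
          using True by (cases "y = 0") (simp_all add: c2_def radial_density_def scaleR_sum_right power2_eq_square power3_eq_cube)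
      qed
      finally show ?thesis using True by simp
    qed (simp add: c2_def)
  qed
  also have "\<dots> = (LINT x|lborel. k (norm x) *\<^sub>R radial_avg ?g x)"
  proof (rule radial_avg_weighted(3)[OF _ bounded_support_weight(2) H1D(2)[OF u], symmetric])
    show "\<bar>k (norm x)\<bar> \<le> 1 * indicator (cball 0 b) x" for x :: space
      using k1[of "norm x"] k0[of "norm x"] by (cases "norm x \<le> b") auto
  qed (use a in auto)
  finally show ?thesis .
qed

theorem radial_profile:
  assumes "u \<in> H1r" shows "AE x in lborel. u x = profile u (norm x)"
proof -
  from assms obtain f where u: "u \<in> H1" and f: "AE x in lborel. u x = f (norm x)" by (auto simp: H1r_def)
  have [measurable]: "u \<in> borel_measurable borel" "profile u \<in> borel_measurable borel"
    using H1_measurable[OF u] profile_measurable[OF u] by auto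
  have f2: "AE x in lborel. u (2 *\<^sub>R x) = f (norm (2 *\<^sub>R x))" by (rule scaling_AE[OF f]) simp
  let ?F = "\<lambda>x. profile u (2 * norm x) - profile u (norm (x::space))" and ?D = "\<lambda>x. u (2 *\<^sub>R x) - u x"
  have T: "?D \<in> L2" by (rule L2_diff[OF L2_dilation[OF H1D(1)[OF u]] H1D(1)[OF u]]) simp
  \<comment> \<open>On a shell both dilation differences are integrable and are radial almost
    everywhere, so agreement of their integrals over all Borel sets of radii identifies
    them.\<close>
  have shell: "AE x in lborel. indicator {a..b} (norm x) *\<^sub>R (?D x - ?F x) = 0" if ab: "0 < a" "a \<le> b" for a b
  proof -
    have iD: "integrable lborel (\<lambda>x. k x *\<^sub>R ?D x)" and iF: "integrable lborel (\<lambda>x. k x *\<^sub>R ?F x)"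
      if [measurable]: "k \<in> borel_measurable borel" and k: "\<And>x. \<bar>k x\<bar> \<le> indicator {a..b} (norm x)" for k :: "space \<Rightarrow> real"
    proof -
      have kb: "\<bar>k x\<bar> \<le> 1 * indicator (cball 0 b) x" for x using k[of x] by (auto split: split_indicator_asm split_indicator)
      have b0: "0 \<le> b" using ab by simp
      show "integrable lborel (\<lambda>x. k x *\<^sub>R ?D x)"
        by (rule L2_product_integrable[OF bounded_support_weight(1)[OF _ kb b0] T]) auto
      define s where "s = sqrt (dirichlet u / (4 * pi * a))"
      have pb: "norm (profile u r) \<le> s" if "a \<le> r" for r
      proof -
        have "(norm (profile u r))\<^sup>2 \<le> dirichlet u / (4 * pi * r)" by (rule profile_bound[OF u]) (use ab that in simp)
        also have "\<dots> \<le> dirichlet u / (4 * pi * a)" using that ab by (intro divide_left_mono) (auto simp: dirichlet_nonneg)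
        finally show ?thesis unfolding s_def by (rule real_le_rsqrt)
      qed
      show "integrable lborel (\<lambda>x. k x *\<^sub>R ?F x)"
      proof (rule Bochner_Integration.integrable_bound[OF integrable_mult_left[OF integrable_indicator_ball[of b], of "2 * s"]])
        show "AE x in lborel. norm (k x *\<^sub>R ?F x) \<le> norm (indicator (cball 0 b) x * (2 * s))"
        proof (rule AE_I2)
          fix x :: space
          show "norm (k x *\<^sub>R ?F x) \<le> norm (indicator (cball 0 b) x * (2 * s))"
          proof (cases "norm x \<in> {a..b}")
            case True
            have "norm (?F x) \<le> 2 * s" using norm_triangle_ineq4[of "profile u (2 * norm x)" "profile u (norm x)"] pb[of "norm x"] pb[of "2 * norm x"] True ab by auto
            then have "\<bar>k x\<bar> * norm (?F x) \<le> 1 * (2 * s)" using k[of x] True by (intro mult_mono) auto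
            then show ?thesis using True by simp
          qed (use k[of x] in simp)
        qed
      qed measurable
    qed
    let ?h = "\<lambda>x. indicator {a..b} (norm x) *\<^sub>R (?D x - ?F x)"
    show ?thesis
    proof (rule radial_AE_zero)
      have "integrable lborel (\<lambda>x. indicator {a..b} (norm (x::space)) *\<^sub>R ?D x)" "integrable lborel (\<lambda>x. indicator {a..b} (norm (x::space)) *\<^sub>R ?F x)"
        by (intro iD iF; simp)+
      then show "integrable lborel ?h" unfolding scaleR_diff_right[of _ "?D _"] by (rule Bochner_Integration.integrable_diff)
      show "AE x in lborel. ?h x = (\<lambda>r. indicator {a..b} r *\<^sub>R (f (2 * r) - f r - (profile u (2 * r) - profile u r))) (norm x)"
        using f f2 by eventually_elim auto
      fix Z :: "real set" assume [measurable]: "Z \<in> sets borel"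
      define k where "k r = (indicator Z r * indicator {a..b} r :: real)" for r
      have [measurable]: "k \<in> borel_measurable borel" unfolding k_def by measurable
      have kb: "\<bar>k r\<bar> \<le> indicator {a..b} r" for r by (simp add: k_def split: split_indicator)
      note j = iD[of "\<lambda>x. k (norm x)"] iF[of "\<lambda>x. k (norm x)"]
      have "(LINT x|lborel. indicator Z (norm x) *\<^sub>R ?h x) = (LINT x|lborel. k (norm x) *\<^sub>R ?D x - k (norm x) *\<^sub>R ?F x)"
        by (simp add: k_def scaleR_diff_right)
      also have "\<dots> = (LINT x|lborel. k (norm x) *\<^sub>R ?D x) - (LINT x|lborel. k (norm x) *\<^sub>R ?F x)"
        by (rule Bochner_Integration.integral_diff) (use j kb in auto)
      also have "(LINT x|lborel. k (norm x) *\<^sub>R ?D x) = (LINT x|lborel. k (norm x) *\<^sub>R radial_avg (weak_grad u) x)"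
      proof (rule integral_cong_AE)
        show "AE x in lborel. k (norm x) *\<^sub>R ?D x = k (norm x) *\<^sub>R radial_avg (weak_grad u) x"
          using dilation_difference[OF u] by eventually_elim simp
        have [measurable]: "weak_grad u \<in> borel_measurable borel" using weak_grad_measurable[OF u] by simp
        show "(\<lambda>x. k (norm x) *\<^sub>R radial_avg (weak_grad u) x) \<in> borel_measurable lborel" unfolding radial_avg_def by measurable
      qed measurable
      also have "\<dots> = (LINT x|lborel. k (norm x) *\<^sub>R ?F x)" by (rule profile_pairing[OF u _ ab kb, symmetric]) measurable
      finally show "(LINT x|lborel. indicator Z (norm x) *\<^sub>R ?h x) = 0" by simp
    qed
  qed
  have "1 / real (Suc n) \<le> real (Suc n)" for n
    using mult_mono[of 1 "real (Suc n)" 1 "real (Suc n)"] by (simp add: divide_le_eq)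
  then have "AE x in lborel. \<forall>n. indicator {1 / real (Suc n)..real (Suc n)} (norm x) *\<^sub>R (?D x - ?F x) = 0"
    unfolding AE_all_countable by (intro allI shell) simp_all
  with AE_lborel_singleton[of "0::space"] have step: "AE x in lborel. ?D x = ?F x"
  proof eventually_elim
    case (elim x)
    then have r: "norm x > 0" by simp
    obtain m where m: "1 / real (Suc m) < norm x" using reals_Archimedean[OF r] by (auto simp: inverse_eq_divide)
    obtain l where l: "norm x < real l" using reals_Archimedean2 by blast
    have "1 / real (Suc (max m l)) \<le> 1 / real (Suc m)" by (intro divide_left_mono) auto
    with m l have "norm x \<in> {1 / real (Suc (max m l))..real (Suc (max m l))}" by auto
    with elim(2)[rule_format, of "max m l"] show ?case by simp
  qed
  have all: "AE x in lborel. \<forall>n. ?D ((2 ^ n) *\<^sub>R x) = ?F ((2 ^ n) *\<^sub>R x)"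
    unfolding AE_all_countable by (intro allI scaling_AE[OF step]) simp
  \<comment> \<open>The masses of the dilates by \<open>2 ^ n\<close> form a geometric series of
    ratio \<open>1 / 8\<close>. Hence for almost every \<open>x\<close> the values of
    \<open>u\<close> at the points \<open>2 ^ n x\<close> are square summable and tend to 0.\<close>
  have "AE x in lborel. (\<integral>\<^sup>+n. ennreal ((cmod (u ((2 ^ n) *\<^sub>R x)))\<^sup>2) \<partial>count_space UNIV) \<noteq> \<infinity>"
  proof -
    define M where "M = (LINT x|lborel. (cmod (u x))\<^sup>2)"
    have "((2::real) ^ n) ^ 3 = (2 ^ 3) ^ n" for n by (simp only: power_mult[symmetric] mult.commute)
    then have n8: "((2::real) ^ n) ^ 3 = 8 ^ n" for n by simp
    have L: "(\<integral>\<^sup>+x. ennreal ((cmod (u ((2 ^ n) *\<^sub>R x)))\<^sup>2) \<partial>lborel) = ennreal (M * (1 / 8) ^ n)" for n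
    proof -
      have "integrable lborel (\<lambda>x. (cmod (u ((2 ^ n) *\<^sub>R x)))\<^sup>2)" using L2_integrable[OF L2_dilation[OF H1D(1)[OF u], of "2 ^ n"]] by simp
      then have "(\<integral>\<^sup>+x. ennreal ((cmod (u ((2 ^ n) *\<^sub>R x)))\<^sup>2) \<partial>lborel) = ennreal (LINT x|lborel. (cmod (u ((2 ^ n) *\<^sub>R x)))\<^sup>2)"
        by (intro nn_integral_eq_integral) auto
      also have "(LINT x|lborel. (cmod (u ((2 ^ n) *\<^sub>R x)))\<^sup>2) = M * (1 / 8) ^ n"
        using scaling_integral[of "2 ^ n" "\<lambda>x. (cmod (u x))\<^sup>2"] by (simp add: M_def power_divide n8)
      finally show ?thesis .
    qed
    have "(\<integral>\<^sup>+x. (\<Sum>n. ennreal ((cmod (u ((2 ^ n) *\<^sub>R x)))\<^sup>2)) \<partial>lborel) = (\<Sum>n. ennreal (M * (1 / 8) ^ n))"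
      unfolding L[symmetric] by (rule nn_integral_suminf) measurable
    also have "\<dots> = ennreal (\<Sum>n. M * (1 / 8) ^ n)"
      by (rule suminf_ennreal2) (auto simp: M_def intro!: summable_mult summable_geometric)
    finally have "(\<integral>\<^sup>+x. (\<Sum>n. ennreal ((cmod (u ((2 ^ n) *\<^sub>R x)))\<^sup>2)) \<partial>lborel) \<noteq> \<infinity>" by simp
    then show ?thesis unfolding nn_integral_count_space_nat by (intro nn_integral_PInf_AE) auto
  qed
  with all AE_lborel_singleton[of "0::space"] show ?thesis
  proof eventually_elim
    case (elim x)
    then have r: "norm x > 0" by simp
    have const: "u ((2 ^ n) *\<^sub>R x) - profile u (2 ^ n * norm x) = u x - profile u (norm x)" for n
    proof (induction n)
      case (Suc n)
      have "u ((2 ^ Suc n) *\<^sub>R x) - u ((2 ^ n) *\<^sub>R x) = profile u (2 ^ Suc n * norm x) - profile u (2 ^ n * norm x)"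
        using elim(1)[rule_format, of n] by (simp add: mult.assoc)
      then have "u ((2 ^ Suc n) *\<^sub>R x) - profile u (2 ^ Suc n * norm x) = u ((2 ^ n) *\<^sub>R x) - profile u (2 ^ n * norm x)"
        by (simp add: algebra_simps)
      with Suc show ?case by simp
    qed simp
    have "summable (\<lambda>n. (cmod (u ((2 ^ n) *\<^sub>R x)))\<^sup>2)"
      using elim(3) by (intro summable_suminf_not_top) (auto simp: nn_integral_count_space_nat)
    then have "(\<lambda>n. sqrt ((cmod (u ((2 ^ n) *\<^sub>R x)))\<^sup>2)) \<longlonglongrightarrow> sqrt 0" by (intro tendsto_real_sqrt summable_LIMSEQ_zero)
    then have 1: "(\<lambda>n. u ((2 ^ n) *\<^sub>R x)) \<longlonglongrightarrow> 0" by (simp add: tendsto_norm_zero_iff)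
    have 2: "(\<lambda>n. profile u (2 ^ n * norm x)) \<longlonglongrightarrow> 0"
    proof (rule Lim_null_comparison)
      show "\<forall>\<^sub>F n in sequentially. norm (profile u (2 ^ n * norm x)) \<le> sqrt (dirichlet u / (4 * pi * norm x) * (1 / 2) ^ n)"
      proof (intro always_eventually allI real_le_rsqrt)
        fix n
        have "(norm (profile u (2 ^ n * norm x)))\<^sup>2 \<le> dirichlet u / (4 * pi * (2 ^ n * norm x))" by (rule profile_bound[OF u]) (use r in simp)
        then show "(norm (profile u (2 ^ n * norm x)))\<^sup>2 \<le> dirichlet u / (4 * pi * norm x) * (1 / 2) ^ n" by (simp add: power_divide mult_ac)
      qed
      have "(\<lambda>n. sqrt (dirichlet u / (4 * pi * norm x) * (1 / 2) ^ n)) \<longlonglongrightarrow> sqrt (dirichlet u / (4 * pi * norm x) * 0)"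
        by (intro tendsto_intros LIMSEQ_power_zero) simp
      then show "(\<lambda>n. sqrt (dirichlet u / (4 * pi * norm x) * (1 / 2) ^ n)) \<longlonglongrightarrow> 0" by simp
    qed
    from tendsto_diff[OF 1 2] have "(\<lambda>n::nat. u x - profile u (norm x)) \<longlonglongrightarrow> 0" unfolding const by simp
    then show ?case by (simp add: LIMSEQ_const_iff)
  qed
qed


section \<open>Consequences of the pointwise decay\<close>

definition mass :: "(space \<Rightarrow> complex) \<Rightarrow> real" where
  "mass u = (LINT x|lborel. (cmod (u x))\<^sup>2)"

text \<open>All that later estimates use of a radial function besides its equation: square
  integrability and a decay constant that can be shared by a whole family. Being stable under sums
  of moduli and differences, it also applies to auxiliary functions that are not in
  \<open>H1\<close>.\<close>

definition decay_bound :: "real \<Rightarrow> (space \<Rightarrow> complex) \<Rightarrow> bool" where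
  "decay_bound C u \<longleftrightarrow> 0 \<le> C \<and> u \<in> L2 \<and> (AE x in lborel. cmod (u x) \<le> C * norm x powr (- 1 / 2))"

lemma mass_nonneg: "0 \<le> mass u"
  by (simp add: mass_def)

lemma H1r_decay:
  assumes "u \<in> H1r" shows "decay_bound (sqrt (dirichlet u)) u"
  unfolding decay_bound_def
proof (intro conjI)
  have u: "u \<in> H1" using assms by (simp add: H1r_def)
  then show "u \<in> L2" by (rule H1D)
  show "0 \<le> sqrt (dirichlet u)" by (simp add: dirichlet_nonneg)
  show "AE x in lborel. cmod (u x) \<le> sqrt (dirichlet u) * norm x powr (- 1 / 2)"
    using radial_profile[OF assms] AE_lborel_singleton[of "0::space"]
  proof eventually_elim
    case (elim x)
    then have r: "norm x > 0" by simp
    have "(cmod (u x))\<^sup>2 \<le> dirichlet u / (4 * pi * norm x)" using profile_bound[OF u r] elim by simp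
    also have "\<dots> \<le> dirichlet u / norm x"
    proof (rule divide_left_mono)
      have "1 * norm x \<le> (4 * pi) * norm x" using pi_gt3 by (intro mult_right_mono) auto
      then show "norm x \<le> 4 * pi * norm x" by simp
    qed (use r dirichlet_nonneg pi_gt_zero in auto)
    finally have "cmod (u x) \<le> sqrt (dirichlet u / norm x)" by (rule real_le_rsqrt)
    also have "\<dots> = sqrt (dirichlet u) * norm x powr (- 1 / 2)"
      using r powr_minus_divide[of "norm x" "1 / 2"] by (simp add: real_sqrt_divide powr_half_sqrt)
    finally show ?case .
  qed
qed

section \<open>Power weights and the radial Gagliardo-Nirenberg inequality\<close>

definition ball_const :: "real \<Rightarrow> real" where
  "ball_const s = (LINT x|lborel. indicator (cball 0 1) (x::space) * norm x powr (- s))"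

lemma ball_const_nonneg: "0 \<le> ball_const s"
  unfolding ball_const_def by (intro Bochner_Integration.integral_nonneg) auto

lemma cball_indicator_measurable[measurable]: "(indicator (cball a R) :: 'a::euclidean_space \<Rightarrow> real) \<in> borel_measurable borel"
  by (rule borel_measurable_indicator) auto

lemma ball_integral:
  assumes "s < 3" "\<rho> > 0"
  shows "integrable lborel (\<lambda>x::space. indicator (cball 0 \<rho>) x * norm x powr (- s))"
    and "(LINT x|lborel. indicator (cball 0 \<rho>) (x::space) * norm x powr (- s)) = ball_const s * \<rho> powr (3 - s)"
proof -
  have m: "(\<lambda>x::space. indicator (cball 0 \<rho>) x * norm x powr (- s)) \<in> borel_measurable lborel" by measurable
  have "(\<integral>\<^sup>+x. ennreal (indicator (cball 0 \<rho>) x * norm (x::space) powr - s) \<partial>lborel)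
    = (\<integral>\<^sup>+x. ennreal (norm (x::space) powr - s) * indicator (cball 0 \<rho>) x \<partial>lborel)"
    by (intro nn_integral_cong) (auto simp: indicator_def)
  also have "\<dots> < \<infinity>" by (rule nn_integral_norm_powr) (use assms in simp)
  finally show "integrable lborel (\<lambda>x::space. indicator (cball 0 \<rho>) x * norm x powr (- s))"
    by (intro integrableI_nonneg m) auto
  have c: "inverse \<rho> > 0" using assms by simp
  have e: "indicator (cball 0 1) (inverse \<rho> *\<^sub>R x) * norm (inverse \<rho> *\<^sub>R x) powr (- s)
    = \<rho> powr s * (indicator (cball 0 \<rho>) x * norm x powr (- s))" for x :: space
  proof -
    have "norm (inverse \<rho> *\<^sub>R x) powr (- s) = \<rho> powr s * norm x powr (- s)"
    proof -
      have "inverse \<rho> powr (- s) = \<rho> powr s" using assms by (simp add: powr_def ln_inverse)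
      then show ?thesis using assms by (simp add: powr_mult)
    qed
    moreover have "inverse \<rho> *\<^sub>R x \<in> cball 0 1 \<longleftrightarrow> x \<in> cball 0 \<rho>" using assms by (auto simp: field_simps)
    ultimately show ?thesis by (auto simp: indicator_def)
  qed
  have "(LINT x|lborel. indicator (cball 0 1) (inverse \<rho> *\<^sub>R x) * norm (inverse \<rho> *\<^sub>R (x::space)) powr (- s)) = \<rho> ^ 3 * ball_const s"
    using scaling_integral[OF c, of "\<lambda>x::space. indicator (cball 0 1) x * norm x powr (- s)"] assms
    by (simp add: ball_const_def power_inverse divide_inverse)
  then have "\<rho> powr s * (LINT x|lborel. indicator (cball 0 \<rho>) (x::space) * norm x powr (- s)) = \<rho> powr 3 * ball_const s"
    unfolding e using assms by (simp add: powr_numeral)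
  then have "(LINT x|lborel. indicator (cball 0 \<rho>) (x::space) * norm x powr (- s)) = \<rho> powr 3 / \<rho> powr s * ball_const s"
    using assms by (simp add: field_simps)
  then show "(LINT x|lborel. indicator (cball 0 \<rho>) (x::space) * norm x powr (- s)) = ball_const s * \<rho> powr (3 - s)"
    by (simp add: powr_diff)
qed

text \<open>The integral is split at a free radius. Inside, decay turns the integrand into
  \<open>|x| powr (- (s + 1))\<close>, integrable because \<open>s < 2\<close>; outside, the weight
  is at most its value at \<open>\<rho>\<close>. A balanced radius gives the Gagliardo-Nirenberg
  inequality, a small one an arbitrarily small gradient coefficient.\<close>

lemma decay_weighted:
  assumes w: "decay_bound D w" and s: "0 \<le> s" "s < 2" and \<rho>: "\<rho> > 0"
  shows "integrable lborel (\<lambda>x. norm x powr (- s) * (cmod (w x))\<^sup>2)"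
    and "(LINT x|lborel. norm x powr (- s) * (cmod (w x))\<^sup>2) \<le> D\<^sup>2 * ball_const (s + 1) * \<rho> powr (2 - s) + \<rho> powr (- s) * mass w"
proof -
  have D: "0 \<le> D" and L2: "w \<in> L2" and b: "AE x in lborel. cmod (w x) \<le> D * norm x powr (- 1 / 2)"
    using w by (auto simp: decay_bound_def)
  have [measurable]: "w \<in> borel_measurable borel" using L2_measurable[OF L2] by simp
  note bi = ball_integral[of "s + 1", OF _ \<rho>]
  let ?R = "\<lambda>x::space. D\<^sup>2 * (indicator (cball 0 \<rho>) x * norm x powr (- (s + 1))) + \<rho> powr (- s) * (cmod (w x))\<^sup>2"
  have Ri: "integrable lborel ?R"
    using bi(1) s L2_integrable[OF L2] by (intro Bochner_Integration.integrable_add integrable_mult_right) auto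
  have le: "AE x in lborel. norm x powr (- s) * (cmod (w x))\<^sup>2 \<le> ?R x"
    using b AE_lborel_singleton[of "0::space"]
  proof eventually_elim
    case (elim x)
    then have r: "norm x > 0" by simp
    show ?case
    proof (cases "norm x \<le> \<rho>")
      case True
      have "(cmod (w x))\<^sup>2 \<le> (D * norm x powr (- 1 / 2))\<^sup>2" using elim by (intro power_mono) auto
      also have "\<dots> = D\<^sup>2 * norm x powr (- 1)"
      proof -
        have "(norm x powr (- 1 / 2))\<^sup>2 = norm x powr (- 1)" unfolding power2_eq_square powr_add[symmetric] by simp
        then show ?thesis unfolding power_mult_distrib by simp
      qed
      finally have "norm x powr (- s) * (cmod (w x))\<^sup>2 \<le> norm x powr (- s) * (D\<^sup>2 * norm x powr (- 1))"
        by (intro mult_left_mono) auto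
      also have "\<dots> = D\<^sup>2 * norm x powr (- (s + 1))"
        using powr_add[of "norm x" "- s" "- 1"] by simp
      finally show ?thesis using True by (simp add: add_increasing2)
    next
      case False
      then have "norm x powr (- s) \<le> \<rho> powr (- s)" using s \<rho> by (intro powr_mono2') auto
      then have "norm x powr (- s) * (cmod (w x))\<^sup>2 \<le> \<rho> powr (- s) * (cmod (w x))\<^sup>2" by (rule mult_right_mono) simp
      then show ?thesis using False by simp
    qed
  qed
  show i: "integrable lborel (\<lambda>x. norm x powr (- s) * (cmod (w x))\<^sup>2)"
    by (rule Bochner_Integration.integrable_bound[OF Ri]) (use le in \<open>auto elim!: eventually_mono\<close>)
  have "(LINT x|lborel. norm x powr (- s) * (cmod (w x))\<^sup>2) \<le> (LINT x|lborel. ?R x)"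
    by (rule integral_mono_AE[OF i Ri le])
  also have "\<dots> = D\<^sup>2 * (ball_const (s + 1) * \<rho> powr (3 - (s + 1))) + \<rho> powr (- s) * mass w"
  proof -
    have "(LINT x|lborel. ?R x) = D\<^sup>2 * (LINT x|lborel. indicator (cball 0 \<rho>) (x::space) * norm x powr (- (s + 1))) + \<rho> powr (- s) * (LINT x|lborel. (cmod (w x))\<^sup>2)"
      using bi(1) s L2_integrable[OF L2] by (subst Bochner_Integration.integral_add) auto
    then show ?thesis using bi(2) s by (simp add: mass_def)
  qed
  finally show "(LINT x|lborel. norm x powr (- s) * (cmod (w x))\<^sup>2) \<le> D\<^sup>2 * ball_const (s + 1) * \<rho> powr (2 - s) + \<rho> powr (- s) * mass w"
    by (simp add: algebra_simps)
qed

lemma decay_power_le: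
  assumes "cmod z \<le> C * r powr (- 1 / 2)" "2 \<le> t"
  shows "cmod z powr t \<le> C powr (t - 2) * (r powr (- ((t - 2) / 2)) * (cmod z)\<^sup>2)"
proof (cases "z = 0")
  case False
  then have p: "C * r powr (- 1 / 2) > 0" using assms(1) by (meson less_le_trans zero_less_norm_iff)
  then have C: "C > 0" by (simp add: zero_less_mult_iff)
  have "cmod z powr t = cmod z powr ((t - 2) + 2)" by simp
  also have "\<dots> = cmod z powr (t - 2) * cmod z powr 2" by (rule powr_add)
  also have "\<dots> \<le> (C * r powr (- 1 / 2)) powr (t - 2) * cmod z powr 2"
    using assms by (intro mult_right_mono powr_mono2) auto
  also have "(C * r powr (- 1 / 2)) powr (t - 2) = C powr (t - 2) * r powr (- ((t - 2) / 2))"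
    using C by (simp add: powr_mult powr_powr algebra_simps)
  finally show ?thesis by (simp add: mult.assoc powr_numeral)
qed simp

lemma decay_power_integral:
  assumes w: "decay_bound D w" and t: "2 \<le> t" "t < 6" and \<rho>: "\<rho> > 0"
  shows "integrable lborel (\<lambda>x. cmod (w x) powr t)"
    and "(LINT x|lborel. cmod (w x) powr t) \<le> D powr (t - 2) * (D\<^sup>2 * ball_const (t / 2) * \<rho> powr (3 - t / 2) + \<rho> powr (- ((t - 2) / 2)) * mass w)"
proof -
  let ?s = "(t - 2) / 2"
  have s: "0 \<le> ?s" "?s < 2" using t by auto
  have L2: "w \<in> L2" and b: "AE x in lborel. cmod (w x) \<le> D * norm x powr (- 1 / 2)"
    using w by (auto simp: decay_bound_def)
  have [measurable]: "w \<in> borel_measurable borel" using L2_measurable[OF L2] by simp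
  note W = decay_weighted[OF w s \<rho>]
  have le: "AE x in lborel. cmod (w x) powr t \<le> D powr (t - 2) * (norm x powr (- ?s) * (cmod (w x))\<^sup>2)"
    using b by eventually_elim (rule decay_power_le[OF _ t(1)])
  have Ri: "integrable lborel (\<lambda>x. D powr (t - 2) * (norm x powr (- ?s) * (cmod (w x))\<^sup>2))"
    by (rule integrable_mult_right[OF W(1)])
  show i: "integrable lborel (\<lambda>x. cmod (w x) powr t)"
    by (rule Bochner_Integration.integrable_bound[OF Ri]) (use le in \<open>auto elim!: eventually_mono\<close>)
  have "(LINT x|lborel. cmod (w x) powr t) \<le> (LINT x|lborel. D powr (t - 2) * (norm x powr (- ?s) * (cmod (w x))\<^sup>2))"
    by (rule integral_mono_AE[OF i Ri le])
  also have "\<dots> = D powr (t - 2) * (LINT x|lborel. norm x powr (- ?s) * (cmod (w x))\<^sup>2)" by simp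
  also have "\<dots> \<le> D powr (t - 2) * (D\<^sup>2 * ball_const (?s + 1) * \<rho> powr (2 - ?s) + \<rho> powr (- ?s) * mass w)"
    using W(2) by (rule mult_left_mono) simp
  also have "?s + 1 = t / 2" by (simp add: field_simps)
  also have "2 - ?s = 3 - t / 2" by (simp add: field_simps)
  finally show "(LINT x|lborel. cmod (w x) powr t) \<le> D powr (t - 2) * (D\<^sup>2 * ball_const (t / 2) * \<rho> powr (3 - t / 2) + \<rho> powr (- ?s) * mass w)" .
qed

lemma dirichlet_pos:
  assumes "u \<in> H1r" "mass u > 0" shows "dirichlet u > 0"
proof (rule ccontr)
  assume "\<not> dirichlet u > 0"
  then have "dirichlet u = 0" using dirichlet_nonneg[of u] by simp
  with H1r_decay[OF assms(1)] have "AE x in lborel. u x = 0" by (auto simp: decay_bound_def)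
  then have "mass u = (LINT x|(lborel :: space measure). 0)"
    unfolding mass_def using H1_measurable[of u] assms(1) by (intro integral_cong_AE) (auto simp: H1r_def)
  with assms(2) show False by simp
qed

text \<open>The exponents are those of the sharp inequality raised to the power \<open>t\<close>:
  with \<open>a\<close> the L2 norm, \<open>t * gn_exp t = 3 * (t - 2) / 2\<close> falls on the
  gradient norm and \<open>(6 - t) / 2\<close> remains for \<open>a\<close>.\<close>

theorem radial_gagliardo_nirenberg:
  assumes u: "u \<in> H1r" and a: "a > 0" "mass u = a\<^sup>2" and t: "2 \<le> t" "t < 6"
  shows "(LINT x|lborel. cmod (u x) powr t) \<le> (ball_const (t / 2) + 1) * a powr ((6 - t) / 2) * dirichlet u powr (3 * (t - 2) / 4)"
proof -
  let ?A = "dirichlet u" and ?s = "(t - 2) / 2"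
  have A: "?A > 0" using dirichlet_pos[OF u] a by simp
  \<comment> \<open>At this radius the gradient part and the mass part of the split estimate have
    the same size.\<close>
  define \<rho> where "\<rho> = a / sqrt ?A"
  have \<rho>: "\<rho> > 0" using a A by (simp add: \<rho>_def)
  have \<rho>2: "?A * \<rho> powr 2 = a powr 2" using A a by (simp add: \<rho>_def power_divide powr_numeral)
  have e: "\<rho> powr (3 - t / 2) = \<rho> powr (- ?s) * \<rho> powr 2" by (simp flip: powr_add add: field_simps)
  have "(LINT x|lborel. cmod (u x) powr t) \<le> sqrt ?A powr (t - 2) * ((sqrt ?A)\<^sup>2 * ball_const (t / 2) * \<rho> powr (3 - t / 2) + \<rho> powr (- ?s) * mass u)"
    by (rule decay_power_integral(2)[OF H1r_decay[OF u] t \<rho>])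
  also have "(sqrt ?A)\<^sup>2 * ball_const (t / 2) * \<rho> powr (3 - t / 2) + \<rho> powr (- ?s) * mass u
    = \<rho> powr (- ?s) * (ball_const (t / 2) * (?A * \<rho> powr 2) + a powr 2)"
    unfolding e a(2) using A a by (simp add: algebra_simps powr_numeral)
  also have "\<dots> = (ball_const (t / 2) + 1) * (\<rho> powr (- ?s) * a powr 2)" unfolding \<rho>2 by (simp add: algebra_simps)
  also have "\<rho> powr (- ?s) = a powr (- ?s) * ?A powr (?s / 2)"
    unfolding \<rho>_def using a A by (simp add: powr_divide powr_half_sqrt[symmetric] powr_powr powr_minus field_simps del: powr_half_sqrt)
  also have "sqrt ?A powr (t - 2) * ((ball_const (t / 2) + 1) * (a powr (- ?s) * ?A powr (?s / 2) * a powr 2))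
    = (ball_const (t / 2) + 1) * (a powr (- ?s) * a powr 2) * (sqrt ?A powr (t - 2) * ?A powr (?s / 2))"
    by (simp add: algebra_simps)
  also have "a powr (- ?s) * a powr 2 = a powr ((6 - t) / 2)" unfolding powr_add[symmetric] by (simp add: field_simps)
  also have "sqrt ?A powr (t - 2) = ?A powr ((t - 2) / 2)"
    using A by (simp add: powr_half_sqrt[symmetric] powr_powr del: powr_half_sqrt)
  also have "?A powr ((t - 2) / 2) * ?A powr (?s / 2) = ?A powr (3 * (t - 2) / 4)"
  proof -
    have "(t - 2) / 2 + ?s / 2 = 3 * (t - 2) / 4" by (simp add: field_simps)
    then show ?thesis unfolding powr_add[symmetric] by (simp only:)
  qed
  finally show ?thesis .
qed


section \<open>The Coulomb term\<close>

lemma distr_reflect: "distr lborel borel (\<lambda>y. x - y) = (lborel :: space measure)"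
  using lborel_affine[of "- 1 :: real" x] by (simp add: density_1)

lemma reflect_integrable:
  fixes f :: "space \<Rightarrow> 'b::{banach,second_countable_topology}"
  assumes "integrable lborel f" shows "integrable lborel (\<lambda>y. f (x - y))"
proof -
  have [measurable]: "f \<in> borel_measurable borel" using assms by auto
  show ?thesis using assms by (subst (asm) distr_reflect[of x, symmetric]) (simp add: integrable_distr_eq)
qed

lemma reflect_integral:
  fixes f :: "space \<Rightarrow> 'b::{banach,second_countable_topology}"
  assumes [measurable]: "f \<in> borel_measurable borel"
  shows "(LINT y|lborel. f (x - y)) = (LINT y|lborel. f y)"
  by (subst (2) distr_reflect[of x, symmetric]) (simp add: integral_distr)

text \<open>Where \<open>|x - y| \<le> \<rho>\<close>, decay leaves
  \<open>1 / (|y| |x - y|)\<close>, which is at most the larger of the two inverse squares; if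
  \<open>|y|\<close> is the smaller distance, it is itself at most \<open>\<rho>\<close>. Both
  inverse squares are locally integrable with integrals independent of \<open>x\<close>.\<close>

lemma coulomb_pointwise:
  fixes x y :: space
  assumes u: "cmod z \<le> C * norm y powr (- 1 / 2)" and \<rho>: "\<rho> > 0" and y: "y \<noteq> 0" and C: "C \<ge> 0"
  shows "(cmod z)\<^sup>2 / norm (x - y) \<le>
    C\<^sup>2 * (indicator (cball 0 \<rho>) (x - y) * norm (x - y) powr (- 2) + indicator (cball 0 \<rho>) y * norm y powr (- 2)) + (cmod z)\<^sup>2 / \<rho>"
proof (cases "x = y")
  case False
  then have d: "norm (x - y) > 0" by simp
  have ny: "norm y > 0" using y by simp
  have z2: "(cmod z)\<^sup>2 \<le> C\<^sup>2 / norm y"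
  proof -
    have "(cmod z)\<^sup>2 \<le> (C * norm y powr (- 1 / 2))\<^sup>2" using u by (intro power_mono) auto
    also have "(norm y powr (- 1 / 2))\<^sup>2 = norm y powr (- 1)" unfolding power2_eq_square powr_add[symmetric] by simp
    then have "(C * norm y powr (- 1 / 2))\<^sup>2 = C\<^sup>2 / norm y" unfolding power_mult_distrib using ny by (simp add: powr_minus_divide)
    finally show ?thesis .
  qed
  have m2: "r powr (- 2) = 1 / (r * r)" if "r > 0" for r :: real
    using that by (simp add: powr_minus_divide powr_numeral power2_eq_square)
  show ?thesis
  proof (cases "norm (x - y) \<le> \<rho>")
    case True
    have "(cmod z)\<^sup>2 / norm (x - y) \<le> C\<^sup>2 / norm y / norm (x - y)" using z2 d by (intro divide_right_mono) auto
    also have "\<dots> \<le> C\<^sup>2 * (indicator (cball 0 \<rho>) (x - y) * norm (x - y) powr (- 2) + indicator (cball 0 \<rho>) y * norm y powr (- 2))"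
    proof (cases "norm (x - y) \<le> norm y")
      case le: True
      have "1 / norm y / norm (x - y) \<le> 1 / norm (x - y) / norm (x - y)"
        using le d ny by (intro divide_right_mono divide_left_mono mult_pos_pos) auto
      then have "1 / norm y / norm (x - y) \<le> norm (x - y) powr (- 2)" using m2[OF d] by simp
      then have "C\<^sup>2 * (1 / norm y / norm (x - y)) \<le> C\<^sup>2 * (norm (x - y) powr (- 2) + indicator (cball 0 \<rho>) y * norm y powr (- 2))"
        by (intro mult_left_mono) (auto intro: add_increasing2)
      then show ?thesis using True by simp
    next
      case False
      then have ge: "norm y \<le> norm (x - y)" and yr: "norm y \<le> \<rho>" using True by auto
      have "1 / norm y / norm (x - y) \<le> 1 / norm y / norm y"
        using ge ny d by (intro divide_left_mono) auto
      then have "1 / norm y / norm (x - y) \<le> norm y powr (- 2)" using m2[OF ny] by simp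
      then have "C\<^sup>2 * (1 / norm y / norm (x - y)) \<le> C\<^sup>2 * (indicator (cball 0 \<rho>) (x - y) * norm (x - y) powr (- 2) + norm y powr (- 2))"
        by (intro mult_left_mono) (auto intro: add_increasing)
      then show ?thesis using yr by simp
    qed
    finally show ?thesis using \<rho> by (simp add: add_increasing2)
  next
    case False
    have "(cmod z)\<^sup>2 / norm (x - y) \<le> (cmod z)\<^sup>2 / \<rho>" using False \<rho> d by (intro divide_left_mono) auto
    then show ?thesis by (simp add: add_increasing)
  qed
qed (use \<rho> in \<open>auto intro!: add_nonneg_nonneg mult_nonneg_nonneg divide_nonneg_nonneg\<close>)

lemma coulomb_potential_measurable[measurable (raw)]:
  assumes "u \<in> L2" shows "coulomb_potential u \<in> borel_measurable borel"
proof -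
  have [measurable]: "u \<in> borel_measurable borel" using L2_measurable[OF assms] by simp
  show ?thesis unfolding coulomb_potential_def[abs_def] by measurable
qed

lemma coulomb_potential_nonneg: "0 \<le> coulomb_potential u x"
  unfolding coulomb_potential_def by (intro Bochner_Integration.integral_nonneg) auto

context
  fixes C :: real and u :: "space \<Rightarrow> complex"
  assumes decay: "decay_bound C u"
begin

lemma coulomb_dominant:
  assumes \<rho>: "\<rho> > 0"
  defines "R \<equiv> \<lambda>x y. C\<^sup>2 * (indicator (cball 0 \<rho>) (x - y) * norm (x - y) powr (- 2) + indicator (cball 0 \<rho>) y * norm y powr (- 2)) + (cmod (u y))\<^sup>2 / \<rho>"
  shows "integrable lborel (R x)" "LINT y|lborel. R x y = 2 * C\<^sup>2 * ball_const 2 * \<rho> + mass u / \<rho>"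
    "AE y in lborel. (cmod (u y))\<^sup>2 / norm (x - y) \<le> R x y"
proof -
  have C: "C \<ge> 0" and L2: "u \<in> L2" and b: "AE y in lborel. cmod (u y) \<le> C * norm y powr (- 1 / 2)"
    using decay by (auto simp: decay_bound_def)
  note bi = ball_integral[of 2, OF _ \<rho>]
  let ?k = "\<lambda>y::space. indicator (cball 0 \<rho>) y * norm y powr (- 2)"
  have m: "?k \<in> borel_measurable borel" by measurable
  have i1: "integrable lborel ?k" by (rule bi(1)) simp
  have i2: "integrable lborel (\<lambda>y. ?k (x - y))" by (rule reflect_integrable[OF i1])
  have e: "LINT y|lborel. ?k y = ball_const 2 * \<rho>" using bi(2) \<rho> by simp
  have e2: "LINT y|lborel. ?k (x - y) = ball_const 2 * \<rho>" unfolding reflect_integral[OF m] by (rule e)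
  have iu: "integrable lborel (\<lambda>y. (cmod (u y))\<^sup>2 / \<rho>)" using L2_integrable[OF L2] by (rule integrable_divide)
  have iC: "integrable lborel (\<lambda>y. C\<^sup>2 * (?k (x - y) + ?k y))"
    by (intro integrable_mult_right Bochner_Integration.integrable_add i1 i2)
  show "integrable lborel (R x)" unfolding R_def
    by (rule Bochner_Integration.integrable_add[OF iC iu])
  have "LINT y|lborel. R x y = (LINT y|lborel. C\<^sup>2 * (?k (x - y) + ?k y)) + (LINT y|lborel. (cmod (u y))\<^sup>2 / \<rho>)"
    unfolding R_def by (rule Bochner_Integration.integral_add[OF iC iu])
  also have "(LINT y|lborel. C\<^sup>2 * (?k (x - y) + ?k y)) = C\<^sup>2 * ((LINT y|lborel. ?k (x - y)) + (LINT y|lborel. ?k y))"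
    unfolding integral_mult_right_zero Bochner_Integration.integral_add[OF i2 i1] ..
  also have "(LINT y|lborel. (cmod (u y))\<^sup>2 / \<rho>) = mass u / \<rho>" by (simp add: mass_def)
  finally show "LINT y|lborel. R x y = 2 * C\<^sup>2 * ball_const 2 * \<rho> + mass u / \<rho>" unfolding e e2 by simp
  show "AE y in lborel. (cmod (u y))\<^sup>2 / norm (x - y) \<le> R x y"
    using b AE_lborel_singleton[of "0::space"] unfolding R_def
    by eventually_elim (rule coulomb_pointwise[OF _ \<rho> _ C])
qed

lemma coulomb_integrable: "integrable lborel (\<lambda>y. (cmod (u y))\<^sup>2 / norm (x - y))"
proof -
  have [measurable]: "u \<in> borel_measurable borel" using decay L2_measurable by (auto simp: decay_bound_def)
  show ?thesis
    by (rule Bochner_Integration.integrable_bound[OF coulomb_dominant(1)[of 1 x]])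
      (use coulomb_dominant(3)[of 1 x] in \<open>auto elim!: eventually_mono\<close>)
qed

lemma coulomb_potential_le:
  assumes "\<rho> > 0" shows "coulomb_potential u x \<le> 2 * C\<^sup>2 * ball_const 2 * \<rho> + mass u / \<rho>"
  unfolding coulomb_potential_def coulomb_dominant(2)[OF assms, symmetric, of x]
  by (rule integral_mono_AE[OF coulomb_integrable coulomb_dominant(1,3)[OF assms]])

text \<open>For \<open>|x - y| \<le> \<rho>\<close> the point \<open>y\<close> is itself at distance
  at least \<open>|x| / 2\<close> from the origin, so the density there is of order
  \<open>1 / |x|\<close>; the rest contributes at most \<open>mass u / \<rho>\<close>. Choosing
  \<open>\<rho>\<close> first and then \<open>|x|\<close> large makes the potential uniformly
  small.\<close>

lemma coulomb_potential_decay: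
  assumes \<rho>: "\<rho> > 0" and x: "2 * \<rho> \<le> norm x"
  shows "coulomb_potential u x \<le> 2 * C\<^sup>2 * ball_const 2 * \<rho>\<^sup>2 / norm x + mass u / \<rho>"
proof -
  have C: "C \<ge> 0" and L2: "u \<in> L2" and b: "AE y in lborel. cmod (u y) \<le> C * norm y powr (- 1 / 2)"
    using decay by (auto simp: decay_bound_def)
  note bi = ball_integral[of 2, OF _ \<rho>]
  let ?k = "\<lambda>y::space. indicator (cball 0 \<rho>) y * norm y powr (- 2)"
  let ?c = "2 * C\<^sup>2 * \<rho> / norm x"
  have nx: "norm x > 0" using assms by linarith
  have m: "?k \<in> borel_measurable borel" by measurable
  have i1: "integrable lborel ?k" by (rule bi(1)) simp
  have i2: "integrable lborel (\<lambda>y. ?c * ?k (x - y))" by (rule integrable_mult_right[OF reflect_integrable[OF i1]])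
  have e2: "LINT y|lborel. ?k (x - y) = ball_const 2 * \<rho>" unfolding reflect_integral[OF m] using bi(2) \<rho> by simp
  have iu: "integrable lborel (\<lambda>y. (cmod (u y))\<^sup>2 / \<rho>)" using L2_integrable[OF L2] by (rule integrable_divide)
  have le: "AE y in lborel. (cmod (u y))\<^sup>2 / norm (x - y) \<le> ?c * ?k (x - y) + (cmod (u y))\<^sup>2 / \<rho>"
    using b AE_lborel_singleton[of "0::space"] AE_lborel_singleton[of x]
  proof eventually_elim
    case (elim y)
    then have d: "norm (x - y) > 0" and ny: "norm y > 0" by auto
    show ?case
    proof (cases "norm (x - y) \<le> \<rho>")
      case True
      have y2: "norm x / 2 \<le> norm y" using norm_triangle_ineq2[of x "x - y"] True x by simp
      have "(cmod (u y))\<^sup>2 \<le> (C * norm y powr (- 1 / 2))\<^sup>2" using elim(1) by (intro power_mono) auto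
      also have "(norm y powr (- 1 / 2))\<^sup>2 = norm y powr (- 1)" unfolding power2_eq_square powr_add[symmetric] by simp
      then have "(C * norm y powr (- 1 / 2))\<^sup>2 = C\<^sup>2 / norm y" unfolding power_mult_distrib using ny by (simp add: powr_minus_divide)
      also have "\<dots> \<le> C\<^sup>2 / (norm x / 2)" using y2 nx ny by (intro divide_left_mono) auto
      finally have 1: "(cmod (u y))\<^sup>2 \<le> 2 * C\<^sup>2 / norm x" by (simp add: mult.commute)
      \<comment> \<open>One power of the distance is traded for \<open>\<rho>\<close>, so the
        truncated inverse square serves as kernel again.\<close>
      have "1 / norm (x - y) \<le> \<rho> * norm (x - y) powr (- 2)"
        using True d by (simp add: powr_minus_divide powr_numeral power2_eq_square field_simps)
      then have "(cmod (u y))\<^sup>2 * (1 / norm (x - y)) \<le> (2 * C\<^sup>2 / norm x) * (\<rho> * norm (x - y) powr (- 2))"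
        using 1 nx by (intro mult_mono) auto
      then have "(cmod (u y))\<^sup>2 / norm (x - y) \<le> ?c * ?k (x - y)" using True by (simp add: algebra_simps)
      then show ?thesis using \<rho> by (simp add: add_increasing2)
    next
      case False
      have "(cmod (u y))\<^sup>2 / norm (x - y) \<le> (cmod (u y))\<^sup>2 / \<rho>" using False \<rho> d by (intro divide_left_mono) auto
      then show ?thesis using False by simp
    qed
  qed
  have "coulomb_potential u x \<le> (LINT y|lborel. ?c * ?k (x - y) + (cmod (u y))\<^sup>2 / \<rho>)"
    unfolding coulomb_potential_def
    by (rule integral_mono_AE[OF coulomb_integrable Bochner_Integration.integrable_add[OF i2 iu] le])
  also have "\<dots> = ?c * (ball_const 2 * \<rho>) + mass u / \<rho>"
    unfolding Bochner_Integration.integral_add[OF i2 iu] integral_mult_right_zero e2 by (simp add: mass_def)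
  finally show ?thesis by (simp add: power2_eq_square algebra_simps)
qed

lemma coulomb_L2_integrable:
  fixes f g :: "space \<Rightarrow> complex" and h :: "space \<Rightarrow> 'b::{banach,second_countable_topology}"
  assumes "f \<in> L2" "g \<in> L2" "h \<in> borel_measurable borel" "\<And>x. norm (h x) \<le> coulomb_potential u x * (cmod (f x) * cmod (g x))"
  shows "integrable lborel h"
proof (rule Bochner_Integration.integrable_bound[OF integrable_mult_right[OF L2_norm_mult(1)[OF assms(1,2)], of "2 * C\<^sup>2 * ball_const 2 * 1 + mass u / 1"]])
  show "AE x in lborel. norm (h x) \<le> norm ((2 * C\<^sup>2 * ball_const 2 * 1 + mass u / 1) * (cmod (f x) * cmod (g x)))"
  proof (rule AE_I2)
    fix x
    have "norm (h x) \<le> (2 * C\<^sup>2 * ball_const 2 * 1 + mass u / 1) * (cmod (f x) * cmod (g x))"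
      by (rule order_trans[OF assms(4) mult_right_mono[OF coulomb_potential_le]]) auto
    then show "norm (h x) \<le> norm ((2 * C\<^sup>2 * ball_const 2 * 1 + mass u / 1) * (cmod (f x) * cmod (g x)))" by simp
  qed
qed (use assms(3) in simp)

lemma coulomb_density_integrable:
  assumes "v \<in> L2" shows "integrable lborel (\<lambda>x. (cmod (v x))\<^sup>2 * coulomb_potential u x)"
proof -
  have [measurable]: "v \<in> borel_measurable borel" "coulomb_potential u \<in> borel_measurable borel"
    using L2_measurable[OF assms] decay by (auto simp: decay_bound_def intro: coulomb_potential_measurable)
  show ?thesis
    by (rule coulomb_L2_integrable[OF assms assms]) (auto simp: coulomb_potential_nonneg power2_eq_square abs_mult)
qed

lemma coulomb_density_le:
  assumes "v \<in> L2" "\<And>x. coulomb_potential u x \<le> K"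
  shows "(LINT x|lborel. (cmod (v x))\<^sup>2 * coulomb_potential u x) \<le> K * mass v"
proof -
  have "(LINT x|lborel. (cmod (v x))\<^sup>2 * coulomb_potential u x) \<le> (LINT x|lborel. K * (cmod (v x))\<^sup>2)"
  proof (rule integral_mono[OF coulomb_density_integrable[OF assms(1)]])
    show "integrable lborel (\<lambda>x. K * (cmod (v x))\<^sup>2)" using L2_integrable[OF assms(1)] by (rule integrable_mult_right)
    show "(cmod (v x))\<^sup>2 * coulomb_potential u x \<le> K * (cmod (v x))\<^sup>2" for x
      using mult_left_mono[OF assms(2)[of x], of "(cmod (v x))\<^sup>2"] by (simp add: mult.commute)
  qed
  then show ?thesis by (simp add: mass_def)
qed

end

lemma coulomb_energy_eq: "coulomb_energy u = (LINT x|lborel. (cmod (u x))\<^sup>2 * coulomb_potential u x)"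
  unfolding coulomb_energy_def coulomb_potential_def
  by (intro Bochner_Integration.integral_cong refl) (simp flip: integral_mult_right_zero)

lemma coulomb_energy_nonneg: "0 \<le> coulomb_energy u"
  unfolding coulomb_energy_eq by (intro Bochner_Integration.integral_nonneg) (auto simp: coulomb_potential_nonneg)

lemma coulomb_symmetric:
  assumes u: "decay_bound C u" and v: "decay_bound D v"
  shows "(LINT x|lborel. (cmod (v x))\<^sup>2 * coulomb_potential u x) = (LINT x|lborel. (cmod (u x))\<^sup>2 * coulomb_potential v x)"
proof -
  have [measurable]: "u \<in> borel_measurable borel" "v \<in> borel_measurable borel"
    using u v L2_measurable by (auto simp: decay_bound_def)
  have L2: "u \<in> L2" "v \<in> L2" using u v by (auto simp: decay_bound_def)
  have nn: "ennreal (LINT x|lborel. (cmod (b x))\<^sup>2 * coulomb_potential a x) =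
      (\<integral>\<^sup>+x. \<integral>\<^sup>+y. ennreal ((cmod (b x))\<^sup>2 * (cmod (a y))\<^sup>2 / norm (x - y)) \<partial>lborel \<partial>lborel)"
    if a: "decay_bound A a" and b: "b \<in> L2" for a b A
  proof -
    have "ennreal (LINT x|lborel. (cmod (b x))\<^sup>2 * coulomb_potential a x) = (\<integral>\<^sup>+x. ennreal ((cmod (b x))\<^sup>2 * coulomb_potential a x) \<partial>lborel)"
      using coulomb_density_integrable[OF a b] by (subst nn_integral_eq_integral) (auto simp: coulomb_potential_nonneg)
    also have "\<dots> = (\<integral>\<^sup>+x. \<integral>\<^sup>+y. ennreal ((cmod (b x))\<^sup>2 * (cmod (a y))\<^sup>2 / norm (x - y)) \<partial>lborel \<partial>lborel)"
    proof (rule nn_integral_cong)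
      fix x
      have "(\<integral>\<^sup>+y. ennreal ((cmod (b x))\<^sup>2 * ((cmod (a y))\<^sup>2 / norm (x - y))) \<partial>lborel) = ennreal (LINT y|lborel. (cmod (b x))\<^sup>2 * ((cmod (a y))\<^sup>2 / norm (x - y)))"
        using integrable_mult_right[OF coulomb_integrable[OF a, of x], of "(cmod (b x))\<^sup>2"] by (intro nn_integral_eq_integral) auto
      moreover have "(LINT y|lborel. (cmod (b x))\<^sup>2 * ((cmod (a y))\<^sup>2 / norm (x - y))) = (cmod (b x))\<^sup>2 * coulomb_potential a x"
        unfolding coulomb_potential_def by (rule integral_mult_right_zero)
      ultimately show "ennreal ((cmod (b x))\<^sup>2 * coulomb_potential a x) = (\<integral>\<^sup>+y. ennreal ((cmod (b x))\<^sup>2 * (cmod (a y))\<^sup>2 / norm (x - y)) \<partial>lborel)"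
        by (simp only: times_divide_eq_right)
    qed
    finally show ?thesis .
  qed
  have "ennreal (LINT x|lborel. (cmod (v x))\<^sup>2 * coulomb_potential u x) = ennreal (LINT x|lborel. (cmod (u x))\<^sup>2 * coulomb_potential v x)"
    unfolding nn[OF u L2(2)] nn[OF v L2(1)]
    by (subst lborel_pair.Fubini') (auto simp: mult.commute norm_minus_commute)
  then show ?thesis
    by (subst (asm) ennreal_inj) (auto intro!: Bochner_Integration.integral_nonneg simp: coulomb_potential_nonneg)
qed

lemma decay_add_norm:
  assumes u: "decay_bound C u" and v: "decay_bound D v"
  shows "decay_bound (C + D) (\<lambda>x. of_real (cmod (u x) + cmod (v x)))"
  unfolding decay_bound_def
proof (intro conjI)
  show "0 \<le> C + D" using u v by (simp add: decay_bound_def)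
  have L2: "u \<in> L2" "v \<in> L2" using u v by (auto simp: decay_bound_def)
  have [measurable]: "u \<in> borel_measurable borel" "v \<in> borel_measurable borel"
    using L2_measurable[OF L2(1)] L2_measurable[OF L2(2)] by auto
  have "(\<lambda>x. of_real (cmod (u x)) :: complex) \<in> L2"
    by (rule L2_bound[OF L2(1), where c=1]) auto
  moreover have "(\<lambda>x. of_real (cmod (v x)) :: complex) \<in> L2"
    by (rule L2_bound[OF L2(2), where c=1]) auto
  ultimately show "(\<lambda>x. of_real (cmod (u x) + cmod (v x)) :: complex) \<in> L2"
    using L2_add by fastforce
  show "AE x in lborel. cmod (of_real (cmod (u x) + cmod (v x))) \<le> (C + D) * norm x powr (- 1 / 2)"
  proof -
    have "AE x in lborel. cmod (u x) \<le> C * norm x powr (- 1 / 2)" "AE x in lborel. cmod (v x) \<le> D * norm x powr (- 1 / 2)"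
      using u v by (auto simp: decay_bound_def)
    then show ?thesis
    proof eventually_elim
      case (elim x)
      have "cmod (of_real (cmod (u x) + cmod (v x))) = cmod (u x) + cmod (v x)" unfolding norm_of_real by simp
      then show ?case using elim by (simp add: distrib_right)
    qed
  qed
qed


lemma decay_diff:
  assumes u: "decay_bound C u" and v: "decay_bound D v"
  shows "decay_bound (C + D) (\<lambda>x. v x - u x)"
  unfolding decay_bound_def
proof (intro conjI)
  show "0 \<le> C + D" using u v by (simp add: decay_bound_def)
  show "(\<lambda>x. v x - u x) \<in> L2" using u v by (intro L2_diff) (auto simp: decay_bound_def)
  have "AE x in lborel. cmod (u x) \<le> C * norm x powr (- 1 / 2)" "AE x in lborel. cmod (v x) \<le> D * norm x powr (- 1 / 2)"
    using u v by (auto simp: decay_bound_def)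
  then show "AE x in lborel. cmod (v x - u x) \<le> (C + D) * norm x powr (- 1 / 2)"
  proof eventually_elim
    case (elim x)
    then show ?case using norm_triangle_ineq4[of "v x" "u x"] by (simp add: distrib_right)
  qed
qed

text \<open>Write \<open>\<sigma>\<close> for the difference of the squared moduli. The energy
  difference is twice the pairing of the first density with \<open>\<sigma>\<close> plus the pairing
  of \<open>\<sigma>\<close> with itself. The former contains the derivative and a nonnegative rest;
  the latter is of order \<open>mass (v - u)\<close> because \<open>|\<sigma>|\<close> is at most
  \<open>|v - u|\<close> times \<open>|u| + |v|\<close>.\<close>

lemma coulomb_expand:
  assumes u: "decay_bound C u" and v: "decay_bound D v"
    and K: "\<And>x. coulomb_potential (\<lambda>x. of_real (cmod (u x) + cmod (v x))) x \<le> K"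
  shows "coulomb_energy v - coulomb_energy u \<ge>
    4 * (LINT x|lborel. coulomb_potential u x * inner (u x) (v x - u x)) - K * mass (\<lambda>x. v x - u x)"
proof -
  define w where "w x = v x - u x" for x
  define z where "z x = complex_of_real (cmod (u x) + cmod (v x))" for x
  have L2: "u \<in> L2" "v \<in> L2" using u v by (auto simp: decay_bound_def)
  have w: "decay_bound (C + D) w" unfolding w_def[abs_def] by (rule decay_diff[OF u v])
  have z: "decay_bound (C + D) z" unfolding z_def[abs_def] by (rule decay_add_norm[OF u v])
  have L2': "w \<in> L2" "z \<in> L2" using w z by (auto simp: decay_bound_def)
  have [measurable]: "u \<in> borel_measurable borel" "v \<in> borel_measurable borel" "w \<in> borel_measurable borel" "z \<in> borel_measurable borel"
    "coulomb_potential u \<in> borel_measurable borel" "coulomb_potential v \<in> borel_measurable borel"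
    "coulomb_potential w \<in> borel_measurable borel" "coulomb_potential z \<in> borel_measurable borel"
    using L2 L2' L2_measurable coulomb_potential_measurable by auto
  define \<sigma> where "\<sigma> x = (cmod (v x))\<^sup>2 - (cmod (u x))\<^sup>2" for x
  have \<sigma>_inner: "\<sigma> x = 2 * inner (u x) (w x) + (cmod (w x))\<^sup>2" for x
    unfolding \<sigma>_def w_def power2_norm_eq_inner by (simp add: inner_diff inner_commute algebra_simps)
  have \<sigma>_abs: "\<bar>\<sigma> x\<bar> \<le> cmod (w x) * cmod (z x)" for x
  proof -
    have "\<bar>\<sigma> x\<bar> = \<bar>cmod (v x) - cmod (u x)\<bar> * (cmod (v x) + cmod (u x))"
      unfolding \<sigma>_def by (simp add: power2_eq_square square_diff_square_factored abs_mult)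
    also have "\<dots> \<le> cmod (w x) * (cmod (v x) + cmod (u x))"
      unfolding w_def by (intro mult_right_mono norm_triangle_ineq3) auto
    also have "cmod (v x) + cmod (u x) = cmod (z x)" unfolding z_def norm_of_real by simp
    finally show ?thesis .
  qed
  note iuu = coulomb_density_integrable[OF u L2(1)] and iuv = coulomb_density_integrable[OF u L2(2)]
    and ivu = coulomb_density_integrable[OF v L2(1)] and ivv = coulomb_density_integrable[OF v L2(2)]
  note iuw = coulomb_density_integrable[OF u L2'(1)] and izw = coulomb_density_integrable[OF z L2'(1)]
    and iwz = coulomb_density_integrable[OF w L2'(2)]
  let ?I = "\<lambda>a b. LINT x|lborel. (cmod (a x))\<^sup>2 * coulomb_potential b x"
  have sym: "?I v u = ?I u v" by (rule coulomb_symmetric[OF u v])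
  have iinner: "integrable lborel (\<lambda>x. coulomb_potential u x * inner (u x) (w x))"
  proof (rule coulomb_L2_integrable[OF u L2(1) L2'(1)])
    show "norm (coulomb_potential u x * inner (u x) (w x)) \<le> coulomb_potential u x * (cmod (u x) * cmod (w x))" for x
      using Cauchy_Schwarz_ineq2[of "u x" "w x"] coulomb_potential_nonneg[of u x] by (simp add: abs_mult mult_left_mono)
  qed measurable
  have first: "?I v u - ?I u u \<ge> 2 * (LINT x|lborel. coulomb_potential u x * inner (u x) (w x))"
  proof -
    have "?I v u - ?I u u = (LINT x|lborel. (cmod (v x))\<^sup>2 * coulomb_potential u x - (cmod (u x))\<^sup>2 * coulomb_potential u x)"
      by (rule Bochner_Integration.integral_diff[OF iuv iuu, symmetric])
    also have "\<dots> = (LINT x|lborel. 2 * (coulomb_potential u x * inner (u x) (w x)) + (cmod (w x))\<^sup>2 * coulomb_potential u x)"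
    proof (rule Bochner_Integration.integral_cong[OF refl])
      fix x
      have "(cmod (v x))\<^sup>2 * coulomb_potential u x - (cmod (u x))\<^sup>2 * coulomb_potential u x = \<sigma> x * coulomb_potential u x"
        by (simp add: \<sigma>_def left_diff_distrib)
      then show "(cmod (v x))\<^sup>2 * coulomb_potential u x - (cmod (u x))\<^sup>2 * coulomb_potential u x
        = 2 * (coulomb_potential u x * inner (u x) (w x)) + (cmod (w x))\<^sup>2 * coulomb_potential u x"
        unfolding \<sigma>_inner by (simp add: algebra_simps)
    qed
    also have "\<dots> = 2 * (LINT x|lborel. coulomb_potential u x * inner (u x) (w x)) + ?I w u"
      using iinner iuw by (subst Bochner_Integration.integral_add) auto
    finally have "?I v u - ?I u u = 2 * (LINT x|lborel. coulomb_potential u x * inner (u x) (w x)) + ?I w u" .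
    moreover have "?I w u \<ge> 0" by (intro Bochner_Integration.integral_nonneg) (simp add: coulomb_potential_nonneg)
    ultimately show ?thesis by linarith
  qed
  have second: "?I v v - ?I v u - ?I u v + ?I u u \<ge> - (K * mass w)"
  proof -
    have i\<sigma>: "integrable lborel (\<lambda>x. \<sigma> x * (coulomb_potential v x - coulomb_potential u x))"
      using Bochner_Integration.integrable_add[OF Bochner_Integration.integrable_diff[OF Bochner_Integration.integrable_diff[OF ivv iuv] ivu] iuu]
      by (rule back_subst[of "integrable lborel"]) (auto simp: \<sigma>_def algebra_simps)
    have "?I v v - ?I v u - ?I u v + ?I u u = (LINT x|lborel. \<sigma> x * (coulomb_potential v x - coulomb_potential u x))"
    proof -
      have "(LINT x|lborel. \<sigma> x * (coulomb_potential v x - coulomb_potential u x)) =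
        (LINT x|lborel. (cmod (v x))\<^sup>2 * coulomb_potential v x - (cmod (v x))\<^sup>2 * coulomb_potential u x
          - (cmod (u x))\<^sup>2 * coulomb_potential v x + (cmod (u x))\<^sup>2 * coulomb_potential u x)"
        by (intro Bochner_Integration.integral_cong) (auto simp: \<sigma>_def algebra_simps)
      then show ?thesis using iuu iuv ivu ivv by simp
    qed
    moreover have "\<bar>LINT x|lborel. \<sigma> x * (coulomb_potential v x - coulomb_potential u x)\<bar> \<le> K * mass w"
    proof -
      have pt: "\<bar>\<sigma> x * (coulomb_potential v x - coulomb_potential u x)\<bar> \<le> 1 / 2 * ((cmod (w x))\<^sup>2 * coulomb_potential z x) + 1 / 2 * ((cmod (z x))\<^sup>2 * coulomb_potential w x)" for x
      proof -
        note cu = coulomb_integrable[OF u, of x] and cv = coulomb_integrable[OF v, of x]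
          and cw = coulomb_integrable[OF w, of x] and cz = coulomb_integrable[OF z, of x]
        have "coulomb_potential v x - coulomb_potential u x = (LINT y|lborel. \<sigma> y / norm (x - y))"
          unfolding coulomb_potential_def \<sigma>_def diff_divide_distrib by (rule Bochner_Integration.integral_diff[OF cv cu, symmetric])
        then have "\<bar>\<sigma> x * (coulomb_potential v x - coulomb_potential u x)\<bar> = \<bar>LINT y|lborel. \<sigma> x * (\<sigma> y / norm (x - y))\<bar>"
          by (simp only: integral_mult_right_zero)
        also have "\<dots> \<le> (LINT y|lborel. \<bar>\<sigma> x * (\<sigma> y / norm (x - y))\<bar>)" by (rule integral_abs_bound)
        also have "\<dots> \<le> (LINT y|lborel. (1 / 2 * (cmod (w x))\<^sup>2) * ((cmod (z y))\<^sup>2 / norm (x - y)) + (1 / 2 * (cmod (z x))\<^sup>2) * ((cmod (w y))\<^sup>2 / norm (x - y)))"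
        proof (rule integral_mono)
          have i: "integrable lborel (\<lambda>y. \<sigma> y / norm (x - y))"
            unfolding \<sigma>_def diff_divide_distrib by (rule Bochner_Integration.integrable_diff[OF cv cu])
          show "integrable lborel (\<lambda>y. \<bar>\<sigma> x * (\<sigma> y / norm (x - y))\<bar>)" by (intro integrable_abs integrable_mult_right i)
          show "integrable lborel (\<lambda>y. (1 / 2 * (cmod (w x))\<^sup>2) * ((cmod (z y))\<^sup>2 / norm (x - y)) + (1 / 2 * (cmod (z x))\<^sup>2) * ((cmod (w y))\<^sup>2 / norm (x - y)))"
            by (intro Bochner_Integration.integrable_add integrable_mult_right cz cw)
          fix y
          have "\<bar>\<sigma> x * (\<sigma> y / norm (x - y))\<bar> = \<bar>\<sigma> x\<bar> * \<bar>\<sigma> y\<bar> / norm (x - y)" by (simp add: abs_mult)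
          also have "\<dots> \<le> (cmod (w x) * cmod (z x)) * (cmod (w y) * cmod (z y)) / norm (x - y)"
            using \<sigma>_abs by (intro divide_right_mono mult_mono) auto
          \<comment> \<open>Young's inequality separates the product so that in each summand one
            point carries both factors of \<open>w\<close> and the other both factors of
            \<open>z\<close>; one integration then yields a potential of \<open>z\<close>, which
            \<open>K\<close> bounds after symmetrisation.\<close>
          also have "\<dots> \<le> (1 / 2 * ((cmod (w x))\<^sup>2 * (cmod (z y))\<^sup>2) + 1 / 2 * ((cmod (z x))\<^sup>2 * (cmod (w y))\<^sup>2)) / norm (x - y)"
            using sum_squares_bound[of "cmod (w x) * cmod (z y)" "cmod (z x) * cmod (w y)"]
            by (intro divide_right_mono) (auto simp: power_mult_distrib algebra_simps)
          finally show "\<bar>\<sigma> x * (\<sigma> y / norm (x - y))\<bar> \<le> (1 / 2 * (cmod (w x))\<^sup>2) * ((cmod (z y))\<^sup>2 / norm (x - y)) + (1 / 2 * (cmod (z x))\<^sup>2) * ((cmod (w y))\<^sup>2 / norm (x - y))"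
            by (simp add: add_divide_distrib)
        qed
        also have "\<dots> = 1 / 2 * ((cmod (w x))\<^sup>2 * coulomb_potential z x) + 1 / 2 * ((cmod (z x))\<^sup>2 * coulomb_potential w x)"
          unfolding coulomb_potential_def
          by (subst Bochner_Integration.integral_add[OF integrable_mult_right[OF cz] integrable_mult_right[OF cw]])
            (simp only: integral_mult_right_zero mult.assoc)
        finally show ?thesis .
      qed
      have "\<bar>LINT x|lborel. \<sigma> x * (coulomb_potential v x - coulomb_potential u x)\<bar>
        \<le> (LINT x|lborel. \<bar>\<sigma> x * (coulomb_potential v x - coulomb_potential u x)\<bar>)" by (rule integral_abs_bound)
      also have "\<dots> \<le> (LINT x|lborel. 1 / 2 * ((cmod (w x))\<^sup>2 * coulomb_potential z x) + 1 / 2 * ((cmod (z x))\<^sup>2 * coulomb_potential w x))"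
        by (rule integral_mono[OF integrable_abs[OF i\<sigma>] Bochner_Integration.integrable_add[OF integrable_mult_right[OF izw] integrable_mult_right[OF iwz]] pt])
      also have "\<dots> = 1 / 2 * ?I w z + 1 / 2 * ?I z w"
        unfolding Bochner_Integration.integral_add[OF integrable_mult_right[OF izw] integrable_mult_right[OF iwz]] integral_mult_right_zero ..
      also have "\<dots> = ?I w z" using coulomb_symmetric[OF w z] by simp
      also have "\<dots> \<le> K * mass w" using K by (intro coulomb_density_le[OF z L2'(1)]) (simp add: z_def[abs_def])
      finally show ?thesis .
    qed
    ultimately show ?thesis by linarith
  qed
  have "coulomb_energy v - coulomb_energy u = 2 * (?I v u - ?I u u) + (?I v v - ?I v u - ?I u v + ?I u u)"
    unfolding coulomb_energy_eq using sym by simp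
  with first second show ?thesis by (simp add: w_def[abs_def])
qed

section \<open>Elementary inequalities for powers\<close>

lemma powr_diff_bounds:
  fixes a b :: real
  assumes "0 \<le> a" "a \<le> b" "1 \<le> s"
  shows "s * a powr (s - 1) * (b - a) \<le> b powr s - a powr s" "b powr s - a powr s \<le> s * b powr (s - 1) * (b - a)"
proof -
  have "\<exists>\<xi>. a \<le> \<xi> \<and> \<xi> \<le> b \<and> b powr s - a powr s = s * \<xi> powr (s - 1) * (b - a)"
  proof (cases "a = b")
    case False
    then have ab: "a < b" using assms by simp
    have "continuous_on {a..b} (\<lambda>x. x powr s)" using assms by (intro continuous_on_powr' continuous_intros) auto
    moreover have "((\<lambda>x. x powr s) has_real_derivative s * x powr (s - 1)) (at x)" if "a < x" "x < b" for x
      using that assms by (intro has_real_derivative_powr) auto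
    ultimately obtain l z where z: "a < z" "z < b" "((\<lambda>x. x powr s) has_real_derivative l) (at z)" "b powr s - a powr s = (b - a) * l"
      using MVT[OF ab, of "\<lambda>x. x powr s"] by (auto simp: real_differentiable_def)
    have "((\<lambda>x. x powr s) has_real_derivative s * z powr (s - 1)) (at z)"
      using z assms by (intro has_real_derivative_powr) auto
    with z(3) have "l = s * z powr (s - 1)" by (rule DERIV_unique)
    with z show ?thesis by (intro exI[of _ z]) auto
  qed (auto intro: exI[of _ b])
  then obtain \<xi> where \<xi>: "a \<le> \<xi>" "\<xi> \<le> b" "b powr s - a powr s = s * \<xi> powr (s - 1) * (b - a)" by blast
  have "a powr (s - 1) \<le> \<xi> powr (s - 1)" "\<xi> powr (s - 1) \<le> b powr (s - 1)"
    using \<xi> assms by (auto intro!: powr_mono2)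
  then show "s * a powr (s - 1) * (b - a) \<le> b powr s - a powr s" "b powr s - a powr s \<le> s * b powr (s - 1) * (b - a)"
    unfolding \<xi>(3) using assms by (auto intro!: mult_right_mono mult_left_mono)
qed

text \<open>The mean value bounds are applied first to the power and then to its derivative. The
  larger of \<open>a\<close> and \<open>b\<close> determines the remainder, and the sum of both
  powers covers either order.\<close>

lemma powr_taylor:
  fixes a b :: real
  assumes "0 \<le> a" "0 \<le> b" "2 \<le> t"
  shows "b powr t - a powr t - t * (a powr (t - 1) * (b - a)) \<le> t * (t - 1) * ((a powr (t - 2) + b powr (t - 2)) * (b - a)\<^sup>2)"
proof (cases "a \<le> b")
  case True
  have "b powr t - a powr t - t * (a powr (t - 1) * (b - a)) \<le> t * (b powr (t - 1) - a powr (t - 1)) * (b - a)"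
    using powr_diff_bounds(2)[OF assms(1) True, of t] assms by (simp add: algebra_simps)
  also have "\<dots> \<le> t * ((t - 1) * b powr (t - 2) * (b - a)) * (b - a)"
    using powr_diff_bounds(2)[OF assms(1) True, of "t - 1"] assms True by (intro mult_right_mono mult_left_mono) auto
  also have "\<dots> = t * (t - 1) * (b powr (t - 2) * (b - a)\<^sup>2)" by (simp add: power2_eq_square)
  also have "\<dots> \<le> t * (t - 1) * ((a powr (t - 2) + b powr (t - 2)) * (b - a)\<^sup>2)"
    using assms by (intro mult_left_mono mult_right_mono) auto
  finally show ?thesis .
next
  case False
  then have ba: "b \<le> a" by simp
  have "b powr t - a powr t - t * (a powr (t - 1) * (b - a)) \<le> t * (a powr (t - 1) - b powr (t - 1)) * (a - b)"
    using powr_diff_bounds(1)[OF assms(2) ba, of t] assms by (simp add: algebra_simps)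
  also have "\<dots> \<le> t * ((t - 1) * a powr (t - 2) * (a - b)) * (a - b)"
    using powr_diff_bounds(2)[OF assms(2) ba, of "t - 1"] assms ba by (intro mult_right_mono mult_left_mono) auto
  also have "\<dots> = t * (t - 1) * (a powr (t - 2) * (b - a)\<^sup>2)" by (simp add: power2_eq_square algebra_simps)
  also have "\<dots> \<le> t * (t - 1) * ((a powr (t - 2) + b powr (t - 2)) * (b - a)\<^sup>2)"
    using assms by (intro mult_left_mono mult_right_mono) auto
  finally show ?thesis .
qed

lemma powr_young:
  fixes a b :: real
  assumes "0 \<le> a" "0 \<le> b" "1 < t"
  shows "a powr (t - 1) * b \<le> a powr t + b powr t"
proof (cases "a \<le> b")
  case True
  then have "a powr (t - 1) * b \<le> b powr (t - 1) * b powr 1" using assms by (auto intro!: mult_mono powr_mono2)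
  also have "\<dots> = b powr t" unfolding powr_add[symmetric] by simp
  finally show ?thesis by (simp add: add_increasing)
next
  case False
  then have "a powr (t - 1) * b \<le> a powr (t - 1) * a powr 1" using assms by (auto intro!: mult_mono)
  also have "\<dots> = a powr t" unfolding powr_add[symmetric] by simp
  finally show ?thesis by (simp add: add_increasing2)
qed

lemma powr_interpolate:
  fixes a :: real
  assumes "0 \<le> a" "s \<le> q" "q \<le> t" "0 < s"
  shows "a powr q \<le> a powr s + a powr t"
proof (cases "a \<le> 1")
  case True
  then have "a powr q \<le> a powr s" using assms by (cases "a = 0") (auto intro: powr_mono')
  then show ?thesis by (simp add: add_increasing2)
next
  case False
  then have "a powr q \<le> a powr t" using assms by (intro powr_mono) auto
  then show ?thesis by (simp add: add_increasing)
qed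

section \<open>Mass preserving dilations\<close>

definition dil :: "real \<Rightarrow> (space \<Rightarrow> complex) \<Rightarrow> space \<Rightarrow> complex" where
  "dil s u x = of_real (exp (3 * s / 2)) * u (exp s *\<^sub>R x)"

lemma dil_H1:
  assumes "u \<in> H1"
  shows "dil s u \<in> H1" "AE x in lborel. weak_grad (dil s u) x = of_real (exp (3 * s / 2)) *s (exp s *\<^sub>R weak_grad u (exp s *\<^sub>R x))"
proof -
  have e: "exp s > 0" by simp
  show "dil s u \<in> H1" unfolding dil_def[abs_def] by (intro H1_cmult H1_dilation assms e)
  show "AE x in lborel. weak_grad (dil s u) x = of_real (exp (3 * s / 2)) *s (exp s *\<^sub>R weak_grad u (exp s *\<^sub>R x))"
    using H1_cmult(2)[OF H1_dilation(1)[OF assms e], of "of_real (exp (3 * s / 2))"] H1_dilation(2)[OF assms e]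
    unfolding dil_def[abs_def] by eventually_elim simp
qed

lemma dil_H1r:
  assumes "u \<in> H1r" shows "dil s u \<in> H1r"
proof -
  from assms obtain f where u: "u \<in> H1" and f: "AE x in lborel. u x = f (norm x)" by (auto simp: H1r_def)
  have "AE x in lborel. u (exp s *\<^sub>R x) = f (norm (exp s *\<^sub>R x))"
    using scaling_AE[OF f, of "exp s"] by simp
  then have "AE x in lborel. dil s u x = (\<lambda>r. of_real (exp (3 * s / 2)) * f (exp s * r)) (norm x)"
    by eventually_elim (simp add: dil_def)
  then show ?thesis using dil_H1[OF u] by (auto simp: H1r_def)
qed

lemma dil_power_integral: "(LINT x|lborel. cmod (dil s u x) powr t) = exp (3 * (t - 2) / 2 * s) * (LINT x|lborel. cmod (u x) powr t)"
proof -
  have "(LINT x|lborel. cmod (dil s u x) powr t) = (LINT x|lborel. exp (3 * s / 2 * t) * (cmod (u (exp s *\<^sub>R x)) powr t))"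
    by (intro Bochner_Integration.integral_cong) (auto simp: dil_def norm_mult powr_mult exp_powr_real)
  also have "\<dots> = exp (3 * s / 2 * t) * (1 / exp s ^ 3 * (LINT x|lborel. cmod (u x) powr t))"
    using scaling_integral[of "exp s" "\<lambda>x::space. cmod (u x) powr t"] by simp
  also have "exp s ^ 3 = exp (3 * s)" by (simp add: exp_of_nat_mult[symmetric])
  also have "exp (3 * s / 2 * t) * (1 / exp (3 * s) * (LINT x|lborel. cmod (u x) powr t)) = exp (3 * s / 2 * t - 3 * s) * (LINT x|lborel. cmod (u x) powr t)"
    by (simp add: exp_diff)
  also have "3 * s / 2 * t - 3 * s = 3 * (t - 2) / 2 * s" by (simp add: field_simps)
  finally show ?thesis .
qed

lemma dil_square_integral: "(LINT x|lborel. (cmod (dil s f x))\<^sup>2) = (LINT x|lborel. (cmod (f x))\<^sup>2)"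
proof -
  have "(LINT x|lborel. (cmod (dil s f x))\<^sup>2) = (LINT x|lborel. exp (3 * s) * (cmod (f (exp s *\<^sub>R x)))\<^sup>2)"
    by (intro Bochner_Integration.integral_cong)
      (auto simp: dil_def norm_mult power_mult_distrib exp_double[symmetric] simp flip: exp_of_nat_mult)
  also have "\<dots> = exp (3 * s) * (1 / exp s ^ 3 * (LINT x|lborel. (cmod (f x))\<^sup>2))"
    using scaling_integral[of "exp s" "\<lambda>x::space. (cmod (f x))\<^sup>2"] by simp
  also have "exp s ^ 3 = exp (3 * s)" by (simp add: exp_of_nat_mult[symmetric])
  finally show ?thesis by simp
qed

lemma dil_mass: "mass (dil s u) = mass u"
  unfolding mass_def by (rule dil_square_integral)

lemma dil_dirichlet:
  assumes "u \<in> H1" shows "dirichlet (dil s u) = exp (2 * s) * dirichlet u"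
proof -
  have [measurable]: "weak_grad u \<in> borel_measurable borel" "weak_grad (dil s u) \<in> borel_measurable borel"
    using weak_grad_measurable[OF assms] weak_grad_measurable[OF dil_H1(1)[OF assms]] by auto
  have "dirichlet (dil s u) = (LINT x|lborel. exp (5 * s) * (norm (weak_grad u (exp s *\<^sub>R x)))\<^sup>2)"
    unfolding dirichlet_def
  proof (rule integral_cong_AE)
    show "AE x in lborel. (norm (weak_grad (dil s u) x))\<^sup>2 = exp (5 * s) * (norm (weak_grad u (exp s *\<^sub>R x)))\<^sup>2"
      using dil_H1(2)[OF assms, of s]
    proof eventually_elim
      case (elim x)
      have "(norm (weak_grad (dil s u) x))\<^sup>2 = (exp (3 * s / 2) * exp s)\<^sup>2 * (norm (weak_grad u (exp s *\<^sub>R x)))\<^sup>2"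
        unfolding elim norm_vector_smult by (simp add: power_mult_distrib)
      also have "(exp (3 * s / 2) * exp s)\<^sup>2 = exp (5 * s)"
        unfolding power2_eq_square exp_add[symmetric] by simp
      finally show ?case .
    qed
  qed auto
  also have "\<dots> = exp (5 * s) * (1 / exp s ^ 3 * dirichlet u)"
    using scaling_integral[of "exp s" "\<lambda>x::space. (norm (weak_grad u x))\<^sup>2"] by (simp add: dirichlet_def)
  also have "exp s ^ 3 = exp (3 * s)" by (simp add: exp_of_nat_mult[symmetric])
  also have "exp (5 * s) * (1 / exp (3 * s) * dirichlet u) = exp (5 * s - 3 * s) * dirichlet u" unfolding exp_diff by simp
  finally show ?thesis by simp
qed

lemma dil_coulomb_potential: "coulomb_potential (dil s u) x = exp s * coulomb_potential u (exp s *\<^sub>R x)"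
proof -
  have "coulomb_potential (dil s u) x = (LINT y|lborel. exp (4 * s) * ((cmod (u (exp s *\<^sub>R y)))\<^sup>2 / norm (exp s *\<^sub>R x - exp s *\<^sub>R y)))"
    unfolding coulomb_potential_def
  proof (rule Bochner_Integration.integral_cong[OF refl])
    fix y
    have "norm (exp s *\<^sub>R x - exp s *\<^sub>R y) = exp s * norm (x - y)" by (simp flip: scaleR_diff_right)
    moreover have "(exp (3 * s / 2))\<^sup>2 = exp (3 * s)" unfolding power2_eq_square exp_add[symmetric] by simp
    moreover have "exp (4 * s) = exp (3 * s) * exp s" unfolding exp_add[symmetric] by simp
    ultimately show "(cmod (dil s u y))\<^sup>2 / norm (x - y) = exp (4 * s) * ((cmod (u (exp s *\<^sub>R y)))\<^sup>2 / norm (exp s *\<^sub>R x - exp s *\<^sub>R y))"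
      by (simp add: dil_def norm_mult power_mult_distrib)
  qed
  also have "\<dots> = exp (4 * s) * (1 / exp s ^ 3 * coulomb_potential u (exp s *\<^sub>R x))"
    using scaling_integral[of "exp s" "\<lambda>y. (cmod (u y))\<^sup>2 / norm (exp s *\<^sub>R x - y)"]
    by (simp add: coulomb_potential_def del: times_divide_eq_right)
  also have "exp s ^ 3 = exp (3 * s)" by (simp add: exp_of_nat_mult[symmetric])
  also have "exp (4 * s) * (1 / exp (3 * s) * coulomb_potential u (exp s *\<^sub>R x)) = exp (4 * s - 3 * s) * coulomb_potential u (exp s *\<^sub>R x)"
    unfolding exp_diff by simp
  finally show ?thesis by simp
qed

lemma dil_coulomb_energy: "coulomb_energy (dil s u) = exp s * coulomb_energy u"
proof -
  have "coulomb_energy (dil s u) = (LINT x|lborel. exp (4 * s) * ((cmod (u (exp s *\<^sub>R x)))\<^sup>2 * coulomb_potential u (exp s *\<^sub>R x)))"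
    unfolding coulomb_energy_eq
  proof (rule Bochner_Integration.integral_cong[OF refl])
    fix x
    have "(exp (3 * s / 2))\<^sup>2 = exp (3 * s)" unfolding power2_eq_square exp_add[symmetric] by simp
    moreover have "exp (4 * s) = exp (3 * s) * exp s" unfolding exp_add[symmetric] by simp
    ultimately show "(cmod (dil s u x))\<^sup>2 * coulomb_potential (dil s u) x = exp (4 * s) * ((cmod (u (exp s *\<^sub>R x)))\<^sup>2 * coulomb_potential u (exp s *\<^sub>R x))"
      unfolding dil_coulomb_potential by (simp add: dil_def norm_mult power_mult_distrib)
  qed
  also have "\<dots> = exp (4 * s) * (1 / exp s ^ 3 * coulomb_energy u)"
    using scaling_integral[of "exp s" "\<lambda>x. (cmod (u x))\<^sup>2 * coulomb_potential u x"]
    by (simp add: coulomb_energy_eq)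
  also have "exp s ^ 3 = exp (3 * s)" by (simp add: exp_of_nat_mult[symmetric])
  also have "exp (4 * s) * (1 / exp (3 * s) * coulomb_energy u) = exp (4 * s - 3 * s) * coulomb_energy u"
    unfolding exp_diff by simp
  finally show ?thesis by simp
qed


section \<open>The distance between a radial function and its dilation\<close>

text \<open>The squared increment of the profile is at most \<open>s / (4 pi |x|)\<close> times the
  gradient integral over \<open>|x| < |y| \<le> exp s |x|\<close>. After exchanging the integrals,
  for fixed \<open>y\<close> the admissible radii of \<open>x\<close> fill an interval of length at
  most \<open>s |y|\<close>, which supplies the second factor \<open>s\<close>. The 3 bounds
  \<open>exp s\<close>.\<close>

lemma dil_diff_ball:
  assumes u: "u \<in> H1" and s: "0 < s" "s \<le> 1" and R: "R > 0"
  shows "(\<integral>\<^sup>+x. ennreal (indicator (cball 0 R) x * (cmod (profile u (exp s * norm (x::space)) - profile u (norm x)))\<^sup>2) \<partial>lborel)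
    \<le> ennreal (3 * s\<^sup>2 * R\<^sup>2 * dirichlet u)"
proof -
  have [measurable]: "weak_grad u \<in> borel_measurable borel" "profile u \<in> borel_measurable borel"
    using weak_grad_measurable[OF u] profile_measurable[OF u] by auto
  let ?g = "\<lambda>y. (norm (weak_grad u y))\<^sup>2"
  define k where "k x y = (if 0 < norm x \<and> norm x \<le> R \<and> norm x < norm y \<and> norm y \<le> exp s * norm x then s / (4 * pi * norm x) else 0)" for x y :: space
  have k_nn: "0 \<le> k x y" for x y unfolding k_def using s by auto
  have km[measurable]: "(\<lambda>(x, y). k x y) \<in> borel_measurable (borel \<Otimes>\<^sub>M borel)"
    unfolding k_def by measurable
  have es: "exp s \<le> 3" using s exp_le by (meson exp_le_cancel_iff order_trans)
  have "(\<integral>\<^sup>+x. ennreal (indicator (cball 0 R) x * (cmod (profile u (exp s * norm (x::space)) - profile u (norm x)))\<^sup>2) \<partial>lborel)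
    \<le> (\<integral>\<^sup>+x. \<integral>\<^sup>+y. ennreal (k x y * ?g y) \<partial>lborel \<partial>lborel)"
  proof (rule nn_integral_mono_AE)
    show "AE x in lborel. ennreal (indicator (cball 0 R) x * (cmod (profile u (exp s * norm (x::space)) - profile u (norm x)))\<^sup>2)
      \<le> (\<integral>\<^sup>+y. ennreal (k x y * ?g y) \<partial>lborel)"
      using AE_lborel_singleton[of "0::space"]
    proof eventually_elim
      case (elim x)
      then have r: "0 < norm x" by simp
      show ?case
      proof (cases "norm x \<le> R")
        case True
        have rs: "norm x \<le> exp s * norm x" using s r by simp
        let ?I = "LINT y|lborel. indicator {norm x<..exp s * norm x} (norm y) * ?g y"
        have "(cmod (profile u (exp s * norm x) - profile u (norm x)))\<^sup>2 = (norm (profile u (norm x) - profile u (exp s * norm x)))\<^sup>2"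
          by (simp add: norm_minus_commute)
        also have "\<dots> \<le> ?I * (1 / norm x - 1 / (exp s * norm x)) / (4 * pi)"
          by (rule profile_diff_bound[OF u r rs])
        also have "\<dots> \<le> ?I * (s / norm x) / (4 * pi)"
        proof (intro divide_right_mono mult_left_mono)
          have "1 - 1 / exp s \<le> s" using exp_ge_add_one_self[of "- s"] by (simp add: exp_minus inverse_eq_divide)
          then have "(1 - 1 / exp s) / norm x \<le> s / norm x" using r by (intro divide_right_mono) auto
          then show "1 / norm x - 1 / (exp s * norm x) \<le> s / norm x" by (simp add: diff_divide_distrib)
        qed (auto intro!: Bochner_Integration.integral_nonneg)
        also have "\<dots> = (LINT y|lborel. k x y * ?g y)"
        proof -
          have "(LINT y|lborel. k x y * ?g y) = (LINT y|lborel. s / (4 * pi * norm x) * (indicator {norm x<..exp s * norm x} (norm y) * ?g y))"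
            using True r by (intro Bochner_Integration.integral_cong) (auto simp: k_def indicator_def)
          then show ?thesis by (simp add: mult_ac)
        qed
        finally have le: "(cmod (profile u (exp s * norm x) - profile u (norm x)))\<^sup>2 \<le> (LINT y|lborel. k x y * ?g y)" .
        have "integrable lborel (\<lambda>y. s / (4 * pi * norm x) * ?g y)"
          by (rule integrable_mult_right[OF L2_integrable[OF H1D(2)[OF u]]])
        then have "integrable lborel (\<lambda>y. k x y * ?g y)"
          by (rule Bochner_Integration.integrable_bound) (auto simp: k_def)
        then have "(\<integral>\<^sup>+y. ennreal (k x y * ?g y) \<partial>lborel) = ennreal (LINT y|lborel. k x y * ?g y)"
          using k_nn by (intro nn_integral_eq_integral) auto
        then show ?thesis using le True by (simp add: ennreal_leI)
      qed simp
    qed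
  qed
  also have "\<dots> = (\<integral>\<^sup>+y. \<integral>\<^sup>+x. ennreal (k x y * ?g y) \<partial>lborel \<partial>lborel)"
    by (rule lborel_pair.Fubini') measurable
  also have "\<dots> \<le> (\<integral>\<^sup>+y. ennreal (3 * s\<^sup>2 * R\<^sup>2) * ennreal (?g y) \<partial>lborel)"
  proof (rule nn_integral_mono)
    fix y
    have "(\<integral>\<^sup>+x. ennreal (k x y) \<partial>lborel) \<le> ennreal (3 * s\<^sup>2 * R\<^sup>2)"
    proof (cases "norm y \<le> exp s * R")
      case True
      define l where "l = (1 / exp s) * norm y"
      have l: "0 \<le> l" "l \<le> norm y" using s by (auto simp: l_def divide_le_eq mult_le_cancel_left1)
      have "(\<integral>\<^sup>+x. ennreal (k x y) \<partial>lborel) =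
        (\<integral>\<^sup>+r. ennreal (4 * pi * r\<^sup>2) * indicator {0..} r * ennreal (if 0 < r \<and> r \<le> R \<and> r < norm y \<and> norm y \<le> exp s * r then s / (4 * pi * r) else 0) \<partial>lborel)"
        unfolding k_def by (rule polar_nn_integral) measurable
      also have "\<dots> \<le> (\<integral>\<^sup>+r. ennreal (s * R) * indicator {l..norm y} r \<partial>lborel)"
      proof (rule nn_integral_mono)
        fix r :: real
        show "ennreal (4 * pi * r\<^sup>2) * indicator {0..} r * ennreal (if 0 < r \<and> r \<le> R \<and> r < norm y \<and> norm y \<le> exp s * r then s / (4 * pi * r) else 0)
          \<le> ennreal (s * R) * indicator {l..norm y} r"
        proof (cases "0 < r \<and> r \<le> R \<and> r < norm y \<and> norm y \<le> exp s * r")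
          case c: True
          then have "l \<le> r" by (simp add: l_def divide_le_eq mult.commute)
          moreover have "(4 * pi * r\<^sup>2) * (s / (4 * pi * r)) \<le> s * R"
            using c s by (simp add: power2_eq_square)
          ultimately show ?thesis using c s by (simp add: ennreal_mult[symmetric] ennreal_leI)
        qed (auto simp del: ennreal_mult)
      qed
      also have "\<dots> = ennreal (s * R * (norm y - l))"
        using l s R by (subst nn_integral_cmult) (auto simp: ennreal_mult[symmetric])
      also have "\<dots> \<le> ennreal (3 * s\<^sup>2 * R\<^sup>2)"
      proof (rule ennreal_leI)
        have "1 - 1 / exp s \<le> s" using exp_ge_add_one_self[of "- s"] by (simp add: exp_minus inverse_eq_divide)
        moreover have "norm y - l = (1 - 1 / exp s) * norm y" by (simp add: l_def algebra_simps)
        ultimately have "norm y - l \<le> s * norm y" by (simp add: mult_right_mono)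
        also have "\<dots> \<le> s * (3 * R)"
          using True es R s by (intro mult_left_mono order_trans[OF True] mult_right_mono) auto
        finally have "s * R * (norm y - l) \<le> s * R * (s * (3 * R))" using s R by (intro mult_left_mono) auto
        then show "s * R * (norm y - l) \<le> 3 * s\<^sup>2 * R\<^sup>2" by (simp add: power2_eq_square algebra_simps)
      qed
      finally show ?thesis .
    next
      case False
      have "k x y = 0" for x
      proof -
        have "\<not> (norm x \<le> R \<and> norm y \<le> exp s * norm x)"
        proof
          assume a: "norm x \<le> R \<and> norm y \<le> exp s * norm x"
          then have "exp s * norm x \<le> exp s * R" by (intro mult_left_mono) auto
          with a False show False by linarith
        qed
        then show ?thesis unfolding k_def by auto
      qed
      then show ?thesis by simp
    qed
    then have "(\<integral>\<^sup>+x. ennreal (k x y) \<partial>lborel) * ennreal (?g y) \<le> ennreal (3 * s\<^sup>2 * R\<^sup>2) * ennreal (?g y)"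
      by (rule mult_right_mono) simp
    also have "(\<integral>\<^sup>+x. ennreal (k x y) \<partial>lborel) * ennreal (?g y) = (\<integral>\<^sup>+x. ennreal (k x y * ?g y) \<partial>lborel)"
      using k_nn by (subst nn_integral_multc[symmetric]) (auto simp: ennreal_mult)
    finally show "(\<integral>\<^sup>+x. ennreal (k x y * ?g y) \<partial>lborel) \<le> ennreal (3 * s\<^sup>2 * R\<^sup>2) * ennreal (?g y)" .
  qed
  also have "\<dots> = ennreal (3 * s\<^sup>2 * R\<^sup>2) * ennreal (dirichlet u)"
    unfolding dirichlet_def using L2_integrable[OF H1D(2)[OF u]]
    by (subst nn_integral_cmult) (auto simp: nn_integral_eq_integral)
  also have "\<dots> = ennreal (3 * s\<^sup>2 * R\<^sup>2 * dirichlet u)" by (simp add: ennreal_mult dirichlet_nonneg)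
  finally show ?thesis .
qed

definition tail_mass :: "real \<Rightarrow> (space \<Rightarrow> complex) \<Rightarrow> real" where
  "tail_mass R u = (LINT x|lborel. indicator {R<..} (norm x) * (cmod (u x))\<^sup>2)"

text \<open>Inside the ball the difference is an increment of the profile, scaled by
  \<open>exp (3 s / 2)\<close>, plus \<open>exp (3 s / 2) - 1\<close> times \<open>u\<close>, so its
  square is of order \<open>s^2\<close>. Outside, the two masses are estimated separately.\<close>

lemma dil_diff_mass:
  assumes u: "u \<in> H1r" and s: "0 < s" "s \<le> 1" and R: "R > 0"
  shows "mass (\<lambda>x. dil s u x - u x) \<le> 162 * s\<^sup>2 * R\<^sup>2 * dirichlet u + 366 * s\<^sup>2 * mass u + 4 * tail_mass R u"
proof -
  have uH: "u \<in> H1" using u by (simp add: H1r_def)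
  have L2: "u \<in> L2" "dil s u \<in> L2" using H1D(1)[OF uH] H1D(1)[OF dil_H1(1)[OF uH]] by auto
  have [measurable]: "u \<in> borel_measurable borel" "dil s u \<in> borel_measurable borel" "profile u \<in> borel_measurable borel"
    using L2_measurable[OF L2(1)] L2_measurable[OF L2(2)] profile_measurable[OF uH] by auto
  let ?P = "\<lambda>x::space. indicator (cball 0 R) x * (cmod (profile u (exp s * norm x) - profile u (norm x)))\<^sup>2"
  note nn = dil_diff_ball[OF uH s R]
  have iP: "integrable lborel ?P"
    using le_less_trans[OF nn] by (intro integrableI_nonneg) auto
  have LP: "(LINT x|lborel. ?P x) \<le> 3 * s\<^sup>2 * R\<^sup>2 * dirichlet u"
  proof -
    have "ennreal (LINT x|lborel. ?P x) = (\<integral>\<^sup>+x. ennreal (?P x) \<partial>lborel)"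
      using iP by (intro nn_integral_eq_integral[symmetric]) auto
    with nn have "ennreal (LINT x|lborel. ?P x) \<le> ennreal (3 * s\<^sup>2 * R\<^sup>2 * dirichlet u)" by (simp only:)
    moreover have "0 \<le> 3 * s\<^sup>2 * R\<^sup>2 * dirichlet u" using dirichlet_nonneg[of u] by simp
    ultimately show ?thesis by (simp only: ennreal_le_iff)
  qed
  have iu: "integrable lborel (\<lambda>x. (cmod (u x))\<^sup>2)" by (rule L2_integrable[OF L2(1)])
  let ?t = "\<lambda>f x. indicator {R<..} (norm x) * (cmod (f x))\<^sup>2"
  have it: "integrable lborel (?t u)" "integrable lborel (?t (dil s u))"
    by (rule Bochner_Integration.integrable_bound[OF L2_integrable[OF L2(1)]], auto simp: indicator_def)
      (rule Bochner_Integration.integrable_bound[OF L2_integrable[OF L2(2)]], auto simp: indicator_def)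
  \<comment> \<open>Since \<open>s > 0\<close>, a point outside the ball is moved further out, so
    the dilated function has no more mass outside than \<open>u\<close>.\<close>
  have td: "(LINT x|lborel. ?t (dil s u) x) \<le> tail_mass R u"
  proof -
    let ?f = "\<lambda>x. of_real (indicator {R<..} (norm x)) * u x"
    have f2: "(cmod (?f x))\<^sup>2 = ?t u x" for x by (auto simp: norm_mult indicator_def)
    have i: "integrable lborel (\<lambda>x. (cmod (dil s ?f x))\<^sup>2)"
    proof -
      have "integrable lborel (\<lambda>x. exp (3 * s) * ?t u (exp s *\<^sub>R x))"
        by (intro integrable_mult_right scaling_integrable[OF it(1)]) simp
      then show ?thesis
        by (rule back_subst[of "integrable lborel"]) (auto simp: dil_def norm_mult power_mult_distrib exp_double[symmetric] indicator_def)
    qed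
    have "(LINT x|lborel. ?t (dil s u) x) \<le> (LINT x|lborel. (cmod (dil s ?f x))\<^sup>2)"
    proof (rule integral_mono[OF it(2) i])
      fix x :: space
      have "norm x \<le> exp s * norm x" using s by (simp add: mult_le_cancel_right1)
      then show "?t (dil s u) x \<le> (cmod (dil s ?f x))\<^sup>2"
        by (auto simp: dil_def norm_mult indicator_def)
    qed
    also have "\<dots> = tail_mass R u" unfolding dil_square_integral f2 tail_mass_def ..
    finally show ?thesis .
  qed
  \<comment> \<open>54 is twice the bound 27 for \<open>exp (3 s)\<close>, and 366 exceeds twice the
    square of \<open>27 / 2\<close>, the constant in
    \<open>exp (3 s / 2) - 1 \<le> 27 / 2 * s\<close>.\<close>
  let ?B = "\<lambda>x. 54 * ?P x + 366 * s\<^sup>2 * (cmod (u x))\<^sup>2 + (2 * ?t (dil s u) x + 2 * ?t u x)"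
  have iB: "integrable lborel ?B"
    by (intro Bochner_Integration.integrable_add integrable_mult_right iP iu it)
  have pw: "AE x in lborel. (cmod (dil s u x - u x))\<^sup>2 \<le> ?B x"
    using radial_profile[OF u] scaling_AE[OF radial_profile[OF u], of "exp s", simplified]
  proof eventually_elim
    case (elim x)
    show ?case
    proof (cases "norm x \<le> R")
      case True
      let ?e = "exp (3 * s / 2)"
      let ?d = "profile u (exp s * norm x) - profile u (norm x)"
      have e9: "?e \<le> 9"
      proof -
        have "exp (3 * s / 2) \<le> exp (1 + 1)" using s by simp
        also have "\<dots> \<le> 3 * 3" unfolding exp_add using exp_le by (intro mult_mono) auto
        finally show ?thesis by simp
      qed
      have e27: "?e\<^sup>2 \<le> 27"
      proof -
        have "?e\<^sup>2 = exp (3 * s)" unfolding power2_eq_square exp_add[symmetric] by simp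
        also have "\<dots> \<le> exp (1 + 1 + 1)" using s by simp
        also have "\<dots> \<le> 3 * 3 * 3" unfolding exp_add using exp_le by (intro mult_mono) auto
        finally show ?thesis by simp
      qed
      have e1: "?e - 1 \<le> 27 / 2 * s"
      proof -
        have "1 - 3 * s / 2 \<le> exp (- (3 * s / 2))" using exp_ge_add_one_self[of "- (3 * s / 2)"] by simp
        then have "(1 - 3 * s / 2) * ?e \<le> exp (- (3 * s / 2)) * ?e" by (rule mult_right_mono) simp
        also have "\<dots> = 1" unfolding exp_add[symmetric] by simp
        finally have "?e - 1 \<le> 3 * s / 2 * ?e" by (simp add: algebra_simps)
        also have "\<dots> \<le> 3 * s / 2 * 9" using e9 s by (intro mult_left_mono) auto
        finally show ?thesis by simp
      qed
      have "dil s u x - u x = of_real ?e * ?d + of_real (?e - 1) * u x"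
        unfolding dil_def elim(2) by (subst (1 2) elim(1)) (simp add: algebra_simps)
      then have "cmod (dil s u x - u x) \<le> ?e * cmod ?d + (?e - 1) * cmod (u x)"
        using s norm_triangle_ineq[of "of_real ?e * ?d" "of_real (?e - 1) * u x"] by (simp add: norm_mult del: of_real_diff)
      then have "(cmod (dil s u x - u x))\<^sup>2 \<le> (?e * cmod ?d + (?e - 1) * cmod (u x))\<^sup>2" by (rule power_mono) simp
      also have "\<dots> \<le> 2 * (?e * cmod ?d)\<^sup>2 + 2 * ((?e - 1) * cmod (u x))\<^sup>2"
        using sum_squares_bound[of "?e * cmod ?d" "(?e - 1) * cmod (u x)"] by (simp add: power2_sum)
      also have "(?e * cmod ?d)\<^sup>2 \<le> 27 * (cmod ?d)\<^sup>2" unfolding power_mult_distrib using e27 by (rule mult_right_mono) simp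
      also have "((?e - 1) * cmod (u x))\<^sup>2 \<le> (27 / 2 * s)\<^sup>2 * (cmod (u x))\<^sup>2"
        unfolding power_mult_distrib[of "?e - 1"] using e1 s by (intro mult_right_mono power_mono) auto
      finally have "(cmod (dil s u x - u x))\<^sup>2 \<le> 54 * (cmod ?d)\<^sup>2 + 2 * ((27 / 2 * s)\<^sup>2 * (cmod (u x))\<^sup>2)" by simp
      also have "2 * ((27 / 2 * s)\<^sup>2 * (cmod (u x))\<^sup>2) \<le> 366 * s\<^sup>2 * (cmod (u x))\<^sup>2"
        by (simp add: power_mult_distrib power_divide mult_right_mono)
      finally show ?thesis using True by simp
    next
      case False
      have "(cmod (dil s u x - u x))\<^sup>2 \<le> (cmod (dil s u x) + cmod (u x))\<^sup>2"
        by (intro power_mono norm_triangle_ineq4) auto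
      also have "\<dots> \<le> 2 * (cmod (dil s u x))\<^sup>2 + 2 * (cmod (u x))\<^sup>2"
        using sum_squares_bound[of "cmod (dil s u x)" "cmod (u x)"] by (simp add: power2_sum)
      finally show ?thesis using False by (simp add: add_increasing)
    qed
  qed
  have iw: "integrable lborel (\<lambda>x. (cmod (dil s u x - u x))\<^sup>2)" by (rule L2_integrable[OF L2_diff[OF L2(2,1)]])
  have "mass (\<lambda>x. dil s u x - u x) \<le> (LINT x|lborel. ?B x)"
    unfolding mass_def by (rule integral_mono_AE[OF iw iB pw])
  also have "\<dots> = 54 * (LINT x|lborel. ?P x) + 366 * s\<^sup>2 * mass u + (2 * (LINT x|lborel. ?t (dil s u) x) + 2 * tail_mass R u)"
  proof -
    have "(LINT x|lborel. ?B x) = (LINT x|lborel. 54 * ?P x + 366 * s\<^sup>2 * (cmod (u x))\<^sup>2) + (LINT x|lborel. 2 * ?t (dil s u) x + 2 * ?t u x)"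
      by (rule Bochner_Integration.integral_add) (intro Bochner_Integration.integrable_add integrable_mult_right iP iu it)+
    also have "(LINT x|lborel. 54 * ?P x + 366 * s\<^sup>2 * (cmod (u x))\<^sup>2) = (LINT x|lborel. 54 * ?P x) + (LINT x|lborel. 366 * s\<^sup>2 * (cmod (u x))\<^sup>2)"
      by (rule Bochner_Integration.integral_add) (intro integrable_mult_right iP iu)+
    also have "(LINT x|lborel. 2 * ?t (dil s u) x + 2 * ?t u x) = (LINT x|lborel. 2 * ?t (dil s u) x) + (LINT x|lborel. 2 * ?t u x)"
      by (rule Bochner_Integration.integral_add) (intro integrable_mult_right it)+
    finally show ?thesis by (simp only: integral_mult_right_zero mass_def tail_mass_def)
  qed
  also have "\<dots> \<le> 162 * s\<^sup>2 * R\<^sup>2 * dirichlet u + 366 * s\<^sup>2 * mass u + 4 * tail_mass R u"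
    using LP td by linarith
  finally show ?thesis .
qed

text \<open>\<open>dil s\<close> preserves mass and inverts \<open>dil (- s)\<close>, so applying it
  to one difference gives the negative of the other.\<close>

lemma dil_neg_diff_mass: "mass (\<lambda>x. dil (- s) u x - u x) = mass (\<lambda>x. dil s u x - u x)"
proof -
  have "dil s (\<lambda>x. dil (- s) u x - u x) x = - (dil s u x - u x)" for x
  proof -
    have "exp (3 * s / 2) * exp (3 * - s / 2) = 1" unfolding exp_add[symmetric] by simp
    then have "complex_of_real (exp (3 * s / 2)) * complex_of_real (exp (3 * - s / 2)) = 1" by (metis of_real_1 of_real_mult)
    moreover have "exp (- s) *\<^sub>R exp s *\<^sub>R x = x" by (simp add: exp_minus)
    ultimately show ?thesis unfolding dil_def by (simp add: algebra_simps flip: mult.assoc)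
  qed
  then have "mass (dil s (\<lambda>x. dil (- s) u x - u x)) = mass (\<lambda>x. - (dil s u x - u x))" unfolding mass_def by (simp only:)
  then have "mass (\<lambda>x. dil (- s) u x - u x) = mass (\<lambda>x. - (dil s u x - u x))" unfolding dil_mass .
  then show ?thesis unfolding mass_def norm_minus_cancel .
qed

text \<open>With \<open>R^2 = \<delta> / s\<close> the ball contributes \<open>s\<close> times a
  multiple of \<open>\<delta>\<close>, and the tail mass is at most \<open>s / \<delta>\<close>
  times a tail of the second moment. First \<open>\<delta>\<close> is fixed, then that tail is made
  small compared with it.\<close>

lemma dil_diff_little_o:
  assumes u: "u \<in> H1r" and W: "integrable lborel (\<lambda>x. (norm x)\<^sup>2 * (cmod (u x))\<^sup>2)" and e: "e > 0"
  shows "\<exists>s0>0. \<forall>s. 0 < s \<and> s < s0 \<longrightarrow> mass (\<lambda>x. dil s u x - u x) \<le> e * s"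
proof -
  have uH: "u \<in> H1" using u by (simp add: H1r_def)
  have [measurable]: "u \<in> borel_measurable borel" using H1_measurable[OF uH] by simp
  define \<delta> where "\<delta> = e / (3 * 162 * (dirichlet u + 1))"
  have \<delta>: "\<delta> > 0" unfolding \<delta>_def using e dirichlet_nonneg[of u] by simp
  have \<delta>A: "162 * \<delta> * dirichlet u \<le> e / 3"
  proof -
    have "162 * \<delta> * dirichlet u \<le> 162 * \<delta> * (dirichlet u + 1)" using \<delta> by simp
    also have "\<dots> = e / 3" unfolding \<delta>_def using dirichlet_nonneg[of u] by (simp add: field_simps)
    finally show ?thesis .
  qed
  define \<tau> where "\<tau> R = (LINT x|lborel. indicator {R<..} (norm x) * ((norm x)\<^sup>2 * (cmod (u x))\<^sup>2))" for R
  have "(\<lambda>n. \<tau> (real n)) \<longlonglongrightarrow> (LINT x|(lborel::space measure). 0)"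
    unfolding \<tau>_def
  proof (rule integral_dominated_convergence[OF _ _ W])
    show "AE x in lborel. (\<lambda>n. indicator {real n<..} (norm x) * ((norm x)\<^sup>2 * (cmod (u x))\<^sup>2)) \<longlonglongrightarrow> 0"
    proof (rule AE_I2)
      fix x :: space
      obtain N where N: "norm x \<le> real N" using real_arch_simple by blast
      have "\<forall>\<^sub>F n in sequentially. indicator {real n<..} (norm x) * ((norm x)\<^sup>2 * (cmod (u x))\<^sup>2) = 0"
        using eventually_ge_at_top[of N] by eventually_elim (use N in \<open>auto simp: indicator_def\<close>)
      then show "(\<lambda>n. indicator {real n<..} (norm x) * ((norm x)\<^sup>2 * (cmod (u x))\<^sup>2)) \<longlonglongrightarrow> 0" by (rule tendsto_eventually)
    qed
  qed (auto simp: indicator_def)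
  then have "\<forall>\<^sub>F n in sequentially. \<tau> (real n) < \<delta> * e / 12" using \<delta> e by (intro order_tendstoD(2)[of _ 0]) auto
  then obtain N where N: "\<tau> (real N) < \<delta> * e / 12" by (auto simp: eventually_sequentially)
  have it: "integrable lborel (\<lambda>x. indicator {R<..} (norm x) * ((norm x)\<^sup>2 * (cmod (u x))\<^sup>2))" for R
    by (rule Bochner_Integration.integrable_bound[OF W]) (auto simp: indicator_def)
  have itm: "integrable lborel (\<lambda>x. indicator {R<..} (norm x) * (cmod (u x))\<^sup>2)" for R
    by (rule Bochner_Integration.integrable_bound[OF L2_integrable[OF H1D(1)[OF uH]]]) (auto simp: indicator_def)
  have tail: "tail_mass R u \<le> (1 / R\<^sup>2) * \<tau> (real N)" if R: "R > 0" "R \<ge> real N" for R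
  proof -
    have "tail_mass R u \<le> (LINT x|lborel. (1 / R\<^sup>2) * (indicator {real N<..} (norm x) * ((norm x)\<^sup>2 * (cmod (u x))\<^sup>2)))"
      unfolding tail_mass_def
    proof (rule integral_mono[OF itm integrable_mult_right[OF it]])
      fix x :: space
      show "indicator {R<..} (norm x) * (cmod (u x))\<^sup>2 \<le> (1 / R\<^sup>2) * (indicator {real N<..} (norm x) * ((norm x)\<^sup>2 * (cmod (u x))\<^sup>2))"
      proof (cases "norm x > R")
        case True
        then have "R\<^sup>2 \<le> (norm x)\<^sup>2" using R by (intro power_mono) auto
        then have "R\<^sup>2 * (cmod (u x))\<^sup>2 \<le> (norm x)\<^sup>2 * (cmod (u x))\<^sup>2" by (rule mult_right_mono) simp
        then show ?thesis using True R by (simp add: pos_le_divide_eq mult.commute)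
      qed simp
    qed
    then show ?thesis by (simp only: integral_mult_right_zero \<tau>_def)
  qed
  \<comment> \<open>The second entry forces \<open>R \<ge> N + 1\<close>; the third makes the term
    with 366 at most \<open>e / 3 * s\<close>.\<close>
  define s0 where "s0 = min 1 (min (\<delta> / (real N + 1)\<^sup>2) (e / (3 * 366 * (mass u + 1))))"
  have s0: "s0 > 0" unfolding s0_def using \<delta> e mass_nonneg[of u] by simp
  show ?thesis
  proof (intro exI[of _ s0] conjI s0 allI impI)
    fix s assume "0 < s \<and> s < s0"
    then have s: "0 < s" "s \<le> 1" "s < \<delta> / (real N + 1)\<^sup>2" "s < e / (3 * 366 * (mass u + 1))" by (auto simp: s0_def)
    define R where "R = sqrt (\<delta> / s)"
    have R: "R > 0" "R\<^sup>2 = \<delta> / s" using \<delta> s by (auto simp: R_def)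
    have "(real N + 1)\<^sup>2 \<le> \<delta> / s" using s(1,3) by (simp add: field_simps)
    then have "real N + 1 \<le> R" unfolding R_def by (rule real_le_rsqrt)
    then have RN: "R \<ge> real N" by simp
    have "mass (\<lambda>x. dil s u x - u x) \<le> 162 * s\<^sup>2 * R\<^sup>2 * dirichlet u + 366 * s\<^sup>2 * mass u + 4 * tail_mass R u"
      by (rule dil_diff_mass[OF u s(1,2) R(1)])
    also have "162 * s\<^sup>2 * R\<^sup>2 * dirichlet u = s * (162 * \<delta> * dirichlet u)" unfolding R using s by (simp add: power2_eq_square)
    also have "\<dots> \<le> s * (e / 3)" using s \<delta>A by (intro mult_left_mono) auto
    also have "366 * s\<^sup>2 * mass u \<le> s * (e / 3)"
    proof -
      have "366 * s * mass u \<le> 366 * s * (mass u + 1)" using s by simp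
      also have "\<dots> \<le> e / 3" using s(4) mass_nonneg[of u] by (simp add: field_simps)
      finally have "s * (366 * s * mass u) \<le> s * (e / 3)" using s by (intro mult_left_mono) auto
      then show ?thesis by (simp add: power2_eq_square algebra_simps)
    qed
    also have "4 * tail_mass R u \<le> s * (e / 3)"
    proof -
      have "tail_mass R u \<le> (1 / R\<^sup>2) * \<tau> (real N)" by (rule tail[OF R(1) RN])
      also have "\<dots> \<le> (1 / R\<^sup>2) * (\<delta> * e / 12)" using N R(1) by (intro mult_left_mono) auto
      also have "\<dots> = s * e / 12" unfolding R using \<delta> s by (simp add: field_simps)
      finally show ?thesis by simp
    qed
    finally show "mass (\<lambda>x. dil s u x - u x) \<le> e * s" by (simp add: field_simps)
  qed
qed


section \<open>The weak equation in real form\<close>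

text \<open>The real part of the tested equation. Estimates use this real form, while the complex
  \<open>weak_residual\<close> is kept for passing to the limit, since the notion of solution is
  complex.\<close>

definition weak_form :: "real \<Rightarrow> real \<Rightarrow> real \<Rightarrow> real \<Rightarrow> (space \<Rightarrow> complex) \<Rightarrow> (space \<Rightarrow> complex) \<Rightarrow> real" where
  "weak_form \<mu> p q lam u v =
     (LINT x|lborel. inner (weak_grad u x) (weak_grad v x)) + lam * (LINT x|lborel. inner (u x) (v x))
     + (LINT x|lborel. coulomb_potential u x * inner (u x) (v x))
     - (LINT x|lborel. cmod (u x) powr (p - 2) * inner (u x) (v x))
     - \<mu> * (LINT x|lborel. cmod (u x) powr (q - 2) * inner (u x) (v x))"

definition weak_residual :: "real \<Rightarrow> real \<Rightarrow> real \<Rightarrow> real \<Rightarrow> (space \<Rightarrow> complex) \<Rightarrow> (space \<Rightarrow> complex) \<Rightarrow> complex" where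
  "weak_residual \<mu> p q lam u v =
     (LINT x|lborel. (\<Sum>i\<in>UNIV. weak_grad u x $ i * cnj (weak_grad v x $ i)))
     + of_real lam * (LINT x|lborel. u x * cnj (v x))
     + (LINT x|lborel. of_real (coulomb_potential u x) * u x * cnj (v x))
     - (LINT x|lborel. of_real (cmod (u x) powr (p - 2)) * u x * cnj (v x))
     - of_real \<mu> * (LINT x|lborel. of_real (cmod (u x) powr (q - 2)) * u x * cnj (v x))"

lemma weak_solution_residual:
  "weak_solution \<mu> p q lam u \<longleftrightarrow> u \<in> H1 \<and> (\<forall>v\<in>H1. weak_residual \<mu> p q lam u v = 0)"
  unfolding weak_solution_def weak_residual_def by (auto simp: algebra_simps)

lemma Re_mult_cnj: "Re (z * cnj w) = inner z w"
  by (simp add: inner_complex_def)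

lemma cmod_powr_step: "2 < t \<Longrightarrow> cmod z powr (t - 2) * cmod z = cmod z powr (t - 1)"
proof (cases "z = 0")
  case False
  assume "2 < t"
  have "cmod z powr (t - 2) * cmod z powr 1 = cmod z powr (t - 1)" unfolding powr_add[symmetric] by simp
  then show ?thesis using False by simp
qed simp

lemma cmod_powr_square: "2 < t \<Longrightarrow> cmod z powr (t - 2) * (cmod z)\<^sup>2 = cmod z powr t"
proof (cases "z = 0")
  case False
  assume "2 < t"
  have "cmod z powr (t - 2) * cmod z powr 2 = cmod z powr t" unfolding powr_add[symmetric] by simp
  then show ?thesis using False by (simp add: powr_numeral)
qed simp

lemma borel_measurable_cnj[measurable (raw)]:
  assumes "f \<in> borel_measurable M" shows "(\<lambda>x. cnj (f x)) \<in> borel_measurable M"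
proof -
  have "cnj \<in> borel_measurable borel" by (intro borel_measurable_continuous_onI continuous_intros)
  from measurable_compose[OF assms this] show ?thesis .
qed

text \<open>Taking real parts under an integral is justified only for integrable functions:
  otherwise the complex integral is 0 by default while its real part may still be integrable. Hence
  the two integrability hypotheses on the power terms; the other terms follow from L2 and
  decay.\<close>

lemma Re_weak_residual:
  assumes u: "u \<in> H1" "decay_bound C u" and v: "v \<in> H1" and pq: "2 < p" "2 < q"
    and ip: "integrable lborel (\<lambda>x. cmod (u x) powr (p - 1) * cmod (v x))"
    and iq: "integrable lborel (\<lambda>x. cmod (u x) powr (q - 1) * cmod (v x))"
  shows "Re (weak_residual \<mu> p q lam u v) = weak_form \<mu> p q lam u v"
proof -
  have [measurable]: "u \<in> borel_measurable borel" "v \<in> borel_measurable borel"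
    "weak_grad u \<in> borel_measurable borel" "weak_grad v \<in> borel_measurable borel" "coulomb_potential u \<in> borel_measurable borel"
    using H1_measurable[OF u(1)] H1_measurable[OF v] weak_grad_measurable[OF u(1)] weak_grad_measurable[OF v]
      coulomb_potential_measurable[OF H1D(1)[OF u(1)]] by auto
  have i1: "integrable lborel (\<lambda>x. \<Sum>i\<in>UNIV. weak_grad u x $ i * cnj (weak_grad v x $ i))"
  proof (rule L2_product_integrable[OF H1D(2)[OF u(1)] H1D(2)[OF v]])
    show "(\<lambda>x. \<Sum>i\<in>UNIV. weak_grad u x $ i * cnj (weak_grad v x $ i)) \<in> borel_measurable lborel" by measurable
    fix x
    have "norm (\<Sum>i\<in>UNIV. weak_grad u x $ i * cnj (weak_grad v x $ i)) \<le> (\<Sum>i\<in>UNIV. \<bar>norm (weak_grad u x $ i)\<bar> * \<bar>norm (weak_grad v x $ i)\<bar>)"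
      by (rule order_trans[OF norm_sum]) (simp add: norm_mult)
    also have "\<dots> \<le> norm (weak_grad u x) * norm (weak_grad v x)"
      using L2_set_mult_ineq[of "\<lambda>i. norm (weak_grad u x $ i)" "\<lambda>i. norm (weak_grad v x $ i)" UNIV] by (simp add: norm_vec_def)
    finally show "norm (\<Sum>i\<in>UNIV. weak_grad u x $ i * cnj (weak_grad v x $ i)) \<le> norm (weak_grad u x) * norm (weak_grad v x)" .
  qed
  have i2: "integrable lborel (\<lambda>x. u x * cnj (v x))"
    by (rule L2_product_integrable[OF H1D(1)[OF u(1)] H1D(1)[OF v]]) (auto simp: norm_mult)
  have i3: "integrable lborel (\<lambda>x. of_real (coulomb_potential u x) * u x * cnj (v x))"
    by (rule coulomb_L2_integrable[OF u(2) H1D(1)[OF u(1)] H1D(1)[OF v]])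
      (auto simp: norm_mult coulomb_potential_nonneg mult.assoc)
  have i4: "integrable lborel (\<lambda>x. of_real (cmod (u x) powr (t - 2)) * u x * cnj (v x))"
    if "2 < t" "integrable lborel (\<lambda>x. cmod (u x) powr (t - 1) * cmod (v x))" for t
    by (rule Bochner_Integration.integrable_bound[OF that(2)]) (auto simp: norm_mult cmod_powr_step[OF that(1), symmetric])
  have r1: "Re (\<Sum>i\<in>UNIV. weak_grad u x $ i * cnj (weak_grad v x $ i)) = inner (weak_grad u x) (weak_grad v x)" for x
    by (simp add: inner_vec_def inner_complex_def)
  have r3: "inner (of_real c * z) w = c * inner z w" for c and z w :: complex
    by (simp add: inner_complex_def algebra_simps)
  have r5: "Re (of_real c * z) = c * Re z" for c z by simp
  show ?thesis
    unfolding weak_residual_def weak_form_def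
    by (simp only: minus_complex.sel plus_complex.sel r5 integral_Re[OF i1, symmetric] integral_Re[OF i2, symmetric]
        integral_Re[OF i3, symmetric] integral_Re[OF i4[OF pq(1) ip], symmetric] integral_Re[OF i4[OF pq(2) iq], symmetric]
        r1 Re_mult_cnj r3)
qed

lemma decay_nonlinear_integrable:
  assumes u: "decay_bound C u" and v: "decay_bound D v" and t: "2 < t" "t < 6"
  shows "integrable lborel (\<lambda>x. cmod (u x) powr (t - 1) * cmod (v x))"
proof -
  have [measurable]: "u \<in> borel_measurable borel" "v \<in> borel_measurable borel"
    using u v L2_measurable by (auto simp: decay_bound_def)
  have "integrable lborel (\<lambda>x. cmod (u x) powr t + cmod (v x) powr t)"
    using t by (intro Bochner_Integration.integrable_add decay_power_integral(1)[OF u, of t 1] decay_power_integral(1)[OF v, of t 1]) auto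
  then show ?thesis
    by (rule Bochner_Integration.integrable_bound) (use t in \<open>auto intro!: AE_I2 powr_young\<close>)
qed

lemma weak_form_eq_0:
  assumes ws: "weak_solution \<mu> p q lam u" and u: "decay_bound C u" and v: "v \<in> H1" "decay_bound D v"
    and pq: "2 < p" "p < 6" "2 < q" "q < 6"
  shows "weak_form \<mu> p q lam u v = 0"
proof -
  have uH: "u \<in> H1" and r: "weak_residual \<mu> p q lam u v = 0" using ws v by (auto simp: weak_solution_residual)
  have "Re (weak_residual \<mu> p q lam u v) = weak_form \<mu> p q lam u v"
    by (rule Re_weak_residual[OF uH u v(1) pq(1,3) decay_nonlinear_integrable[OF u v(2) pq(1,2)] decay_nonlinear_integrable[OF u v(2) pq(3,4)]])
  with r show ?thesis by simp
qed

section \<open>Solutions have finite second moment\<close>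

lemma Dk_const: "Dk I k (\<lambda>_. c)"
proof (induction k arbitrary: c)
  case (Suc k)
  show ?case by (rule Dk_SucI[of I "\<lambda>_. c" "\<lambda>_. 0" k, OF _ Suc]) auto
qed auto

lemma Dk_shift_powr: "Dk {- d<..} m (\<lambda>t. c * (t + d) powr r)"
proof (induction m arbitrary: c r)
  case 0
  then show ?case by (auto intro!: continuous_intros)
next
  case (Suc m)
  have "((\<lambda>t. c * (t + d) powr r) has_real_derivative (c * r) * (t + d) powr (r - 1)) (at t)" if "t \<in> {- d<..}" for t
    using that by (auto intro!: derivative_eq_intros simp: powr_diff)
  then show ?case by (rule Dk_SucI[OF _ Suc])
qed

text \<open>Formulated for large \<open>r\<close>; small radii and small masses are reached through
  the reciprocal.\<close>

lemma tail_weight_small: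
  fixes c s \<eta> :: real
  assumes "s > 0" "\<eta> > 0" "c \<ge> 0"
  shows "\<exists>R\<ge>1. \<forall>r\<ge>R. c * r powr (- s) \<le> \<eta>"
proof -
  have "((\<lambda>r. c * r powr (- s)) \<longlongrightarrow> c * 0) at_top"
    by (intro tendsto_mult tendsto_const tendsto_neg_powr filterlim_ident) (use assms in auto)
  then have "\<forall>\<^sub>F r in at_top. c * r powr (- s) < \<eta>" using assms by (intro order_tendstoD(2)) auto
  then obtain N where "\<And>r. r \<ge> N \<Longrightarrow> c * r powr (- s) < \<eta>" by (auto simp: eventually_at_top_linorder)
  then show ?thesis by (intro exI[of _ "max 1 N"]) (auto intro: less_imp_le)
qed

lemma decay_power_outside:
  assumes "cmod z \<le> C * norm x powr (- 1 / 2)" "2 < t" "C powr (t - 2) * norm x powr (- ((t - 2) / 2)) \<le> \<eta>"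
  shows "cmod z powr (t - 2) \<le> \<eta>"
proof (cases "z = 0")
  case True
  have "0 \<le> C powr (t - 2) * norm x powr (- ((t - 2) / 2))" by simp
  from order_trans[OF this assms(3)] show ?thesis using True by simp
next
  case False
  then have p: "C * norm x powr (- 1 / 2) > 0" using assms(1) by (meson less_le_trans zero_less_norm_iff)
  then have C: "C > 0" by (simp add: zero_less_mult_iff)
  have "cmod z powr (t - 2) \<le> (C * norm x powr (- 1 / 2)) powr (t - 2)" using assms by (intro powr_mono2) auto
  also have "\<dots> = C powr (t - 2) * norm x powr (- ((t - 2) / 2))"
    using C by (simp add: powr_mult powr_powr algebra_simps)
  finally show ?thesis using assms(3) by simp
qed

text \<open>A bounded smooth substitute for \<open>\<bar>x\<bar>\<^sup>2\<close>, increasing to it as \<open>d\<close> grows, so that its product with \<open>u\<close> is an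
  admissible test function.\<close>

definition trunc_sq :: "real \<Rightarrow> space \<Rightarrow> real" where
  "trunc_sq d x = d * (norm x)\<^sup>2 / ((norm x)\<^sup>2 + d)"

lemma trunc_sq_bounds:
  assumes "d > 0" shows "0 \<le> trunc_sq d x" "trunc_sq d x \<le> d" "trunc_sq d x \<le> (norm x)\<^sup>2"
proof -
  have p: "(norm x)\<^sup>2 + d > 0" using assms by (simp add: add_nonneg_pos)
  show "0 \<le> trunc_sq d x" unfolding trunc_sq_def using assms by (intro divide_nonneg_nonneg) auto
  show "trunc_sq d x \<le> d" "trunc_sq d x \<le> (norm x)\<^sup>2"
    unfolding trunc_sq_def using assms p by (auto simp: pos_divide_le_eq algebra_simps)
qed

lemma trunc_sq_smooth:
  assumes "d > 0" shows "Ck k (trunc_sq d)"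
    and "partial i (trunc_sq d) x = 2 * (x $ i) * (d\<^sup>2 / ((norm x)\<^sup>2 + d)\<^sup>2)"
proof -
  define h where "h t = d + (- d\<^sup>2) * (t + d) powr (- 1)" for t
  have Dk: "Dk {- d<..} k h" for k unfolding h_def[abs_def] by (intro Dk_add Dk_const Dk_shift_powr)
  have eq: "trunc_sq d x = h ((norm x)\<^sup>2)" for x
  proof -
    have p: "(norm x)\<^sup>2 + d > 0" using assms by (simp add: add_nonneg_pos)
    then show ?thesis by (simp add: trunc_sq_def h_def powr_minus_divide field_simps power2_eq_square)
  qed
  show "Ck k (trunc_sq d)" unfolding eq[abs_def]
    by (rule Ck_compose[OF Dk Ck_norm_sq]) (use assms in \<open>auto intro: less_le_trans[of _ 0]\<close>)
  have p: "(norm x)\<^sup>2 + d > 0" using assms by (simp add: add_nonneg_pos)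
  have "(h has_real_derivative (- d\<^sup>2) * ((- 1) * ((norm x)\<^sup>2 + d) powr (- 1 - 1))) (at ((norm x)\<^sup>2))"
  proof -
    have "((\<lambda>t. (t + d) powr (- 1)) has_real_derivative (- 1) * ((norm x)\<^sup>2 + d) powr (- 1 - 1) * (1 + 0)) (at ((norm x)\<^sup>2))"
      by (rule DERIV_chain2[OF has_real_derivative_powr[OF p] DERIV_add[OF DERIV_ident DERIV_const]])
    from DERIV_add[OF DERIV_const[of d] DERIV_cmult[OF this, of "- d\<^sup>2"]]
    show ?thesis unfolding h_def[abs_def] by (simp only: mult_1_right add_0_left add_0_right)
  qed
  moreover have "(- d\<^sup>2) * ((- 1) * ((norm x)\<^sup>2 + d) powr (- 1 - 1)) = d\<^sup>2 / ((norm x)\<^sup>2 + d)\<^sup>2"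
    using p by (simp add: powr_minus_divide powr_numeral)
  ultimately have h': "(h has_derivative (*) (d\<^sup>2 / ((norm x)\<^sup>2 + d)\<^sup>2)) (at ((norm x)\<^sup>2))"
    by (simp add: has_field_derivative_def)
  have n: "((\<lambda>x. (norm x)\<^sup>2) has_derivative (\<lambda>v. 2 * inner x v)) (at (x::space))"
    unfolding power2_norm_eq_inner by (auto intro!: derivative_eq_intros simp: inner_commute)
  have "(trunc_sq d has_derivative (\<lambda>v. d\<^sup>2 / ((norm x)\<^sup>2 + d)\<^sup>2 * (2 * inner x v))) (at x)"
    unfolding eq[abs_def] by (rule has_derivative_compose[OF n h'])
  from partial_has_derivative[OF this, of i]
  show "partial i (trunc_sq d) x = 2 * (x $ i) * (d\<^sup>2 / ((norm x)\<^sup>2 + d)\<^sup>2)" by (simp add: inner_axis)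
qed

text \<open>The truncation keeps the property of \<open>|x|^2\<close> that its squared gradient is
  at most four times the function: with \<open>q = d / (|x|^2 + d)\<close> in the unit interval, the
  left side is \<open>|x|^2 q^4\<close> and the right side \<open>|x|^2 q\<close>.\<close>

lemma trunc_sq_gradient_le:
  assumes "d > 0" shows "(norm x * (d\<^sup>2 / ((norm x)\<^sup>2 + d)\<^sup>2))\<^sup>2 \<le> trunc_sq d x"
proof -
  let ?q = "d / ((norm x)\<^sup>2 + d)"
  have p: "(norm x)\<^sup>2 + d > 0" using assms by (simp add: add_nonneg_pos)
  have q: "0 \<le> ?q" "?q \<le> 1" using assms p by (auto simp: pos_divide_le_eq)
  have "(norm x * (d\<^sup>2 / ((norm x)\<^sup>2 + d)\<^sup>2))\<^sup>2 = (norm x)\<^sup>2 * ?q ^ 4"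
    by (simp add: power_mult_distrib power_divide flip: power_mult)
  also have "\<dots> \<le> (norm x)\<^sup>2 * ?q ^ 1" using q by (intro mult_left_mono power_decreasing) auto
  also have "\<dots> = trunc_sq d x" by (simp add: trunc_sq_def)
  finally show ?thesis .
qed

text \<open>The product rule gives \<open>trunc_sq d\<close> times the squared gradient and a cross
  term. The previous estimate lets the first absorb the cross term up to
  \<open>|u|^2\<close>.\<close>

lemma trunc_sq_mult:
  assumes u: "u \<in> H1" and d: "d > 0"
  defines "v \<equiv> \<lambda>x. trunc_sq d x *\<^sub>R u x"
  shows "v \<in> H1" "AE x in lborel. inner (weak_grad u x) (weak_grad v x) \<ge> - (cmod (u x))\<^sup>2"
proof -
  let ?g = "weak_grad u"
  define c where "c x = d\<^sup>2 / ((norm x)\<^sup>2 + d)\<^sup>2" for x :: space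
  have c: "c x \<ge> 0" for x by (simp add: c_def)
  define G where "G x = (\<chi> i. trunc_sq d x *\<^sub>R (?g x $ i) + partial i (trunc_sq d) x *\<^sub>R u x)" for x
  have [measurable]: "u \<in> borel_measurable borel" "?g \<in> borel_measurable borel"
    using H1_measurable[OF u] weak_grad_measurable[OF u] by auto
  have [measurable]: "trunc_sq d \<in> borel_measurable borel" unfolding trunc_sq_def[abs_def] by measurable
  have [measurable]: "partial i (trunc_sq d) \<in> borel_measurable borel" for i
    unfolding trunc_sq_smooth(2)[OF d, abs_def] by measurable
  note b = trunc_sq_bounds[OF d]
  have b2: "(norm x * c x)\<^sup>2 \<le> trunc_sq d x" for x unfolding c_def by (rule trunc_sq_gradient_le[OF d])
  have vL2: "v \<in> L2" unfolding v_def
    by (rule L2_bound[OF H1D(1)[OF u], where c=d]) (use b in \<open>auto intro!: AE_I2 mult_right_mono\<close>)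
  have GL2: "G \<in> L2"
  proof (rule L2_vec)
    fix i
    have "(\<lambda>x. trunc_sq d x *\<^sub>R (?g x $ i)) \<in> L2"
      by (rule L2_bound[OF L2_component[OF H1D(2)[OF u]], where c=d]) (use b in \<open>auto intro!: AE_I2 mult_right_mono\<close>)
    moreover have "(\<lambda>x. partial i (trunc_sq d) x *\<^sub>R u x) \<in> L2"
    proof (rule L2_bound[OF H1D(1)[OF u], where c="2 * sqrt d"])
      show "AE x in lborel. cmod (partial i (trunc_sq d) x *\<^sub>R u x) \<le> 2 * sqrt d * cmod (u x)"
      proof (rule AE_I2)
        fix x
        have "norm x * c x \<le> sqrt d" using b2[of x] b(2)[of x] by (intro real_le_rsqrt) simp
        moreover have "\<bar>x $ i\<bar> * c x \<le> norm x * c x" using c component_le_norm_cart[of x i] by (intro mult_right_mono) auto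
        ultimately have "\<bar>partial i (trunc_sq d) x\<bar> \<le> 2 * sqrt d"
          unfolding trunc_sq_smooth(2)[OF d] c_def[symmetric] using c[of x] by (simp add: abs_mult)
        then show "cmod (partial i (trunc_sq d) x *\<^sub>R u x) \<le> 2 * sqrt d * cmod (u x)" by (simp add: mult_right_mono)
      qed
    qed measurable
    ultimately show "(\<lambda>x. G x $ i) \<in> L2" unfolding G_def using L2_add by simp
  qed
  have hw: "has_weak_gradient v G" unfolding v_def G_def
    by (rule has_weak_gradient_smooth_mult[OF H1D[OF u] trunc_sq_smooth(1)[OF d]])
  note H = H1I[OF vL2 GL2 hw]
  show "v \<in> H1" by (rule H)
  show "AE x in lborel. inner (?g x) (weak_grad v x) \<ge> - (cmod (u x))\<^sup>2"
    using H(2)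
  proof eventually_elim
    case (elim x)
    let ?S = "\<Sum>i\<in>UNIV. (x $ i) *\<^sub>R (?g x $ i)"
    have "inner (?g x) (G x) = trunc_sq d x * (norm (?g x))\<^sup>2 + 2 * c x * inner ?S (u x)"
    proof -
      have pc: "partial i (trunc_sq d) x = 2 * (x $ i) * c x" for i unfolding c_def by (rule trunc_sq_smooth(2)[OF d])
      have "(norm (?g x))\<^sup>2 = (\<Sum>i\<in>UNIV. inner (?g x $ i) (?g x $ i))" by (simp add: power2_norm_eq_inner inner_vec_def)
      then show ?thesis unfolding G_def inner_vec_def pc
        by (simp add: inner_add_right sum.distrib inner_sum_left sum_distrib_left mult_ac)
    qed
    moreover have "\<bar>2 * c x * inner ?S (u x)\<bar> \<le> trunc_sq d x * (norm (?g x))\<^sup>2 + (cmod (u x))\<^sup>2"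
    proof -
      have "\<bar>inner ?S (u x)\<bar> \<le> norm x * norm (?g x) * cmod (u x)"
        by (rule order_trans[OF Cauchy_Schwarz_ineq2 mult_right_mono[OF norm_radial_sum]]) simp
      then have "\<bar>2 * c x * inner ?S (u x)\<bar> \<le> 2 * c x * (norm x * norm (?g x) * cmod (u x))"
        using c[of x] by (simp add: abs_mult mult_left_mono)
      also have "\<dots> = 2 * (norm x * c x * norm (?g x)) * cmod (u x)" by simp
      also have "\<dots> \<le> (norm x * c x * norm (?g x))\<^sup>2 + (cmod (u x))\<^sup>2" by (rule sum_squares_bound)
      also have "(norm x * c x * norm (?g x))\<^sup>2 \<le> trunc_sq d x * (norm (?g x))\<^sup>2"
        unfolding power_mult_distrib[of "norm x * c x"] using b2 by (rule mult_right_mono) simp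
      finally show ?thesis by simp
    qed
    ultimately show ?case unfolding elim by linarith
  qed
qed


text \<open>Outside the ball the power is a small coefficient that the multiplier can absorb;
  inside, the weight is at most \<open>R^2\<close>, whatever the truncation
  \<open>d\<close>.\<close>

lemma weighted_power_le:
  assumes dec: "cmod z \<le> C * norm x powr (- 1 / 2)" and t: "2 < t" and d: "d > 0" and R: "R \<ge> 1"
    and small: "\<And>r. r \<ge> R \<Longrightarrow> C powr (t - 2) * r powr (- ((t - 2) / 2)) \<le> \<eta>"
  shows "cmod z powr (t - 2) * (trunc_sq d x * (cmod z)\<^sup>2) \<le> \<eta> * (trunc_sq d x * (cmod z)\<^sup>2) + R\<^sup>2 * cmod z powr t"
proof (cases "norm x \<ge> R")
  case True
  have "cmod z powr (t - 2) \<le> \<eta>" by (rule decay_power_outside[OF dec t small[OF True]])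
  then have "cmod z powr (t - 2) * (trunc_sq d x * (cmod z)\<^sup>2) \<le> \<eta> * (trunc_sq d x * (cmod z)\<^sup>2)"
    using trunc_sq_bounds(1)[OF d] by (intro mult_right_mono) auto
  then show ?thesis by (simp add: add_increasing2)
next
  case False
  have "0 \<le> C powr (t - 2) * R powr (- ((t - 2) / 2))" by simp
  also have "\<dots> \<le> \<eta>" by (rule small) simp
  finally have \<eta>: "0 \<le> \<eta> * (trunc_sq d x * (cmod z)\<^sup>2)" using trunc_sq_bounds(1)[OF d] by simp
  have "trunc_sq d x \<le> R\<^sup>2" using trunc_sq_bounds(3)[OF d, of x] power_mono[of "norm x" R 2] False by auto
  then have "trunc_sq d x * cmod z powr t \<le> R\<^sup>2 * cmod z powr t" by (rule mult_right_mono) simp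
  moreover have "cmod z powr (t - 2) * (trunc_sq d x * (cmod z)\<^sup>2) = trunc_sq d x * cmod z powr t"
    unfolding cmod_powr_square[OF t, symmetric] by simp
  ultimately show ?thesis using \<eta> by linarith
qed

text \<open>The equation is tested with \<open>trunc_sq d\<close> times \<open>u\<close>. The
  gradient term costs at most the mass, the Coulomb term has a good sign, and far out decay reduces
  each nonlinear term to a quarter of the multiplier term. Half of that term survives with a bound
  free of \<open>d\<close>, and Fatou's lemma removes the truncation.\<close>

lemma second_moment_integrable:
  assumes u: "u \<in> H1r" and ws: "weak_solution \<mu> p q lam u" and pos: "lam > 0" "\<mu> > 0"
    and pq: "2 < p" "p < 6" "2 < q" "q < 6"
  shows "integrable lborel (\<lambda>x. (norm x)\<^sup>2 * (cmod (u x))\<^sup>2)"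
proof -
  have uH: "u \<in> H1" using u by (simp add: H1r_def)
  define C where "C = sqrt (dirichlet u)"
  have dec: "decay_bound C u" unfolding C_def by (rule H1r_decay[OF u])
  have [measurable]: "u \<in> borel_measurable borel" using H1_measurable[OF uH] by simp
  obtain R1 where R1: "R1 \<ge> 1" "\<And>r. r \<ge> R1 \<Longrightarrow> C powr (p - 2) * r powr (- ((p - 2) / 2)) \<le> lam / 4"
    using tail_weight_small[of "(p - 2) / 2" "lam / 4" "C powr (p - 2)"] pos pq by auto
  obtain R2 where R2: "R2 \<ge> 1" "\<And>r. r \<ge> R2 \<Longrightarrow> C powr (q - 2) * r powr (- ((q - 2) / 2)) \<le> lam / (4 * \<mu>)"
    using tail_weight_small[of "(q - 2) / 2" "lam / (4 * \<mu>)" "C powr (q - 2)"] pos pq by auto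
  note ip = decay_power_integral(1)[OF dec, of _ 1]
  define B where "B = 2 / lam * (mass u + R1\<^sup>2 * (LINT x|lborel. cmod (u x) powr p) + \<mu> * (R2\<^sup>2 * (LINT x|lborel. cmod (u x) powr q)))"
  have bound: "(\<integral>\<^sup>+x. ennreal (trunc_sq d x * (cmod (u x))\<^sup>2) \<partial>lborel) \<le> ennreal B" if d: "d > 0" for d
  proof -
    define v where "v x = trunc_sq d x *\<^sub>R u x" for x
    note b = trunc_sq_bounds[OF d]
    have [measurable]: "trunc_sq d \<in> borel_measurable borel" unfolding trunc_sq_def[abs_def] by measurable
    have vH: "v \<in> H1" and gr: "AE x in lborel. inner (weak_grad u x) (weak_grad v x) \<ge> - (cmod (u x))\<^sup>2"
      using trunc_sq_mult[OF uH d] unfolding v_def[abs_def] by auto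
    have vd: "decay_bound (d * C) v"
      unfolding decay_bound_def
    proof (intro conjI)
      show "0 \<le> d * C" using d by (simp add: C_def dirichlet_nonneg)
      show "v \<in> L2" by (rule H1D(1)[OF vH])
      have "AE x in lborel. cmod (u x) \<le> C * norm x powr (- 1 / 2)" using dec by (simp add: decay_bound_def)
      then show "AE x in lborel. cmod (v x) \<le> d * C * norm x powr (- 1 / 2)"
      proof eventually_elim
        case (elim x)
        have "trunc_sq d x * cmod (u x) \<le> d * (C * norm x powr (- 1 / 2))" using b d elim by (intro mult_mono) auto
        then show ?case using b by (simp add: v_def mult.assoc)
      qed
    qed
    have inn: "inner (u x) (v x) = trunc_sq d x * (cmod (u x))\<^sup>2" for x by (simp add: v_def power2_norm_eq_inner)
    define M where "M = (LINT x|lborel. trunc_sq d x * (cmod (u x))\<^sup>2)"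
    have iM: "integrable lborel (\<lambda>x. trunc_sq d x * (cmod (u x))\<^sup>2)"
      using L2_inner(1)[OF H1D(1)[OF uH] H1D(1)[OF vH]] unfolding inn .
    have wf: "weak_form \<mu> p q lam u v = 0" by (rule weak_form_eq_0[OF ws dec vH vd pq])
    have g: "(LINT x|lborel. inner (weak_grad u x) (weak_grad v x)) \<ge> - mass u"
      unfolding mass_def integral_minus[symmetric]
      by (rule integral_mono_AE) (use L2_inner(1)[OF H1D(2)[OF uH] H1D(2)[OF vH]] L2_integrable[OF H1D(1)[OF uH]] gr in auto)
    have c: "0 \<le> (LINT x|lborel. coulomb_potential u x * inner (u x) (v x))"
      unfolding inn using b coulomb_potential_nonneg by (intro Bochner_Integration.integral_nonneg) auto
    have nl: "(LINT x|lborel. cmod (u x) powr (t - 2) * inner (u x) (v x)) \<le> \<eta> * M + R\<^sup>2 * (LINT x|lborel. cmod (u x) powr t)"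
      if t: "2 < t" "t < 6" and R: "R \<ge> 1" and small: "\<And>r. r \<ge> R \<Longrightarrow> C powr (t - 2) * r powr (- ((t - 2) / 2)) \<le> \<eta>" for t R \<eta>
    proof -
      have AE1: "AE x in lborel. cmod (u x) powr (t - 2) * inner (u x) (v x) \<le> \<eta> * (trunc_sq d x * (cmod (u x))\<^sup>2) + R\<^sup>2 * cmod (u x) powr t"
      proof -
        have "AE x in lborel. cmod (u x) \<le> C * norm x powr (- 1 / 2)" using dec by (simp add: decay_bound_def)
        then show ?thesis
        proof eventually_elim
          case (elim x)
          show ?case unfolding inn by (rule weighted_power_le[OF elim t(1) d R small])
        qed
      qed
      have it: "integrable lborel (\<lambda>x. cmod (u x) powr t)" using ip[of t] t by simp
      have "integrable lborel (\<lambda>x. cmod (u x) powr (t - 2) * inner (u x) (v x))"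
      proof (rule Bochner_Integration.integrable_bound)
        show "integrable lborel (\<lambda>x. d * cmod (u x) powr t)" using it by simp
        show "(\<lambda>x. cmod (u x) powr (t - 2) * inner (u x) (v x)) \<in> borel_measurable lborel" unfolding inn by measurable
        show "AE x in lborel. norm (cmod (u x) powr (t - 2) * inner (u x) (v x)) \<le> norm (d * cmod (u x) powr t)"
          unfolding inn cmod_powr_square[OF t(1), symmetric] using b d
          by (auto simp: abs_mult mult_ac intro!: AE_I2 mult_left_mono mult_right_mono)
      qed
      then have "(LINT x|lborel. cmod (u x) powr (t - 2) * inner (u x) (v x)) \<le> (LINT x|lborel. \<eta> * (trunc_sq d x * (cmod (u x))\<^sup>2) + R\<^sup>2 * cmod (u x) powr t)"
        by (rule integral_mono_AE) (use iM it AE1 in auto)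
      also have "\<dots> = \<eta> * M + R\<^sup>2 * (LINT x|lborel. cmod (u x) powr t)" unfolding M_def using iM it by simp
      finally show ?thesis .
    qed
    have M: "(LINT x|lborel. inner (u x) (v x)) = M" unfolding inn M_def ..
    have "lam * M \<le> mass u + (lam / 4 * M + R1\<^sup>2 * (LINT x|lborel. cmod (u x) powr p)) + \<mu> * (lam / (4 * \<mu>) * M + R2\<^sup>2 * (LINT x|lborel. cmod (u x) powr q))"
    proof -
      have "\<mu> * (LINT x|lborel. cmod (u x) powr (q - 2) * inner (u x) (v x)) \<le> \<mu> * (lam / (4 * \<mu>) * M + R2\<^sup>2 * (LINT x|lborel. cmod (u x) powr q))"
        using nl[OF pq(3,4) R2] pos by (intro mult_left_mono) auto
      then show ?thesis using wf g c nl[OF pq(1,2) R1] unfolding weak_form_def M by linarith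
    qed
    moreover have "\<mu> * (lam / (4 * \<mu>) * M) = lam / 4 * M" using pos by simp
    ultimately have "lam / 2 * M \<le> mass u + R1\<^sup>2 * (LINT x|lborel. cmod (u x) powr p) + \<mu> * (R2\<^sup>2 * (LINT x|lborel. cmod (u x) powr q))"
      unfolding distrib_left[of \<mu>] by linarith
    then have "M \<le> B" unfolding B_def using pos by (simp add: field_simps)
    moreover have "(\<integral>\<^sup>+x. ennreal (trunc_sq d x * (cmod (u x))\<^sup>2) \<partial>lborel) = ennreal M"
      unfolding M_def by (rule nn_integral_eq_integral[OF iM]) (use b in auto)
    ultimately show ?thesis by (simp add: ennreal_leI)
  qed
  have lim: "(\<lambda>n. trunc_sq (real (Suc n)) x) \<longlonglongrightarrow> (norm x)\<^sup>2" for x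
  proof -
    have "(\<lambda>n. (norm x)\<^sup>2 - (norm x)\<^sup>2 * (norm x)\<^sup>2 / ((norm x)\<^sup>2 + real (Suc n))) \<longlonglongrightarrow> (norm x)\<^sup>2 - 0"
      by (intro tendsto_diff tendsto_const tendsto_divide_0[OF tendsto_const] filterlim_at_top_imp_at_infinity
          filterlim_tendsto_add_at_top[OF tendsto_const] filterlim_compose[OF filterlim_real_sequentially filterlim_Suc])
    moreover have "trunc_sq (real (Suc n)) x = (norm x)\<^sup>2 - (norm x)\<^sup>2 * (norm x)\<^sup>2 / ((norm x)\<^sup>2 + real (Suc n))" for n
    proof -
      have "(norm x)\<^sup>2 + real (Suc n) > 0" by (simp add: add_nonneg_pos)
      then show ?thesis unfolding trunc_sq_def by (simp add: field_simps)
    qed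
    ultimately show ?thesis by simp
  qed
  have [measurable]: "trunc_sq d \<in> borel_measurable borel" for d unfolding trunc_sq_def[abs_def] by measurable
  have "(\<integral>\<^sup>+x. ennreal ((norm x)\<^sup>2 * (cmod (u x))\<^sup>2) \<partial>lborel) = (\<integral>\<^sup>+x. liminf (\<lambda>n. ennreal (trunc_sq (real (Suc n)) x * (cmod (u x))\<^sup>2)) \<partial>lborel)"
  proof (rule nn_integral_cong)
    fix x
    have "(\<lambda>n. ennreal (trunc_sq (real (Suc n)) x * (cmod (u x))\<^sup>2)) \<longlonglongrightarrow> ennreal ((norm x)\<^sup>2 * (cmod (u x))\<^sup>2)"
      by (intro tendsto_ennrealI tendsto_mult lim tendsto_const)
    from lim_imp_Liminf[OF _ this] show "ennreal ((norm x)\<^sup>2 * (cmod (u x))\<^sup>2) = liminf (\<lambda>n. ennreal (trunc_sq (real (Suc n)) x * (cmod (u x))\<^sup>2))" by simp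
  qed
  also have "\<dots> \<le> liminf (\<lambda>n. \<integral>\<^sup>+x. ennreal (trunc_sq (real (Suc n)) x * (cmod (u x))\<^sup>2) \<partial>lborel)"
    by (rule nn_integral_liminf) measurable
  also have "\<dots> \<le> liminf (\<lambda>n::nat. ennreal B)"
    by (intro Liminf_mono always_eventually allI bound) simp
  also have "\<dots> = ennreal B" by (rule Liminf_const) simp
  finally have "(\<integral>\<^sup>+x. ennreal ((norm x)\<^sup>2 * (cmod (u x))\<^sup>2) \<partial>lborel) < \<infinity>" by (simp add: le_less_trans)
  then show ?thesis by (intro integrableI_nonneg) auto
qed


section \<open>The Pohozaev identity\<close>

lemma decay_mono:
  assumes "decay_bound C u" "C \<le> D" shows "decay_bound D u"
proof -
  have "AE x in lborel. cmod (u x) \<le> C * norm x powr (- 1 / 2)" using assms by (simp add: decay_bound_def)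
  then have "AE x in lborel. cmod (u x) \<le> D * norm x powr (- 1 / 2)"
  proof eventually_elim
    case (elim x)
    show ?case by (rule order_trans[OF elim mult_right_mono[OF assms(2)]]) simp
  qed
  then show ?thesis using assms by (auto simp: decay_bound_def)
qed

text \<open>The powers of \<open>u\<close> and \<open>v\<close> are bounded by a multiple of
  \<open>|x| powr (- s)\<close> with \<open>s < 2\<close>, so a small splitting radius
  \<open>1 / R\<close> makes the gradient coefficient at most \<open>\<eta>\<close>, at the price of
  a large mass coefficient. The functions enter only through \<open>E\<close>, hence
  \<open>L\<close> is uniform.\<close>

lemma decay_quadratic:
  assumes E: "E \<ge> 0" and t: "2 < t" "t < 6" and \<eta>: "\<eta> > 0"
  shows "\<exists>L\<ge>0. \<forall>u v w. decay_bound E u \<and> decay_bound E v \<and> w \<in> H1r \<longrightarrow>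
    integrable lborel (\<lambda>x. (cmod (u x) powr (t - 2) + cmod (v x) powr (t - 2)) * (cmod (w x))\<^sup>2) \<and>
    (LINT x|lborel. (cmod (u x) powr (t - 2) + cmod (v x) powr (t - 2)) * (cmod (w x))\<^sup>2) \<le> \<eta> * dirichlet w + L * mass w"
proof -
  define s where "s = (t - 2) / 2"
  have s: "0 \<le> s" "s < 2" using t by (auto simp: s_def)
  define c where "c = 2 * E powr (t - 2)"
  have c: "c \<ge> 0" by (simp add: c_def)
  obtain R where R: "R \<ge> 1" "c * ball_const (s + 1) * R powr (- (2 - s)) \<le> \<eta>"
    using tail_weight_small[of "2 - s" \<eta> "c * ball_const (s + 1)"] s \<eta> c ball_const_nonneg[of "s + 1"] by auto
  define \<rho> where "\<rho> = 1 / R"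
  have "\<rho> powr (2 - s) = R powr (- (2 - s))"
    unfolding powr_minus_divide \<rho>_def using R by (simp add: powr_divide)
  then have \<rho>: "\<rho> > 0" "c * ball_const (s + 1) * \<rho> powr (2 - s) \<le> \<eta>"
    using R by (auto simp: \<rho>_def)
  show ?thesis
  proof (intro exI[of _ "c * \<rho> powr (- s)"] conjI allI impI)
    show "0 \<le> c * \<rho> powr (- s)" using c by simp
    fix u v w assume *: "decay_bound E u \<and> decay_bound E v \<and> w \<in> H1r"
    then have w: "decay_bound (sqrt (dirichlet w)) w" using H1r_decay by auto
    have [measurable]: "u \<in> borel_measurable borel" "v \<in> borel_measurable borel" "w \<in> borel_measurable borel"
      using * L2_measurable H1_measurable by (auto simp: decay_bound_def H1r_def)
    note W = decay_weighted[OF w s \<rho>(1)]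
    have single: "cmod z powr (t - 2) \<le> E powr (t - 2) * norm x powr (- s)" if "cmod z \<le> E * norm x powr (- 1 / 2)" for z and x :: space
      by (rule decay_power_outside[OF that t(1)]) (simp add: s_def)
    have AEb: "AE x in lborel. (cmod (u x) powr (t - 2) + cmod (v x) powr (t - 2)) * (cmod (w x))\<^sup>2 \<le> c * (norm x powr (- s) * (cmod (w x))\<^sup>2)"
    proof -
      have "AE x in lborel. cmod (u x) \<le> E * norm x powr (- 1 / 2)" "AE x in lborel. cmod (v x) \<le> E * norm x powr (- 1 / 2)"
        using * by (auto simp: decay_bound_def)
      then show ?thesis
      proof eventually_elim
        case (elim x)
        have "cmod (u x) powr (t - 2) + cmod (v x) powr (t - 2) \<le> c * norm x powr (- s)"
          using single[OF elim(1)] single[OF elim(2)] unfolding c_def by linarith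
        from mult_right_mono[OF this, of "(cmod (w x))\<^sup>2"] show ?case by (simp add: mult.assoc)
      qed
    qed
    show i: "integrable lborel (\<lambda>x. (cmod (u x) powr (t - 2) + cmod (v x) powr (t - 2)) * (cmod (w x))\<^sup>2)"
    proof (rule Bochner_Integration.integrable_bound)
      show "integrable lborel (\<lambda>x. c * (norm x powr (- s) * (cmod (w x))\<^sup>2))" using W(1) by simp
      show "AE x in lborel. norm ((cmod (u x) powr (t - 2) + cmod (v x) powr (t - 2)) * (cmod (w x))\<^sup>2) \<le> norm (c * (norm x powr (- s) * (cmod (w x))\<^sup>2))"
        using AEb by eventually_elim (use c in auto)
    qed measurable
    have "(LINT x|lborel. (cmod (u x) powr (t - 2) + cmod (v x) powr (t - 2)) * (cmod (w x))\<^sup>2) \<le> (LINT x|lborel. c * (norm x powr (- s) * (cmod (w x))\<^sup>2))"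
      by (rule integral_mono_AE[OF i _ AEb]) (use W(1) in simp)
    also have "\<dots> = c * (LINT x|lborel. norm x powr (- s) * (cmod (w x))\<^sup>2)" by simp
    also have "\<dots> \<le> c * (dirichlet w * ball_const (s + 1) * \<rho> powr (2 - s) + \<rho> powr (- s) * mass w)"
      using W(2) dirichlet_nonneg[of w] by (intro mult_left_mono[OF _ c]) simp
    also have "\<dots> = (c * ball_const (s + 1) * \<rho> powr (2 - s)) * dirichlet w + c * \<rho> powr (- s) * mass w" by (simp add: algebra_simps)
    also have "\<dots> \<le> \<eta> * dirichlet w + c * \<rho> powr (- s) * mass w"
      by (rule add_right_mono[OF mult_right_mono[OF \<rho>(2) dirichlet_nonneg]])
    finally show "(LINT x|lborel. (cmod (u x) powr (t - 2) + cmod (v x) powr (t - 2)) * (cmod (w x))\<^sup>2) \<le> \<eta> * dirichlet w + c * \<rho> powr (- s) * mass w" .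
  qed
qed

lemma H1r_diff:
  assumes "u \<in> H1r" "v \<in> H1r" shows "(\<lambda>x. u x - v x) \<in> H1r"
proof -
  have uv: "u \<in> H1" "v \<in> H1" using assms by (auto simp: H1r_def)
  have "AE x in lborel. u x - v x = (\<lambda>r. profile u r - profile v r) (norm x)"
    using radial_profile[OF assms(1)] radial_profile[OF assms(2)] by eventually_elim simp
  then have "\<exists>f. AE x in lborel. u x - v x = f (norm x)" by (rule exI[of _ "\<lambda>r. profile u r - profile v r"])
  then show ?thesis unfolding H1r_def using H1_diff(1)[OF uv] by simp
qed

lemma dirichlet_diff:
  assumes "u \<in> H1" "v \<in> H1"
  defines "w \<equiv> \<lambda>x. v x - u x"
  shows "dirichlet v = dirichlet u + 2 * (LINT x|lborel. inner (weak_grad u x) (weak_grad w x)) + dirichlet w"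
    and "mass v = mass u + 2 * (LINT x|lborel. inner (u x) (w x)) + mass w"
proof -
  have w: "w \<in> H1" and g: "AE x in lborel. weak_grad w x = weak_grad v x - weak_grad u x"
    using H1_diff[OF assms(2,1)] unfolding w_def by auto
  have sq: "(norm b)\<^sup>2 = (norm a)\<^sup>2 + 2 * inner a (b - a) + (norm (b - a))\<^sup>2" for a b :: "'b::euclidean_space"
    by (simp add: power2_norm_eq_inner inner_diff_left inner_diff_right inner_commute)
  note i = L2_integrable[OF H1D(1)[OF assms(1)]] L2_integrable[OF H1D(1)[OF w]] L2_inner(1)[OF H1D(1)[OF assms(1)] H1D(1)[OF w]]
    L2_integrable[OF H1D(2)[OF assms(1)]] L2_integrable[OF H1D(2)[OF w]] L2_inner(1)[OF H1D(2)[OF assms(1)] H1D(2)[OF w]]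
  have "dirichlet v = (LINT x|lborel. (norm (weak_grad u x))\<^sup>2 + 2 * inner (weak_grad u x) (weak_grad w x) + (norm (weak_grad w x))\<^sup>2)"
    unfolding dirichlet_def
  proof (rule integral_cong_AE)
    show "AE x in lborel. (norm (weak_grad v x))\<^sup>2 = (norm (weak_grad u x))\<^sup>2 + 2 * inner (weak_grad u x) (weak_grad w x) + (norm (weak_grad w x))\<^sup>2"
      using g
    proof eventually_elim
      case (elim x) show ?case using sq[of "weak_grad v x" "weak_grad u x"] unfolding elim .
    qed
  qed (use assms(2) i weak_grad_measurable in auto)
  then show "dirichlet v = dirichlet u + 2 * (LINT x|lborel. inner (weak_grad u x) (weak_grad w x)) + dirichlet w"
    unfolding dirichlet_def using i by simp
  have "mass v = (LINT x|lborel. (cmod (u x))\<^sup>2 + 2 * inner (u x) (w x) + (cmod (w x))\<^sup>2)"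
    unfolding mass_def w_def by (rule Bochner_Integration.integral_cong[OF refl sq])
  then show "mass v = mass u + 2 * (LINT x|lborel. inner (u x) (w x)) + mass w"
    unfolding mass_def using i by simp
qed

text \<open>The first order terms are those of the weak equation tested with \<open>v - u\<close>; its multiplier term
  has a favourable sign because the masses agree.\<close>

lemma energy_lower:
  assumes u: "u \<in> H1r" and v: "v \<in> H1r" and ws: "weak_solution \<mu> p q lam u" and pos: "lam > 0" "\<mu> > 0"
    and pq: "2 < p" "p < 6" "2 < q" "q < 6" and E: "decay_bound E u" "decay_bound E v" and m: "mass v = mass u"
    and al: "AE x in lborel. inner (u x) (v x) = cmod (u x) * cmod (v x)"
    and \<theta>: "(p - 1) * \<theta>p = 1 / 4" "\<mu> * ((q - 1) * \<theta>q) = 1 / 4"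
    and Lp: "\<And>u v w. decay_bound E u \<and> decay_bound E v \<and> w \<in> H1r \<Longrightarrow>
      integrable lborel (\<lambda>x. (cmod (u x) powr (p - 2) + cmod (v x) powr (p - 2)) * (cmod (w x))\<^sup>2) \<and>
      (LINT x|lborel. (cmod (u x) powr (p - 2) + cmod (v x) powr (p - 2)) * (cmod (w x))\<^sup>2) \<le> \<theta>p * dirichlet w + Mp * mass w"
    and Lq: "\<And>u v w. decay_bound E u \<and> decay_bound E v \<and> w \<in> H1r \<Longrightarrow>
      integrable lborel (\<lambda>x. (cmod (u x) powr (q - 2) + cmod (v x) powr (q - 2)) * (cmod (w x))\<^sup>2) \<and>
      (LINT x|lborel. (cmod (u x) powr (q - 2) + cmod (v x) powr (q - 2)) * (cmod (w x))\<^sup>2) \<le> \<theta>q * dirichlet w + Mq * mass w"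
    and K: "\<And>x. coulomb_potential (\<lambda>x. of_real (cmod (u x) + cmod (v x))) x \<le> K"
  shows "energy \<mu> p q v - energy \<mu> p q u \<ge> - (K / 4 + (p - 1) * Mp + \<mu> * (q - 1) * Mq) * mass (\<lambda>x. v x - u x)"
proof -
  have uH: "u \<in> H1" and vH: "v \<in> H1" using u v by (auto simp: H1r_def)
  have [measurable]: "u \<in> borel_measurable borel" "v \<in> borel_measurable borel"
    using H1_measurable[OF uH] H1_measurable[OF vH] by auto
  define w where "w x = v x - u x" for x
  have wr: "w \<in> H1r" unfolding w_def[abs_def] by (rule H1r_diff[OF v u])
  then have wH: "w \<in> H1" by (auto simp: H1r_def)
  have [measurable]: "w \<in> borel_measurable borel" using H1_measurable[OF wH] by auto
  have wd: "decay_bound (E + E) w" unfolding w_def[abs_def] by (rule decay_diff[OF E])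
  have wf: "weak_form \<mu> p q lam u w = 0" by (rule weak_form_eq_0[OF ws E(1) wH wd pq])
  note dd = dirichlet_diff[OF uH vH, folded w_def]
  have cb: "coulomb_energy v - coulomb_energy u \<ge> 4 * (LINT x|lborel. coulomb_potential u x * inner (u x) (w x)) - K * mass w"
    using coulomb_expand[OF E K] unfolding w_def .
  have nl: "(LINT x|lborel. cmod (v x) powr t) - (LINT x|lborel. cmod (u x) powr t) \<le>
      t * (LINT x|lborel. cmod (u x) powr (t - 2) * inner (u x) (w x)) + t * (t - 1) * (\<theta> * dirichlet w + L * mass w)"
    if t: "2 < t" "t < 6" and L: "integrable lborel (\<lambda>x. (cmod (u x) powr (t - 2) + cmod (v x) powr (t - 2)) * (cmod (w x))\<^sup>2) \<and>
      (LINT x|lborel. (cmod (u x) powr (t - 2) + cmod (v x) powr (t - 2)) * (cmod (w x))\<^sup>2) \<le> \<theta> * dirichlet w + L * mass w" for t \<theta> L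
  proof -
    have iu: "integrable lborel (\<lambda>x. cmod (u x) powr t)" using decay_power_integral(1)[OF E(1), of t 1] t by simp
    have iv: "integrable lborel (\<lambda>x. cmod (v x) powr t)" using decay_power_integral(1)[OF E(2), of t 1] t by simp
    have iw: "integrable lborel (\<lambda>x. cmod (u x) powr (t - 2) * inner (u x) (w x))"
    proof (rule Bochner_Integration.integrable_bound[OF decay_nonlinear_integrable[OF E(1) wd t]])
      show "AE x in lborel. norm (cmod (u x) powr (t - 2) * inner (u x) (w x)) \<le> norm (cmod (u x) powr (t - 1) * cmod (w x))"
        unfolding cmod_powr_step[OF t(1), symmetric]
        by (auto simp: abs_mult mult.assoc intro!: AE_I2 mult_left_mono Cauchy_Schwarz_ineq2)
    qed measurable
    have "(LINT x|lborel. cmod (v x) powr t) - (LINT x|lborel. cmod (u x) powr t) = (LINT x|lborel. cmod (v x) powr t - cmod (u x) powr t)"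
      using iu iv by simp
    also have "\<dots> \<le> (LINT x|lborel. t * (cmod (u x) powr (t - 2) * inner (u x) (w x)) + t * (t - 1) * ((cmod (u x) powr (t - 2) + cmod (v x) powr (t - 2)) * (cmod (w x))\<^sup>2))"
    proof (rule integral_mono_AE)
      show "AE x in lborel. cmod (v x) powr t - cmod (u x) powr t \<le> t * (cmod (u x) powr (t - 2) * inner (u x) (w x)) + t * (t - 1) * ((cmod (u x) powr (t - 2) + cmod (v x) powr (t - 2)) * (cmod (w x))\<^sup>2)"
        using al
      proof eventually_elim
        case (elim x)
        let ?a = "cmod (u x)" and ?b = "cmod (v x)"
        \<comment> \<open>Because the phases of \<open>u\<close> and \<open>v\<close> agree, the
          first order term of the modulus is the real inner product that occurs in the
          equation.\<close>
        have 1: "inner (u x) (w x) = ?a * (?b - ?a)"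
          unfolding w_def inner_diff_right elim by (simp add: algebra_simps power2_norm_eq_inner[symmetric] power2_eq_square)
        have "?a powr (t - 1) * (?b - ?a) = ?a powr (t - 2) * inner (u x) (w x)"
          unfolding 1 cmod_powr_step[OF t(1), symmetric] by simp
        moreover have "(?b - ?a)\<^sup>2 \<le> (cmod (w x))\<^sup>2"
          unfolding w_def using norm_triangle_ineq3[of "v x" "u x"] by (simp add: abs_le_square_iff[symmetric])
        then have "t * (t - 1) * ((?a powr (t - 2) + ?b powr (t - 2)) * (?b - ?a)\<^sup>2) \<le> t * (t - 1) * ((?a powr (t - 2) + ?b powr (t - 2)) * (cmod (w x))\<^sup>2)"
          using t by (intro mult_left_mono) auto
        moreover have "?b powr t - ?a powr t - t * (?a powr (t - 1) * (?b - ?a)) \<le> t * (t - 1) * ((?a powr (t - 2) + ?b powr (t - 2)) * (?b - ?a)\<^sup>2)"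
          by (rule powr_taylor) (use t in auto)
        ultimately show ?case by simp
      qed
    qed (use iu iv iw L in auto)
    also have "\<dots> = t * (LINT x|lborel. cmod (u x) powr (t - 2) * inner (u x) (w x)) + t * (t - 1) * (LINT x|lborel. (cmod (u x) powr (t - 2) + cmod (v x) powr (t - 2)) * (cmod (w x))\<^sup>2)"
      using iw L by simp
    also have "\<dots> \<le> t * (LINT x|lborel. cmod (u x) powr (t - 2) * inner (u x) (w x)) + t * (t - 1) * (\<theta> * dirichlet w + L * mass w)"
      using L t by (intro add_left_mono mult_left_mono) auto
    finally show ?thesis .
  qed
  have nl': "1 / t * (LINT x|lborel. cmod (v x) powr t) - 1 / t * (LINT x|lborel. cmod (u x) powr t) \<le>
      (LINT x|lborel. cmod (u x) powr (t - 2) * inner (u x) (w x)) + (t - 1) * (\<theta> * dirichlet w + L * mass w)"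
    if t: "2 < t" "t < 6" and L: "integrable lborel (\<lambda>x. (cmod (u x) powr (t - 2) + cmod (v x) powr (t - 2)) * (cmod (w x))\<^sup>2) \<and>
      (LINT x|lborel. (cmod (u x) powr (t - 2) + cmod (v x) powr (t - 2)) * (cmod (w x))\<^sup>2) \<le> \<theta> * dirichlet w + L * mass w" for t \<theta> L
  proof -
    have "1 / t * (LINT x|lborel. cmod (v x) powr t) - 1 / t * (LINT x|lborel. cmod (u x) powr t) = ((LINT x|lborel. cmod (v x) powr t) - (LINT x|lborel. cmod (u x) powr t)) / t" by (simp add: diff_divide_distrib)
    also have "\<dots> \<le> (t * (LINT x|lborel. cmod (u x) powr (t - 2) * inner (u x) (w x)) + t * (t - 1) * (\<theta> * dirichlet w + L * mass w)) / t"
      by (rule divide_right_mono[OF nl[OF t L]]) (use t in simp)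
    also have "\<dots> = (LINT x|lborel. cmod (u x) powr (t - 2) * inner (u x) (w x)) + (t - 1) * (\<theta> * dirichlet w + L * mass w)"
      using t by (simp add: add_divide_distrib)
    finally show ?thesis .
  qed
  \<comment> \<open>Each of the two powers uses up a quarter of \<open>dirichlet w\<close>, together
    exactly the half that the gradient part of the energy provides.\<close>
  have np: "1 / p * (LINT x|lborel. cmod (v x) powr p) - 1 / p * (LINT x|lborel. cmod (u x) powr p) \<le>
      (LINT x|lborel. cmod (u x) powr (p - 2) * inner (u x) (w x)) + (1 / 4 * dirichlet w + (p - 1) * Mp * mass w)"
  proof -
    have "(p - 1) * (\<theta>p * dirichlet w + Mp * mass w) = ((p - 1) * \<theta>p) * dirichlet w + (p - 1) * Mp * mass w" by (simp add: algebra_simps)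
    then show ?thesis using nl'[OF pq(1,2) Lp[of u v w]] E wr unfolding \<theta> by simp
  qed
  have nq: "\<mu> / q * (LINT x|lborel. cmod (v x) powr q) - \<mu> / q * (LINT x|lborel. cmod (u x) powr q) \<le>
      \<mu> * (LINT x|lborel. cmod (u x) powr (q - 2) * inner (u x) (w x)) + (1 / 4 * dirichlet w + \<mu> * (q - 1) * Mq * mass w)"
  proof -
    have "\<mu> / q * (LINT x|lborel. cmod (v x) powr q) - \<mu> / q * (LINT x|lborel. cmod (u x) powr q)
        = \<mu> * (1 / q * (LINT x|lborel. cmod (v x) powr q) - 1 / q * (LINT x|lborel. cmod (u x) powr q))"
      by (simp add: right_diff_distrib)
    also have "\<dots> \<le> \<mu> * ((LINT x|lborel. cmod (u x) powr (q - 2) * inner (u x) (w x)) + (q - 1) * (\<theta>q * dirichlet w + Mq * mass w))"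
      using nl'[OF pq(3,4) Lq[of u v w]] E wr pos by (intro mult_left_mono) auto
    also have "\<dots> = \<mu> * (LINT x|lborel. cmod (u x) powr (q - 2) * inner (u x) (w x)) + ((\<mu> * ((q - 1) * \<theta>q)) * dirichlet w + \<mu> * (q - 1) * Mq * mass w)"
      by (simp add: algebra_simps)
    finally show ?thesis unfolding \<theta> .
  qed
  have m2: "lam * (LINT x|lborel. inner (u x) (w x)) \<le> 0"
    using dd(2) m mass_nonneg[of w] pos by (intro mult_nonneg_nonpos) auto
  have mw: "mass (\<lambda>x. v x - u x) = mass w" unfolding w_def ..
  have ar: "1 / 2 * a + 1 / 4 * b - c - d - (1 / 2 * a' + 1 / 4 * b' - c' - d') \<ge> - (k / 4 + kp + kq) * m"
    if "a = a' + 2 * G + A" "b - b' \<ge> 4 * I - k * m" "c - c' \<le> N + (1 / 4 * A + kp * m)" "d - d' \<le> N' + (1 / 4 * A + kq * m)"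
      "G + l + I - N - N' = 0" "l \<le> 0" for a b c d a' b' c' d' G A I k m N N' kp kq l :: real
    using that by (simp add: field_simps)
  show ?thesis
    unfolding mw energy_def by (rule ar[OF dd(1)[unfolded dirichlet_def[of u] dirichlet_def[of v]] cb np nq wf[unfolded weak_form_def] m2])
qed


text \<open>To the right of 0 the difference quotients are at least \<open>- e\<close>, to the left
  at most \<open>e\<close>, and both sides converge to \<open>D\<close>.\<close>

lemma derivative_zero_from_lower_bound:
  fixes f :: "real \<Rightarrow> real"
  assumes f: "(f has_real_derivative D) (at 0)"
    and low: "\<And>e. e > 0 \<Longrightarrow> \<exists>s0>0. \<forall>s. s \<noteq> 0 \<and> \<bar>s\<bar> < s0 \<longrightarrow> f s - f 0 \<ge> - e * \<bar>s\<bar>"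
  shows "D = 0"
proof -
  have lim: "((\<lambda>s. (f s - f 0) / s) \<longlongrightarrow> D) (at 0)" using f by (simp add: DERIV_def)
  have "- e \<le> D \<and> D \<le> e" if e: "e > 0" for e
  proof -
    obtain s0 where s0: "s0 > 0" "\<And>s. s \<noteq> 0 \<Longrightarrow> \<bar>s\<bar> < s0 \<Longrightarrow> f s - f 0 \<ge> - e * \<bar>s\<bar>" using low[OF e] by blast
    have "\<forall>\<^sub>F s in at_right 0. - e \<le> (f s - f 0) / s"
      unfolding eventually_at_right_field
    proof (intro exI[of _ s0] conjI allI impI)
      fix s :: real assume "0 < s" "s < s0"
      then show "- e \<le> (f s - f 0) / s" using s0(2)[of s] by (simp add: pos_le_divide_eq)
    qed (use s0 in simp)
    then have 1: "- e \<le> D" by (intro tendsto_lowerbound[OF tendsto_mono[OF at_le lim]]) auto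
    have "\<forall>\<^sub>F s in at_left 0. (f s - f 0) / s \<le> e"
      unfolding eventually_at_left_field
    proof (intro exI[of _ "- s0"] conjI allI impI)
      fix s :: real assume "- s0 < s" "s < 0"
      then show "(f s - f 0) / s \<le> e" using s0(2)[of s] by (simp add: neg_divide_le_eq)
    qed (use s0 in simp)
    then have 2: "D \<le> e" by (intro tendsto_upperbound[OF tendsto_mono[OF at_le lim]]) auto
    from 1 2 show ?thesis ..
  qed
  then have *: "- e \<le> D" "D \<le> e" if "e > 0" for e using that by auto
  have "D \<le> 0" by (rule field_le_epsilon) (use *(2) in simp)
  moreover have "0 \<le> D" by (rule field_le_epsilon) (drule *(1), simp)
  ultimately show ?thesis by simp
qed

lemma energy_dil:
  assumes "u \<in> H1"
  shows "energy \<mu> p q (dil s u) = exp (2 * s) / 2 * dirichlet u + exp s / 4 * coulomb_energy u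
    - exp (3 * (p - 2) / 2 * s) / p * (LINT x|lborel. cmod (u x) powr p) - \<mu> / q * (exp (3 * (q - 2) / 2 * s) * (LINT x|lborel. cmod (u x) powr q))"
  unfolding energy_def dirichlet_def[symmetric] dil_dirichlet[OF assms] dil_coulomb_energy dil_power_integral by simp

text \<open>Along the dilations the energy is a combination of exponentials in \<open>s\<close>
  whose derivative at 0 is the Pohozaev functional. The lower estimate is available for both signs
  of \<open>s\<close>, because dilating by \<open>- s\<close> changes the function by the same mass
  as dilating by \<open>s\<close>.\<close>

theorem pohozaev_identity:
  assumes u: "u \<in> H1r" and upos: "AE x in lborel. Im (u x) = 0 \<and> Re (u x) > 0"
    and ws: "weak_solution \<mu> p q lam u" and pos: "lam > 0" "\<mu> > 0"
    and pq: "2 < p" "p < 6" "2 < q" "q < 6"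
  shows "pohozaev \<mu> p q u = 0"
proof (rule derivative_zero_from_lower_bound)
  have uH: "u \<in> H1" using u by (simp add: H1r_def)
  \<comment> \<open>One decay constant for all dilations with \<open>|s| \<le> 1\<close>, so that
    the remainder constants do not depend on \<open>s\<close>.\<close>
  define E where "E = exp 1 * sqrt (dirichlet u)"
  have E0: "E \<ge> 0" by (simp add: E_def dirichlet_nonneg)
  have dE: "decay_bound E (dil s u)" if "\<bar>s\<bar> \<le> 1" for s
  proof (rule decay_mono[OF H1r_decay[OF dil_H1r[OF u]]])
    have "sqrt (dirichlet (dil s u)) = exp s * sqrt (dirichlet u)"
      unfolding dil_dirichlet[OF uH] by (simp add: real_sqrt_mult exp_double)
    also have "\<dots> \<le> E" unfolding E_def using that by (intro mult_right_mono) (auto simp: dirichlet_nonneg)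
    finally show "sqrt (dirichlet (dil s u)) \<le> E" .
  qed
  have d0: "dil 0 u = u" by (simp add: dil_def fun_eq_iff)
  have dEu: "decay_bound E u" using dE[of 0] by (simp add: d0)
  \<comment> \<open>Multiplied by \<open>p - 1\<close> and by \<open>\<mu> * (q - 1)\<close>, these
    coefficients become the \<open>1 / 4\<close> that \<open>energy_lower\<close> asks for.\<close>
  have \<eta>p: "1 / (4 * (p - 1)) > 0" and \<eta>q: "1 / (4 * \<mu> * (q - 1)) > 0" using pq pos by auto
  obtain Mp where Mp: "Mp \<ge> 0" "\<And>u v w. decay_bound E u \<and> decay_bound E v \<and> w \<in> H1r \<Longrightarrow>
      integrable lborel (\<lambda>x. (cmod (u x) powr (p - 2) + cmod (v x) powr (p - 2)) * (cmod (w x))\<^sup>2) \<and>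
      (LINT x|lborel. (cmod (u x) powr (p - 2) + cmod (v x) powr (p - 2)) * (cmod (w x))\<^sup>2) \<le> 1 / (4 * (p - 1)) * dirichlet w + Mp * mass w"
    using decay_quadratic[OF E0 pq(1,2) \<eta>p] by (elim exE conjE) blast
  obtain Mq where Mq: "Mq \<ge> 0" "\<And>u v w. decay_bound E u \<and> decay_bound E v \<and> w \<in> H1r \<Longrightarrow>
      integrable lborel (\<lambda>x. (cmod (u x) powr (q - 2) + cmod (v x) powr (q - 2)) * (cmod (w x))\<^sup>2) \<and>
      (LINT x|lborel. (cmod (u x) powr (q - 2) + cmod (v x) powr (q - 2)) * (cmod (w x))\<^sup>2) \<le> 1 / (4 * \<mu> * (q - 1)) * dirichlet w + Mq * mass w"
    using decay_quadratic[OF E0 pq(3,4) \<eta>q] by (elim exE conjE) blast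
  define K where "K = 2 * (E + E)\<^sup>2 * ball_const 2 + 4 * mass u"
  have K0: "K \<ge> 0" by (simp add: K_def ball_const_nonneg mass_nonneg)
  have K: "coulomb_potential (\<lambda>x. of_real (cmod (u x) + cmod (dil s u x))) x \<le> K" if s: "\<bar>s\<bar> \<le> 1" for s x
  proof -
    let ?z = "\<lambda>x. of_real (cmod (u x) + cmod (dil s u x)) :: complex"
    note dz = decay_add_norm[OF dEu dE[OF s]]
    have i: "integrable lborel (\<lambda>x. (cmod (u x))\<^sup>2)" "integrable lborel (\<lambda>x. (cmod (dil s u x))\<^sup>2)"
      using L2_integrable dEu dE[OF s] by (auto simp: decay_bound_def)
    have "mass ?z \<le> (LINT x|lborel. 2 * (cmod (u x))\<^sup>2 + 2 * (cmod (dil s u x))\<^sup>2)"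
      unfolding mass_def
    proof (rule integral_mono)
      show "integrable lborel (\<lambda>x. (cmod (?z x))\<^sup>2)" using L2_integrable[of ?z] dz unfolding decay_bound_def by simp
      fix x
      have "(cmod (?z x))\<^sup>2 = (cmod (u x) + cmod (dil s u x))\<^sup>2" by (simp only: norm_of_real power2_abs)
      then show "(cmod (?z x))\<^sup>2 \<le> 2 * (cmod (u x))\<^sup>2 + 2 * (cmod (dil s u x))\<^sup>2"
        using sum_squares_bound[of "cmod (u x)" "cmod (dil s u x)"] by (simp add: power2_sum)
    qed (use i in auto)
    also have "\<dots> = 2 * mass u + 2 * mass (dil s u)" unfolding mass_def using i by simp
    finally have "mass ?z \<le> 4 * mass u" by (simp add: dil_mass)
    then show ?thesis using coulomb_potential_le[OF dz, of 1 x] by (simp add: K_def)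
  qed
  define Kt where "Kt = K / 4 + (p - 1) * Mp + \<mu> * (q - 1) * Mq"
  have Kt: "Kt \<ge> 0" unfolding Kt_def using K0 Mp(1) Mq(1) pq pos by simp
  have low: "energy \<mu> p q (dil s u) - energy \<mu> p q u \<ge> - Kt * mass (\<lambda>x. dil s u x - u x)" if s: "\<bar>s\<bar> \<le> 1" for s
    unfolding Kt_def
  proof (rule energy_lower[OF u dil_H1r[OF u] ws pos pq dEu dE[OF s] dil_mass _ _ _ Mp(2) Mq(2) K[OF s]])
    show "AE x in lborel. inner (u x) (dil s u x) = cmod (u x) * cmod (dil s u x)"
      using upos scaling_AE[OF upos exp_gt_zero[of s]]
    proof eventually_elim
      case (elim x)
      then have "u x = of_real (Re (u x))" "u (exp s *\<^sub>R x) = of_real (Re (u (exp s *\<^sub>R x)))" by (auto simp: complex_eq_iff)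
      then obtain a b where ab: "u x = of_real a" "u (exp s *\<^sub>R x) = of_real b" by blast
      with elim have "a > 0" "b > 0" by auto
      then show ?case unfolding dil_def ab by (simp add: inner_complex_def norm_mult)
    qed
    show "(p - 1) * (1 / (4 * (p - 1))) = 1 / 4" using pq by simp
    show "\<mu> * ((q - 1) * (1 / (4 * \<mu> * (q - 1)))) = 1 / 4" using pq pos by simp
  qed
  have ex: "((\<lambda>s. exp (c * s) * k) has_real_derivative c * k) (at 0)" for c k :: real
    by (auto intro!: derivative_eq_intros)
  have "((\<lambda>s. exp (2 * s) * (dirichlet u / 2) + exp (1 * s) * (coulomb_energy u / 4)
      - exp (3 * (p - 2) / 2 * s) * ((LINT x|lborel. cmod (u x) powr p) / p) - exp (3 * (q - 2) / 2 * s) * (\<mu> / q * (LINT x|lborel. cmod (u x) powr q)))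
      has_real_derivative 2 * (dirichlet u / 2) + 1 * (coulomb_energy u / 4) - 3 * (p - 2) / 2 * ((LINT x|lborel. cmod (u x) powr p) / p)
      - 3 * (q - 2) / 2 * (\<mu> / q * (LINT x|lborel. cmod (u x) powr q))) (at 0)"
    by (intro DERIV_add DERIV_diff ex)
  then show "((\<lambda>s. energy \<mu> p q (dil s u)) has_real_derivative pohozaev \<mu> p q u) (at 0)"
    unfolding energy_dil[OF uH] pohozaev_def gn_exp_def dirichlet_def by (simp add: mult.assoc mult.commute mult.left_commute)
  fix e :: real assume e: "e > 0"
  \<comment> \<open>The added 1 covers \<open>Kt = 0\<close>.\<close>
  have "e / (Kt + 1) > 0" using e Kt by simp
  from dil_diff_little_o[OF u second_moment_integrable[OF u ws pos pq] this]
  obtain s0 where s0: "s0 > 0" "\<And>s. 0 < s \<Longrightarrow> s < s0 \<Longrightarrow> mass (\<lambda>x. dil s u x - u x) \<le> e / (Kt + 1) * s"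
    by blast
  show "\<exists>s0>0. \<forall>s. s \<noteq> 0 \<and> \<bar>s\<bar> < s0 \<longrightarrow> energy \<mu> p q (dil s u) - energy \<mu> p q (dil 0 u) \<ge> - e * \<bar>s\<bar>"
  proof (intro exI[of _ "min s0 1"] conjI allI impI)
    fix s :: real assume s: "s \<noteq> 0 \<and> \<bar>s\<bar> < min s0 1"
    have "mass (\<lambda>x. dil s u x - u x) = mass (\<lambda>x. dil \<bar>s\<bar> u x - u x)"
      using dil_neg_diff_mass[of "\<bar>s\<bar>" u] by (auto simp: abs_if)
    also have "\<dots> \<le> e / (Kt + 1) * \<bar>s\<bar>" using s by (intro s0) auto
    finally have "Kt * mass (\<lambda>x. dil s u x - u x) \<le> Kt * (e / (Kt + 1) * \<bar>s\<bar>)" by (rule mult_left_mono[OF _ Kt])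
    also have "\<dots> = (Kt / (Kt + 1)) * (e * \<bar>s\<bar>)" by simp
    also have "\<dots> \<le> 1 * (e * \<bar>s\<bar>)" using Kt e by (intro mult_right_mono) auto
    finally show "energy \<mu> p q (dil s u) - energy \<mu> p q (dil 0 u) \<ge> - e * \<bar>s\<bar>" unfolding d0 using low[of s] s by simp
  qed (use s0 in simp)
qed


section \<open>Upper semicontinuity of the level\<close>

definition Lp_integral :: "real \<Rightarrow> (space \<Rightarrow> complex) \<Rightarrow> real" where
  "Lp_integral t u = (LINT x|lborel. cmod (u x) powr t)"

lemma Lp_integral_nonneg: "0 \<le> Lp_integral t u"
  unfolding Lp_integral_def by (intro Bochner_Integration.integral_nonneg) simp

lemma Lp_integral_pos:
  assumes "decay_bound C u" "mass u > 0" "2 \<le> t" "t < 6" shows "Lp_integral t u > 0"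
proof (rule ccontr)
  assume "\<not> Lp_integral t u > 0"
  then have "Lp_integral t u = 0" using Lp_integral_nonneg[of t u] by simp
  then have "AE x in lborel. cmod (u x) powr t = 0"
    using integral_nonneg_eq_0_iff_AE[OF decay_power_integral(1)[OF assms(1,3,4), of 1]] unfolding Lp_integral_def by simp
  then have "AE x in lborel. (cmod (u x))\<^sup>2 = 0" by eventually_elim simp
  then have "mass u = 0" unfolding mass_def by (rule integral_eq_zero_AE)
  with assms(2) show False by simp
qed

text \<open>Function and exponent vary together; every intermediate power of the majorant is at most
  the sum of its square and its power \<open>t\<close>.\<close>

lemma Lp_integral_tendsto:
  assumes W: "decay_bound C W" and dom: "AE x in lborel. \<forall>n. cmod (f n x) \<le> cmod (W x)"
    and lim: "AE x in lborel. (\<lambda>n. f n x) \<longlonglongrightarrow> g x"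
    and meas: "\<And>n. f n \<in> borel_measurable borel" "g \<in> borel_measurable borel"
    and q: "q \<longlonglongrightarrow> q0" "\<And>n. 2 \<le> q n" "\<And>n. q n \<le> t" "t < 6"
  shows "(\<lambda>n. Lp_integral (q n) (f n)) \<longlonglongrightarrow> Lp_integral q0 g"
  unfolding Lp_integral_def
proof (rule integral_dominated_convergence)
  have q0: "2 \<le> q0" by (rule LIMSEQ_le_const[OF q(1)]) (use q in auto)
  have t: "2 \<le> t" using q(2,3)[of 0] by simp
  show "integrable lborel (\<lambda>x. cmod (W x) powr 2 + cmod (W x) powr t)"
    using decay_power_integral(1)[OF W, of 2 1] decay_power_integral(1)[OF W, of t 1] t q(4)
    by (intro Bochner_Integration.integrable_add) simp_all
  show "AE x in lborel. (\<lambda>n. cmod (f n x) powr q n) \<longlonglongrightarrow> cmod (g x) powr q0"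
    using lim by eventually_elim (intro tendsto_powr' tendsto_norm q(1); use q0 in auto)
  show "AE x in lborel. norm (cmod (f n x) powr q n) \<le> cmod (W x) powr 2 + cmod (W x) powr t" for n
    using dom
  proof eventually_elim
    case (elim x)
    have "cmod (f n x) powr q n \<le> cmod (W x) powr q n" using elim q(2)[of n] by (intro powr_mono2) auto
    also have "\<dots> \<le> cmod (W x) powr 2 + cmod (W x) powr t" using q(2,3)[of n] by (intro powr_interpolate) auto
    finally show ?case by simp
  qed
qed (use meas in measurable)

lemma energy_eq: "energy \<mu> p q u = 1 / 2 * dirichlet u + 1 / 4 * coulomb_energy u - 1 / p * Lp_integral p u - \<mu> / q * Lp_integral q u"
  and pohozaev_eq: "pohozaev \<mu> p q u = dirichlet u + 1 / 4 * coulomb_energy u - gn_exp p * Lp_integral p u - \<mu> * gn_exp q * Lp_integral q u"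
  unfolding energy_def pohozaev_def dirichlet_def Lp_integral_def by simp_all

lemma mass_sphere_iff: "a > 0 \<Longrightarrow> u \<in> mass_sphere a \<longleftrightarrow> u \<in> H1 \<and> mass u = a\<^sup>2"
proof -
  assume a: "a > 0"
  have "Lp_norm 2 u = sqrt (mass u)"
    unfolding Lp_norm_def mass_def by (simp add: powr_half_sqrt powr_numeral)
  moreover have "sqrt (mass u) = a \<longleftrightarrow> mass u = a\<^sup>2" using a mass_nonneg[of u] by (auto simp: real_sqrt_unique)
  ultimately show ?thesis by (simp add: mass_sphere_def)
qed

lemma pohozaev_set_iff:
  "a > 0 \<Longrightarrow> u \<in> pohozaev_set_r \<mu> p a q \<longleftrightarrow> u \<in> H1r \<and> mass u = a\<^sup>2 \<and> pohozaev \<mu> p q u = 0"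
  unfolding pohozaev_set_r_def by (auto simp: mass_sphere_iff H1r_def)

text \<open>Equality at \<open>10 / 3\<close> is mass criticality: there
  \<open>t * gn_exp t = 2\<close>, and the power scales under dilations like the gradient
  term.\<close>

lemma gn_exp_ge: "10 / 3 \<le> t \<Longrightarrow> gn_exp t \<ge> 2 / t"
  unfolding gn_exp_def by (simp add: field_simps)

text \<open>Half of the Pohozaev functional eliminates the gradient and leaves coefficients that are
  nonnegative for exponents from \<open>10 / 3\<close> on. A bound on the energy thus controls the
  \<open>p\<close> norm, and the gradient only through it.\<close>

lemma energy_on_pohozaev:
  assumes "pohozaev \<mu> p q u = 0"
  shows "energy \<mu> p q u = 1 / 8 * coulomb_energy u + (gn_exp p / 2 - 1 / p) * Lp_integral p u + \<mu> * (gn_exp q / 2 - 1 / q) * Lp_integral q u"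
proof -
  have "energy \<mu> p q u = energy \<mu> p q u - 1 / 2 * pohozaev \<mu> p q u" using assms by simp
  then show ?thesis unfolding energy_eq pohozaev_eq by (simp add: algebra_simps add_divide_distrib diff_divide_distrib)
qed

lemma energy_nonneg_on_pohozaev:
  assumes "pohozaev \<mu> p q u = 0" "10 / 3 \<le> p" "10 / 3 \<le> q" "\<mu> > 0"
  shows "0 \<le> energy \<mu> p q u"
proof -
  have "0 \<le> gn_exp p / 2 - 1 / p" "0 \<le> gn_exp q / 2 - 1 / q" using gn_exp_ge[OF assms(2)] gn_exp_ge[OF assms(3)] by auto
  then show ?thesis unfolding energy_on_pohozaev[OF assms(1)] using coulomb_energy_nonneg[of u] Lp_integral_nonneg assms(4) by simp
qed

text \<open>The bound of the energy by 0 from below on the Pohozaev set is what gives the real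
  infimum its meaning.\<close>

lemma level_le:
  assumes a: "a > 0" and "u \<in> H1r" "mass u = a\<^sup>2" "pohozaev \<mu> p q u = 0" "10 / 3 \<le> p" "10 / 3 \<le> q" "\<mu> > 0"
  shows "level_r \<mu> p a q \<le> energy \<mu> p q u"
  unfolding level_r_def
proof (rule cINF_lower)
  show "bdd_below (energy \<mu> p q ` pohozaev_set_r \<mu> p a q)"
  proof (rule bdd_belowI2[of _ 0])
    fix v assume "v \<in> pohozaev_set_r \<mu> p a q"
    then have "pohozaev \<mu> p q v = 0" by (simp add: pohozaev_set_r_def)
    then show "0 \<le> energy \<mu> p q v" by (rule energy_nonneg_on_pohozaev[OF _ assms(5-7)])
  qed
  show "u \<in> pohozaev_set_r \<mu> p a q" unfolding pohozaev_set_iff[OF a] by (intro conjI assms)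
qed

lemma pohozaev_dil:
  assumes "u \<in> H1"
  shows "pohozaev \<mu> p q (dil s u) = exp (2 * s) * dirichlet u + exp s / 4 * coulomb_energy u
    - gn_exp p * (exp (3 * (p - 2) / 2 * s) * Lp_integral p u) - \<mu> * gn_exp q * (exp (3 * (q - 2) / 2 * s) * Lp_integral q u)"
  unfolding pohozaev_eq dil_dirichlet[OF assms] dil_coulomb_energy Lp_integral_def dil_power_integral by simp

lemma pohozaev_dil_continuous:
  assumes "u \<in> H1" shows "continuous_on S (\<lambda>s. pohozaev \<mu> p q (dil s u))"
  unfolding pohozaev_dil[OF assms] by (intro continuous_intros) simp

text \<open>At \<open>10 / 3\<close> the power and the gradient both carry
  \<open>exp (2 * s)\<close> and merge into one coefficient. After factoring, the Coulomb part is
  nonincreasing in \<open>s\<close> and the subtracted \<open>p\<close> part nondecreasing for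
  supercritical \<open>p\<close>.\<close>

lemma pohozaev_dil_critical:
  assumes u: "u \<in> H1"
  shows "pohozaev \<mu> p (10 / 3) (dil s u) = exp (2 * s) * ((dirichlet u - 3 / 5 * \<mu> * Lp_integral (10 / 3) u)
    + exp (- s) / 4 * coulomb_energy u - gn_exp p * (exp ((3 * (p - 2) / 2 - 2) * s) * Lp_integral p u))"
proof -
  have "exp (2 * s) * exp (- s) = exp s" "exp (2 * s) * exp ((3 * (p - 2) / 2 - 2) * s) = exp (3 * (p - 2) / 2 * s)"
    unfolding exp_add[symmetric] by (auto simp: algebra_simps)
  then have "exp (2 * s) * ((dirichlet u - 3 / 5 * \<mu> * Lp_integral (10 / 3) u)
      + exp (- s) / 4 * coulomb_energy u - gn_exp p * (exp ((3 * (p - 2) / 2 - 2) * s) * Lp_integral p u))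
    = exp (2 * s) * dirichlet u + exp s / 4 * coulomb_energy u - gn_exp p * (exp (3 * (p - 2) / 2 * s) * Lp_integral p u)
      - exp (2 * s) * (3 / 5 * \<mu> * Lp_integral (10 / 3) u)"
    by (simp add: algebra_simps)
  then show ?thesis unfolding pohozaev_dil[OF u] by (simp add: gn_exp_def)
qed

text \<open>The bracket vanishes at 0 and is strictly decreasing because the \<open>p\<close> part
  is present. Strictness is what survives a small change of the exponent.\<close>

lemma pohozaev_dil_sign:
  assumes u: "u \<in> H1" and p: "10 / 3 < p" and Cp: "Lp_integral p u > 0" and P: "pohozaev \<mu> p (10 / 3) u = 0" and s: "s > 0"
  shows "pohozaev \<mu> p (10 / 3) (dil s u) < 0" "pohozaev \<mu> p (10 / 3) (dil (- s) u) > 0"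
proof -
  define X where "X = dirichlet u - 3 / 5 * \<mu> * Lp_integral (10 / 3) u"
  define B where "B = coulomb_energy u"
  define c where "c = 3 * (p - 2) / 2 - 2"
  define Y where "Y = gn_exp p * Lp_integral p u"
  have c: "c > 0" and Y: "Y > 0" using p Cp by (auto simp: c_def Y_def gn_exp_def)
  have B: "B \<ge> 0" by (simp add: B_def coulomb_energy_nonneg)
  have form: "pohozaev \<mu> p (10 / 3) (dil s u) = exp (2 * s) * (X + exp (- s) / 4 * B - exp (c * s) * Y)" for s
    unfolding pohozaev_dil_critical[OF u] X_def B_def c_def Y_def by simp
  have "dil 0 u = u" by (simp add: dil_def fun_eq_iff)
  with form[of 0] P have 0: "X + 1 / 4 * B - Y = 0" by simp
  have "exp (- s) * B \<le> 1 * B" "exp s * B \<ge> 1 * B" using s B by (intro mult_right_mono; simp)+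
  moreover have "exp (c * s) * Y > 1 * Y" "exp (c * (- s)) * Y < 1 * Y" using s c Y by (auto intro!: mult_strict_right_mono)
  ultimately have "X + exp (- s) / 4 * B - exp (c * s) * Y < 0" "X + exp (- (- s)) / 4 * B - exp (c * (- s)) * Y > 0"
    using 0 by auto
  then show "pohozaev \<mu> p (10 / 3) (dil s u) < 0" "pohozaev \<mu> p (10 / 3) (dil (- s) u) > 0"
    unfolding form by (auto simp: mult_less_0_iff zero_less_mult_iff)
qed

text \<open>The strict sign change between \<open>dil (- s) w\<close> and \<open>dil s w\<close>
  persists for nearby exponents, and the intermediate value theorem places some dilation of
  \<open>w\<close>, with parameter between \<open>- s\<close> and \<open>s\<close>, on the nearby
  Pohozaev set. Only this bound on the parameter is used, not its convergence.\<close>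

lemma level_upper_semicontinuous:
  assumes a: "a > 0" and \<mu>: "\<mu> > 0" and p: "10 / 3 < p" "p < 6"
    and w: "w \<in> pohozaev_set_r \<mu> p a (10 / 3)"
    and q: "q \<longlonglongrightarrow> 10 / 3" "\<And>n. 10 / 3 < q n" "\<And>n. q n < p" and \<epsilon>: "\<epsilon> > 0"
  shows "\<forall>\<^sub>F n in sequentially. level_r \<mu> p a (q n) \<le> energy \<mu> p (10 / 3) w + \<epsilon>"
proof -
  have wr: "w \<in> H1r" and m: "mass w = a\<^sup>2" and P: "pohozaev \<mu> p (10 / 3) w = 0"
    using w a by (auto simp: pohozaev_set_iff)
  have wH: "w \<in> H1" using wr by (simp add: H1r_def)
  note dec = H1r_decay[OF wr]
  have Cp: "Lp_integral p w > 0" by (rule Lp_integral_pos[OF dec]) (use m a p in auto)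
  have [measurable]: "w \<in> borel_measurable borel" using H1_measurable[OF wH] by simp
  have q2: "2 \<le> q n" for n using q(2)[of n] by simp
  have D: "(\<lambda>n. Lp_integral (q n) w) \<longlonglongrightarrow> Lp_integral (10 / 3) w"
    by (rule Lp_integral_tendsto[OF dec _ _ _ _ q(1), where t=p]) (use q(3) p q2 in \<open>auto intro: less_imp_le\<close>)
  \<comment> \<open>An upper envelope for the energy of all dilations with parameter between
    \<open>- s\<close> and \<open>s\<close>: the positive terms are taken at \<open>s\<close>, the
    negative ones at \<open>- s\<close>.\<close>
  define U where "U s D q = exp (2 * s) / 2 * dirichlet w + exp s / 4 * coulomb_energy w
    - exp (3 * (p - 2) / 2 * (- s)) / p * Lp_integral p w - \<mu> / q * (exp (3 * (q - 2) / 2 * (- s)) * D)" for s D q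
  have "((\<lambda>s. U s (Lp_integral (10 / 3) w) (10 / 3)) \<longlongrightarrow> U 0 (Lp_integral (10 / 3) w) (10 / 3)) (at_right 0)"
    unfolding U_def by (intro tendsto_intros) (use p in simp_all)
  moreover have "U 0 (Lp_integral (10 / 3) w) (10 / 3) < energy \<mu> p (10 / 3) w + \<epsilon>"
    using \<epsilon> unfolding U_def energy_eq by simp
  ultimately have "\<forall>\<^sub>F s in at_right 0. U s (Lp_integral (10 / 3) w) (10 / 3) < energy \<mu> p (10 / 3) w + \<epsilon>" by (rule order_tendstoD(2))
  then obtain b where b: "b > 0" "\<And>s. 0 < s \<Longrightarrow> s < b \<Longrightarrow> U s (Lp_integral (10 / 3) w) (10 / 3) < energy \<mu> p (10 / 3) w + \<epsilon>"
    unfolding eventually_at_right_field by blast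
  define s where "s = b / 2"
  have s: "s > 0" and Us: "U s (Lp_integral (10 / 3) w) (10 / 3) < energy \<mu> p (10 / 3) w + \<epsilon>" using b by (auto simp: s_def)
  have "(\<lambda>n. U s (Lp_integral (q n) w) (q n)) \<longlonglongrightarrow> U s (Lp_integral (10 / 3) w) (10 / 3)"
    unfolding U_def by (intro tendsto_intros D q(1)) auto
  then have e1: "\<forall>\<^sub>F n in sequentially. U s (Lp_integral (q n) w) (q n) < energy \<mu> p (10 / 3) w + \<epsilon>" using Us by (rule order_tendstoD(2))
  have Plim: "(\<lambda>n. pohozaev \<mu> p (q n) (dil \<sigma> w)) \<longlonglongrightarrow> pohozaev \<mu> p (10 / 3) (dil \<sigma> w)" for \<sigma>
    unfolding pohozaev_dil[OF wH] gn_exp_def by (intro tendsto_intros D q(1)) auto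
  note sgn = pohozaev_dil_sign[OF wH p(1) Cp P s]
  have e2: "\<forall>\<^sub>F n in sequentially. pohozaev \<mu> p (q n) (dil s w) < 0" by (rule order_tendstoD(2)[OF Plim sgn(1)])
  have e3: "\<forall>\<^sub>F n in sequentially. 0 < pohozaev \<mu> p (q n) (dil (- s) w)" by (rule order_tendstoD(1)[OF Plim sgn(2)])
  from e1 e2 e3 show ?thesis
  proof eventually_elim
    case (elim n)
    have "\<exists>\<sigma>\<ge>- s. \<sigma> \<le> s \<and> pohozaev \<mu> p (q n) (dil \<sigma> w) = 0"
      by (rule IVT2'[OF _ _ _ pohozaev_dil_continuous[OF wH]]) (use elim s in simp_all)
    then obtain \<sigma> where \<sigma>: "- s \<le> \<sigma>" "\<sigma> \<le> s" "pohozaev \<mu> p (q n) (dil \<sigma> w) = 0" by blast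
    have "level_r \<mu> p a (q n) \<le> energy \<mu> p (q n) (dil \<sigma> w)"
      by (rule level_le[OF a dil_H1r[OF wr] _ \<sigma>(3) _ _ \<mu>]) (use m p q(2)[of n] in \<open>simp_all add: dil_mass\<close>)
    also have "\<dots> \<le> U s (Lp_integral (q n) w) (q n)"
      unfolding energy_dil[OF wH] U_def Lp_integral_def[symmetric]
    proof (intro diff_mono add_mono mult_right_mono mult_left_mono divide_right_mono)
      show "exp (3 * (p - 2) / 2 * - s) \<le> exp (3 * (p - 2) / 2 * \<sigma>)" "exp (3 * (q n - 2) / 2 * - s) \<le> exp (3 * (q n - 2) / 2 * \<sigma>)"
        unfolding exp_le_cancel_iff using \<sigma> p q(2)[of n] by (intro mult_left_mono; simp)+
      show "0 \<le> \<mu> / q n" "0 \<le> p" "0 \<le> Lp_integral p w" "0 \<le> Lp_integral (q n) w" "0 \<le> dirichlet w" "0 \<le> coulomb_energy w"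
        using \<mu> p q(2)[of n] by (simp_all add: dirichlet_nonneg coulomb_energy_nonneg Lp_integral_nonneg)
    qed (use \<sigma> in simp_all)
    finally show ?case using elim(1) by simp
  qed
qed

text \<open>Needed before any lower bound can be passed to the infimum. Dilations far in one
  direction let the positive coefficient of the gradient and critical power win, far in the other
  the \<open>p\<close> power; a zero lies between.\<close>

lemma pohozaev_set_nonempty:
  assumes a: "a > 0" and p: "10 / 3 < p" "p < 6" and u: "u \<in> H1r" "mass u = a\<^sup>2"
    and X: "3 / 5 * \<mu> * Lp_integral (10 / 3) u < dirichlet u"
  shows "pohozaev_set_r \<mu> p a (10 / 3) \<noteq> {}"
proof -
  have uH: "u \<in> H1" using u by (simp add: H1r_def)
  have Cp: "Lp_integral p u > 0" by (rule Lp_integral_pos[OF H1r_decay[OF u(1)]]) (use u a p in auto)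
  define X where "X = dirichlet u - 3 / 5 * \<mu> * Lp_integral (10 / 3) u"
  define B where "B = coulomb_energy u"
  define c where "c = 3 * (p - 2) / 2 - 2"
  define Y where "Y = gn_exp p * Lp_integral p u"
  have c: "c > 0" and Y: "Y > 0" and B: "B \<ge> 0" and X: "X > 0"
    using p Cp X coulomb_energy_nonneg[of u] by (auto simp: c_def Y_def gn_exp_def X_def B_def)
  have form: "pohozaev \<mu> p (10 / 3) (dil s u) = exp (2 * s) * (X + exp (- s) / 4 * B - exp (c * s) * Y)" for s
    unfolding pohozaev_dil_critical[OF uH] X_def B_def c_def Y_def by simp
  \<comment> \<open>By \<open>1 + x \<le> exp x\<close> these parameters satisfy
    \<open>Y < X * exp (c * s1)\<close> and \<open>X + B < exp (c * s2) * Y\<close>.\<close>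
  define s1 where "s1 = Y / (c * X)"
  define s2 where "s2 = (X + B) / (c * Y)"
  have s: "s1 > 0" "s2 > 0" unfolding s1_def s2_def using c Y X B by auto
  have "c * s1 = Y / X" "c * s2 = (X + B) / Y" unfolding s1_def s2_def using c by auto
  then have "1 + Y / X \<le> exp (c * s1)" "1 + (X + B) / Y \<le> exp (c * s2)"
    using exp_ge_add_one_self[of "c * s1"] exp_ge_add_one_self[of "c * s2"] by auto
  then have "X * (1 + Y / X) \<le> X * exp (c * s1)" "(1 + (X + B) / Y) * Y \<le> exp (c * s2) * Y"
    using X Y by (intro mult_left_mono mult_right_mono; simp)+
  moreover have "(1 + (X + B) / Y) * Y = Y + (X + B)" "X * (1 + Y / X) = X + Y" using X Y by (auto simp: field_simps)
  ultimately have "Y < X * exp (c * s1)" and 2: "X + B < exp (c * s2) * Y" using X Y by linarith+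
  then have 1: "exp (c * (- s1)) * Y < X" by (simp add: exp_minus field_simps)
  have "exp (- s2) * B \<le> 1 * B" using s B by (intro mult_right_mono) auto
  then have n: "pohozaev \<mu> p (10 / 3) (dil s2 u) \<le> 0"
    unfolding form using 2 B by (intro mult_nonneg_nonpos) auto
  have "exp s1 * B \<ge> 0" using B by simp
  then have pz: "0 \<le> pohozaev \<mu> p (10 / 3) (dil (- s1) u)" unfolding form using 1 by (intro mult_nonneg_nonneg) auto
  have "\<exists>\<sigma>\<ge>- s1. \<sigma> \<le> s2 \<and> pohozaev \<mu> p (10 / 3) (dil \<sigma> u) = 0"
    by (rule IVT2'[OF n pz _ pohozaev_dil_continuous[OF uH]]) (use s in simp)
  then obtain \<sigma> where "pohozaev \<mu> p (10 / 3) (dil \<sigma> u) = 0" by (elim exE conjE)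
  then have "dil \<sigma> u \<in> pohozaev_set_r \<mu> p a (10 / 3)" using dil_H1r[OF u(1)] u(2) unfolding pohozaev_set_iff[OF a] dil_mass by (intro conjI)
  then show ?thesis by (metis empty_iff)
qed


section \<open>Singular weights against Sobolev functions\<close>

text \<open>Dilating by 2 multiplies the weighted integral by \<open>2 powr (\<beta> - 3) < 1\<close>, so the dilation difference, which the
  gradient controls, absorbs it. This makes the nonlinear terms of the equation integrable against every
  (not necessarily radial) element of \<open>H1\<close>; otherwise the integrals would have the junk value 0.\<close>

lemma nn_integral_singular_ball:
  assumes v: "v \<in> H1" and \<beta>: "0 \<le> \<beta>" "\<beta> < 5 / 2"
  shows "(\<integral>\<^sup>+x. ennreal (indicator (cball 0 1) x * (norm x powr (- \<beta>) * cmod (v x))) \<partial>lborel) < \<infinity>"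
proof -
  have [measurable]: "v \<in> borel_measurable borel" using H1_measurable[OF v] by simp
  let ?h = "radial_avg (weak_grad v)"
  define H where "H = (LINT x|lborel. norm ((indicator (cball 0 1) x * norm x powr (- \<beta>)) *\<^sub>R ?h x))"
  \<comment> \<open>The weight times \<open>|x|\<close> must be square integrable near the origin,
    that is \<open>2 * \<beta> - 2 < 3\<close>; this is the origin of the bound
    \<open>5 / 2\<close>.\<close>
  have hi: "integrable lborel (\<lambda>x. (indicator (cball 0 1) x * norm x powr (- \<beta>)) *\<^sub>R ?h x)"
  proof (rule radial_avg_weighted(2)[OF _ _ H1D(2)[OF v]])
    have "integrable lborel (\<lambda>x::space. indicator (cball 0 1) x * norm x powr (- (2 * \<beta> - 2)))"
      by (rule ball_integral(1)) (use \<beta> in auto)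
    moreover have "(indicator (cball 0 1) x * norm x powr (- \<beta>) * norm x)\<^sup>2 = indicator (cball 0 1) x * norm x powr (- (2 * \<beta> - 2))" for x :: space
    proof (cases "x = 0")
      case False
      have "(norm x powr (- \<beta>) * norm x)\<^sup>2 = norm x powr (- \<beta>) * norm x powr (- \<beta>) * norm x powr 2"
        using False by (simp add: power_mult_distrib power2_eq_square powr_numeral)
      also have "\<dots> = norm x powr (- (2 * \<beta> - 2))" unfolding powr_add[symmetric] by (simp add: algebra_simps)
      finally show ?thesis by (simp add: mult.assoc split: split_indicator)
    qed simp
    ultimately show "integrable lborel (\<lambda>x::space. (indicator (cball 0 1) x * norm x powr (- \<beta>) * norm x)\<^sup>2)" by simp
  qed measurable
  have H0: "H \<ge> 0" unfolding H_def by (intro Bochner_Integration.integral_nonneg) simp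
  have v2: "integrable lborel (\<lambda>x. indicator (cball 0 2) x * cmod (v x))" using ball_L2_integrable[OF H1D(1)[OF v]] by simp
  define V where "V = (LINT x|lborel. indicator (cball 0 2) x * cmod (v x))"
  have V0: "V \<ge> 0" unfolding V_def by (intro Bochner_Integration.integral_nonneg) simp
  define c where "c = (2::real) powr (\<beta> - 3)"
  have "c < 2 powr 0" unfolding c_def using \<beta> by (intro powr_less_mono) auto
  then have c: "0 < c" "c < 1" by (auto simp: c_def)
  \<comment> \<open>The cut at \<open>\<delta>\<close> makes the integral finite, so that a fraction
    of it may be moved to the other side; the resulting bound is free of
    \<open>\<delta>\<close>.\<close>
  define w where "w \<delta> x = indicator {\<delta>..1} (norm x) * norm x powr (- \<beta>)" for \<delta> and x :: space
  have wm[measurable]: "w \<delta> \<in> borel_measurable borel" for \<delta> unfolding w_def[abs_def] by measurable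
  have w0: "0 \<le> w \<delta> x" for \<delta> x by (simp add: w_def)
  have bound: "(LINT x|lborel. w \<delta> x * cmod (v x)) \<le> (V + H) / (1 - c)" and wi: "integrable lborel (\<lambda>x. w \<delta> x * cmod (v x))" if \<delta>: "\<delta> > 0" for \<delta>
  proof -
    have wb: "w \<delta> x * cmod (v x) \<le> \<delta> powr (- \<beta>) * (indicator (cball 0 2) x * cmod (v x))" for x
      using \<delta> \<beta> by (auto simp: w_def split: split_indicator intro!: mult_right_mono powr_mono2')
    show wi: "integrable lborel (\<lambda>x. w \<delta> x * cmod (v x))"
      by (rule Bochner_Integration.integrable_bound[OF integrable_mult_right[OF v2, of "\<delta> powr (- \<beta>)"]])
        (use wb w0 in \<open>auto intro!: AE_I2 simp: abs_mult\<close>)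
    \<comment> \<open>While \<open>2 x\<close> stays in the unit ball, the weight at
      \<open>x\<close> is \<open>2 powr \<beta> = 8 * c\<close> times the weight at
      \<open>2 x\<close>. Where it leaves the ball, the weight at \<open>x\<close> is at most
      \<open>2 powr \<beta>\<close> and the indicator of the ball of radius 2 takes over.\<close>
    have dw: "w \<delta> x * cmod (v (2 *\<^sub>R x)) \<le> 8 * c * (w \<delta> (2 *\<^sub>R x) * cmod (v (2 *\<^sub>R x)) + indicator (cball 0 2) (2 *\<^sub>R x) * cmod (v (2 *\<^sub>R x)))" for x
    proof -
      have "w \<delta> x \<le> 8 * c * (w \<delta> (2 *\<^sub>R x) + indicator (cball 0 2) (2 *\<^sub>R x))"
      proof (cases "\<delta> \<le> norm x \<and> norm x \<le> 1")
        case True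
        have c8: "8 * c = 2 powr \<beta>" unfolding c_def powr_diff by simp
        have e: "2 powr \<beta> * norm (2 *\<^sub>R x) powr (- \<beta>) = norm x powr (- \<beta>)"
          using True \<delta> by (simp add: powr_mult powr_minus)
        show ?thesis
        proof (cases "norm (2 *\<^sub>R x) \<le> 1")
          case True
          then have "w \<delta> (2 *\<^sub>R x) = norm (2 *\<^sub>R x) powr (- \<beta>)" "w \<delta> x = norm x powr (- \<beta>)"
            using \<open>\<delta> \<le> norm x \<and> norm x \<le> 1\<close> \<delta> by (auto simp: w_def)
          then show ?thesis using e unfolding c8 by (simp add: distrib_left)
        next
          case False
          have "norm x powr (- \<beta>) \<le> (1 / 2) powr (- \<beta>)" using False \<beta> by (intro powr_mono2') auto
          also have "\<dots> = 2 powr \<beta>" by (simp add: powr_minus powr_divide)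
          finally show ?thesis using True w0[of \<delta> "2 *\<^sub>R x"] unfolding c8 by (simp add: w_def distrib_left add_increasing)
        qed
      next
        case False
        then have "w \<delta> x = 0" by (auto simp: w_def)
        then show ?thesis using c w0[of \<delta> "2 *\<^sub>R x"] by simp
      qed
      from mult_right_mono[OF this, of "cmod (v (2 *\<^sub>R x))"] show ?thesis by (simp add: algebra_simps)
    qed
    have si: "integrable lborel (\<lambda>x. w \<delta> x * cmod (v x) + indicator (cball 0 2) x * cmod (v x))" using wi v2 by simp
    have si2: "integrable lborel (\<lambda>x. w \<delta> (2 *\<^sub>R x) * cmod (v (2 *\<^sub>R x)) + indicator (cball 0 2) (2 *\<^sub>R x) * cmod (v (2 *\<^sub>R x)))"
      using scaling_integrable[OF si, of 2] by simp
    have "(LINT x|lborel. w \<delta> x * cmod (v x)) \<le> (LINT x|lborel. 8 * c * (w \<delta> (2 *\<^sub>R x) * cmod (v (2 *\<^sub>R x)) + indicator (cball 0 2) (2 *\<^sub>R x) * cmod (v (2 *\<^sub>R x)))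
        + norm ((indicator (cball 0 1) x * norm x powr (- \<beta>)) *\<^sub>R ?h x))"
    proof (rule integral_mono_AE)
      show "AE x in lborel. w \<delta> x * cmod (v x) \<le> 8 * c * (w \<delta> (2 *\<^sub>R x) * cmod (v (2 *\<^sub>R x)) + indicator (cball 0 2) (2 *\<^sub>R x) * cmod (v (2 *\<^sub>R x)))
        + norm ((indicator (cball 0 1) x * norm x powr (- \<beta>)) *\<^sub>R ?h x)"
        using dilation_difference[OF v]
      proof eventually_elim
        case (elim x)
        have "cmod (v x) \<le> cmod (v (2 *\<^sub>R x)) + cmod (?h x)" unfolding elim[symmetric] using norm_triangle_sub[of "v x" "v (2 *\<^sub>R x)"] by (simp add: norm_minus_commute)
        from mult_left_mono[OF this w0[of \<delta> x]] have "w \<delta> x * cmod (v x) \<le> w \<delta> x * cmod (v (2 *\<^sub>R x)) + w \<delta> x * cmod (?h x)" by (simp add: distrib_left)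
        also have "w \<delta> x * cmod (?h x) \<le> norm ((indicator (cball 0 1) x * norm x powr (- \<beta>)) *\<^sub>R ?h x)"
          by (auto simp: w_def abs_mult split: split_indicator)
        finally show ?case using dw[of x] by linarith
      qed
    qed (rule wi, rule Bochner_Integration.integrable_add[OF integrable_mult_right[OF si2] integrable_norm[OF hi]])
    also have "\<dots> = 8 * c * (LINT x|lborel. w \<delta> (2 *\<^sub>R x) * cmod (v (2 *\<^sub>R x)) + indicator (cball 0 2) (2 *\<^sub>R x) * cmod (v (2 *\<^sub>R x))) + H"
      unfolding H_def using si2 hi by (simp only: Bochner_Integration.integral_add[OF integrable_mult_right[OF si2] integrable_norm[OF hi]] integral_mult_right_zero)
    also have "(LINT x|lborel. w \<delta> (2 *\<^sub>R x) * cmod (v (2 *\<^sub>R x)) + indicator (cball 0 2) (2 *\<^sub>R x) * cmod (v (2 *\<^sub>R x))) = 1 / 8 * ((LINT x|lborel. w \<delta> x * cmod (v x)) + V)"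
      unfolding V_def Bochner_Integration.integral_add[OF wi v2, symmetric] using scaling_integral[of 2 "\<lambda>x. w \<delta> x * cmod (v x) + indicator (cball 0 2) x * cmod (v x)"] by simp
    \<comment> \<open>The Jacobian \<open>1 / 8\<close> reduces the factor to \<open>c < 1\<close>,
      which is absorbed.\<close>
    finally have "(LINT x|lborel. w \<delta> x * cmod (v x)) * (1 - c) \<le> c * V + H" by (simp add: algebra_simps)
    also have "\<dots> \<le> V + H" using c V0 by (simp add: mult_left_le_one_le)
    finally show "(LINT x|lborel. w \<delta> x * cmod (v x)) \<le> (V + H) / (1 - c)" using c by (simp add: pos_le_divide_eq)
  qed
  let ?w = "\<lambda>n. w (inverse (real (Suc n)))"
  have lim: "(\<lambda>n. ennreal (?w n x * cmod (v x))) \<longlonglongrightarrow> ennreal (indicator (cball 0 1) x * (norm x powr (- \<beta>) * cmod (v x)))" for x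
  proof (rule tendsto_ennrealI, cases "x = 0")
    case False
    then have "\<forall>\<^sub>F n in sequentially. inverse (real (Suc n)) < norm x" by (intro order_tendstoD(2)[OF LIMSEQ_inverse_real_of_nat]) simp
    then have "\<forall>\<^sub>F n in sequentially. ?w n x * cmod (v x) = indicator (cball 0 1) x * (norm x powr (- \<beta>) * cmod (v x))"
      by eventually_elim (auto simp: w_def split: split_indicator)
    then show "(\<lambda>n. ?w n x * cmod (v x)) \<longlonglongrightarrow> indicator (cball 0 1) x * (norm x powr (- \<beta>) * cmod (v x))"
      by (rule tendsto_eventually)
  qed (simp add: w_def)
  have "(\<integral>\<^sup>+x. ennreal (indicator (cball 0 1) x * (norm x powr (- \<beta>) * cmod (v x))) \<partial>lborel) = (\<integral>\<^sup>+x. liminf (\<lambda>n. ennreal (?w n x * cmod (v x))) \<partial>lborel)"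
    using lim_imp_Liminf[OF _ lim] by (intro nn_integral_cong) simp
  also have "\<dots> \<le> liminf (\<lambda>n. \<integral>\<^sup>+x. ennreal (?w n x * cmod (v x)) \<partial>lborel)" by (rule nn_integral_liminf) measurable
  also have "\<dots> \<le> liminf (\<lambda>n::nat. ennreal ((V + H) / (1 - c)))"
  proof (intro Liminf_mono always_eventually allI)
    fix n
    have "(\<integral>\<^sup>+x. ennreal (?w n x * cmod (v x)) \<partial>lborel) = ennreal (LINT x|lborel. ?w n x * cmod (v x))"
      by (rule nn_integral_eq_integral[OF wi]) (use w0 in auto)
    then show "(\<integral>\<^sup>+x. ennreal (?w n x * cmod (v x)) \<partial>lborel) \<le> ennreal ((V + H) / (1 - c))"
      using bound[of "inverse (real (Suc n))"] by (simp add: ennreal_leI)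
  qed
  also have "\<dots> = ennreal ((V + H) / (1 - c))" by (rule Liminf_const) simp
  finally show ?thesis by (simp add: le_less_trans)
qed

text \<open>Near the origin decay gives the weight with exponent \<open>(t - 1) / 2\<close>, which
  is below \<open>5 / 2\<close> exactly for \<open>t < 6\<close>. Outside the unit ball
  \<open>w\<close> is bounded and Cauchy-Schwarz applies.\<close>

lemma decay_H1_integrable:
  assumes w: "decay_bound C w" and v: "v \<in> H1" and t: "2 \<le> t" "t < 6"
  shows "integrable lborel (\<lambda>x. cmod (w x) powr (t - 1) * cmod (v x))"
proof -
  have [measurable]: "v \<in> borel_measurable borel" "w \<in> borel_measurable borel" using H1_measurable[OF v] w L2_measurable[of w] by (auto simp: decay_bound_def)
  have C: "C \<ge> 0" using w by (simp add: decay_bound_def)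
  let ?\<beta> = "(t - 1) / 2"
  have "(\<lambda>x. indicator (cball 0 1) x * (norm x powr (- ?\<beta>) * cmod (v x))) \<in> borel_measurable lborel" by measurable
  then have i1: "integrable lborel (\<lambda>x. indicator (cball 0 1) x * (norm x powr (- ?\<beta>) * cmod (v x)))"
    by (rule integrableI_nonneg) (use nn_integral_singular_ball[OF v, of ?\<beta>] t in auto)
  have wL: "w \<in> L2" using w by (simp add: decay_bound_def)
  show ?thesis
  proof (rule Bochner_Integration.integrable_bound)
    show "integrable lborel (\<lambda>x. C powr (t - 1) * (indicator (cball 0 1) x * (norm x powr (- ?\<beta>) * cmod (v x))) + C powr (t - 2) * (cmod (w x) * cmod (v x)))"
      using i1 L2_norm_mult(1)[OF wL H1D(1)[OF v]] by (intro Bochner_Integration.integrable_add integrable_mult_right)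
    have "AE x in lborel. cmod (w x) \<le> C * norm x powr (- 1 / 2)" using w by (simp add: decay_bound_def)
    then show "AE x in lborel. norm (cmod (w x) powr (t - 1) * cmod (v x)) \<le> norm (C powr (t - 1) * (indicator (cball 0 1) x * (norm x powr (- ?\<beta>) * cmod (v x))) + C powr (t - 2) * (cmod (w x) * cmod (v x)))"
    proof eventually_elim
      case (elim x)
      have "cmod (w x) powr (t - 1) \<le> C powr (t - 1) * (indicator (cball 0 1) x * norm x powr (- ?\<beta>)) + C powr (t - 2) * cmod (w x)"
      proof (cases "norm x \<le> 1")
        case True
        have "cmod (w x) powr (t - 1) \<le> (C * norm x powr (- 1 / 2)) powr (t - 1)" using elim t by (intro powr_mono2) auto
        also have "\<dots> = C powr (t - 1) * norm x powr (- ?\<beta>)" using C by (simp add: powr_mult powr_powr algebra_simps)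
        finally show ?thesis using True by (simp add: add_increasing2)
      next
        case False
        have "norm x powr (- 1 / 2) \<le> 1 powr (- 1 / 2)" using False by (intro powr_mono2') auto
        then have "C * norm x powr (- 1 / 2) \<le> C" using C by (simp add: mult_left_le)
        then have le: "cmod (w x) \<le> C" using elim by simp
        show ?thesis
        proof (cases "w x = 0")
          case z: False
          have "cmod (w x) powr (t - 1) = cmod (w x) powr (t - 2) * cmod (w x) powr 1" unfolding powr_add[symmetric] by simp
          also have "\<dots> \<le> C powr (t - 2) * cmod (w x)" using le t by (auto intro!: mult_right_mono powr_mono2)
          finally show ?thesis using False by simp
        qed simp
      qed
      from mult_right_mono[OF this, of "cmod (v x)"] show ?case by (simp add: algebra_simps)
    qed
  qed measurable
qed


section \<open>Compactness of radial solutions\<close>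

text \<open>The decay rate raised to the power \<open>p - 1\<close> and cut to a ball. Up to a
  constant it dominates there every power \<open>t - 1\<close> with \<open>t \<le> p\<close> of a
  decaying function, and the function itself.\<close>

definition core_weight :: "real \<Rightarrow> real \<Rightarrow> space \<Rightarrow> real" where
  "core_weight p R x = indicator (cball 0 R) x * norm x powr (- ((p - 1) / 2))"

lemma core_weight_measurable[measurable]: "core_weight p R \<in> borel_measurable borel"
  unfolding core_weight_def[abs_def] by measurable

lemma core_weight_nonneg: "0 \<le> core_weight p R x"
  by (simp add: core_weight_def)

lemma core_weight_integrable:
  assumes "p < 6" "R > 0" shows "integrable lborel (\<lambda>x. core_weight p R x * norm x powr (- 1 / 2))"
proof -
  have "core_weight p R x * norm x powr (- 1 / 2) = indicator (cball 0 R) x * norm x powr (- (p / 2))" for x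
    unfolding core_weight_def mult.assoc powr_add[symmetric] by (simp add: field_simps)
  then show ?thesis using ball_integral(1)[of "p / 2" R] assms by simp
qed

lemma core_power_le:
  assumes z: "cmod z \<le> E * norm x powr (- 1 / 2)" and E: "E \<ge> 0" and t: "2 \<le> t" "t \<le> p" and R: "R \<ge> 1" "norm x \<le> R"
  shows "cmod z powr (t - 1) \<le> ((E + 1) * sqrt R) powr (p - 1) * core_weight p R x"
proof (cases "x = 0")
  case True
  then show ?thesis using z t core_weight_nonneg[of p R x] by simp
next
  case False
  \<comment> \<open>Enlarged so that \<open>Y \<ge> 1\<close> on the whole ball; lower exponents are
    then dominated by \<open>p - 1\<close>.\<close>
  define Y where "Y = (E + 1) * sqrt R * norm x powr (- 1 / 2)"
  have s: "sqrt R * norm x powr (- 1 / 2) \<ge> 1"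
  proof -
    have "R powr (1 / 2) * norm x powr (- (1 / 2)) \<ge> norm x powr (1 / 2) * norm x powr (- (1 / 2))"
      using R by (intro mult_right_mono powr_mono2) auto
    also have "norm x powr (1 / 2) * norm x powr (- (1 / 2)) = 1" unfolding powr_add[symmetric] using False by simp
    finally show ?thesis using R by (simp add: powr_half_sqrt)
  qed
  have "1 * 1 \<le> (E + 1) * (sqrt R * norm x powr (- 1 / 2))" using E s by (intro mult_mono) auto
  then have Y1: "1 \<le> Y" by (simp add: Y_def mult.assoc)
  have "sqrt R \<ge> 1" using R by simp
  then have "E * 1 \<le> (E + 1) * sqrt R" using E by (intro mult_mono) auto
  then have "E * norm x powr (- 1 / 2) \<le> (E + 1) * sqrt R * norm x powr (- 1 / 2)" by (intro mult_right_mono) auto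
  then have zY: "cmod z \<le> Y" using z by (simp add: Y_def)
  have "cmod z powr (t - 1) \<le> Y powr (t - 1)" using zY t by (intro powr_mono2) auto
  also have "\<dots> \<le> Y powr (p - 1)" using Y1 t by (intro powr_mono) auto
  also have "\<dots> = ((E + 1) * sqrt R) powr (p - 1) * (norm x powr (- 1 / 2)) powr (p - 1)"
    unfolding Y_def using E R by (intro powr_mult) 
  also have "(norm x powr (- 1 / 2)) powr (p - 1) = core_weight p R x" using R by (simp add: core_weight_def powr_powr algebra_simps)
  finally show ?thesis .
qed

text \<open>Each nonlinear term becomes a small multiple of \<open>|z|\<close>, valid far out, plus
  a fixed weight on a ball. \<open>R\<close> and \<open>K\<close> depend neither on the function nor
  on the exponent \<open>t\<close>, so one choice serves an entire sequence of solutions.\<close>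

lemma uniform_tail_split:
  assumes E: "E \<ge> 0" and p: "10 / 3 < p" and \<eta>: "\<eta> > 0"
  shows "\<exists>R\<ge>1. \<exists>K\<ge>0. (\<forall>z x t. cmod z \<le> E * norm x powr (- 1 / 2) \<and> 10 / 3 \<le> t \<and> t \<le> p \<longrightarrow>
      cmod z powr (t - 1) \<le> \<eta> * cmod z + K * core_weight p R x) \<and>
    (\<forall>v z x. decay_bound E v \<and> mass v = M \<and> cmod z \<le> E * norm x powr (- 1 / 2) \<longrightarrow>
      coulomb_potential v x * cmod z \<le> \<eta> * cmod z + K * core_weight p R x)"
proof -
  \<comment> \<open>The cap at 1 forces \<open>|z| \<le> 1\<close> far out, where every power
    \<open>t - 2\<close> with \<open>t \<ge> 10 / 3\<close> is then at most the power
    \<open>4 / 3\<close>.\<close>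
  define \<eta>' where "\<eta>' = min \<eta> 1"
  obtain R1 where R1: "R1 \<ge> 1" "\<And>r. r \<ge> R1 \<Longrightarrow> E powr (4 / 3) * r powr (- (2 / 3)) \<le> \<eta>'"
    using tail_weight_small[of "2 / 3" \<eta>' "E powr (4 / 3)"] \<eta> by (auto simp: \<eta>'_def)
  \<comment> \<open>The mass part \<open>M / \<rho>\<close> of the potential is then at most
    \<open>\<eta> / 2\<close>; the other half is secured by
    \<open>R \<ge> 2 * c / \<eta>\<close>.\<close>
  define \<rho> where "\<rho> = 2 * \<bar>M\<bar> / \<eta> + 1"
  have \<rho>: "\<rho> > 0" unfolding \<rho>_def using \<eta> by (simp add: add_nonneg_pos)
  have M\<rho>: "M / \<rho> \<le> \<eta> / 2"
  proof -
    have "\<eta> / 2 * \<rho> = \<bar>M\<bar> + \<eta> / 2" unfolding \<rho>_def using \<eta> by (simp add: field_simps)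
    then show ?thesis using \<rho> \<eta> by (simp add: pos_divide_le_eq)
  qed
  define c where "c = 2 * E\<^sup>2 * ball_const 2 * \<rho>\<^sup>2"
  have c: "c \<ge> 0" by (simp add: c_def ball_const_nonneg)
  define R where "R = R1 + 2 * \<rho> + 2 * c / \<eta>"
  have "0 \<le> 2 * c / \<eta>" using c \<eta> by simp
  then have R: "R \<ge> 1" "R \<ge> R1" "R \<ge> 2 * \<rho>" "R \<ge> 2 * c / \<eta>" using R1(1) \<rho> unfolding R_def by linarith+
  define L where "L = ((E + 1) * sqrt R) powr (p - 1)"
  have L: "L \<ge> 0" by (simp add: L_def)
  define K0 where "K0 = 2 * E\<^sup>2 * ball_const 2 + \<bar>M\<bar>"
  have K0: "K0 \<ge> 0" by (simp add: K0_def ball_const_nonneg)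
  have cw: "0 \<le> L * core_weight p R x" "0 \<le> K0 * (L * core_weight p R x)" for x using L K0 core_weight_nonneg[of p R x] by auto
  have 1: "cmod z powr (t - 1) \<le> \<eta> * cmod z + (1 + K0) * L * core_weight p R x"
    if z: "cmod z \<le> E * norm x powr (- 1 / 2)" and t: "10 / 3 \<le> t" "t \<le> p" for z x t
  proof (cases "norm x \<le> R")
    case True
    have "cmod z powr (t - 1) \<le> L * core_weight p R x" unfolding L_def by (rule core_power_le[OF z E _ t(2) R(1) True]) (use t in simp)
    moreover have "(1 + K0) * L * core_weight p R x = L * core_weight p R x + K0 * (L * core_weight p R x)" by (simp add: algebra_simps)
    ultimately show ?thesis using cw[of x] \<eta> by (simp add: add_increasing)
  next
    case False
    have s: "cmod z powr (10 / 3 - 2) \<le> \<eta>'"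
      by (rule decay_power_outside[OF z]) (use R1(2)[of "norm x"] False R(2) in auto)
    have z1: "cmod z \<le> 1"
    proof (rule ccontr)
      assume "\<not> cmod z \<le> 1"
      then have "1 < cmod z powr (10 / 3 - 2)" by (intro gr_one_powr) auto
      with s show False by (simp add: \<eta>'_def)
    qed
    have "cmod z powr (t - 1) = cmod z powr (t - 2) * cmod z" using cmod_powr_step[of t z] t by simp
    also have "\<dots> \<le> cmod z powr (10 / 3 - 2) * cmod z" using t z1 by (intro mult_right_mono powr_mono') auto
    also have "\<dots> \<le> \<eta> * cmod z" using s by (intro mult_right_mono) (auto simp: \<eta>'_def)
    finally show ?thesis using cw[of x] K0 by (simp add: algebra_simps add_increasing2)
  qed
  have 2: "coulomb_potential v x * cmod z \<le> \<eta> * cmod z + (1 + K0) * L * core_weight p R x"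
    if v: "decay_bound E v" "mass v = M" and z: "cmod z \<le> E * norm x powr (- 1 / 2)" for v z x
  proof (cases "norm x \<le> R")
    case True
    have "coulomb_potential v x \<le> K0" using coulomb_potential_le[OF v(1), of 1 x] v(2) by (simp add: K0_def)
    then have "coulomb_potential v x * cmod z \<le> K0 * cmod z" by (rule mult_right_mono) simp
    also have "cmod z \<le> L * core_weight p R x"
      using core_power_le[OF z E _ _ R(1) True, of 2 p] p by (simp add: L_def)
    then have "K0 * cmod z \<le> K0 * (L * core_weight p R x)" by (rule mult_left_mono[OF _ K0])
    also have "\<dots> \<le> \<eta> * cmod z + (1 + K0) * L * core_weight p R x" using cw[of x] \<eta> by (simp add: algebra_simps add_increasing2)
    finally show ?thesis .
  next
    case False
    have "coulomb_potential v x \<le> c / norm x + M / \<rho>"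
      using coulomb_potential_decay[OF v(1) \<rho>, of x] False R(3) v(2) by (simp add: c_def)
    also have "c / norm x \<le> \<eta> / 2"
    proof -
      have "2 * c / \<eta> < norm x" using False R by linarith
      then have "c < norm x * (\<eta> / 2)" using \<eta> by (simp add: pos_divide_less_eq)
      moreover have "norm x > 0" using False R(1) by linarith
      ultimately show ?thesis by (simp only: pos_divide_le_eq mult.commute)
    qed
    finally have "coulomb_potential v x \<le> \<eta>" using M\<rho> by linarith
    from mult_right_mono[OF this, of "cmod z"] show ?thesis using cw[of x] by (simp add: algebra_simps add_increasing2)
  qed
  show ?thesis
    by (intro exI[of _ R] conjI exI[of _ "(1 + K0) * L"]) (use R(1) K0 L 1 2 in auto)
qed

lemma integral_abs_le:
  fixes f g :: "space \<Rightarrow> real"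
  assumes "integrable lborel g" "f \<in> borel_measurable lborel" "AE x in lborel. \<bar>f x\<bar> \<le> g x"
  shows "integrable lborel f" "\<bar>LINT x|lborel. f x\<bar> \<le> (LINT x|lborel. g x)"
proof -
  show i: "integrable lborel f" by (rule Bochner_Integration.integrable_bound[OF assms(1,2)]) (use assms(3) in eventually_elim, simp)
  have "\<bar>LINT x|lborel. f x\<bar> \<le> (LINT x|lborel. \<bar>f x\<bar>)" by (rule integral_abs_bound)
  also have "\<dots> \<le> (LINT x|lborel. g x)" by (rule integral_mono_AE) (use i assms in auto)
  finally show "\<bar>LINT x|lborel. f x\<bar> \<le> (LINT x|lborel. g x)" .
qed

text \<open>The equation is solved for its linear part and the rest is estimated in absolute value.
  The factor \<open>2 + \<mu>\<close> counts the Coulomb term, the \<open>p\<close> power and the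
  \<open>q\<close> power with its coefficient.\<close>

lemma solution_pairing_bound:
  assumes ws: "weak_solution \<mu> p q lam u" and u: "decay_bound E u" and w: "w \<in> H1" "decay_bound D w" and \<mu>: "\<mu> > 0"
    and pq: "10 / 3 < q" "q < p" "p < 6" and R: "R \<ge> 1" "\<eta> \<ge> 0" "K \<ge> 0"
    and P: "\<And>z x t. cmod z \<le> E * norm x powr (- 1 / 2) \<Longrightarrow> 10 / 3 \<le> t \<Longrightarrow> t \<le> p \<Longrightarrow>
      cmod z powr (t - 1) \<le> \<eta> * cmod z + K * core_weight p R x"
    and \<Phi>: "\<And>z x. cmod z \<le> E * norm x powr (- 1 / 2) \<Longrightarrow> coulomb_potential u x * cmod z \<le> \<eta> * cmod z + K * core_weight p R x"
  shows "integrable lborel (\<lambda>x. core_weight p R x * cmod (w x))"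
    and "\<bar>(LINT x|lborel. inner (weak_grad u x) (weak_grad w x)) + lam * (LINT x|lborel. inner (u x) (w x))\<bar>
      \<le> (2 + \<mu>) * (\<eta> * (LINT x|lborel. cmod (u x) * cmod (w x)) + K * (LINT x|lborel. core_weight p R x * cmod (w x)))"
proof -
  have uH: "u \<in> H1" using ws by (simp add: weak_solution_def)
  have [measurable]: "u \<in> borel_measurable borel" "w \<in> borel_measurable borel" "coulomb_potential u \<in> borel_measurable borel"
    using H1_measurable[OF uH] H1_measurable[OF w(1)] coulomb_potential_measurable[OF H1D(1)[OF uH]] by auto
  have ud: "AE x in lborel. cmod (u x) \<le> E * norm x powr (- 1 / 2)" and wd: "AE x in lborel. cmod (w x) \<le> D * norm x powr (- 1 / 2)"
    using u w by (auto simp: decay_bound_def)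
  have p6: "p < 6" "0 < R" using pq R by auto
  show ci: "integrable lborel (\<lambda>x. core_weight p R x * cmod (w x))"
  proof (rule integral_abs_le(1)[OF integrable_mult_right[OF core_weight_integrable[OF p6], of D]])
    show "AE x in lborel. \<bar>core_weight p R x * cmod (w x)\<bar> \<le> D * (core_weight p R x * norm x powr (- 1 / 2))"
      using wd by eventually_elim (auto simp: abs_mult core_weight_nonneg mult.left_commute[of D] intro!: mult_left_mono)
  qed measurable
  have ui: "integrable lborel (\<lambda>x. cmod (u x) * cmod (w x))" by (rule L2_norm_mult(1)[OF H1D(1)[OF uH] H1D(1)[OF w(1)]])
  define S where "S = \<eta> * (LINT x|lborel. cmod (u x) * cmod (w x)) + K * (LINT x|lborel. core_weight p R x * cmod (w x))"
  have B: "\<bar>LINT x|lborel. f x * inner (u x) (w x)\<bar> \<le> S"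
    if f: "f \<in> borel_measurable borel" "AE x in lborel. \<bar>f x\<bar> * cmod (u x) \<le> \<eta> * cmod (u x) + K * core_weight p R x" for f
  proof -
    have [measurable]: "f \<in> borel_measurable borel" by (rule f)
    have "\<bar>LINT x|lborel. f x * inner (u x) (w x)\<bar> \<le> (LINT x|lborel. \<eta> * (cmod (u x) * cmod (w x)) + K * (core_weight p R x * cmod (w x)))"
    proof (rule integral_abs_le(2))
      show "AE x in lborel. \<bar>f x * inner (u x) (w x)\<bar> \<le> \<eta> * (cmod (u x) * cmod (w x)) + K * (core_weight p R x * cmod (w x))"
        using f(2)
      proof eventually_elim
        case (elim x)
        have "\<bar>f x * inner (u x) (w x)\<bar> \<le> \<bar>f x\<bar> * (cmod (u x) * cmod (w x))"
          unfolding abs_mult by (intro mult_left_mono Cauchy_Schwarz_ineq2) simp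
        also have "\<dots> \<le> (\<eta> * cmod (u x) + K * core_weight p R x) * cmod (w x)"
          unfolding mult.assoc[symmetric] by (rule mult_right_mono[OF elim]) simp
        finally show ?case by (simp add: algebra_simps)
      qed
    qed (use ci ui in auto)
    also have "\<dots> = S" unfolding S_def using ci ui by simp
    finally show ?thesis .
  qed
  have Bt: "\<bar>LINT x|lborel. cmod (u x) powr (t - 2) * inner (u x) (w x)\<bar> \<le> S" if t: "10 / 3 \<le> t" "t \<le> p" for t
  proof (rule B)
    show "AE x in lborel. \<bar>cmod (u x) powr (t - 2)\<bar> * cmod (u x) \<le> \<eta> * cmod (u x) + K * core_weight p R x"
      using ud
    proof eventually_elim
      case (elim x)
      show ?case using P[OF elim t] cmod_powr_step[of t "u x"] t by simp
    qed
  qed measurable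
  have B\<Phi>: "\<bar>LINT x|lborel. coulomb_potential u x * inner (u x) (w x)\<bar> \<le> S"
  proof (rule B)
    show "AE x in lborel. \<bar>coulomb_potential u x\<bar> * cmod (u x) \<le> \<eta> * cmod (u x) + K * core_weight p R x"
      using ud by eventually_elim (simp add: \<Phi> coulomb_potential_nonneg)
  qed measurable
  have wf: "weak_form \<mu> p q lam u w = 0" by (rule weak_form_eq_0[OF ws u w]) (use pq in auto)
  have "\<bar>\<mu> * (LINT x|lborel. cmod (u x) powr (q - 2) * inner (u x) (w x))\<bar> \<le> \<mu> * S"
    unfolding abs_mult using Bt[of q] \<mu> pq by simp
  moreover have "\<bar>LINT x|lborel. cmod (u x) powr (p - 2) * inner (u x) (w x)\<bar> \<le> S" using Bt[of p] pq by simp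
  ultimately show "\<bar>(LINT x|lborel. inner (weak_grad u x) (weak_grad w x)) + lam * (LINT x|lborel. inner (u x) (w x))\<bar>
      \<le> (2 + \<mu>) * (\<eta> * (LINT x|lborel. cmod (u x) * cmod (w x)) + K * (LINT x|lborel. core_weight p R x * cmod (w x)))"
    using wf B\<Phi> unfolding weak_form_def S_def[symmetric] by (simp add: algebra_simps)
qed


text \<open>The nonlinear terms of the two equations are not compared with each other but bounded
  separately against \<open>w\<close>, so exponents and potentials need not be close. Besides the
  multipliers and \<open>\<eta>\<close>, only the integral of \<open>|w|\<close> against
  \<open>core_weight\<close> has to become small.\<close>

lemma solution_difference_bound:
  assumes ws: "weak_solution \<mu> p q lam u" "weak_solution \<mu> p q' lam' v" and E: "decay_bound E u" "decay_bound E v"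
    and m: "mass u = a\<^sup>2" "mass v = a\<^sup>2" "a > 0" and \<mu>: "\<mu> > 0"
    and pq: "10 / 3 < q" "q < p" "10 / 3 < q'" "q' < p" "p < 6" and R: "R \<ge> 1" "\<eta> \<ge> 0" "K \<ge> 0"
    and P: "\<And>z x t. cmod z \<le> E * norm x powr (- 1 / 2) \<Longrightarrow> 10 / 3 \<le> t \<Longrightarrow> t \<le> p \<Longrightarrow>
      cmod z powr (t - 1) \<le> \<eta> * cmod z + K * core_weight p R x"
    and \<Phi>: "\<And>u z x. decay_bound E u \<Longrightarrow> mass u = a\<^sup>2 \<Longrightarrow> cmod z \<le> E * norm x powr (- 1 / 2) \<Longrightarrow>
      coulomb_potential u x * cmod z \<le> \<eta> * cmod z + K * core_weight p R x"
  defines "w \<equiv> \<lambda>x. u x - v x"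
  shows "dirichlet w + lam * mass w \<le> \<bar>lam - lam'\<bar> * (2 * a\<^sup>2) + 2 * (2 + \<mu>) * (2 * a\<^sup>2 * \<eta> + K * (LINT x|lborel. core_weight p R x * cmod (w x)))"
proof -
  have uH: "u \<in> H1" and vH: "v \<in> H1" using ws by (auto simp: weak_solution_def)
  note w = H1_diff[OF uH vH, folded w_def]
  have wd: "decay_bound (E + E) w" unfolding w_def by (rule decay_diff[OF E(2,1)])
  note pu = solution_pairing_bound(2)[OF ws(1) E(1) w(1) wd \<mu> pq(1,2,5) R P \<Phi>[OF E(1) m(1)]]
  note pv = solution_pairing_bound(2)[OF ws(2) E(2) w(1) wd \<mu> pq(3,4,5) R P \<Phi>[OF E(2) m(2)]]
  have L2s: "u \<in> L2" "v \<in> L2" "w \<in> L2" "weak_grad u \<in> L2" "weak_grad v \<in> L2" "weak_grad w \<in> L2"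
    using H1D(1,2)[OF uH] H1D(1,2)[OF vH] H1D(1,2)[OF w(1)] by auto
  have "dirichlet w = (LINT x|lborel. inner (weak_grad u x) (weak_grad w x) - inner (weak_grad v x) (weak_grad w x))"
    unfolding dirichlet_def
  proof (rule integral_cong_AE)
    show "AE x in lborel. (norm (weak_grad w x))\<^sup>2 = inner (weak_grad u x) (weak_grad w x) - inner (weak_grad v x) (weak_grad w x)"
      using w(2) by eventually_elim (simp add: power2_norm_eq_inner inner_diff_left)
  qed (rule borel_measurable_integrable[OF L2_integrable[OF L2s(6)]],
      rule borel_measurable_integrable[OF Bochner_Integration.integrable_diff[OF L2_inner(1)[OF L2s(4,6)] L2_inner(1)[OF L2s(5,6)]]])
  also have "\<dots> = (LINT x|lborel. inner (weak_grad u x) (weak_grad w x)) - (LINT x|lborel. inner (weak_grad v x) (weak_grad w x))"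
    using L2s by (intro Bochner_Integration.integral_diff L2_inner(1))
  finally have dw: "dirichlet w = \<dots>" .
  have mw: "mass w = (LINT x|lborel. inner (u x) (w x)) - (LINT x|lborel. inner (v x) (w x))"
    unfolding mass_def Bochner_Integration.integral_diff[OF L2_inner(1)[OF L2s(1,3)] L2_inner(1)[OF L2s(2,3)], symmetric]
    by (simp add: power2_norm_eq_inner w_def inner_diff_left)
  have "mass w \<le> (LINT x|lborel. 2 * (cmod (u x))\<^sup>2 + 2 * (cmod (v x))\<^sup>2)"
    unfolding mass_def
  proof (rule integral_mono)
    fix x
    have "(cmod (w x))\<^sup>2 \<le> (cmod (u x) + cmod (v x))\<^sup>2" unfolding w_def by (intro power_mono norm_triangle_ineq4) simp
    then show "(cmod (w x))\<^sup>2 \<le> 2 * (cmod (u x))\<^sup>2 + 2 * (cmod (v x))\<^sup>2"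
      using sum_squares_bound[of "cmod (u x)" "cmod (v x)"] by (simp add: power2_sum)
  qed (use L2_integrable[OF L2s(1)] L2_integrable[OF L2s(2)] L2_integrable[OF L2s(3)] in auto)
  also have "\<dots> = (2 * a)\<^sup>2" using L2_integrable[OF L2s(1)] L2_integrable[OF L2s(2)] m by (simp add: mass_def power_mult_distrib)
  finally have sw: "sqrt (mass w) \<le> 2 * a" using m(3) by (intro real_le_lsqrt) (auto simp: mass_nonneg)
  have cs: "(LINT x|lborel. cmod (z x) * cmod (w x)) \<le> 2 * a\<^sup>2" if "z \<in> L2" "mass z = a\<^sup>2" for z
  proof -
    have "(LINT x|lborel. cmod (z x) * cmod (w x)) \<le> sqrt (mass z) * sqrt (mass w)"
      unfolding mass_def by (rule L2_norm_mult(2)[OF that(1) L2s(3)])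
    also have "\<dots> \<le> a * (2 * a)" using sw that m(3) by (auto intro!: mult_left_mono)
    finally show ?thesis by (simp add: power2_eq_square)
  qed
  have vw: "\<bar>LINT x|lborel. inner (v x) (w x)\<bar> \<le> 2 * a\<^sup>2"
  proof -
    have "\<bar>LINT x|lborel. inner (v x) (w x)\<bar> \<le> (LINT x|lborel. cmod (v x) * cmod (w x))"
      by (rule integral_abs_le(2)[OF L2_norm_mult(1)[OF L2s(2,3)]])
        (use L2_inner(1)[OF L2s(2,3)] Cauchy_Schwarz_ineq2 in \<open>auto intro: borel_measurable_integrable\<close>)
    with cs[OF L2s(2) m(2)] show ?thesis by simp
  qed
  define I where "I = K * (LINT x|lborel. core_weight p R x * cmod (w x))"
  have le: "(2 + \<mu>) * (\<eta> * (LINT x|lborel. cmod (z x) * cmod (w x)) + I) \<le> (2 + \<mu>) * (2 * a\<^sup>2 * \<eta> + I)" if "z \<in> L2" "mass z = a\<^sup>2" for z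
    using mult_left_mono[OF cs[OF that] R(2)] \<mu> by (intro mult_left_mono add_right_mono) (auto simp: mult_ac)
  have "\<bar>(lam - lam') * (LINT x|lborel. inner (v x) (w x))\<bar> \<le> \<bar>lam - lam'\<bar> * (2 * a\<^sup>2)"
    unfolding abs_mult by (rule mult_left_mono[OF vw]) simp
  \<comment> \<open>The second equation carries its own multiplier; replacing it by
    \<open>lam\<close> leaves a pairing with \<open>v\<close>.\<close>
  moreover have "dirichlet w + lam * mass w = ((LINT x|lborel. inner (weak_grad u x) (weak_grad w x)) + lam * (LINT x|lborel. inner (u x) (w x)))
      - ((LINT x|lborel. inner (weak_grad v x) (weak_grad w x)) + lam' * (LINT x|lborel. inner (v x) (w x)))
      - (lam - lam') * (LINT x|lborel. inner (v x) (w x))"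
    unfolding dw mw by (simp add: algebra_simps)
  moreover have "2 * (2 + \<mu>) * (2 * a\<^sup>2 * \<eta> + I) = (2 + \<mu>) * (2 * a\<^sup>2 * \<eta> + I) + (2 + \<mu>) * (2 * a\<^sup>2 * \<eta> + I)" by simp
  ultimately show ?thesis
    using order_trans[OF pu[folded I_def] le[OF L2s(1) m(1)]] order_trans[OF pv[folded I_def] le[OF L2s(2) m(2)]]
    unfolding I_def[symmetric] abs_le_iff by linarith
qed

text \<open>Decay supplies the majorant: core weight times decay rate is
  \<open>|x| powr (- p / 2)\<close> on the ball, integrable since \<open>p < 6\<close>. Pointwise
  convergence therefore suffices.\<close>

lemma core_weight_convergence:
  assumes d: "\<And>n. decay_bound E (u n)" and conv: "AE x in lborel. convergent (\<lambda>n. u n x)" and p: "p < 6" "R > 0" and e: "e > 0"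
  shows "\<exists>N. \<forall>m\<ge>N. \<forall>n\<ge>N. (LINT x|lborel. core_weight p R x * cmod (u m x - u n x)) < e"
proof -
  have [measurable]: "u n \<in> borel_measurable borel" for n using d[of n] L2_measurable[of "u n"] by (simp add: decay_bound_def)
  define U where "U x = lim (\<lambda>n. u n x)" for x
  have [measurable]: "U \<in> borel_measurable borel" unfolding U_def[abs_def] by (rule borel_measurable_lim_metric) simp
  have E: "E \<ge> 0" using d[of 0] by (simp add: decay_bound_def)
  have ud: "AE x in lborel. \<forall>n. cmod (u n x) \<le> E * norm x powr (- 1 / 2)" unfolding AE_all_countable using d by (simp add: decay_bound_def)
  have lim: "AE x in lborel. (\<lambda>n. u n x) \<longlonglongrightarrow> U x" using conv by eventually_elim (simp add: U_def convergent_LIMSEQ_iff)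
  have Ub: "AE x in lborel. cmod (U x) \<le> E * norm x powr (- 1 / 2)"
    using ud lim by eventually_elim (rule LIMSEQ_le_const2[OF tendsto_norm], auto)
  let ?D = "\<lambda>x. 2 * E * (core_weight p R x * norm x powr (- 1 / 2))"
  have Di: "integrable lborel ?D" using core_weight_integrable[OF p] by simp
  have bn: "AE x in lborel. norm (core_weight p R x * cmod (u n x - U x)) \<le> ?D x" for n
    using ud Ub
  proof eventually_elim
    case (elim x)
    have "cmod (u n x - U x) \<le> 2 * (E * norm x powr (- 1 / 2))" using norm_triangle_ineq4[of "u n x" "U x"] elim(1)[rule_format, of n] elim(2) by linarith
    from mult_left_mono[OF this core_weight_nonneg[of p R x]] show ?case by (simp add: abs_mult core_weight_nonneg mult_ac)
  qed
  have "(\<lambda>n. LINT x|lborel. core_weight p R x * cmod (u n x - U x)) \<longlonglongrightarrow> (LINT x|(lborel::space measure). (0::real))"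
  proof (rule integral_dominated_convergence[where w="?D"])
    show "integrable lborel ?D" by (rule Di)
    show "AE x in lborel. norm (core_weight p R x * cmod (u n x - U x)) \<le> ?D x" for n by (rule bn)
    show "AE x in lborel. (\<lambda>n. core_weight p R x * cmod (u n x - U x)) \<longlonglongrightarrow> 0"
      using lim by eventually_elim (intro tendsto_mult_right_zero tendsto_norm_zero, simp add: LIM_zero)
  qed measurable
  then have "\<forall>\<^sub>F n in sequentially. (LINT x|lborel. core_weight p R x * cmod (u n x - U x)) < e / 2"
    by (rule order_tendstoD(2)) (use e in simp)
  then obtain N where N: "\<And>n. n \<ge> N \<Longrightarrow> (LINT x|lborel. core_weight p R x * cmod (u n x - U x)) < e / 2"
    by (auto simp: eventually_sequentially)
  have i: "integrable lborel (\<lambda>x. core_weight p R x * cmod (u n x - U x))" for n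
    by (rule integral_abs_le(1)[OF Di]) (use bn[of n] in auto)
  show ?thesis
  proof (intro exI[of _ N] allI impI)
    fix m n assume mn: "N \<le> m" "N \<le> n"
    have "(LINT x|lborel. core_weight p R x * cmod (u m x - u n x)) \<le> (LINT x|lborel. core_weight p R x * cmod (u m x - U x) + core_weight p R x * cmod (u n x - U x))"
    proof (rule order_trans[OF abs_ge_self integral_abs_le(2)])
      show "integrable lborel (\<lambda>x. core_weight p R x * cmod (u m x - U x) + core_weight p R x * cmod (u n x - U x))" using i by simp
      show "AE x in lborel. \<bar>core_weight p R x * cmod (u m x - u n x)\<bar> \<le> core_weight p R x * cmod (u m x - U x) + core_weight p R x * cmod (u n x - U x)"
      proof (rule AE_I2)
        fix x
        have "cmod (u m x - u n x) \<le> cmod (u m x - U x) + cmod (u n x - U x)" using norm_triangle_ineq4[of "u m x - U x" "u n x - U x"] by simp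
        from mult_left_mono[OF this core_weight_nonneg[of p R x]]
        show "\<bar>core_weight p R x * cmod (u m x - u n x)\<bar> \<le> core_weight p R x * cmod (u m x - U x) + core_weight p R x * cmod (u n x - U x)"
          by (simp add: abs_mult core_weight_nonneg distrib_left)
      qed
    qed measurable
    also have "\<dots> = (LINT x|lborel. core_weight p R x * cmod (u m x - U x)) + (LINT x|lborel. core_weight p R x * cmod (u n x - U x))"
      using i by simp
    also have "\<dots> < e" using N[OF mn(1)] N[OF mn(2)] by simp
    finally show "(LINT x|lborel. core_weight p R x * cmod (u m x - u n x)) < e" .
  qed
qed

text \<open>The Arzela-Ascoli argument for profiles: a diagonal subsequence converges at all
  positive rational radii, and the uniform Hoelder estimate extends this to every positive
  radius.\<close>

lemma radial_pointwise_subsequence: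
  fixes u :: "nat \<Rightarrow> space \<Rightarrow> complex" and A :: real
  assumes u: "\<And>n. u n \<in> H1r" and A: "\<And>n. dirichlet (u n) \<le> A"
  obtains r where "strict_mono r" "AE x in lborel. convergent (\<lambda>n. u (r n) x)"
proof -
  have uH: "u n \<in> H1" for n using u by (simp add: H1r_def)
  have A0: "A \<ge> 0" using A[of 0] dirichlet_nonneg[of "u 0"] by simp
  let ?S = "\<rat> \<inter> {0<..} :: real set"
  \<comment> \<open>The factor \<open>sqrt r\<close> turns the decay into one bound for all radii,
    the form the diagonal lemma asks for.\<close>
  let ?f = "\<lambda>n r. sqrt r *\<^sub>R profile (u n) r"
  have b: "norm (?f n r) \<le> sqrt (A / (4 * pi))" if "r \<in> ?S" for n r
  proof -
    have r: "r > 0" using that by simp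
    have "(norm (?f n r))\<^sup>2 = r * (norm (profile (u n) r))\<^sup>2" using r by (simp add: power_mult_distrib)
    also have "\<dots> \<le> r * (dirichlet (u n) / (4 * pi * r))" using profile_bound[OF uH r, of n] r by (intro mult_left_mono) auto
    also have "\<dots> = dirichlet (u n) / (4 * pi)" using r by simp
    also have "\<dots> \<le> A / (4 * pi)" using A[of n] by (simp add: divide_right_mono)
    finally show ?thesis by (rule real_le_rsqrt)
  qed
  have "countable ?S" by (intro countable_Int1 countable_rat)
  from function_convergent_subsequence[of ?S ?f, OF this b]
  obtain k where k: "strict_mono k" "\<And>r. r \<in> ?S \<Longrightarrow> \<exists>l. (\<lambda>n. ?f (k n) r) \<longlonglongrightarrow> l" by blast
  have rat: "Cauchy (\<lambda>n. profile (u (k n)) s)" if s: "s \<in> ?S" for s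
  proof -
    obtain l where "(\<lambda>n. ?f (k n) s) \<longlonglongrightarrow> l" using k(2)[OF s] by blast
    then have "(\<lambda>n. (1 / sqrt s) *\<^sub>R ?f (k n) s) \<longlonglongrightarrow> (1 / sqrt s) *\<^sub>R l" by (intro tendsto_intros)
    then have "(\<lambda>n. profile (u (k n)) s) \<longlonglongrightarrow> (1 / sqrt s) *\<^sub>R l" using s by simp
    then show ?thesis by (rule LIMSEQ_imp_Cauchy)
  qed
  have conv: "convergent (\<lambda>n. profile (u (k n)) r)" if r: "r > 0" for r
  proof (rule Cauchy_convergent, rule CauchyI)
    fix e :: real assume e: "e > 0"
    \<comment> \<open>A rational radius close to \<open>r\<close> from the right makes the Hoelder
      error smaller than \<open>e / 3\<close>, for all members of the sequence at once.\<close>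
    have "((\<lambda>s. sqrt (A * \<bar>1 / r - 1 / s\<bar> / (4 * pi))) \<longlongrightarrow> sqrt (A * \<bar>1 / r - 1 / r\<bar> / (4 * pi))) (at_right r)"
      using r by (intro tendsto_intros) auto
    then have "\<forall>\<^sub>F s in at_right r. sqrt (A * \<bar>1 / r - 1 / s\<bar> / (4 * pi)) < e / 3" using e by (intro order_tendstoD(2)) auto
    then obtain b where b: "b > r" "\<And>s. r < s \<Longrightarrow> s < b \<Longrightarrow> sqrt (A * \<bar>1 / r - 1 / s\<bar> / (4 * pi)) < e / 3"
      unfolding eventually_at_right_field by blast
    obtain s where s: "s \<in> \<rat>" "r < s" "s < b" using Rats_dense_in_real[OF b(1)] by blast
    have h: "norm (profile (u n) r - profile (u n) s) < e / 3" for n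
    proof -
      have "norm (profile (u n) r - profile (u n) s) \<le> sqrt (dirichlet (u n) * \<bar>1 / r - 1 / s\<bar> / (4 * pi))"
        by (rule profile_holder[OF uH]) (use r s in auto)
      also have "\<dots> \<le> sqrt (A * \<bar>1 / r - 1 / s\<bar> / (4 * pi))" using A[of n] by (intro real_sqrt_le_mono divide_right_mono mult_right_mono) auto
      finally show ?thesis using b(2)[OF s(2,3)] by simp
    qed
    have "Cauchy (\<lambda>n. profile (u (k n)) s)" by (rule rat) (use s r in auto)
    then obtain M where M: "\<And>m n. m \<ge> M \<Longrightarrow> n \<ge> M \<Longrightarrow> norm (profile (u (k m)) s - profile (u (k n)) s) < e / 3"
      using e by (meson CauchyD divide_pos_pos zero_less_numeral)
    show "\<exists>M. \<forall>m\<ge>M. \<forall>n\<ge>M. norm (profile (u (k m)) r - profile (u (k n)) r) < e"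
    proof (intro exI[of _ M] allI impI)
      fix m n assume mn: "M \<le> m" "M \<le> n"
      let ?d = "\<lambda>m. profile (u (k m)) r - profile (u (k m)) s"
      have "norm (profile (u (k m)) r - profile (u (k n)) r) = norm (?d m + (profile (u (k m)) s - profile (u (k n)) s) - ?d n)" by simp
      also have "\<dots> \<le> norm (?d m) + norm (profile (u (k m)) s - profile (u (k n)) s) + norm (?d n)"
        by (intro order_trans[OF norm_triangle_ineq4] add_right_mono norm_triangle_ineq)
      also have "\<dots> < e" using h[of "k m"] h[of "k n"] M[OF mn] by linarith
      finally show "norm (profile (u (k m)) r - profile (u (k n)) r) < e" .
    qed
  qed
  show thesis
  proof (rule that[OF k(1)])
    have 1: "AE x in lborel. \<forall>n. u n x = profile (u n) (norm x)" unfolding AE_all_countable by (intro allI radial_profile u)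
    have 2: "AE x in lborel. x \<noteq> (0::space)" by (rule AE_lborel_singleton)
    from 1 2 show "AE x in lborel. convergent (\<lambda>n. u (k n) x)"
      by eventually_elim (simp add: conv)
  qed
qed


section \<open>Passage to the limit in the functionals and in the equation\<close>

text \<open>The hypotheses are what \<open>L2_Cauchy_subseq\<close> yields for the functions and for
  their gradients. Dominated convergence in the defining identity shows that the limit of the
  gradients is the gradient of the limit.\<close>

lemma H1_dominated_limit:
  fixes U :: "nat \<Rightarrow> space \<Rightarrow> complex"
  assumes U: "\<And>n. U n \<in> H1" and u0: "u0 \<in> L2" and G: "G \<in> L2"
    and W: "W \<in> borel_measurable borel" "integrable lborel (\<lambda>x. (W x)\<^sup>2)" "AE x in lborel. \<forall>n. cmod (U n x) \<le> W x"
    and V: "V \<in> borel_measurable borel" "integrable lborel (\<lambda>x. (V x)\<^sup>2)" "AE x in lborel. \<forall>n. norm (weak_grad (U n) x) \<le> V x"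
    and lim: "AE x in lborel. (\<lambda>n. U n x) \<longlonglongrightarrow> u0 x" "AE x in lborel. (\<lambda>n. weak_grad (U n) x) \<longlonglongrightarrow> G x"
    and L2: "(\<lambda>n. LINT x|lborel. (cmod (U n x - u0 x))\<^sup>2) \<longlonglongrightarrow> 0" "(\<lambda>n. LINT x|lborel. (norm (weak_grad (U n) x - G x))\<^sup>2) \<longlonglongrightarrow> 0"
  shows "u0 \<in> H1" "AE x in lborel. (\<lambda>n. weak_grad (U n) x) \<longlonglongrightarrow> weak_grad u0 x"
    "(\<lambda>n. mass (U n)) \<longlonglongrightarrow> mass u0" "(\<lambda>n. dirichlet (U n)) \<longlonglongrightarrow> dirichlet u0"
    "(\<lambda>n. H1_norm (\<lambda>x. U n x - u0 x)) \<longlonglongrightarrow> 0"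
proof -
  have m[measurable]: "U n \<in> borel_measurable borel" "weak_grad (U n) \<in> borel_measurable borel" "u0 \<in> borel_measurable borel" "G \<in> borel_measurable borel" for n
    using H1_measurable[OF U] weak_grad_measurable[OF U] L2_measurable[OF u0] L2_measurable[OF G] by auto
  have [measurable]: "(\<lambda>x. weak_grad (U n) x $ i) \<in> borel_measurable borel" "(\<lambda>x. G x $ i) \<in> borel_measurable borel" for n i
    by measurable
  have "has_weak_gradient u0 G"
    unfolding has_weak_gradient_def
  proof (intro ballI allI)
    fix \<phi> i assume \<phi>: "\<phi> \<in> test_functions"
    have [measurable]: "\<phi> \<in> borel_measurable borel" "partial i \<phi> \<in> borel_measurable borel"
      using test_function_measurable[OF \<phi>] test_function_measurable[OF partial_test_function[OF \<phi>]] by auto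
    have d: "integrable lborel (\<lambda>x. \<bar>\<psi> x\<bar> * Z x)" if "\<psi> \<in> test_functions" "Z \<in> borel_measurable borel" "integrable lborel (\<lambda>x. (Z x)\<^sup>2)" for \<psi> and Z :: "space \<Rightarrow> real"
    proof -
      have [measurable]: "\<psi> \<in> borel_measurable borel" using test_function_measurable[OF that(1)] by simp
      show ?thesis by (rule L2_mult(1)) (use that L2_integrable[OF test_function_L2[OF that(1)]] in auto)
    qed
    have "(\<lambda>n. LINT x|lborel. partial i \<phi> x *\<^sub>R U n x) \<longlonglongrightarrow> (LINT x|lborel. partial i \<phi> x *\<^sub>R u0 x)"
    proof (rule integral_dominated_convergence)
      show "integrable lborel (\<lambda>x. \<bar>partial i \<phi> x\<bar> * W x)" by (rule d[OF partial_test_function[OF \<phi>] W(1,2)])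
      show "AE x in lborel. (\<lambda>n. partial i \<phi> x *\<^sub>R U n x) \<longlonglongrightarrow> partial i \<phi> x *\<^sub>R u0 x"
        using lim(1) by eventually_elim (intro tendsto_intros)
      show "AE x in lborel. norm (partial i \<phi> x *\<^sub>R U n x) \<le> \<bar>partial i \<phi> x\<bar> * W x" for n
        using W(3) by eventually_elim (simp add: mult_left_mono)
    qed measurable
    moreover have "(\<lambda>n. - (LINT x|lborel. \<phi> x *\<^sub>R (weak_grad (U n) x $ i))) \<longlonglongrightarrow> - (LINT x|lborel. \<phi> x *\<^sub>R (G x $ i))"
    proof (rule tendsto_minus, rule integral_dominated_convergence)
      show "integrable lborel (\<lambda>x. \<bar>\<phi> x\<bar> * V x)" by (rule d[OF \<phi> V(1,2)])
      show "AE x in lborel. (\<lambda>n. \<phi> x *\<^sub>R (weak_grad (U n) x $ i)) \<longlonglongrightarrow> \<phi> x *\<^sub>R (G x $ i)"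
        using lim(2) by eventually_elim (intro tendsto_intros)
      show "AE x in lborel. norm (\<phi> x *\<^sub>R (weak_grad (U n) x $ i)) \<le> \<bar>\<phi> x\<bar> * V x" for n
        using V(3) by eventually_elim (auto intro!: mult_left_mono order_trans[OF Finite_Cartesian_Product.norm_nth_le])
    qed measurable
    moreover have "(LINT x|lborel. partial i \<phi> x *\<^sub>R U n x) = - (LINT x|lborel. \<phi> x *\<^sub>R (weak_grad (U n) x $ i))" for n
      using H1D(3)[OF U] \<phi> by (auto simp: has_weak_gradient_def)
    ultimately show "(LINT x|lborel. partial i \<phi> x *\<^sub>R u0 x) = - (LINT x|lborel. \<phi> x *\<^sub>R (G x $ i))"
      using LIMSEQ_unique by simp
  qed
  note H = H1I[OF u0 G this]
  show u0H: "u0 \<in> H1" by (rule H)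
  show glim: "AE x in lborel. (\<lambda>n. weak_grad (U n) x) \<longlonglongrightarrow> weak_grad u0 x" using lim(2) H(2) by eventually_elim simp
  have [measurable]: "weak_grad u0 \<in> borel_measurable borel" using weak_grad_measurable[OF u0H] by simp
  show "(\<lambda>n. mass (U n)) \<longlonglongrightarrow> mass u0"
    unfolding mass_def
  proof (rule integral_dominated_convergence[OF _ _ W(2)])
    show "AE x in lborel. (\<lambda>n. (cmod (U n x))\<^sup>2) \<longlonglongrightarrow> (cmod (u0 x))\<^sup>2" using lim(1) by eventually_elim (intro tendsto_intros)
    show "AE x in lborel. norm ((cmod (U n x))\<^sup>2) \<le> (W x)\<^sup>2" for n using W(3) by eventually_elim (simp add: power_mono)
  qed measurable
  show "(\<lambda>n. dirichlet (U n)) \<longlonglongrightarrow> dirichlet u0"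
    unfolding dirichlet_def
  proof (rule integral_dominated_convergence[OF _ _ V(2)])
    show "AE x in lborel. (\<lambda>n. (norm (weak_grad (U n) x))\<^sup>2) \<longlonglongrightarrow> (norm (weak_grad u0 x))\<^sup>2" using glim by eventually_elim (intro tendsto_intros)
    show "AE x in lborel. norm ((norm (weak_grad (U n) x))\<^sup>2) \<le> (V x)\<^sup>2" for n using V(3) by eventually_elim (simp add: power_mono)
  qed measurable
  have "(LINT x|lborel. (norm (weak_grad (\<lambda>x. U n x - u0 x) x))\<^sup>2) = (LINT x|lborel. (norm (weak_grad (U n) x - G x))\<^sup>2)" for n
  proof (rule integral_cong_AE)
    show "AE x in lborel. (norm (weak_grad (\<lambda>x. U n x - u0 x) x))\<^sup>2 = (norm (weak_grad (U n) x - G x))\<^sup>2"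
      using H1_diff(2)[OF U u0H, of n] H(2) by eventually_elim simp
  qed (use weak_grad_measurable[OF H1_diff(1)[OF U u0H]] in measurable)
  then have "H1_norm (\<lambda>x. U n x - u0 x) = sqrt ((LINT x|lborel. (norm (weak_grad (U n) x - G x))\<^sup>2) + (LINT x|lborel. (cmod (U n x - u0 x))\<^sup>2))" for n
    unfolding H1_norm_def by simp
  moreover have "(\<lambda>n. sqrt ((LINT x|lborel. (norm (weak_grad (U n) x - G x))\<^sup>2) + (LINT x|lborel. (cmod (U n x - u0 x))\<^sup>2))) \<longlonglongrightarrow> sqrt (0 + 0)"
    by (intro tendsto_intros L2)
  ultimately show "(\<lambda>n. H1_norm (\<lambda>x. U n x - u0 x)) \<longlonglongrightarrow> 0" by simp
qed

context
  fixes U :: "nat \<Rightarrow> space \<Rightarrow> complex" and u0 V E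
  assumes V: "decay_bound E V" and dom: "AE x in lborel. \<forall>n. cmod (U n x) \<le> cmod (V x)"
    and lim: "AE x in lborel. (\<lambda>n. U n x) \<longlonglongrightarrow> u0 x"
    and U: "\<And>n. U n \<in> H1" and u0: "u0 \<in> H1"
begin

lemma limit_measurable [measurable]: "U n \<in> borel_measurable borel" "u0 \<in> borel_measurable borel" "V \<in> borel_measurable borel"
  using H1_measurable[OF U] H1_measurable[OF u0] L2_measurable[of V] V by (auto simp: decay_bound_def)

lemma coulomb_potential_limit: "(\<lambda>n. coulomb_potential (U n) x) \<longlonglongrightarrow> coulomb_potential u0 x"
  unfolding coulomb_potential_def
proof (rule integral_dominated_convergence[OF _ _ coulomb_integrable[OF V]])
  show "AE y in lborel. (\<lambda>n. (cmod (U n y))\<^sup>2 / norm (x - y)) \<longlonglongrightarrow> (cmod (u0 y))\<^sup>2 / norm (x - y)"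
    using lim by eventually_elim (unfold divide_inverse, intro tendsto_intros)
  show "AE y in lborel. norm ((cmod (U n y))\<^sup>2 / norm (x - y)) \<le> (cmod (V y))\<^sup>2 / norm (x - y)" for n
    using dom by eventually_elim (auto intro!: divide_right_mono power_mono)
qed measurable

lemma coulomb_potential_uniform: "\<exists>K. \<forall>n x. coulomb_potential (U n) x \<le> K"
proof (intro exI allI)
  fix n x
  have "coulomb_potential (U n) x \<le> coulomb_potential V x"
    unfolding coulomb_potential_def
  proof (rule order_trans[OF abs_ge_self integral_abs_le(2)[OF coulomb_integrable[OF V]]])
    show "AE y in lborel. \<bar>(cmod (U n y))\<^sup>2 / norm (x - y)\<bar> \<le> (cmod (V y))\<^sup>2 / norm (x - y)"
      using dom by eventually_elim (auto intro!: divide_right_mono power_mono)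
  qed measurable
  also have "\<dots> \<le> 2 * E\<^sup>2 * ball_const 2 * 1 + mass V / 1" by (rule coulomb_potential_le[OF V]) simp
  finally show "coulomb_potential (U n) x \<le> 2 * E\<^sup>2 * ball_const 2 * 1 + mass V / 1" .
qed

lemma coulomb_energy_limit: "(\<lambda>n. coulomb_energy (U n)) \<longlonglongrightarrow> coulomb_energy u0"
proof -
  obtain K where K: "\<And>n x. coulomb_potential (U n) x \<le> K" using coulomb_potential_uniform by blast
  have [measurable]: "coulomb_potential (U n) \<in> borel_measurable borel" "coulomb_potential u0 \<in> borel_measurable borel" for n
    using coulomb_potential_measurable H1D(1) U u0 by auto
  have VL: "V \<in> L2" using V by (simp add: decay_bound_def)
  have "(\<lambda>n. LINT x|lborel. (cmod (U n x))\<^sup>2 * coulomb_potential (U n) x) \<longlonglongrightarrow> (LINT x|lborel. (cmod (u0 x))\<^sup>2 * coulomb_potential u0 x)"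
  proof (rule integral_dominated_convergence)
    show "integrable lborel (\<lambda>x. (cmod (V x))\<^sup>2 * K)" using L2_integrable[OF VL] by simp
    show "AE x in lborel. (\<lambda>n. (cmod (U n x))\<^sup>2 * coulomb_potential (U n) x) \<longlonglongrightarrow> (cmod (u0 x))\<^sup>2 * coulomb_potential u0 x"
      using lim by eventually_elim (intro tendsto_intros coulomb_potential_limit)
    show "AE x in lborel. norm ((cmod (U n x))\<^sup>2 * coulomb_potential (U n) x) \<le> (cmod (V x))\<^sup>2 * K" for n
      using dom by eventually_elim (auto simp: abs_mult coulomb_potential_nonneg intro!: mult_mono power_mono K)
  qed measurable
  then show ?thesis unfolding coulomb_energy_eq .
qed

text \<open>The test function is an arbitrary element of \<open>H1\<close>, so the power terms are
  dominated by means of \<open>decay_H1_integrable\<close> at the exponents \<open>10 / 3\<close>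
  and \<open>p\<close>, between which all the exponents lie.\<close>

lemma weak_residual_limit:
  assumes g: "integrable lborel (\<lambda>x. (Vg x)\<^sup>2)" "Vg \<in> borel_measurable borel" "AE x in lborel. \<forall>n. norm (weak_grad (U n) x) \<le> Vg x"
    "AE x in lborel. (\<lambda>n. weak_grad (U n) x) \<longlonglongrightarrow> weak_grad u0 x"
    and v: "v \<in> H1" and lam: "lam \<longlonglongrightarrow> lam0" and p: "10 / 3 < p" "p < 6"
    and q: "q \<longlonglongrightarrow> q0" "\<And>n. 10 / 3 \<le> q n" "\<And>n. q n \<le> p"
  shows "(\<lambda>n. weak_residual \<mu> p (q n) (lam n) (U n) v) \<longlonglongrightarrow> weak_residual \<mu> p q0 lam0 u0 v"
proof -
  obtain K where K: "\<And>n x. coulomb_potential (U n) x \<le> K" using coulomb_potential_uniform by blast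
  have q0: "10 / 3 \<le> q0" by (rule LIMSEQ_le_const[OF q(1)]) (use q in auto)
  have [measurable]: "coulomb_potential (U n) \<in> borel_measurable borel" "coulomb_potential u0 \<in> borel_measurable borel" for n
    using coulomb_potential_measurable H1D(1) U u0 by auto
  have [measurable]: "v \<in> borel_measurable borel" "weak_grad v \<in> borel_measurable borel" "weak_grad (U n) \<in> borel_measurable borel" "weak_grad u0 \<in> borel_measurable borel" for n
    using H1_measurable[OF v] weak_grad_measurable[OF v] weak_grad_measurable[OF U] weak_grad_measurable[OF u0] by auto
  have VL: "V \<in> L2" using V by (simp add: decay_bound_def)
  have Vv: "integrable lborel (\<lambda>x. cmod (V x) * cmod (v x))" by (rule L2_norm_mult(1)[OF VL H1D(1)[OF v]])
  have t1: "(\<lambda>n. LINT x|lborel. (\<Sum>i\<in>UNIV. weak_grad (U n) x $ i * cnj (weak_grad v x $ i))) \<longlonglongrightarrow> (LINT x|lborel. (\<Sum>i\<in>UNIV. weak_grad u0 x $ i * cnj (weak_grad v x $ i)))"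
  proof (rule integral_dominated_convergence)
    \<comment> \<open>The 3 is the number of coordinates.\<close>
    show "integrable lborel (\<lambda>x. Vg x * (3 * norm (weak_grad v x)))"
      by (rule L2_mult(1)) (use g L2_integrable[OF H1D(2)[OF v]] in \<open>auto simp: power_mult_distrib\<close>)
    show "AE x in lborel. (\<lambda>n. \<Sum>i\<in>UNIV. weak_grad (U n) x $ i * cnj (weak_grad v x $ i)) \<longlonglongrightarrow> (\<Sum>i\<in>UNIV. weak_grad u0 x $ i * cnj (weak_grad v x $ i))"
      using g(4) by eventually_elim (intro tendsto_intros)
    show "AE x in lborel. norm (\<Sum>i\<in>UNIV. weak_grad (U n) x $ i * cnj (weak_grad v x $ i)) \<le> Vg x * (3 * norm (weak_grad v x))" for n
      using g(3)
    proof eventually_elim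
      case (elim x)
      have "norm (\<Sum>i\<in>UNIV. weak_grad (U n) x $ i * cnj (weak_grad v x $ i)) \<le> (\<Sum>i::3\<in>UNIV. Vg x * norm (weak_grad v x))"
      proof (rule order_trans[OF norm_sum sum_mono])
        fix i
        have "norm (weak_grad (U n) x $ i) \<le> Vg x" using Finite_Cartesian_Product.norm_nth_le[of "weak_grad (U n) x" i] elim[rule_format, of n] by linarith
        then show "norm (weak_grad (U n) x $ i * cnj (weak_grad v x $ i)) \<le> Vg x * norm (weak_grad v x)"
          unfolding norm_mult complex_mod_cnj by (intro mult_mono Finite_Cartesian_Product.norm_nth_le) (auto intro: order_trans[OF norm_ge_zero])
      qed
      then show ?case by simp
    qed
  qed measurable
  have t2: "(\<lambda>n. LINT x|lborel. U n x * cnj (v x)) \<longlonglongrightarrow> (LINT x|lborel. u0 x * cnj (v x))"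
  proof (rule integral_dominated_convergence[OF _ _ Vv])
    show "AE x in lborel. (\<lambda>n. U n x * cnj (v x)) \<longlonglongrightarrow> u0 x * cnj (v x)" using lim by eventually_elim (intro tendsto_intros)
    show "AE x in lborel. norm (U n x * cnj (v x)) \<le> cmod (V x) * cmod (v x)" for n
      using dom by eventually_elim (simp add: norm_mult mult_right_mono)
  qed measurable
  have t3: "(\<lambda>n. LINT x|lborel. of_real (coulomb_potential (U n) x) * U n x * cnj (v x)) \<longlonglongrightarrow> (LINT x|lborel. of_real (coulomb_potential u0 x) * u0 x * cnj (v x))"
  proof (rule integral_dominated_convergence[OF _ _ integrable_mult_right[OF Vv, of K]])
    show "AE x in lborel. (\<lambda>n. of_real (coulomb_potential (U n) x) * U n x * cnj (v x)) \<longlonglongrightarrow> of_real (coulomb_potential u0 x) * u0 x * cnj (v x)"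
      using lim by eventually_elim (intro tendsto_intros coulomb_potential_limit)
    show "AE x in lborel. norm (of_real (coulomb_potential (U n) x) * U n x * cnj (v x)) \<le> K * (cmod (V x) * cmod (v x))" for n
      using dom
    proof eventually_elim
      case (elim x)
      have "coulomb_potential (U n) x * (cmod (U n x) * cmod (v x)) \<le> K * (cmod (V x) * cmod (v x))"
        using elim K[of n x] coulomb_potential_nonneg[of "U n" x] by (intro mult_mono mult_right_mono) auto
      then show ?case by (simp add: norm_mult coulomb_potential_nonneg mult.assoc)
    qed
  qed measurable
  have t4: "(\<lambda>n. LINT x|lborel. of_real (cmod (U n x) powr (s n - 2)) * U n x * cnj (v x)) \<longlonglongrightarrow> (LINT x|lborel. of_real (cmod (u0 x) powr (s0 - 2)) * u0 x * cnj (v x))"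
    if s: "s \<longlonglongrightarrow> s0" "\<And>n. 10 / 3 \<le> s n" "\<And>n. s n \<le> p" "10 / 3 \<le> s0" for s s0
  proof (rule integral_dominated_convergence)
    show "integrable lborel (\<lambda>x. cmod (V x) powr (10 / 3 - 1) * cmod (v x) + cmod (V x) powr (p - 1) * cmod (v x))"
      using decay_H1_integrable[OF V v, of "10 / 3"] decay_H1_integrable[OF V v, of p] p by (intro Bochner_Integration.integrable_add) auto
    show "AE x in lborel. (\<lambda>n. of_real (cmod (U n x) powr (s n - 2)) * U n x * cnj (v x)) \<longlonglongrightarrow> of_real (cmod (u0 x) powr (s0 - 2)) * u0 x * cnj (v x)"
      using lim
    proof eventually_elim
      case (elim x)
      have "(\<lambda>n. cmod (U n x) powr (s n - 2)) \<longlonglongrightarrow> cmod (u0 x) powr (s0 - 2)"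
        by (rule tendsto_powr'[OF tendsto_norm[OF elim] tendsto_diff[OF s(1) tendsto_const]]) (use s(4) in auto)
      then show ?case by (intro tendsto_mult tendsto_of_real tendsto_const elim)
    qed
    show "AE x in lborel. norm (of_real (cmod (U n x) powr (s n - 2)) * U n x * cnj (v x)) \<le> cmod (V x) powr (10 / 3 - 1) * cmod (v x) + cmod (V x) powr (p - 1) * cmod (v x)" for n
      using dom
    proof eventually_elim
      case (elim x)
      have s2: "2 < s n" using s(2)[of n] by simp
      have "cmod (U n x) powr (s n - 1) \<le> cmod (V x) powr (s n - 1)" using elim s2 by (intro powr_mono2) auto
      also have "\<dots> \<le> cmod (V x) powr (10 / 3 - 1) + cmod (V x) powr (p - 1)" using s(2,3)[of n] by (intro powr_interpolate) auto
      finally have "cmod (U n x) powr (s n - 1) * cmod (v x) \<le> (cmod (V x) powr (10 / 3 - 1) + cmod (V x) powr (p - 1)) * cmod (v x)" by (rule mult_right_mono) simp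
      then show ?case by (simp add: norm_mult cmod_powr_step[OF s2] distrib_right)
    qed
  qed measurable
  have p': "10 / 3 \<le> p" using p by simp
  show ?thesis unfolding weak_residual_def
    by (intro tendsto_diff tendsto_add tendsto_mult tendsto_const tendsto_of_real lam t1 t2 t3 t4 q q0 p' order_refl)
qed

end


lemma solution_sequence_Cauchy:
  fixes u :: "nat \<Rightarrow> space \<Rightarrow> complex"
  assumes ws: "\<And>n. weak_solution \<mu> p (q n) (lam n) (u n)" and d: "\<And>n. decay_bound E (u n)" and m: "\<And>n. mass (u n) = a\<^sup>2"
    and pos: "a > 0" "\<mu> > 0" "l > 0" and pq: "\<And>n. 10 / 3 < q n" "\<And>n. q n < p" "p < 6"
    and lam: "\<And>n. l \<le> lam n" "convergent lam" and conv: "AE x in lborel. convergent (\<lambda>n. u n x)" and e: "e > 0"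
  shows "\<exists>N. \<forall>m\<ge>N. \<forall>n\<ge>N. dirichlet (\<lambda>x. u m x - u n x) + l * mass (\<lambda>x. u m x - u n x) < e"
proof -
  have E: "E \<ge> 0" using d[of 0] by (simp add: decay_bound_def)
  \<comment> \<open>\<open>\<eta>\<close> and \<open>e1\<close> are set so that the multiplier
    difference, the far part and the core part contribute at most \<open>e / 4\<close> each.\<close>
  define \<eta> where "\<eta> = e / (16 * (2 + \<mu>) * a\<^sup>2)"
  have \<eta>: "\<eta> > 0" using e pos by (simp add: \<eta>_def)
  have p: "10 / 3 < p" using pq(1,2)[of 0] by linarith
  obtain R K where R: "R \<ge> 1" "K \<ge> 0"
    and P: "\<And>z x t. cmod z \<le> E * norm x powr (- 1 / 2) \<Longrightarrow> 10 / 3 \<le> t \<Longrightarrow> t \<le> p \<Longrightarrow> cmod z powr (t - 1) \<le> \<eta> * cmod z + K * core_weight p R x"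
    and \<Phi>: "\<And>v z x. decay_bound E v \<Longrightarrow> mass v = a\<^sup>2 \<Longrightarrow> cmod z \<le> E * norm x powr (- 1 / 2) \<Longrightarrow>
      coulomb_potential v x * cmod z \<le> \<eta> * cmod z + K * core_weight p R x"
    using uniform_tail_split[OF E p \<eta>, of "a\<^sup>2"] by (elim exE conjE) blast
  define e1 where "e1 = e / (8 * (2 + \<mu>) * (K + 1))"
  have e1: "e1 > 0" using e pos R by (simp add: e1_def)
  obtain N1 where N1: "\<And>m n. m \<ge> N1 \<Longrightarrow> n \<ge> N1 \<Longrightarrow> (LINT x|lborel. core_weight p R x * cmod (u m x - u n x)) < e1"
    using core_weight_convergence[OF d conv pq(3) _ e1, of R] R(1) by auto
  have "Cauchy lam" using lam(2) by (rule convergent_Cauchy)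
  moreover have "e / (8 * a\<^sup>2) > 0" using e pos by simp
  ultimately obtain N2 where N2: "\<And>m n. m \<ge> N2 \<Longrightarrow> n \<ge> N2 \<Longrightarrow> norm (lam m - lam n) < e / (8 * a\<^sup>2)"
    using CauchyD[of lam "e / (8 * a\<^sup>2)"] by auto
  show ?thesis
  proof (intro exI[of _ "max N1 N2"] allI impI)
    fix m' n assume mn: "max N1 N2 \<le> m'" "max N1 N2 \<le> n"
    define w where "w x = u m' x - u n x" for x
    have "dirichlet w + lam m' * mass w \<le> \<bar>lam m' - lam n\<bar> * (2 * a\<^sup>2) + 2 * (2 + \<mu>) * (2 * a\<^sup>2 * \<eta> + K * (LINT x|lborel. core_weight p R x * cmod (w x)))"
      unfolding w_def
      by (rule solution_difference_bound[OF ws ws d d m m pos(1,2) pq(1,2) pq(1,2) pq(3) R(1) less_imp_le[OF \<eta>] R(2) P \<Phi>])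
    also have "\<dots> < e"
    proof -
      have "\<bar>lam m' - lam n\<bar> * (2 * a\<^sup>2) \<le> e / (8 * a\<^sup>2) * (2 * a\<^sup>2)"
        using N2[of m' n] mn pos by (intro mult_right_mono) auto
      moreover have "e / (8 * a\<^sup>2) * (2 * a\<^sup>2) = e / 4" using pos by simp
      moreover have "2 * (2 + \<mu>) * (2 * a\<^sup>2 * \<eta>) = e / 4"
      proof -
        define D where "D = (2 + \<mu>) * a\<^sup>2"
        have "D > 0" using pos by (simp add: D_def)
        moreover have "2 * (2 + \<mu>) * (2 * a\<^sup>2 * \<eta>) = 4 * D * \<eta>" "\<eta> = e / (16 * D)" by (simp_all add: D_def \<eta>_def)
        ultimately show ?thesis by simp
      qed
      moreover have "2 * (2 + \<mu>) * (K * (LINT x|lborel. core_weight p R x * cmod (w x))) \<le> 2 * (2 + \<mu>) * ((K + 1) * e1)"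
      proof (intro mult_left_mono mult_mono)
        show "(LINT x|lborel. core_weight p R x * cmod (w x)) \<le> e1" unfolding w_def using N1[of m' n] mn by simp
        show "0 \<le> (LINT x|lborel. core_weight p R x * cmod (w x))" by (intro Bochner_Integration.integral_nonneg) (simp add: core_weight_nonneg)
      qed (use R pos in auto)
      moreover have "2 * (2 + \<mu>) * ((K + 1) * e1) = e / 4"
      proof -
        have "(K + 1) * e1 = e / (8 * (2 + \<mu>))" using R by (simp add: e1_def)
        then show ?thesis using pos by (simp add: field_simps)
      qed
      ultimately show ?thesis using e by (simp only: distrib_left)
    qed
    finally have "dirichlet w + lam m' * mass w < e" .
    moreover have "l * mass w \<le> lam m' * mass w" by (rule mult_right_mono[OF lam(1) mass_nonneg])
    ultimately show "dirichlet (\<lambda>x. u m' x - u n x) + l * mass (\<lambda>x. u m' x - u n x) < e"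
      unfolding w_def by linarith
  qed
qed

lemma dirichlet_difference:
  assumes "u \<in> H1" "v \<in> H1"
  shows "dirichlet (\<lambda>x. u x - v x) = (LINT x|lborel. (norm (weak_grad u x - weak_grad v x))\<^sup>2)"
  unfolding dirichlet_def
proof (rule integral_cong_AE)
  show "AE x in lborel. (norm (weak_grad (\<lambda>x. u x - v x) x))\<^sup>2 = (norm (weak_grad u x - weak_grad v x))\<^sup>2"
    using H1_diff(2)[OF assms] by eventually_elim simp
qed (use weak_grad_measurable[OF H1_diff(1)[OF assms]] weak_grad_measurable[OF assms(1)] weak_grad_measurable[OF assms(2)] in measurable)

text \<open>The lower bound \<open>l\<close> on the multipliers turns the difference estimate into
  control of the mass as well as of the gradient, hence of the full norm. No mass is lost and the
  limit stays on the sphere.\<close>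

theorem radial_solution_compactness:
  fixes u :: "nat \<Rightarrow> space \<Rightarrow> complex"
  assumes ur: "\<And>n. u n \<in> H1r" and ws: "\<And>n. weak_solution \<mu> p (q n) (lam n) (u n)" and m: "\<And>n. mass (u n) = a\<^sup>2"
    and A: "\<And>n. dirichlet (u n) \<le> A" and pos: "a > 0" "\<mu> > 0" "l > 0"
    and pq: "\<And>n. 10 / 3 < q n" "\<And>n. q n < p" "p < 6" and q: "q \<longlonglongrightarrow> 10 / 3"
    and lam: "\<And>n. l \<le> lam n" "\<And>n. lam n \<le> L"
  obtains r u0 lam0 where "strict_mono r" "u0 \<in> H1r" "l \<le> lam0" "(\<lambda>n. lam (r n)) \<longlonglongrightarrow> lam0"
    "(\<lambda>n. H1_norm (\<lambda>x. u (r n) x - u0 x)) \<longlonglongrightarrow> 0" "mass u0 = a\<^sup>2" "weak_solution \<mu> p (10 / 3) lam0 u0"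
    "(\<lambda>n. energy \<mu> p (q (r n)) (u (r n))) \<longlonglongrightarrow> energy \<mu> p (10 / 3) u0"
    "(\<lambda>n. pohozaev \<mu> p (q (r n)) (u (r n))) \<longlonglongrightarrow> pohozaev \<mu> p (10 / 3) u0"
proof -
  have p: "10 / 3 < p" using pq(1,2)[of 0] by linarith
  have uH: "u n \<in> H1" for n using ur by (simp add: H1r_def)
  define E where "E = sqrt A"
  have d: "decay_bound E (u n)" for n
    by (rule decay_mono[OF H1r_decay[OF ur]]) (simp add: E_def A)
  \<comment> \<open>The upper bound on the multipliers is used only here, to extract a convergent
    subsequence of them.\<close>
  have "compact {l..L}" "\<forall>n. lam n \<in> {l..L}" using lam by auto
  then obtain r1 lam0 where r1: "strict_mono r1" "lam0 \<in> {l..L}" "(lam \<circ> r1) \<longlonglongrightarrow> lam0"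
    unfolding compact_eq_seq_compact_metric seq_compact_def by meson
  obtain r2 where r2: "strict_mono r2" "AE x in lborel. convergent (\<lambda>n. u (r1 (r2 n)) x)"
    using radial_pointwise_subsequence[of "\<lambda>n. u (r1 n)" A] ur A by blast
  define k where "k n = r1 (r2 n)" for n
  have k: "strict_mono k" unfolding k_def using strict_mono_o[OF r1(1) r2(1)] by (simp add: o_def)
  have lk: "(\<lambda>n. lam (k n)) \<longlonglongrightarrow> lam0" using LIMSEQ_subseq_LIMSEQ[OF r1(3) r2(1)] by (simp add: k_def o_def)
  have C: "\<exists>N. \<forall>m\<ge>N. \<forall>n\<ge>N. dirichlet (\<lambda>x. u (k m) x - u (k n) x) + l * mass (\<lambda>x. u (k m) x - u (k n) x) < e" if "e > 0" for e
    by (rule solution_sequence_Cauchy[where u="\<lambda>n. u (k n)" and q="\<lambda>n. q (k n)" and lam="\<lambda>n. lam (k n)", OF ws d m pos pq lam(1) convergentI[OF lk] _ that])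
      (use r2(2) in \<open>simp add: k_def\<close>)
  have C1: "\<exists>N. \<forall>m\<ge>N. \<forall>n\<ge>N. (LINT x|lborel. (cmod (u (k m) x - u (k n) x))\<^sup>2) < e" if e: "e > 0" for e
  proof -
    obtain N where N: "\<And>m n. m \<ge> N \<Longrightarrow> n \<ge> N \<Longrightarrow> dirichlet (\<lambda>x. u (k m) x - u (k n) x) + l * mass (\<lambda>x. u (k m) x - u (k n) x) < l * e"
      using C[of "l * e"] e pos by auto
    have "mass (\<lambda>x. u (k m) x - u (k n) x) < e" if "m \<ge> N" "n \<ge> N" for m n
    proof -
      have "l * mass (\<lambda>x. u (k m) x - u (k n) x) < l * e" using N[OF that] dirichlet_nonneg[of "\<lambda>x. u (k m) x - u (k n) x"] by linarith
      then show ?thesis using pos by simp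
    qed
    then show ?thesis unfolding mass_def by blast
  qed
  obtain r3 u1 W where r3: "strict_mono r3" "u1 \<in> borel_measurable lborel" "integrable lborel (\<lambda>x. (norm (u1 x))\<^sup>2)"
    "W \<in> borel_measurable lborel" "integrable lborel (\<lambda>x. (W x)\<^sup>2)" "AE x in lborel. \<forall>n. norm (u (k (r3 n)) x) \<le> W x" "AE x in lborel. norm (u1 x) \<le> W x"
    "AE x in lborel. (\<lambda>n. u (k (r3 n)) x) \<longlonglongrightarrow> u1 x" "(\<lambda>n. LINT x|lborel. (norm (u (k (r3 n)) x - u1 x))\<^sup>2) \<longlonglongrightarrow> 0"
    by (rule L2_Cauchy_subseq[of "\<lambda>n. u (k n)", OF H1_measurable[OF uH] L2_integrable[OF H1D(1)[OF uH]] C1]) blast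
  have C2: "\<exists>N. \<forall>m\<ge>N. \<forall>n\<ge>N. (LINT x|lborel. (norm (weak_grad (u (k (r3 m))) x - weak_grad (u (k (r3 n))) x))\<^sup>2) < e" if e: "e > 0" for e
  proof -
    obtain N where N: "\<And>m n. m \<ge> N \<Longrightarrow> n \<ge> N \<Longrightarrow> dirichlet (\<lambda>x. u (k m) x - u (k n) x) + l * mass (\<lambda>x. u (k m) x - u (k n) x) < e"
      using C[OF e] by auto
    have "(LINT x|lborel. (norm (weak_grad (u (k (r3 m))) x - weak_grad (u (k (r3 n))) x))\<^sup>2) < e" if "m \<ge> N" "n \<ge> N" for m n
    proof -
      have mn: "r3 m \<ge> N" "r3 n \<ge> N" using seq_suble[OF r3(1)] that order_trans by blast+
      have "0 \<le> l * mass (\<lambda>x. u (k (r3 m)) x - u (k (r3 n)) x)" using pos mass_nonneg by simp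
      with N[OF mn] show ?thesis unfolding dirichlet_difference[OF uH uH] by linarith
    qed
    then show ?thesis by blast
  qed
  obtain r4 G Wg where r4: "strict_mono r4" "G \<in> borel_measurable lborel" "integrable lborel (\<lambda>x. (norm (G x))\<^sup>2)"
    "Wg \<in> borel_measurable lborel" "integrable lborel (\<lambda>x. (Wg x)\<^sup>2)" "AE x in lborel. \<forall>n. norm (weak_grad (u (k (r3 (r4 n)))) x) \<le> Wg x" "AE x in lborel. norm (G x) \<le> Wg x"
    "AE x in lborel. (\<lambda>n. weak_grad (u (k (r3 (r4 n)))) x) \<longlonglongrightarrow> G x" "(\<lambda>n. LINT x|lborel. (norm (weak_grad (u (k (r3 (r4 n)))) x - G x))\<^sup>2) \<longlonglongrightarrow> 0"
    by (rule L2_Cauchy_subseq[of "\<lambda>n. weak_grad (u (k (r3 n)))", OF weak_grad_measurable[OF uH] L2_integrable[OF H1D(2)[OF uH]] C2]) blast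
  define \<rho> where "\<rho> n = k (r3 (r4 n))" for n
  have \<rho>: "strict_mono \<rho>" using strict_mono_o[OF k strict_mono_o[OF r3(1) r4(1)]] by (simp add: \<rho>_def[abs_def] o_def)
  have r34: "strict_mono (\<lambda>n. r3 (r4 n))" using strict_mono_o[OF r3(1) r4(1)] by (simp add: o_def)
  define U where "U n = u (\<rho> n)" for n
  have UH: "U n \<in> H1" for n by (simp add: U_def uH)
  have Ud: "decay_bound E (U n)" for n by (simp add: U_def d)
  have W: "AE x in lborel. \<forall>n. cmod (U n x) \<le> W x" using r3(6) by eventually_elim (simp add: U_def \<rho>_def)
  have lim: "AE x in lborel. (\<lambda>n. U n x) \<longlonglongrightarrow> u1 x"
    using r3(8) by eventually_elim (use LIMSEQ_subseq_LIMSEQ[OF _ r4(1)] in \<open>force simp: U_def \<rho>_def o_def\<close>)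
  have l2: "(\<lambda>n. LINT x|lborel. (cmod (U n x - u1 x))\<^sup>2) \<longlonglongrightarrow> 0"
    using LIMSEQ_subseq_LIMSEQ[OF r3(9) r4(1)] by (simp add: U_def \<rho>_def o_def)
  have u1L: "u1 \<in> L2" and GL: "G \<in> L2" using r3(2,3) r4(2,3) by (auto intro: L2I)
  have Wm: "W \<in> borel_measurable borel" "Wg \<in> borel_measurable borel" using r3(4) r4(4) by auto
  note H = H1_dominated_limit[of U u1 G W Wg, OF UH u1L GL Wm(1) r3(5) W Wm(2) r4(5) r4(6)[folded \<rho>_def, folded U_def] lim r4(8)[folded \<rho>_def, folded U_def] l2 r4(9)[folded \<rho>_def, folded U_def]]
  \<comment> \<open>The smaller of the L2 majorant and the decay bound satisfies
    \<open>decay_bound E\<close>, so a single function dominates in the limits of the powers, the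
    potential and the equation. It is complex valued because \<open>decay_bound\<close> is stated
    for complex functions.\<close>
  define V where "V x = (of_real (min (W x) (E * norm x powr (- 1 / 2))) :: complex)" for x
  have Ub: "AE x in lborel. \<forall>n. cmod (U n x) \<le> E * norm x powr (- 1 / 2)" unfolding AE_all_countable using Ud by (simp add: decay_bound_def)
  have Vn: "AE x in lborel. cmod (V x) = min (W x) (E * norm x powr (- 1 / 2))"
    using W Ub
  proof eventually_elim
    case (elim x)
    have "0 \<le> W x" "0 \<le> E * norm x powr (- 1 / 2)" using elim(1)[rule_format, of 0] elim(2)[rule_format, of 0] norm_ge_zero[of "U 0 x"] by linarith+
    then show ?case unfolding V_def norm_of_real by simp
  qed
  have dom: "AE x in lborel. \<forall>n. cmod (U n x) \<le> cmod (V x)"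
    using Vn W Ub by eventually_elim simp
  have V: "decay_bound E V"
    unfolding decay_bound_def
  proof (intro conjI)
    show "0 \<le> E" using d[of 0] by (simp add: decay_bound_def)
    have WL: "W \<in> L2" by (rule L2I) (use r3 in auto)
    show "V \<in> L2"
    proof (rule L2_bound[OF WL, of V 1])
      show "V \<in> borel_measurable lborel" unfolding V_def[abs_def] using Wm by measurable
      show "AE x in lborel. norm (V x) \<le> 1 * norm (W x)" using Vn by eventually_elim auto
    qed
    show "AE x in lborel. cmod (V x) \<le> E * norm x powr (- 1 / 2)" using Vn by eventually_elim simp
  qed
  note ctx = V dom lim UH H(1)
  have U\<rho>: "(\<lambda>n. lam (\<rho> n)) \<longlonglongrightarrow> lam0" "(\<lambda>n. q (\<rho> n)) \<longlonglongrightarrow> 10 / 3"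
    using LIMSEQ_subseq_LIMSEQ[OF lk r34] LIMSEQ_subseq_LIMSEQ[OF q \<rho>] by (simp_all add: \<rho>_def o_def)
  have m0: "U n \<in> borel_measurable borel" "u1 \<in> borel_measurable borel" for n using H1_measurable[OF UH] H1_measurable[OF H(1)] by auto
  have Dq: "(\<lambda>n. Lp_integral (q (\<rho> n)) (U n)) \<longlonglongrightarrow> Lp_integral (10 / 3) u1"
  proof (rule Lp_integral_tendsto[OF V dom lim m0 U\<rho>(2)])
    show "2 \<le> q (\<rho> n)" "q (\<rho> n) \<le> p" for n using pq(1,2)[of "\<rho> n"] by linarith+
  qed (rule pq)
  have Dp: "(\<lambda>n. Lp_integral p (U n)) \<longlonglongrightarrow> Lp_integral p u1"
    by (rule Lp_integral_tendsto[OF V dom lim m0 tendsto_const, of p p]) (use p pq(3) in auto)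
  note B = coulomb_energy_limit[OF ctx]
  show thesis
  proof (rule that[OF \<rho>, of u1 lam0])
    \<comment> \<open>All members agree with their profiles outside one null set, so the limit can
      be read off as a function of the radius.\<close>
    have "AE x in lborel. \<forall>n. U n x = profile (U n) (norm x)" unfolding AE_all_countable U_def by (intro allI radial_profile ur)
    with lim have "AE x in lborel. u1 x = lim (\<lambda>n. profile (U n) (norm x))"
      by eventually_elim (simp add: limI)
    then have "\<exists>f. AE x in lborel. u1 x = f (norm x)" by (rule exI[of _ "\<lambda>r. lim (\<lambda>n. profile (U n) r)"])
    then show "u1 \<in> H1r" using H(1) by (simp add: H1r_def)
    show "l \<le> lam0" using r1(2) by simp
    show "(\<lambda>n. lam (\<rho> n)) \<longlonglongrightarrow> lam0" by (rule U\<rho>)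
    show "(\<lambda>n. H1_norm (\<lambda>x. u (\<rho> n) x - u1 x)) \<longlonglongrightarrow> 0" using H(5) unfolding U_def .
    have "(\<lambda>n. a\<^sup>2) \<longlonglongrightarrow> mass u1" using H(3) by (simp add: U_def m)
    then show "mass u1 = a\<^sup>2" using LIMSEQ_unique tendsto_const by blast
    show "weak_solution \<mu> p (10 / 3) lam0 u1"
      unfolding weak_solution_residual
    proof (intro conjI ballI H(1))
      fix v assume v: "v \<in> H1"
      have "(\<lambda>n. weak_residual \<mu> p (q (\<rho> n)) (lam (\<rho> n)) (U n) v) \<longlonglongrightarrow> weak_residual \<mu> p (10 / 3) lam0 u1 v"
        by (rule weak_residual_limit[OF ctx r4(5) Wm(2) r4(6)[folded \<rho>_def, folded U_def] H(2) v U\<rho>(1) p pq(3) U\<rho>(2)])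
          (use pq(1,2) in \<open>auto intro: less_imp_le\<close>)
      moreover have "weak_residual \<mu> p (q (\<rho> n)) (lam (\<rho> n)) (U n) v = 0" for n
        using ws[of "\<rho> n"] v by (auto simp: weak_solution_residual U_def)
      ultimately show "weak_residual \<mu> p (10 / 3) lam0 u1 v = 0" using LIMSEQ_unique[OF _ tendsto_const[of 0]] by simp
    qed
    show "(\<lambda>n. energy \<mu> p (q (\<rho> n)) (u (\<rho> n))) \<longlonglongrightarrow> energy \<mu> p (10 / 3) u1"
      unfolding energy_eq U_def[symmetric] by (intro tendsto_intros H B Dq Dp U\<rho>) auto
    show "(\<lambda>n. pohozaev \<mu> p (q (\<rho> n)) (u (\<rho> n))) \<longlonglongrightarrow> pohozaev \<mu> p (10 / 3) u1"
      unfolding pohozaev_eq U_def[symmetric] gn_exp_def by (intro tendsto_intros H B Dq Dp U\<rho>) auto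
  qed
qed


section \<open>A priori bounds and the limit level\<close>

text \<open>The splitting radius \<open>a / s\<close>, with \<open>s\<close> the gradient norm,
  balances the two parts of the bound on the potential.\<close>

lemma coulomb_energy_bound:
  assumes u: "u \<in> H1r" and m: "mass u = a\<^sup>2" "a > 0"
  shows "coulomb_energy u \<le> (2 * ball_const 2 + 1) * a ^ 3 * sqrt (dirichlet u)"
proof -
  have L: "u \<in> L2" using u H1D(1) by (auto simp: H1r_def)
  have A: "dirichlet u > 0" using dirichlet_pos[OF u] m by simp
  define s where "s = sqrt (dirichlet u)"
  have s: "s > 0" using A by (simp add: s_def)
  have K: "coulomb_potential u x \<le> (2 * ball_const 2 + 1) * a * s" for x
  proof -
    have "coulomb_potential u x \<le> 2 * s\<^sup>2 * ball_const 2 * (a / s) + mass u / (a / s)"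
      unfolding s_def by (rule coulomb_potential_le[OF H1r_decay[OF u]]) (use m s s_def in simp)
    also have "\<dots> = (2 * ball_const 2 + 1) * a * s" using s m by (simp add: field_simps power2_eq_square)
    finally show ?thesis .
  qed
  have "coulomb_energy u \<le> (2 * ball_const 2 + 1) * a * s * mass u"
    unfolding coulomb_energy_eq by (rule coulomb_density_le[OF H1r_decay[OF u] L K])
  then show ?thesis unfolding m s_def by (simp add: power3_eq_cube power2_eq_square mult_ac)
qed

text \<open>At \<open>10 / 3\<close> the Gagliardo-Nirenberg bound is linear in
  \<open>dirichlet u\<close>, and the small power of \<open>a\<close> makes its coefficient at most
  a quarter. The Pohozaev identity then leaves the gradient controlled by the \<open>p\<close> norm,
  and supercriticality of \<open>p\<close> keeps the gradient away from 0.\<close>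

lemma small_mass_bounds:
  assumes u: "u \<in> H1r" and m: "mass u = a\<^sup>2" "a > 0" and \<mu>: "\<mu> > 0"
    and pq: "10 / 3 < q" "q < p" "p < 6" and P: "pohozaev \<mu> p q u = 0"
    and a1: "\<mu> * (ball_const (5 / 3) + 1) * a powr (4 / 3) \<le> 1 / 4"
    and a2: "4 / 3 * (1 + \<mu>) * (ball_const (p / 2) + 1) * a powr ((6 - p) / 2) \<le> 1"
  shows "\<mu> * Lp_integral (10 / 3) u \<le> dirichlet u / 4" "\<mu> * Lp_integral q u \<le> dirichlet u / 4 + \<mu> * Lp_integral p u"
    "3 / 4 * dirichlet u \<le> (1 + \<mu>) * Lp_integral p u" "1 \<le> dirichlet u"
proof -
  define A where "A = dirichlet u"
  have A: "A > 0" using dirichlet_pos[OF u] m by (simp add: A_def)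
  note dec = H1r_decay[OF u]
  have "Lp_integral (10 / 3) u \<le> (ball_const (5 / 3) + 1) * a powr (4 / 3) * A"
    using radial_gagliardo_nirenberg[OF u m(2,1), of "10 / 3"] A by (simp add: Lp_integral_def A_def)
  from mult_left_mono[OF this less_imp_le[OF \<mu>]]
  have "\<mu> * Lp_integral (10 / 3) u \<le> (\<mu> * (ball_const (5 / 3) + 1) * a powr (4 / 3)) * A" by (simp add: mult_ac)
  also have "\<dots> \<le> 1 / 4 * A" by (rule mult_right_mono[OF a1]) (use A in simp)
  finally show 1: "\<mu> * Lp_integral (10 / 3) u \<le> dirichlet u / 4" by (simp add: A_def)
  have ip: "integrable lborel (\<lambda>x. cmod (u x) powr t)" if "2 \<le> t" "t < 6" for t using decay_power_integral(1)[OF dec that, of 1] by simp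
  \<comment> \<open>Interpolation between \<open>10 / 3\<close> and \<open>p\<close> gives constants
    independent of \<open>q\<close>, so the smallness of \<open>a\<close> can be chosen before the
    sequence.\<close>
  have "Lp_integral q u \<le> (LINT x|lborel. cmod (u x) powr (10 / 3) + cmod (u x) powr p)"
    unfolding Lp_integral_def by (rule integral_mono) (use ip pq in \<open>auto intro!: powr_interpolate\<close>)
  also have "\<dots> = Lp_integral (10 / 3) u + Lp_integral p u" unfolding Lp_integral_def using ip pq by simp
  finally have "\<mu> * Lp_integral q u \<le> \<mu> * (Lp_integral (10 / 3) u + Lp_integral p u)" using \<mu> by simp
  with 1 show 2: "\<mu> * Lp_integral q u \<le> dirichlet u / 4 + \<mu> * Lp_integral p u" by (simp add: distrib_left)
  have g: "gn_exp t \<le> 1" if "10 / 3 < t" "t < 6" for t using that by (simp add: gn_exp_def field_simps)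
  have "gn_exp p * Lp_integral p u \<le> 1 * Lp_integral p u" "gn_exp q * (\<mu> * Lp_integral q u) \<le> 1 * (\<mu> * Lp_integral q u)"
    using g[of p] g[of q] pq \<mu> Lp_integral_nonneg[of p u] Lp_integral_nonneg[of q u] by (intro mult_right_mono; simp)+
  then have "A \<le> Lp_integral p u + \<mu> * Lp_integral q u"
    using P coulomb_energy_nonneg[of u] unfolding pohozaev_eq A_def by (simp add: mult_ac)
  with 2 show 3: "3 / 4 * dirichlet u \<le> (1 + \<mu>) * Lp_integral p u" by (simp add: A_def algebra_simps)
  show "1 \<le> dirichlet u"
  proof (rule ccontr)
    assume "\<not> 1 \<le> dirichlet u"
    then have A1: "A < 1" by (simp add: A_def)
    \<comment> \<open>The exponent \<open>3 * (p - 2) / 4\<close> exceeds 1, so a gradient below 1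
      would be bounded by something strictly smaller than itself.\<close>
    have "A \<le> 4 / 3 * (1 + \<mu>) * Lp_integral p u" using 3 by (simp add: A_def algebra_simps)
    also have "\<dots> \<le> 4 / 3 * (1 + \<mu>) * ((ball_const (p / 2) + 1) * a powr ((6 - p) / 2) * A powr (3 * (p - 2) / 4))"
      using radial_gagliardo_nirenberg[OF u m(2,1), of p] pq \<mu> by (intro mult_left_mono) (auto simp: Lp_integral_def A_def)
    also have "\<dots> = (4 / 3 * (1 + \<mu>) * (ball_const (p / 2) + 1) * a powr ((6 - p) / 2)) * A powr (3 * (p - 2) / 4)" by simp
    also have "\<dots> \<le> 1 * A powr (3 * (p - 2) / 4)" by (rule mult_right_mono[OF a2]) simp
    also have "\<dots> < A powr 1" unfolding mult_1 by (rule powr_less_mono') (use A A1 pq in auto)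
    finally show False using A by simp
  qed
qed

lemma multiplier_identity:
  assumes ws: "weak_solution \<mu> p q lam u" and u: "decay_bound C u" and pq: "2 < p" "p < 6" "2 < q" "q < 6"
  shows "dirichlet u + lam * mass u + coulomb_energy u = Lp_integral p u + \<mu> * Lp_integral q u"
proof -
  have "u \<in> H1" using ws by (simp add: weak_solution_def)
  from weak_form_eq_0[OF ws u this u pq]
  show ?thesis
    unfolding weak_form_def dirichlet_def mass_def coulomb_energy_eq Lp_integral_def
      cmod_powr_square[OF pq(1), symmetric] cmod_powr_square[OF pq(3), symmetric] power2_norm_eq_inner
    by (simp add: mult.commute)
qed

lemma powr_small:
  fixes c s \<eta> :: real
  assumes "s > 0" "\<eta> > 0" "c \<ge> 0"
  shows "\<exists>\<kappa>>0. \<forall>a. 0 < a \<and> a < \<kappa> \<longrightarrow> c * a powr s \<le> \<eta>"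
proof -
  obtain R where R: "R \<ge> 1" "\<And>r. r \<ge> R \<Longrightarrow> c * r powr (- s) \<le> \<eta>" using tail_weight_small[OF assms] by blast
  show ?thesis
  proof (intro exI[of _ "1 / R"] conjI allI impI)
    fix a assume a: "0 < a \<and> a < 1 / R"
    then have "1 / a \<ge> R" using R(1) by (simp add: field_simps)
    from R(2)[OF this] show "c * a powr s \<le> \<eta>" using a by (simp add: powr_divide powr_minus)
  qed (use R in simp)
qed

text \<open>Eliminating the gradient between the equation tested with \<open>u\<close> and the
  Pohozaev identity leaves \<open>-3/4\<close> of the Coulomb energy as the only negative term.
  Write \<open>\<delta>\<close> for \<open>(1 - gn_exp p) / (1 + \<mu>)\<close>: the
  \<open>p\<close> term is at least \<open>3/4 \<delta>\<close> times the gradient, the Coulomb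
  energy at most \<open>\<delta> / 2\<close> times it, and the difference is the \<open>3/8\<close>.
  The gradient is at least 1, which makes the lower bound uniform.\<close>

lemma multiplier_bounds:
  assumes u: "u \<in> H1r" and ws: "weak_solution \<mu> p q lam u" and m: "mass u = a\<^sup>2" "a > 0" and \<mu>: "\<mu> > 0"
    and pq: "10 / 3 < q" "q < p" "p < 6" and P: "pohozaev \<mu> p q u = 0"
    and a1: "\<mu> * (ball_const (5 / 3) + 1) * a powr (4 / 3) \<le> 1 / 4"
    and a2: "4 / 3 * (1 + \<mu>) * (ball_const (p / 2) + 1) * a powr ((6 - p) / 2) \<le> 1"
    and a3: "(2 * ball_const 2 + 1) * a ^ 3 \<le> (1 - gn_exp p) / (2 * (1 + \<mu>))"
  shows "3 / 8 * ((1 - gn_exp p) / (1 + \<mu>)) \<le> lam * a\<^sup>2" "lam * a\<^sup>2 \<le> 3 * (1 + \<mu>) * Lp_integral p u"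
proof -
  note b = small_mass_bounds[OF u m \<mu> pq P a1 a2]
  have id: "dirichlet u + lam * a\<^sup>2 + coulomb_energy u = Lp_integral p u + \<mu> * Lp_integral q u"
    using multiplier_identity[OF ws H1r_decay[OF u]] pq m by simp
  define \<delta> where "\<delta> = (1 - gn_exp p) / (1 + \<mu>)"
  have "gn_exp p < 1" using pq by (simp add: gn_exp_def field_simps)
  then have \<delta>: "\<delta> > 0" using \<mu> by (simp add: \<delta>_def)
  have gq: "gn_exp q \<le> 1" using pq by (simp add: gn_exp_def field_simps)
  have s: "sqrt (dirichlet u) \<le> dirichlet u" using b(4) by (simp add: real_le_lsqrt power2_eq_square real_sqrt_le_iff) 
  have "coulomb_energy u \<le> ((2 * ball_const 2 + 1) * a ^ 3) * sqrt (dirichlet u)" by (rule coulomb_energy_bound[OF u m])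
  also have "\<dots> \<le> (\<delta> / 2) * dirichlet u"
  proof (rule mult_mono)
    show "(2 * ball_const 2 + 1) * a ^ 3 \<le> \<delta> / 2" using a3 by (simp add: \<delta>_def mult.commute)
  qed (use s \<delta> b(4) in auto)
  finally have B: "coulomb_energy u \<le> \<delta> / 2 * dirichlet u" .
  have "\<delta> * (3 / 4 * dirichlet u) \<le> \<delta> * ((1 + \<mu>) * Lp_integral p u)" using b(3) \<delta> by simp
  also have "\<dots> = (1 - gn_exp p) * Lp_integral p u" using \<mu> by (simp add: \<delta>_def)
  finally have C: "\<delta> * (3 / 4 * dirichlet u) \<le> (1 - gn_exp p) * Lp_integral p u" .
  have D: "0 \<le> (1 - gn_exp q) * (\<mu> * Lp_integral q u)" using gq \<mu> Lp_integral_nonneg[of q u] by simp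
  have "lam * a\<^sup>2 = (1 - gn_exp p) * Lp_integral p u + (1 - gn_exp q) * (\<mu> * Lp_integral q u) - 3 / 4 * coulomb_energy u"
    using id P unfolding pohozaev_eq by (simp add: algebra_simps)
  then have "3 / 8 * \<delta> * dirichlet u \<le> lam * a\<^sup>2" using B C D by (simp add: algebra_simps)
  moreover have "3 / 8 * \<delta> * 1 \<le> 3 / 8 * \<delta> * dirichlet u" using b(4) \<delta> by (intro mult_left_mono) auto
  ultimately show "3 / 8 * ((1 - gn_exp p) / (1 + \<mu>)) \<le> lam * a\<^sup>2" by (simp add: \<delta>_def)
  show "lam * a\<^sup>2 \<le> 3 * (1 + \<mu>) * Lp_integral p u"
    using id b(2,3,4) coulomb_energy_nonneg[of u] by (simp add: algebra_simps)
qed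

section \<open>The limit at the mass critical exponent\<close>

theorem theorem1p12:
  fixes \<mu> p qbar :: real
  assumes "\<mu> > 0" and "qbar = 10 / 3" and "qbar < p" and "p < 6"
  shows "\<exists>\<kappa>>0. \<forall>a. 0 < a \<and> a < \<kappa> \<and>
     1 - 3 / 5 * gn_const qbar powr qbar * \<mu> * a powr (4 / 3) > 0 \<and>
     (1 / (gn_const p powr p * gn_exp p * a powr (p * (1 - gn_exp p)))) powr (1 / (p * gn_exp p - 2))
       * (1 - 3 / 5 * gn_const qbar powr qbar * \<mu> * a powr (4 / 3)) powr (1 / (p * gn_exp p - 2))
       * (1 / a ^ 3)
     \<ge> (4 * gn_exp p - 1) / (4 * (1 - gn_exp p)) * gn_const (12 / 5) powr (12 / 5)
     \<longrightarrow>
     (\<forall>(q :: nat \<Rightarrow> real) (lam :: nat \<Rightarrow> real) (u :: nat \<Rightarrow> space \<Rightarrow> complex).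
        (\<forall>n. qbar < q n \<and> q n < p) \<and> q \<longlonglongrightarrow> qbar \<and>
        (\<forall>n. radial_mp_solution \<mu> p a (q n) (lam n) (u n))
        \<longrightarrow>
        (\<exists>(lam0 :: real) u0 (r :: nat \<Rightarrow> nat). lam0 > 0 \<and> u0 \<in> H1r \<and> strict_mono r \<and>
           (\<lambda>n. H1_norm (\<lambda>x. u (r n) x - u0 x)) \<longlonglongrightarrow> 0 \<and>
           (\<lambda>n. lam (r n)) \<longlonglongrightarrow> lam0 \<and>
           energy \<mu> p qbar u0 = level_r \<mu> p a qbar \<and>
           normalized_solution \<mu> p a qbar lam0 u0))"
proof -
  have \<mu>: "\<mu> > 0" and p: "10 / 3 < p" "p < 6" and qb: "qbar = 10 / 3" using assms by auto
  have \<gamma>: "gn_exp p < 1" using p by (simp add: gn_exp_def field_simps)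
  \<comment> \<open>The three thresholds control the critical power, the lower bound on the gradient
    and the Coulomb energy; they involve only \<open>\<mu>\<close> and \<open>p\<close>.\<close>
  obtain \<kappa>1 where \<kappa>1: "\<kappa>1 > 0" "\<And>a. 0 < a \<Longrightarrow> a < \<kappa>1 \<Longrightarrow> \<mu> * (ball_const (5 / 3) + 1) * a powr (4 / 3) \<le> 1 / 4"
    using powr_small[of "4 / 3" "1 / 4" "\<mu> * (ball_const (5 / 3) + 1)"] \<mu> ball_const_nonneg[of "5 / 3"] by auto
  obtain \<kappa>2 where \<kappa>2: "\<kappa>2 > 0" "\<And>a. 0 < a \<Longrightarrow> a < \<kappa>2 \<Longrightarrow> 4 / 3 * (1 + \<mu>) * (ball_const (p / 2) + 1) * a powr ((6 - p) / 2) \<le> 1"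
    using powr_small[of "(6 - p) / 2" 1 "4 / 3 * (1 + \<mu>) * (ball_const (p / 2) + 1)"] \<mu> p ball_const_nonneg[of "p / 2"] by auto
  obtain \<kappa>3 where \<kappa>3: "\<kappa>3 > 0" "\<And>a. 0 < a \<Longrightarrow> a < \<kappa>3 \<Longrightarrow> (2 * ball_const 2 + 1) * a powr 3 \<le> (1 - gn_exp p) / (2 * (1 + \<mu>))"
    using powr_small[of 3 "(1 - gn_exp p) / (2 * (1 + \<mu>))" "2 * ball_const 2 + 1"] \<mu> \<gamma> ball_const_nonneg[of 2] by auto
  have main: "\<exists>(lam0 :: real) u0 (r :: nat \<Rightarrow> nat). lam0 > 0 \<and> u0 \<in> H1r \<and> strict_mono r \<and>
           (\<lambda>n. H1_norm (\<lambda>x. u (r n) x - u0 x)) \<longlonglongrightarrow> 0 \<and> (\<lambda>n. lam (r n)) \<longlonglongrightarrow> lam0 \<and>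
           energy \<mu> p (10 / 3) u0 = level_r \<mu> p a (10 / 3) \<and> normalized_solution \<mu> p a (10 / 3) lam0 u0"
    if a: "0 < a" "a < min \<kappa>1 (min \<kappa>2 \<kappa>3)" and q: "\<And>n. 10 / 3 < q n" "\<And>n. q n < p" "q \<longlonglongrightarrow> 10 / 3"
      and sol: "\<And>n. radial_mp_solution \<mu> p a (q n) (lam n) (u n)"
    for a and q lam :: "nat \<Rightarrow> real" and u :: "nat \<Rightarrow> space \<Rightarrow> complex"
  proof -
    have a1: "\<mu> * (ball_const (5 / 3) + 1) * a powr (4 / 3) \<le> 1 / 4" by (rule \<kappa>1(2)) (use a in auto)
    have a2: "4 / 3 * (1 + \<mu>) * (ball_const (p / 2) + 1) * a powr ((6 - p) / 2) \<le> 1" by (rule \<kappa>2(2)) (use a in auto)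
    have a3: "(2 * ball_const 2 + 1) * a ^ 3 \<le> (1 - gn_exp p) / (2 * (1 + \<mu>))" using \<kappa>3(2)[of a] a by (simp add: powr_numeral)
    have ur: "u n \<in> H1r" and ws: "weak_solution \<mu> p (q n) (lam n) (u n)" and m: "mass (u n) = a\<^sup>2" and lp: "lam n > 0"
      and upos: "AE x in lborel. Im (u n x) = 0 \<and> Re (u n x) > 0" and lev: "energy \<mu> p (q n) (u n) = level_r \<mu> p a (q n)" for n
      using sol[of n] by (auto simp: radial_mp_solution_def normalized_solution_def mass_def)
    have P: "pohozaev \<mu> p (q n) (u n) = 0" for n
      by (rule pohozaev_identity[OF ur upos ws lp \<mu>]) (use p q(1,2)[of n] in auto)
    note sb = small_mass_bounds[OF ur m a(1) \<mu> q(1,2) p(2) P a1 a2]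
    note mb = multiplier_bounds[OF ur ws m a(1) \<mu> q(1,2) p(2) P a1 a2 a3]
    \<comment> \<open>The first solution of the sequence is the function to dilate: its critical
      power is at most a quarter of its gradient, which is positive.\<close>
    have "3 / 5 * (\<mu> * Lp_integral (10 / 3) (u 0)) < dirichlet (u 0)" using sb(1)[of 0] sb(4)[of 0] by linarith
    then have ne: "pohozaev_set_r \<mu> p a (10 / 3) \<noteq> {}" by (intro pohozaev_set_nonempty[OF a(1) p ur[of 0] m[of 0]]) simp
    then obtain w where w: "w \<in> pohozaev_set_r \<mu> p a (10 / 3)" by blast
    \<comment> \<open>Upper semicontinuity at one fixed \<open>w\<close> bounds the levels from some
      index \<open>N\<close> on; the compactness result is applied to the sequence shifted by
      \<open>N\<close>.\<close>
    define M where "M = energy \<mu> p (10 / 3) w + 1"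
    obtain N where N: "\<And>n. n \<ge> N \<Longrightarrow> level_r \<mu> p a (q n) \<le> M"
      using level_upper_semicontinuous[OF a(1) \<mu> p w q(3,1,2), of 1] by (auto simp: M_def eventually_sequentially)
    \<comment> \<open>Positive because \<open>p\<close> is strictly above the critical exponent; the
      energy then bounds the \<open>p\<close> norm and, through it, the gradients and the
      multipliers.\<close>
    define c where "c = gn_exp p / 2 - 1 / p"
    have c: "c > 0" using p by (simp add: c_def gn_exp_def field_simps)
    have Cp: "Lp_integral p (u n) \<le> M / c" if "n \<ge> N" for n
    proof -
      have "2 / q n \<le> gn_exp (q n)" by (rule gn_exp_ge) (use q(1)[of n] in simp)
      then have "0 \<le> \<mu> * (gn_exp (q n) / 2 - 1 / q n) * Lp_integral (q n) (u n)" using \<mu> Lp_integral_nonneg[of "q n" "u n"] by simp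
      then have "c * Lp_integral p (u n) \<le> energy \<mu> p (q n) (u n)"
        unfolding energy_on_pohozaev[OF P] c_def using coulomb_energy_nonneg[of "u n"] by linarith
      also have "\<dots> \<le> M" unfolding lev by (rule N[OF that])
      finally show ?thesis using c by (simp add: pos_le_divide_eq mult.commute)
    qed
    define l where "l = 3 / 8 * ((1 - gn_exp p) / (1 + \<mu>)) / a\<^sup>2"
    define A where "A = 4 / 3 * ((1 + \<mu>) * (M / c))"
    define L where "L = 3 * (1 + \<mu>) * (M / c) / a\<^sup>2"
    have l: "l > 0" using \<gamma> \<mu> a by (simp add: l_def)
    have a0: "a\<^sup>2 > 0" using a by simp
    have bA: "dirichlet (u n) \<le> A" if "n \<ge> N" for n
    proof -
      have "(1 + \<mu>) * Lp_integral p (u n) \<le> (1 + \<mu>) * (M / c)" using Cp[OF that] \<mu> by (intro mult_left_mono) auto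
      with sb(3)[of n] have "3 / 4 * dirichlet (u n) \<le> (1 + \<mu>) * (M / c)" by (rule order_trans)
      moreover have "x \<le> 4 / 3 * y" if "3 / 4 * x \<le> y" for x y :: real using that by simp
      ultimately show ?thesis unfolding A_def by blast
    qed
    have bl: "l \<le> lam n" for n using mb(1)[of n] unfolding l_def by (simp only: pos_divide_le_eq[OF a0])
    have bL: "lam n \<le> L" if "n \<ge> N" for n
    proof -
      have "3 * (1 + \<mu>) * Lp_integral p (u n) \<le> 3 * (1 + \<mu>) * (M / c)" using Cp[OF that] \<mu> by (intro mult_left_mono) auto
      then have "lam n * a\<^sup>2 \<le> 3 * (1 + \<mu>) * (M / c)" using mb(2)[of n] by linarith
      then show ?thesis unfolding L_def by (simp only: pos_le_divide_eq[OF a0])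
    qed
    have qN: "(\<lambda>n. q (n + N)) \<longlonglongrightarrow> 10 / 3" using LIMSEQ_ignore_initial_segment[OF q(3)] .
    obtain r u0 lam0 where r: "strict_mono r" "u0 \<in> H1r" "l \<le> lam0" "(\<lambda>n. lam (r n + N)) \<longlonglongrightarrow> lam0"
      "(\<lambda>n. H1_norm (\<lambda>x. u (r n + N) x - u0 x)) \<longlonglongrightarrow> 0" "mass u0 = a\<^sup>2" "weak_solution \<mu> p (10 / 3) lam0 u0"
      "(\<lambda>n. energy \<mu> p (q (r n + N)) (u (r n + N))) \<longlonglongrightarrow> energy \<mu> p (10 / 3) u0"
      "(\<lambda>n. pohozaev \<mu> p (q (r n + N)) (u (r n + N))) \<longlonglongrightarrow> pohozaev \<mu> p (10 / 3) u0"
      by (rule radial_solution_compactness[of "\<lambda>n. u (n + N)" \<mu> p "\<lambda>n. q (n + N)" "\<lambda>n. lam (n + N)" a A l L,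
            OF ur ws m bA[OF le_add2] a(1) \<mu> l q(1,2) p(2) qN bl bL[OF le_add2]]) blast
    define \<rho> where "\<rho> n = r n + N" for n
    have \<rho>: "strict_mono \<rho>" using r(1) by (simp add: \<rho>_def strict_mono_def)
    have "pohozaev \<mu> p (10 / 3) u0 = 0" using r(9) unfolding P by (simp add: LIMSEQ_const_iff)
    then have ge: "level_r \<mu> p a (10 / 3) \<le> energy \<mu> p (10 / 3) u0" by (intro level_le[OF a(1) r(2,6)]) (use p \<mu> in auto)
    \<comment> \<open>Along the subsequence the levels are the energies of the solutions and
      converge to the energy of \<open>u0\<close>; upper semicontinuity at every \<open>v\<close>
      therefore makes \<open>u0\<close> a minimiser.\<close>
    have "energy \<mu> p (10 / 3) u0 \<le> energy \<mu> p (10 / 3) v" if v: "v \<in> pohozaev_set_r \<mu> p a (10 / 3)" for v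
    proof (rule field_le_epsilon)
      fix e :: real assume e: "e > 0"
      have "\<forall>\<^sub>F n in sequentially. level_r \<mu> p a (q (\<rho> n)) \<le> energy \<mu> p (10 / 3) v + e"
        by (rule eventually_subseq[OF \<rho> level_upper_semicontinuous[OF a(1) \<mu> p v q(3,1,2) e]])
      then show "energy \<mu> p (10 / 3) u0 \<le> energy \<mu> p (10 / 3) v + e"
        by (intro tendsto_upperbound[OF r(8)]) (simp_all add: lev \<rho>_def)
    qed
    then have "energy \<mu> p (10 / 3) u0 \<le> level_r \<mu> p a (10 / 3)" unfolding level_r_def by (intro cINF_greatest ne)
    with ge have "energy \<mu> p (10 / 3) u0 = level_r \<mu> p a (10 / 3)" by simp
    moreover have "normalized_solution \<mu> p a (10 / 3) lam0 u0" using r(6,7) by (simp add: normalized_solution_def mass_def)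
    moreover have "lam0 > 0" using l r(3) by simp
    ultimately show ?thesis using r(2,4,5) \<rho> unfolding \<rho>_def by blast
  qed
  have "min \<kappa>1 (min \<kappa>2 \<kappa>3) > 0" using \<kappa>1 \<kappa>2 \<kappa>3 by simp
  then show ?thesis unfolding qb using main by (intro exI[of _ "min \<kappa>1 (min \<kappa>2 \<kappa>3)"]) blast
qed

end
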